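(* Let $K$ be an infinite field, $H\subset K[x_0,\dots,x_{n-1}]$ a homogeneous ideal, $\mathrm L_H$ the scheme of $x_n$-liftings of $H$, and $\overline y_0$ the point of $\mathrm L_H$ corresponding to the lifting $H K[x_0,\dots,x_n]$. Then: (i) all the irreducible components of $\mathrm L_H$ contain the point $\overline y_0$; (ii) $\mathrm L_H$ can be isomorphically embedded into the Zariski tangent space to $\mathrm L_H$ at the point $\overline y_0$; (iii) if $\overline y_0$ is a smooth point, then $\mathrm L_H$ is isomorphic to an affine space.
   Context: Notation: $\mathbf x=\{x_0,\dots,x_{n-1}\}$; rings are commutative with unit $1\neq0$, $K$-algebras are Noetherian, $A[\mathbf x]=A\otimes_KK[\mathbf x]$, $A[\mathbf x,x_n]=A\otimes_KK[\mathbf x,x_n]$. Lifting: for a Noetherian $K$-algebra $A$, a homogeneous ideal $I\subseteq A[\mathbf x,x_n]$ is an $x_n$-lifting of $H$ if (a) $x_n$ is not a zero-divisor in $A[\mathbf x,x_n]/I$ and (b) $\{g(x_0,\dots,x_{n-1},0): g\in I\}=H A[\mathbf x]$. The functor of liftings $\underline{\mathrm L}_H$ sends a Noetherian $K$-algebra $A$ to the set of $x_n$-liftings of $H$ in $A[\mathbf x,x_n]$ and a morphism $A\to B$ to $I\mapsto I\otimes_AB:=I\,B[\mathbf x,x_n]$. It is representable by an affine scheme $\mathrm L_H$ of finite type over $K$, the scheme of liftings of $H$. In (ii), the Zariski tangent space is regarded as an affine space over $K$ and "isomorphically embedded" means isomorphic to a closed subscheme of it. *)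

theory Defs
  imports "HOL-Algebra.Module" "HOL-Algebra.QuotRing" "HOL-Algebra.Ideal_Product"
    "HOL-Algebra.Ring_Divisibility" "HOL-Library.Poly_Mapping" "HOL-Library.Extended_Nat"
    "HOL-Analysis.Abstract_Topology"
begin

section \<open>Algebras over a ring\<close>

text \<open>Morphisms are required to be \<^const>\<open>extensional\<close>, so that equality of morphisms is
  equality on the carrier and sets of morphisms have the right cardinality.\<close>

definition alg_hom ::
  "'k ring \<Rightarrow> ('k, 'a) module \<Rightarrow> ('k, 'b) module \<Rightarrow> ('a \<Rightarrow> 'b) set" where
  "alg_hom K A B = {f \<in> ring_hom A B \<inter> extensional (carrier A).
     \<forall>c\<in>carrier K. \<forall>a\<in>carrier A. f (c \<odot>\<^bsub>A\<^esub> a) = c \<odot>\<^bsub>B\<^esub> f a}"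

definition alg_isomorphic ::
  "'k ring \<Rightarrow> ('k, 'a) module \<Rightarrow> ('k, 'b) module \<Rightarrow> bool" where
  "alg_isomorphic K A B \<longleftrightarrow> (\<exists>f\<in>alg_hom K A B. bij_betw f (carrier A) (carrier B))"

definition noetherian_algebra :: "'k ring \<Rightarrow> ('k, 'a) module \<Rightarrow> bool" where
  "noetherian_algebra K A \<longleftrightarrow> algebra K A \<and> noetherian_ring A \<and> \<one>\<^bsub>A\<^esub> \<noteq> \<zero>\<^bsub>A\<^esub>"

definition base_algebra :: "'k ring \<Rightarrow> ('k, 'k) module" where
  "base_algebra K = ring.extend K (module.fields (monoid.mult K))"

definition quot_algebra :: "('k, 'a) module \<Rightarrow> 'a set \<Rightarrow> ('k, 'a set) module" where
  "quot_algebra A J =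
     ring.extend (A Quot J) (module.fields (\<lambda>c X. \<Union>x\<in>X. J +>\<^bsub>A\<^esub> (c \<odot>\<^bsub>A\<^esub> x)))"


section \<open>Polynomial rings\<close>

text \<open>A polynomial is its coefficient function; the monomial with exponents
  \<open>m :: nat \<Rightarrow>\<^sub>0 nat\<close> is the product of the \<open>x\<^sub>i ^ m\<^sub>i\<close>. The ring \<open>mpoly A n\<close> is
  \<open>A[x\<^sub>0, \<dots>, x\<^sub>n\<^sub>-\<^sub>1]\<close>. With this encoding \<open>mpoly A n\<close> is literally a subring of
  \<open>mpoly A (Suc n) = A[x\<^sub>0, \<dots>, x\<^sub>n]\<close>.\<close>

type_synonym monomial = "nat \<Rightarrow>\<^sub>0 nat"

definition mpoly :: "('a, 'm) ring_scheme \<Rightarrow> nat \<Rightarrow> ('a, monomial \<Rightarrow> 'a) module" where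
  "mpoly A n =
    \<lparr>carrier = {p. (\<forall>m. p m \<in> carrier A) \<and> finite {m. p m \<noteq> \<zero>\<^bsub>A\<^esub>} \<and>
                   (\<forall>m. p m \<noteq> \<zero>\<^bsub>A\<^esub> \<longrightarrow> Poly_Mapping.keys m \<subseteq> {..<n})},
     monoid.mult = (\<lambda>p q m. \<Oplus>\<^bsub>A\<^esub> ab \<in> {(a, b). a + b = m}. p (fst ab) \<otimes>\<^bsub>A\<^esub> q (snd ab)),
     one = (\<lambda>m. if m = 0 then \<one>\<^bsub>A\<^esub> else \<zero>\<^bsub>A\<^esub>),
     zero = (\<lambda>m. \<zero>\<^bsub>A\<^esub>),
     add = (\<lambda>p q m. p m \<oplus>\<^bsub>A\<^esub> q m),
     smult = (\<lambda>c p m. c \<otimes>\<^bsub>A\<^esub> p m)\<rparr>"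

text \<open>\<^const>\<open>finsum\<close> over an infinite set is \<open>\<zero>\<close>; the sum in the product is finite:\<close>

lemma finite_monomial_splittings: "finite {(a, b). a + b = (m :: monomial)}"
proof -
  let ?F = "{f :: nat \<Rightarrow> nat. \<forall>i. (i \<in> Poly_Mapping.keys m \<longrightarrow> f i \<in> {..Poly_Mapping.lookup m i})
              \<and> (i \<notin> Poly_Mapping.keys m \<longrightarrow> f i = 0)}"
  have "?F \<subseteq> {f. (\<forall>i. (i \<in> Poly_Mapping.keys m \<longrightarrow> f i \<in> {..(\<Sum>j\<in>Poly_Mapping.keys m. Poly_Mapping.lookup m j)})
              \<and> (i \<notin> Poly_Mapping.keys m \<longrightarrow> f i = 0))}"
    by (auto intro: order_trans[OF _ member_le_sum])
  then have fin: "finite ?F"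
    by (rule finite_subset) (intro finite_set_of_finite_funs finite_keys finite_atMost)
  have "(\<lambda>(a, b). (Poly_Mapping.lookup a, Poly_Mapping.lookup b)) ` {(a, b). a + b = m} \<subseteq> ?F \<times> ?F"
    by (auto simp: Poly_Mapping.lookup_add in_keys_iff)
  then have "finite ((\<lambda>(a, b). (Poly_Mapping.lookup a, Poly_Mapping.lookup b)) ` {(a, b). a + b = m})"
    by (rule finite_subset) (intro finite_cartesian_product fin)
  then show ?thesis
    by (rule finite_imageD) (auto simp: inj_on_def Poly_Mapping.lookup_inject)
qed

definition mpoly_var :: "('a, 'm) ring_scheme \<Rightarrow> nat \<Rightarrow> (monomial \<Rightarrow> 'a)" where
  "mpoly_var A i = (\<lambda>m. if m = Poly_Mapping.single i 1 then \<one>\<^bsub>A\<^esub> else \<zero>\<^bsub>A\<^esub>)"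

definition monomial_degree :: "monomial \<Rightarrow> nat" where
  "monomial_degree m = (\<Sum>i\<in>Poly_Mapping.keys m. Poly_Mapping.lookup m i)"

definition hom_component :: "('a, 'm) ring_scheme \<Rightarrow> nat \<Rightarrow> (monomial \<Rightarrow> 'a) \<Rightarrow> (monomial \<Rightarrow> 'a)" where
  "hom_component A d p = (\<lambda>m. if monomial_degree m = d then p m else \<zero>\<^bsub>A\<^esub>)"

definition homogeneous_ideal :: "('a, 'm) ring_scheme \<Rightarrow> nat \<Rightarrow> (monomial \<Rightarrow> 'a) set \<Rightarrow> bool" where
  "homogeneous_ideal A n I \<longleftrightarrow>
     ideal I (mpoly A n) \<and> (\<forall>p\<in>I. \<forall>d. hom_component A d p \<in> I)"

text \<open>The substitution \<open>x\<^sub>i = 0\<close> deletes the monomials in which \<open>x\<^sub>i\<close> occurs.\<close>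

definition set_var_zero :: "('a, 'm) ring_scheme \<Rightarrow> nat \<Rightarrow> (monomial \<Rightarrow> 'a) \<Rightarrow> (monomial \<Rightarrow> 'a)" where
  "set_var_zero A i p = (\<lambda>m. if Poly_Mapping.lookup m i = 0 then p m else \<zero>\<^bsub>A\<^esub>)"

definition extend_ideal ::
  "('b, 'm) ring_scheme \<Rightarrow> nat \<Rightarrow> ('a \<Rightarrow> 'b) \<Rightarrow> (monomial \<Rightarrow> 'a) set \<Rightarrow> (monomial \<Rightarrow> 'b) set" where
  "extend_ideal B n f I = genideal (mpoly B n) ((\<lambda>p m. f (p m)) ` I)"


section \<open>Liftings\<close>

definition non_zero_divisor :: "('a, 'm) ring_scheme \<Rightarrow> 'a \<Rightarrow> bool" where
  "non_zero_divisor A x \<longleftrightarrow> (\<forall>y\<in>carrier A. x \<otimes>\<^bsub>A\<^esub> y = \<zero>\<^bsub>A\<^esub> \<longrightarrow> y = \<zero>\<^bsub>A\<^esub>)"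

text \<open>\<open>liftings n H A\<close> is the value at \<open>A\<close> of the functor of \<open>x\<^sub>n\<close>-liftings of
  \<open>H \<subseteq> K[x\<^sub>0, \<dots>, x\<^sub>n\<^sub>-\<^sub>1]\<close>; the structure map \<open>K \<rightarrow> A\<close> is \<open>c \<mapsto> c \<odot>\<^bsub>A\<^esub> \<one>\<^bsub>A\<^esub>\<close>.\<close>

definition liftings ::
  "nat \<Rightarrow> (monomial \<Rightarrow> 'k) set \<Rightarrow> ('k, 'a) module \<Rightarrow> (monomial \<Rightarrow> 'a) set set" where
  "liftings n H A = {I. homogeneous_ideal A (Suc n) I \<and>
     non_zero_divisor (mpoly A (Suc n) Quot I) (I +>\<^bsub>mpoly A (Suc n)\<^esub> mpoly_var A n) \<and>
     set_var_zero A n ` I = extend_ideal A n (\<lambda>c. c \<odot>\<^bsub>A\<^esub> \<one>\<^bsub>A\<^esub>) H}"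

definition base_change ::
  "nat \<Rightarrow> ('k, 'b) module \<Rightarrow> ('a \<Rightarrow> 'b) \<Rightarrow> (monomial \<Rightarrow> 'a) set \<Rightarrow> (monomial \<Rightarrow> 'b) set" where
  "base_change n B f I = extend_ideal B (Suc n) f I"

text \<open>Closed subschemes of \<open>Spec S\<close> are the schemes \<open>Spec (S/J)\<close>, so the following says that
  \<open>Spec R\<close> is isomorphic to a closed subscheme of \<open>Spec S\<close>.\<close>

definition iso_closed_subscheme ::
  "'k ring \<Rightarrow> ('k, 'a) module \<Rightarrow> ('k, 'b) module \<Rightarrow> bool" where
  "iso_closed_subscheme K R S \<longleftrightarrow> (\<exists>J. ideal J S \<and> alg_isomorphic K R (quot_algebra S J))"

definition finite_type :: "'k ring \<Rightarrow> ('k, 'a) module \<Rightarrow> bool" where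
  "finite_type K R \<longleftrightarrow> (\<exists>N. iso_closed_subscheme K R (mpoly K N))"

text \<open>\<open>Spec R\<close>, of finite type over \<open>K\<close>, represents the functor of liftings, with universal
  lifting \<open>U\<close>: the natural transformation \<open>Hom(R, -) \<rightarrow> L\<^sub>H\<close> that sends \<open>f : R \<rightarrow> A\<close> to the
  base change of \<open>U\<close> along \<open>f\<close> is bijective at every Noetherian \<open>K\<close>-algebra \<open>A\<close>.

  As HOL has no quantifier over types, \<open>A\<close> ranges over the algebras with carrier in the type of
  the elements of \<open>R\<close>. For an infinite field \<open>K\<close> this is no restriction. An algebra of finite
  type has cardinality at most that of \<open>K\<close>, hence at most that of \<open>R\<close>, so the type contains a
  copy of every \<open>K\<close>-algebra of finite type and in particular of the scheme of liftings; by
  Yoneda's lemma that copy is isomorphic to \<open>R\<close>, compatibly with the universal liftings.\<close>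

definition scheme_of_liftings ::
  "'k ring \<Rightarrow> nat \<Rightarrow> (monomial \<Rightarrow> 'k) set \<Rightarrow> ('k, 'a) module \<Rightarrow> (monomial \<Rightarrow> 'a) set \<Rightarrow> bool" where
  "scheme_of_liftings K n H R U \<longleftrightarrow>
     noetherian_algebra K R \<and> finite_type K R \<and> U \<in> liftings n H R \<and>
     (\<forall>A :: ('k, 'a) module. noetherian_algebra K A \<longrightarrow>
        bij_betw (\<lambda>f. base_change n A f U) (alg_hom K R A) (liftings n H A))"

text \<open>The point of \<open>Spec R\<close> corresponding to a lifting \<open>I\<close> over \<open>K\<close> is the kernel of the
  classifying morphism \<open>R \<rightarrow> K\<close> of \<open>I\<close>.\<close>

definition lifting_point ::
  "'k ring \<Rightarrow> nat \<Rightarrow> ('k, 'a) module \<Rightarrow> (monomial \<Rightarrow> 'a) set \<Rightarrow> (monomial \<Rightarrow> 'k) set \<Rightarrow> 'a set" where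
  "lifting_point K n R U I =
     a_kernel R (base_algebra K)
       (THE f. f \<in> alg_hom K R (base_algebra K) \<and> base_change n (base_algebra K) f U = I)"


section \<open>Prime spectrum\<close>

definition Spec :: "('a, 'm) ring_scheme \<Rightarrow> 'a set set" where
  "Spec R = {P. primeideal P R}"

definition zariski_topology :: "('a, 'm) ring_scheme \<Rightarrow> 'a set topology" where
  "zariski_topology R = topology (\<lambda>W. \<exists>S\<subseteq>carrier R. W = {P \<in> Spec R. \<not> S \<subseteq> P})"

lemma openin_zariski_topology:
  "openin (zariski_topology R) W \<longleftrightarrow> (\<exists>S\<subseteq>carrier R. W = {P \<in> Spec R. \<not> S \<subseteq> P})"
proof -
  let ?op = "\<lambda>W. \<exists>S\<subseteq>carrier R. W = {P \<in> Spec R. \<not> S \<subseteq> P}"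
  have "istopology ?op"
    unfolding istopology_def
  proof (intro conjI allI impI)
    fix V W assume "?op V" "?op W"
    then obtain S T where S: "S \<subseteq> carrier R" "V = {P \<in> Spec R. \<not> S \<subseteq> P}"
      and T: "T \<subseteq> carrier R" "W = {P \<in> Spec R. \<not> T \<subseteq> P}" by auto
    let ?ST = "{s \<otimes>\<^bsub>R\<^esub> t | s t. s \<in> S \<and> t \<in> T}"
    have "?ST \<subseteq> carrier R \<or> Spec R = {}"
    proof (cases "Spec R = {}")
      case False
      then obtain P where "primeideal P R" by (auto simp: Spec_def)
      then interpret primeideal P R .
      show ?thesis using S(1) T(1) by blast
    qed simp
    moreover have "V \<inter> W = {P \<in> Spec R. \<not> ?ST \<subseteq> P}"
    proof (intro subset_antisym subsetI)
      fix P assume P: "P \<in> V \<inter> W"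
      then interpret primeideal P R by (auto simp: S Spec_def)
      obtain s t where "s \<in> S" "s \<notin> P" "t \<in> T" "t \<notin> P" using P S T by auto
      then have "s \<otimes>\<^bsub>R\<^esub> t \<notin> P" using I_prime S(1) T(1) by blast
      then show "P \<in> {P \<in> Spec R. \<not> ?ST \<subseteq> P}"
        using P \<open>s \<in> S\<close> \<open>t \<in> T\<close> by (auto simp: S)
    next
      fix P assume P: "P \<in> {P \<in> Spec R. \<not> ?ST \<subseteq> P}"
      then interpret primeideal P R by (auto simp: Spec_def)
      obtain s t where st: "s \<in> S" "t \<in> T" "s \<otimes>\<^bsub>R\<^esub> t \<notin> P" using P by auto
      then have "s \<in> carrier R" "t \<in> carrier R" using S(1) T(1) by auto
      then have "s \<notin> P" "t \<notin> P" using st(3) I_l_closed I_r_closed by auto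
      then show "P \<in> V \<inter> W" using P st S(2) T(2) by auto
    qed
    moreover have "?op (V \<inter> W)" if "Spec R = {}"
      by (rule exI[of _ "{}"]) (use S(2) that in simp)
    ultimately show "?op (V \<inter> W)" by meson
  next
    fix \<K> assume "\<forall>V\<in>\<K>. ?op V"
    then have "\<exists>S. \<forall>V\<in>\<K>. S V \<subseteq> carrier R \<and> V = {P \<in> Spec R. \<not> S V \<subseteq> P}"
      by (intro bchoice) simp
    then obtain S where S: "\<And>V. V \<in> \<K> \<Longrightarrow> S V \<subseteq> carrier R"
      "\<And>V. V \<in> \<K> \<Longrightarrow> V = {P \<in> Spec R. \<not> S V \<subseteq> P}"
      by blast
    have "\<Union>\<K> = (\<Union>V\<in>\<K>. V)"
      by simp
    also have "\<dots> = (\<Union>V\<in>\<K>. {P \<in> Spec R. \<not> S V \<subseteq> P})"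
      using S(2) by (rule SUP_cong[OF refl])
    also have "\<dots> = {P \<in> Spec R. \<not> (\<Union>V\<in>\<K>. S V) \<subseteq> P}"
      by auto
    finally have "\<Union>\<K> = {P \<in> Spec R. \<not> (\<Union>V\<in>\<K>. S V) \<subseteq> P}" .
    moreover have "(\<Union>V\<in>\<K>. S V) \<subseteq> carrier R" using S(1) by auto
    ultimately show "?op (\<Union>\<K>)" by (intro exI conjI)
  qed
  then show ?thesis by (simp add: zariski_topology_def topology_inverse')
qed

definition irreducible_in :: "'a topology \<Rightarrow> 'a set \<Rightarrow> bool" where
  "irreducible_in X Z \<longleftrightarrow> Z \<subseteq> topspace X \<and> Z \<noteq> {} \<and>
     (\<forall>C D. closedin X C \<and> closedin X D \<and> Z \<subseteq> C \<union> D \<longrightarrow> Z \<subseteq> C \<or> Z \<subseteq> D)"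

definition irreducible_component :: "'a topology \<Rightarrow> 'a set \<Rightarrow> bool" where
  "irreducible_component X Z \<longleftrightarrow>
     irreducible_in X Z \<and> (\<forall>Y. irreducible_in X Y \<and> Z \<subseteq> Y \<longrightarrow> Y = Z)"

definition krull_dim :: "('a, 'm) ring_scheme \<Rightarrow> enat" where
  "krull_dim R = Sup {enat r | r. \<exists>P :: nat \<Rightarrow> 'a set.
     (\<forall>i\<le>r. P i \<in> Spec R) \<and> (\<forall>i<r. P i \<subset> P (Suc i))}"


section \<open>Local rings and tangent spaces\<close>

text \<open>The local ring of \<open>Spec R\<close> at \<open>P\<close> consists of fractions \<open>a/s\<close> with \<open>s \<notin> P\<close>, which are
  classes of pairs \<open>(a, s)\<close>.\<close>

definition fraction_rel :: "('a, 'm) ring_scheme \<Rightarrow> 'a set \<Rightarrow> (('a \<times> 'a) \<times> ('a \<times> 'a)) set" where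
  "fraction_rel R P = {((a, s), (b, t)).
     a \<in> carrier R \<and> b \<in> carrier R \<and> s \<in> carrier R - P \<and> t \<in> carrier R - P \<and>
     (\<exists>u\<in>carrier R - P. u \<otimes>\<^bsub>R\<^esub> (t \<otimes>\<^bsub>R\<^esub> a) = u \<otimes>\<^bsub>R\<^esub> (s \<otimes>\<^bsub>R\<^esub> b))}"

definition fraction :: "('a, 'm) ring_scheme \<Rightarrow> 'a set \<Rightarrow> 'a \<Rightarrow> 'a \<Rightarrow> ('a \<times> 'a) set" where
  "fraction R P a s = fraction_rel R P `` {(a, s)}"

definition local_ring :: "('k, 'a) module \<Rightarrow> 'a set \<Rightarrow> ('k, ('a \<times> 'a) set) module" where
  "local_ring R P =
    \<lparr>carrier = {fraction R P a s | a s. a \<in> carrier R \<and> s \<in> carrier R - P},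
     monoid.mult = (\<lambda>X Y. \<Union>(a, s)\<in>X. \<Union>(b, t)\<in>Y. fraction R P (a \<otimes>\<^bsub>R\<^esub> b) (s \<otimes>\<^bsub>R\<^esub> t)),
     one = fraction R P \<one>\<^bsub>R\<^esub> \<one>\<^bsub>R\<^esub>,
     zero = fraction R P \<zero>\<^bsub>R\<^esub> \<one>\<^bsub>R\<^esub>,
     add = (\<lambda>X Y. \<Union>(a, s)\<in>X. \<Union>(b, t)\<in>Y.
              fraction R P ((a \<otimes>\<^bsub>R\<^esub> t) \<oplus>\<^bsub>R\<^esub> (b \<otimes>\<^bsub>R\<^esub> s)) (s \<otimes>\<^bsub>R\<^esub> t)),
     smult = (\<lambda>c X. \<Union>(a, s)\<in>X. fraction R P (c \<odot>\<^bsub>R\<^esub> a) s)\<rparr>"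

definition local_ideal :: "('k, 'a) module \<Rightarrow> 'a set \<Rightarrow> ('a \<times> 'a) set set" where
  "local_ideal R P = {fraction R P a s | a s. a \<in> P \<and> s \<in> carrier R - P}"

text \<open>\<open>M/M\<^sup>2\<close>, for the maximal ideal \<open>M\<close> of the local ring \<open>B\<close> at \<open>P\<close>, as a \<open>K\<close>-subspace of
  \<open>B/M\<^sup>2\<close> (the multiplication of the record is irrelevant).\<close>

definition cotangent_space ::
  "('k, 'a) module \<Rightarrow> 'a set \<Rightarrow> ('k, ('a \<times> 'a) set set) module" where
  "cotangent_space R P =
     (let B = local_ring R P; M = local_ideal R P; M2 = ideal_prod B M M
      in (quot_algebra B M2)\<lparr>carrier := (\<lambda>x. M2 +>\<^bsub>B\<^esub> x) ` M\<rparr>)"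

definition dual_space :: "'k ring \<Rightarrow> ('k, 'v) module \<Rightarrow> ('k, 'v \<Rightarrow> 'k) module" where
  "dual_space K V =
    \<lparr>carrier = {\<phi> \<in> carrier V \<rightarrow>\<^sub>E carrier K.
       (\<forall>v\<in>carrier V. \<forall>w\<in>carrier V. \<phi> (v \<oplus>\<^bsub>V\<^esub> w) = \<phi> v \<oplus>\<^bsub>K\<^esub> \<phi> w) \<and>
       (\<forall>c\<in>carrier K. \<forall>v\<in>carrier V. \<phi> (c \<odot>\<^bsub>V\<^esub> v) = c \<otimes>\<^bsub>K\<^esub> \<phi> v)},
     monoid.mult = undefined,
     one = undefined,
     zero = (\<lambda>v\<in>carrier V. \<zero>\<^bsub>K\<^esub>),
     add = (\<lambda>\<phi> \<psi>. \<lambda>v\<in>carrier V. \<phi> v \<oplus>\<^bsub>K\<^esub> \<psi> v),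
     smult = (\<lambda>c \<phi>. \<lambda>v\<in>carrier V. c \<otimes>\<^bsub>K\<^esub> \<phi> v)\<rparr>"

text \<open>Used at points \<open>P\<close> with residue field \<open>K\<close> only.\<close>

definition tangent_space ::
  "'k ring \<Rightarrow> ('k, 'a) module \<Rightarrow> 'a set \<Rightarrow> ('k, ('a \<times> 'a) set set \<Rightarrow> 'k) module" where
  "tangent_space K R P = dual_space K (cotangent_space R P)"

definition is_basis :: "'k ring \<Rightarrow> ('k, 'v) module \<Rightarrow> 'v set \<Rightarrow> bool" where
  "is_basis K V B \<longleftrightarrow> finite B \<and> B \<subseteq> carrier V \<and>
     (\<forall>v\<in>carrier V. \<exists>!c. c \<in> B \<rightarrow>\<^sub>E carrier K \<and> v = (\<Oplus>\<^bsub>V\<^esub> b\<in>B. c b \<odot>\<^bsub>V\<^esub> b))"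

text \<open>The value is 0 for spaces without a finite basis.\<close>

definition vdim :: "'k ring \<Rightarrow> ('k, 'v) module \<Rightarrow> nat" where
  "vdim K V = (if \<exists>B. is_basis K V B then card (SOME B. is_basis K V B) else 0)"

text \<open>A point with residue field \<open>K\<close> of a scheme of finite type is smooth if its local ring is
  regular.\<close>

definition smooth_point :: "'k ring \<Rightarrow> ('k, 'a) module \<Rightarrow> 'a set \<Rightarrow> bool" where
  "smooth_point K R P \<longleftrightarrow>
     enat (vdim K (cotangent_space R P)) = krull_dim (local_ring R P)"

text \<open>The coordinate rings of affine \<open>N\<close>-space and of a finite-dimensional vector space regarded
  as an affine space.\<close>

definition affine_space :: "'k ring \<Rightarrow> nat \<Rightarrow> ('k, monomial \<Rightarrow> 'k) module" where
  "affine_space K N = mpoly K N"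

definition vector_space_scheme :: "'k ring \<Rightarrow> ('k, 'v) module \<Rightarrow> ('k, monomial \<Rightarrow> 'k) module" where
  "vector_space_scheme K V = affine_space K (vdim K V)"

end

(*
Substituting T x_n for x_n in the universal lifting U defines a lifting over R[T] whose fibre at
T = 0 is the trivial lifting generated by H. Its classifying morphism R -> R[T] is a coaction of the
multiplicative monoid, so R is graded in degrees >= 0. At T = 0 it factors through K, so the degree 0
part of R is K, and y0 is the ideal M of elements without component of degree 0.

A minimal prime of a graded ring is homogeneous and therefore contained in M, which is (i). By the
graded Nakayama lemma, homogeneous elements whose classes form a basis of M/M^2 generate R as a
K-algebra; thus R is a quotient K[x_1, ..., x_N]/J with N the dimension of the tangent space, which
is (ii). If J is nonzero, then chains of primes in the local ring at y0 have length less than N,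
because those of K[x_1, ..., x_N] have length at most N; so smoothness at y0 forces J = 0, which is
(iii). The bound for K[x_1, ..., x_N] follows from a count: too many power products of N + 1 elements
are linearly dependent, whereas x_i in P_(i+1) - P_i along a chain of primes makes them independent.
*)
theory Submission imports Defs "HOL-Algebra.UnivPoly" begin


section \<open>Polynomial rings\<close>

text \<open>The substitution of \<open>T x_n\<close> visibly gives a lifting only where
  \<open>T\<close> is invertible; over all of \<open>R[T]\<close> a flat limit at
  \<open>T = 0\<close> is needed. As \<open>K\<close> is infinite, the limit can be described by
  points: a polynomial belongs to it if its value at every nonzero \<open>c\<close> in
  \<open>K\<close>, rescaled by the inverse of \<open>c\<close>, lies in \<open>U\<close>.
  Homogeneity and saturation by \<open>x_n\<close> are then inherited from \<open>U\<close> point by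
  point, and a Vandermonde argument, which recovers coefficients in \<open>T\<close> from infinitely
  many values, does the rest. The same argument turns identities between the endomorphisms for
  \<open>T = c\<close> into the axioms of a grading, so that the coaction is never iterated over a
  ring in two parameters. The fibre at \<open>T = 0\<close> is identified by one inclusion: a
  lifting contained in another lifting equals it. The universal property speaks only of Noetherian
  algebras whose elements have the type of \<open>R\<close>; hence Hilbert's basis theorem, and a
  cardinality argument that copies \<open>R[T]\<close> into that type. Generators are found in
  \<open>R\<close> itself; the local ring enters only because tangent space and smoothness are
  defined by it.\<close>

lemma (in abelian_monoid) finsum_Sigma:
  assumes "finite I" "\<And>i. i \<in> I \<Longrightarrow> finite (B i)"
    "\<And>i j. i \<in> I \<Longrightarrow> j \<in> B i \<Longrightarrow> g i j \<in> carrier G"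
  shows "(\<Oplus>i\<in>I. \<Oplus>j\<in>B i. g i j) = (\<Oplus>ij\<in>Sigma I B. g (fst ij) (snd ij))"
  using assms
proof (induction I rule: finite_induct)
  case (insert i I)
  have S: "Sigma (insert i I) B = Pair i ` B i \<union> Sigma I B"
    by auto
  have "(\<Oplus>ij\<in>Pair i ` B i. g (fst ij) (snd ij)) = (\<Oplus>j\<in>B i. g i j)"
    using insert.prems by (subst finsum_reindex) (auto simp: inj_on_def)
  moreover have "(\<Oplus>ij\<in>Sigma (insert i I) B. g (fst ij) (snd ij)) =
      (\<Oplus>ij\<in>Pair i ` B i. g (fst ij) (snd ij)) \<oplus> (\<Oplus>ij\<in>Sigma I B. g (fst ij) (snd ij))"
    unfolding S using insert by (intro finsum_Un_disjoint) auto
  moreover have "(\<Oplus>i\<in>insert i I. \<Oplus>j\<in>B i. g i j) = (\<Oplus>j\<in>B i. g i j) \<oplus> (\<Oplus>i\<in>I. \<Oplus>j\<in>B i. g i j)"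
    using insert by (intro finsum_insert) (auto intro!: finsum_closed)
  ultimately show ?case
    using insert by simp
qed simp

lemma (in abelian_monoid) finsum_bij:
  assumes "bij_betw h X Y" "\<And>y. y \<in> Y \<Longrightarrow> g y \<in> carrier G" "\<And>x. x \<in> X \<Longrightarrow> f x = g (h x)"
  shows "(\<Oplus>x\<in>X. f x) = (\<Oplus>y\<in>Y. g y)"
proof -
  have Y: "Y = h ` X" "inj_on h X"
    using assms(1) by (auto simp: bij_betw_def)
  have "(\<Oplus>y\<in>h ` X. g y) = (\<Oplus>x\<in>X. g (h x))"
    using assms(2) Y by (intro finsum_reindex) auto
  also have "\<dots> = (\<Oplus>x\<in>X. f x)"
    using assms(2,3) Y by (intro finsum_cong') auto
  finally show ?thesis by (simp add: Y)
qed

lemma (in abelian_monoid) finsum_swap: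
  assumes "finite I" "finite J" "\<And>i j. i \<in> I \<Longrightarrow> j \<in> J \<Longrightarrow> g i j \<in> carrier G"
  shows "(\<Oplus>i\<in>I. \<Oplus>j\<in>J. g i j) = (\<Oplus>j\<in>J. \<Oplus>i\<in>I. g i j)"
proof -
  have "(\<Oplus>ij\<in>I \<times> J. g (fst ij) (snd ij)) = (\<Oplus>ji\<in>J \<times> I. g (snd ji) (fst ji))"
    by (rule finsum_bij[where h = "\<lambda>(i, j). (j, i)"])
       (use assms in \<open>auto simp: bij_betw_def inj_on_def image_def\<close>)
  then show ?thesis
    using assms by (subst (1 2) finsum_Sigma) auto
qed

lemma (in abelian_monoid) finsum_neutral:
  assumes "finite B" "A \<subseteq> B" "\<And>i. i \<in> B - A \<Longrightarrow> h i = \<zero>" "\<And>i. i \<in> B \<Longrightarrow> h i \<in> carrier G"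
  shows "(\<Oplus>i\<in>A. h i) = (\<Oplus>i\<in>B. h i)"
  using assms by (intro add.finprod_mono_neutral_cong_left) auto

lemma (in semiring) finsum_mult:
  assumes "finite I" "finite J" "\<And>i. i \<in> I \<Longrightarrow> f i \<in> carrier R" "\<And>j. j \<in> J \<Longrightarrow> g j \<in> carrier R"
  shows "(\<Oplus>i\<in>I. f i) \<otimes> (\<Oplus>j\<in>J. g j) = (\<Oplus>ij\<in>I \<times> J. f (fst ij) \<otimes> g (snd ij))"
proof -
  have "(\<Oplus>i\<in>I. f i) \<otimes> (\<Oplus>j\<in>J. g j) = (\<Oplus>i\<in>I. f i \<otimes> (\<Oplus>j\<in>J. g j))"
    using assms by (intro finsum_ldistr) (auto intro!: finsum_closed)
  also have "\<dots> = (\<Oplus>i\<in>I. \<Oplus>j\<in>J. f i \<otimes> g j)"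
    using assms by (intro finsum_cong') (auto intro!: finsum_closed finsum_rdistr)
  also have "\<dots> = (\<Oplus>ij\<in>I \<times> J. f (fst ij) \<otimes> g (snd ij))"
    using assms by (intro finsum_Sigma) auto
  finally show ?thesis .
qed

lemma (in abelian_monoid) finsum_single:
  assumes "finite I" "i \<in> I" "f i \<in> carrier G" "\<And>j. j \<in> I \<Longrightarrow> j \<noteq> i \<Longrightarrow> f j = \<zero>"
  shows "(\<Oplus>j\<in>I. f j) = f i"
proof -
  have "(\<Oplus>j\<in>{i}. f j) = (\<Oplus>j\<in>I. f j)"
    using assms(1-3) by (intro finsum_neutral) (use assms in \<open>auto, metis zero_closed\<close>)
  then show ?thesis using assms(3) by simp
qed

abbreviation splits :: "monomial \<Rightarrow> (monomial \<times> monomial) set" where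
  "splits m \<equiv> {(a, b). a + b = m}"

abbreviation mconst :: "('a, 'm) ring_scheme \<Rightarrow> 'a \<Rightarrow> monomial \<Rightarrow> 'a" where
  "mconst A c \<equiv> (\<lambda>m. if m = 0 then c else \<zero>\<^bsub>A\<^esub>)"

lemma keys_add_nat: "Poly_Mapping.keys (a + b) = Poly_Mapping.keys a \<union> Poly_Mapping.keys (b :: monomial)"
  by (auto simp: in_keys_iff lookup_add)

lemma mpoly_simps:
  "monoid.mult (mpoly A n) = (\<lambda>p q m. \<Oplus>\<^bsub>A\<^esub> ab \<in> splits m. p (fst ab) \<otimes>\<^bsub>A\<^esub> q (snd ab))"
  "monoid.one (mpoly A n) = mconst A \<one>\<^bsub>A\<^esub>"
  "ring.zero (mpoly A n) = (\<lambda>m. \<zero>\<^bsub>A\<^esub>)"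
  "ring.add (mpoly A n) = (\<lambda>p q m. p m \<oplus>\<^bsub>A\<^esub> q m)"
  "smult (mpoly A n) = (\<lambda>c p m. c \<otimes>\<^bsub>A\<^esub> p m)"
  by (simp_all add: mpoly_def)

lemma mpoly_carrierI:
  assumes "\<And>m. p m \<in> carrier A" "finite {m. p m \<noteq> \<zero>\<^bsub>A\<^esub>}"
    "\<And>m. p m \<noteq> \<zero>\<^bsub>A\<^esub> \<Longrightarrow> Poly_Mapping.keys m \<subseteq> {..<n}"
  shows "p \<in> carrier (mpoly A n)"
  using assms by (simp add: mpoly_def)

lemma mpoly_carrierD:
  assumes "p \<in> carrier (mpoly A n)"
  shows "p m \<in> carrier A" "finite {m. p m \<noteq> \<zero>\<^bsub>A\<^esub>}"
    "p m \<noteq> \<zero>\<^bsub>A\<^esub> \<Longrightarrow> Poly_Mapping.keys m \<subseteq> {..<n}"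
  using assms by (auto simp: mpoly_def)

context cring
begin

lemma mpoly_mult_closed:
  assumes p: "p \<in> carrier (mpoly R n)" and q: "q \<in> carrier (mpoly R n)"
  shows "p \<otimes>\<^bsub>mpoly R n\<^esub> q \<in> carrier (mpoly R n)"
proof (rule mpoly_carrierI)
  note [simp] = mpoly_carrierD(1)[OF p] mpoly_carrierD(1)[OF q]
  fix m
  show "(p \<otimes>\<^bsub>mpoly R n\<^esub> q) m \<in> carrier R"
    unfolding mpoly_simps by (auto intro!: finsum_closed)
  have nz: "\<exists>a b. a + b = m \<and> p a \<noteq> \<zero> \<and> q b \<noteq> \<zero>" if "(p \<otimes>\<^bsub>mpoly R n\<^esub> q) m \<noteq> \<zero>" for m
  proof (rule ccontr)
    assume "\<not> ?thesis"
    then have "(\<Oplus>ab \<in> splits m. p (fst ab) \<otimes> q (snd ab)) = \<zero>"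
      by (intro add.finprod_one_eqI) (auto, metis l_null r_null mpoly_carrierD(1) p q)
    with that show False by (simp add: mpoly_simps)
  qed
  show "Poly_Mapping.keys m \<subseteq> {..<n}" if "(p \<otimes>\<^bsub>mpoly R n\<^esub> q) m \<noteq> \<zero>"
    using nz[OF that] mpoly_carrierD(3)[OF p] mpoly_carrierD(3)[OF q] by (fastforce simp: keys_add_nat)
  have "{m. (p \<otimes>\<^bsub>mpoly R n\<^esub> q) m \<noteq> \<zero>} \<subseteq> (\<lambda>(a, b). a + b) ` ({m. p m \<noteq> \<zero>} \<times> {m. q m \<noteq> \<zero>})"
    using nz by force
  then show "finite {m. (p \<otimes>\<^bsub>mpoly R n\<^esub> q) m \<noteq> \<zero>}"
    by (rule finite_subset) (use mpoly_carrierD(2)[OF p] mpoly_carrierD(2)[OF q] in auto)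
qed

lemma mpoly_add_closed:
  assumes p: "p \<in> carrier (mpoly R n)" and q: "q \<in> carrier (mpoly R n)"
  shows "p \<oplus>\<^bsub>mpoly R n\<^esub> q \<in> carrier (mpoly R n)"
proof (rule mpoly_carrierI)
  note [simp] = mpoly_carrierD(1)[OF p] mpoly_carrierD(1)[OF q]
  fix m
  show "(p \<oplus>\<^bsub>mpoly R n\<^esub> q) m \<in> carrier R" by (simp add: mpoly_simps)
  have nz: "p m \<noteq> \<zero> \<or> q m \<noteq> \<zero>" if "(p \<oplus>\<^bsub>mpoly R n\<^esub> q) m \<noteq> \<zero>" for m
    using that by (auto simp: mpoly_simps)
  show "Poly_Mapping.keys m \<subseteq> {..<n}" if "(p \<oplus>\<^bsub>mpoly R n\<^esub> q) m \<noteq> \<zero>"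
    using nz[OF that] mpoly_carrierD(3)[OF p] mpoly_carrierD(3)[OF q] by auto
  show "finite {m. (p \<oplus>\<^bsub>mpoly R n\<^esub> q) m \<noteq> \<zero>}"
    by (rule finite_subset[of _ "{m. p m \<noteq> \<zero>} \<union> {m. q m \<noteq> \<zero>}"])
       (use nz mpoly_carrierD(2)[OF p] mpoly_carrierD(2)[OF q] in auto)
qed

lemma mpoly_mconst_closed: "c \<in> carrier R \<Longrightarrow> mconst R c \<in> carrier (mpoly R n)"
  by (rule mpoly_carrierI) (auto split: if_splits)

lemma mpoly_mult_assoc:
  assumes p: "p \<in> carrier (mpoly R n)" and q: "q \<in> carrier (mpoly R n)" and r: "r \<in> carrier (mpoly R n)"
  shows "p \<otimes>\<^bsub>mpoly R n\<^esub> q \<otimes>\<^bsub>mpoly R n\<^esub> r = p \<otimes>\<^bsub>mpoly R n\<^esub> (q \<otimes>\<^bsub>mpoly R n\<^esub> r)"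
proof
  note [simp] = mpoly_carrierD(1)[OF p] mpoly_carrierD(1)[OF q] mpoly_carrierD(1)[OF r]
  fix m
  have "(p \<otimes>\<^bsub>mpoly R n\<^esub> q \<otimes>\<^bsub>mpoly R n\<^esub> r) m =
      (\<Oplus>ab \<in> splits m. \<Oplus>cd \<in> splits (fst ab). p (fst cd) \<otimes> q (snd cd) \<otimes> r (snd ab))"
    unfolding mpoly_simps by (intro finsum_cong') (auto intro!: finsum_closed finsum_ldistr finite_monomial_splittings)
  also have "\<dots> = (\<Oplus>x \<in> Sigma (splits m) (\<lambda>ab. splits (fst ab)).
      p (fst (snd x)) \<otimes> q (snd (snd x)) \<otimes> r (snd (fst x)))"
    by (rule finsum_Sigma) (auto intro!: finite_monomial_splittings)
  \<comment> \<open>Both sides run over the ways to write \<open>m\<close> as a sum of three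
    monomials; the bijection moves the bracket from \<open>(c + d) + b\<close> to
    \<open>c + (d + b)\<close>.\<close>
  also have "\<dots> = (\<Oplus>x \<in> Sigma (splits m) (\<lambda>ab. splits (snd ab)).
      p (fst (fst x)) \<otimes> (q (fst (snd x)) \<otimes> r (snd (snd x))))"
    by (rule finsum_bij[where h = "\<lambda>((a, b), (c, d)). ((c, d + b), (d, b))"],
        rule bij_betw_byWitness[where f' = "\<lambda>((a, b), (c, d)). ((a + c, d), (a, c))"])
       (auto simp: m_assoc add.assoc)
  also have "\<dots> = (\<Oplus>ab \<in> splits m. \<Oplus>cd \<in> splits (snd ab). p (fst ab) \<otimes> (q (fst cd) \<otimes> r (snd cd)))"
    by (rule finsum_Sigma[symmetric]) (auto intro!: finite_monomial_splittings)
  also have "\<dots> = (p \<otimes>\<^bsub>mpoly R n\<^esub> (q \<otimes>\<^bsub>mpoly R n\<^esub> r)) m"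
    unfolding mpoly_simps by (intro finsum_cong') (auto intro!: finsum_closed finsum_rdistr[symmetric] finite_monomial_splittings)
  finally show "(p \<otimes>\<^bsub>mpoly R n\<^esub> q \<otimes>\<^bsub>mpoly R n\<^esub> r) m = (p \<otimes>\<^bsub>mpoly R n\<^esub> (q \<otimes>\<^bsub>mpoly R n\<^esub> r)) m" .
qed

lemma mconst_mult:
  assumes p: "p \<in> carrier (mpoly R n)" and c: "c \<in> carrier R"
  shows "mconst R c \<otimes>\<^bsub>mpoly R n\<^esub> p = (\<lambda>m. c \<otimes> p m)"
proof
  fix m
  have "(\<Oplus>ab\<in>splits m. mconst R c (fst ab) \<otimes> p (snd ab)) = (\<lambda>ab. mconst R c (fst ab) \<otimes> p (snd ab)) (0, m)"
    by (rule finsum_single) (use mpoly_carrierD(1)[OF p] c in \<open>auto intro: finite_monomial_splittings\<close>)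
  then show "(mconst R c \<otimes>\<^bsub>mpoly R n\<^esub> p) m = c \<otimes> p m"
    by (simp add: mpoly_simps)
qed

lemma mpoly_mult_comm:
  assumes p: "p \<in> carrier (mpoly R n)" and q: "q \<in> carrier (mpoly R n)"
  shows "p \<otimes>\<^bsub>mpoly R n\<^esub> q = q \<otimes>\<^bsub>mpoly R n\<^esub> p"
proof
  fix m
  show "(p \<otimes>\<^bsub>mpoly R n\<^esub> q) m = (q \<otimes>\<^bsub>mpoly R n\<^esub> p) m"
    unfolding mpoly_simps
    by (rule finsum_bij[where h = "\<lambda>(a, b). (b, a)"])
       (use mpoly_carrierD(1)[OF p] mpoly_carrierD(1)[OF q] in
        \<open>auto simp: bij_betw_def inj_on_def image_def add.commute m_comm\<close>)
qed

lemma mpoly_abelian_group: "abelian_group (mpoly R n)"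
proof (rule abelian_groupI)
  fix p q r assume "p \<in> carrier (mpoly R n)" "q \<in> carrier (mpoly R n)" "r \<in> carrier (mpoly R n)"
  note [simp] = mpoly_carrierD(1)[OF this(1)] mpoly_carrierD(1)[OF this(2)] mpoly_carrierD(1)[OF this(3)]
  show "p \<oplus>\<^bsub>mpoly R n\<^esub> q \<oplus>\<^bsub>mpoly R n\<^esub> r = p \<oplus>\<^bsub>mpoly R n\<^esub> (q \<oplus>\<^bsub>mpoly R n\<^esub> r)"
    "p \<oplus>\<^bsub>mpoly R n\<^esub> q = q \<oplus>\<^bsub>mpoly R n\<^esub> p" "\<zero>\<^bsub>mpoly R n\<^esub> \<oplus>\<^bsub>mpoly R n\<^esub> p = p"
    by (simp_all add: mpoly_simps a_assoc) (simp add: a_comm)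
next
  fix p assume p: "p \<in> carrier (mpoly R n)"
  note [simp] = mpoly_carrierD(1)[OF p]
  show "\<exists>q\<in>carrier (mpoly R n). q \<oplus>\<^bsub>mpoly R n\<^esub> p = \<zero>\<^bsub>mpoly R n\<^esub>"
  proof (rule bexI)
    show "(\<lambda>m. \<ominus> p m) \<in> carrier (mpoly R n)"
      by (rule mpoly_carrierI)
         (use mpoly_carrierD(3)[OF p] in \<open>fastforce intro!: finite_subset[OF _ mpoly_carrierD(2)[OF p]]\<close>)+
  qed (simp add: mpoly_simps l_neg)
qed (auto intro: mpoly_add_closed, auto intro!: mpoly_carrierI simp: mpoly_simps)

lemma mpoly_cring: "cring (mpoly R n)"
proof (intro cringI mpoly_abelian_group comm_monoidI)
  show "\<one>\<^bsub>mpoly R n\<^esub> \<in> carrier (mpoly R n)"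
    using mpoly_mconst_closed[of \<one> n] by (simp add: mpoly_simps)
  show "\<one>\<^bsub>mpoly R n\<^esub> \<otimes>\<^bsub>mpoly R n\<^esub> p = p" if "p \<in> carrier (mpoly R n)" for p
    using mconst_mult[of p n \<one>] that by (simp add: mpoly_simps(2) mpoly_carrierD)
  show "(p \<oplus>\<^bsub>mpoly R n\<^esub> q) \<otimes>\<^bsub>mpoly R n\<^esub> r = p \<otimes>\<^bsub>mpoly R n\<^esub> r \<oplus>\<^bsub>mpoly R n\<^esub> q \<otimes>\<^bsub>mpoly R n\<^esub> r"
    if "p \<in> carrier (mpoly R n)" "q \<in> carrier (mpoly R n)" "r \<in> carrier (mpoly R n)" for p q r
  proof
    note [simp] = mpoly_carrierD(1)[OF that(1)] mpoly_carrierD(1)[OF that(2)] mpoly_carrierD(1)[OF that(3)]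
    fix m
    have "(\<Oplus>ab\<in>splits m. (p (fst ab) \<oplus> q (fst ab)) \<otimes> r (snd ab)) =
        (\<Oplus>ab\<in>splits m. p (fst ab) \<otimes> r (snd ab) \<oplus> q (fst ab) \<otimes> r (snd ab))"
      by (intro finsum_cong') (auto simp: l_distr)
    then show "((p \<oplus>\<^bsub>mpoly R n\<^esub> q) \<otimes>\<^bsub>mpoly R n\<^esub> r) m =
        (p \<otimes>\<^bsub>mpoly R n\<^esub> r \<oplus>\<^bsub>mpoly R n\<^esub> q \<otimes>\<^bsub>mpoly R n\<^esub> r) m"
      by (simp add: mpoly_simps finsum_addf)
  qed
qed (auto intro: mpoly_mult_closed mpoly_mult_assoc mpoly_mult_comm)

lemma mpoly_a_inv:
  assumes "p \<in> carrier (mpoly R n)"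
  shows "(\<ominus>\<^bsub>mpoly R n\<^esub> p) m = \<ominus> p m"
proof -
  interpret M: cring "mpoly R n" by (rule mpoly_cring)
  have "p m \<oplus> (\<ominus>\<^bsub>mpoly R n\<^esub> p) m = \<zero>"
    using M.r_neg[OF assms] by (simp add: mpoly_simps fun_eq_iff)
  moreover have "(\<ominus>\<^bsub>mpoly R n\<^esub> p) m \<in> carrier R" "p m \<in> carrier R"
    using assms by (auto intro: mpoly_carrierD)
  ultimately show ?thesis
    by (metis a_comm minus_equality)
qed

lemma mpoly_minus:
  assumes "p \<in> carrier (mpoly R n)" "q \<in> carrier (mpoly R n)"
  shows "(p \<ominus>\<^bsub>mpoly R n\<^esub> q) m = p m \<ominus> q m"
  using mpoly_a_inv[OF assms(2)] by (simp add: a_minus_def mpoly_simps)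

lemma mpoly_finsum:
  assumes "finite I" "\<And>i. i \<in> I \<Longrightarrow> f i \<in> carrier (mpoly R n)"
  shows "(\<Oplus>\<^bsub>mpoly R n\<^esub>i\<in>I. f i) m = (\<Oplus>i\<in>I. f i m)"
  using assms
proof (induction I rule: finite_induct)
  case empty
  interpret M: cring "mpoly R n" by (rule mpoly_cring)
  show ?case by (simp add: mpoly_simps)
next
  case (insert i I)
  interpret M: cring "mpoly R n" by (rule mpoly_cring)
  have "f j m \<in> carrier R" if "j \<in> insert i I" for j
    using insert.prems[OF that] by (rule mpoly_carrierD)
  then have "(\<Oplus>i\<in>insert i I. f i m) = f i m \<oplus> (\<Oplus>i\<in>I. f i m)"
    using insert by (intro finsum_insert) auto
  moreover have "(\<Oplus>\<^bsub>mpoly R n\<^esub>i\<in>insert i I. f i) = f i \<oplus>\<^bsub>mpoly R n\<^esub> (\<Oplus>\<^bsub>mpoly R n\<^esub>i\<in>I. f i)"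
    using insert by (intro M.finsum_insert) auto
  ultimately show ?case
    using insert by (simp add: mpoly_simps)
qed

end

lemma mpoly_mono:
  assumes "n \<le> k"
  shows "carrier (mpoly A n) \<subseteq> carrier (mpoly A k)"
  using assms by (force simp: mpoly_def)

lemma mpoly_ops_eq:
  "monoid.mult (mpoly A n) = monoid.mult (mpoly A k)" "monoid.one (mpoly A n) = monoid.one (mpoly A k)"
  "ring.zero (mpoly A n) = ring.zero (mpoly A k)" "ring.add (mpoly A n) = ring.add (mpoly A k)"
  by (simp_all add: mpoly_def)


section \<open>Scaling variables and Vandermonde arguments\<close>

lemma ring_hom_cong:
  assumes "f \<in> ring_hom A B" "\<And>x. x \<in> carrier A \<Longrightarrow> g x = f x" "ring A"
  shows "g \<in> ring_hom A B"
proof -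
  interpret ring A by fact
  show ?thesis
    using assms by (auto intro!: ring_hom_memI simp: ring_hom_closed ring_hom_mult ring_hom_add ring_hom_one)
qed

text \<open>The preimage of an ideal is an ideal, so an ideal of \<open>S\<close> that contains the
  images of generators contains the images of everything they generate. This makes base change
  functorial.\<close>

lemma (in ring_hom_ring) genideal_image:
  assumes "X \<subseteq> carrier R"
  shows "genideal S (h ` genideal R X) = genideal S (h ` X)"
proof
  have X: "h ` X \<subseteq> carrier S" using assms by auto
  have "genideal R X \<subseteq> {r \<in> carrier R. h r \<in> genideal S (h ` X)}"
    using assms S.genideal_self[OF X]
    by (intro R.genideal_minimal ideal_vimage S.genideal_ideal X) auto
  then show "genideal S (h ` genideal R X) \<subseteq> genideal S (h ` X)"
    by (intro S.genideal_minimal S.genideal_ideal X) auto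
  have "genideal R X \<subseteq> carrier R"
    using R.genideal_ideal[OF assms] by (rule ideal.axioms(1)[THEN additive_subgroup.a_subset])
  then show "genideal S (h ` X) \<subseteq> genideal S (h ` genideal R X)"
    by (intro S.subset_Idl_subset image_mono R.genideal_self assms) auto
qed

lemma (in ring_hom_ring) ideal_image_surj:
  assumes "ideal I R" "h ` carrier R = carrier S"
  shows "ideal (h ` I) S"
proof -
  interpret I: ideal I R by fact
  show ?thesis
  proof (rule idealI)
    show "subgroup (h ` I) (add_monoid S)"
      by (rule img_is_add_subgroup) (rule I.a_subgroup)
    fix a x assume "a \<in> h ` I" "x \<in> carrier S"
    then obtain b y where "a = h b" "b \<in> I" "x = h y" "y \<in> carrier R" using assms(2) by blast
    then have "x \<otimes>\<^bsub>S\<^esub> a = h (y \<otimes> b)" "a \<otimes>\<^bsub>S\<^esub> x = h (b \<otimes> y)" by auto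
    then show "x \<otimes>\<^bsub>S\<^esub> a \<in> h ` I" "a \<otimes>\<^bsub>S\<^esub> x \<in> h ` I"
      using I.I_l_closed I.I_r_closed \<open>b \<in> I\<close> \<open>y \<in> carrier R\<close> by (simp_all del: hom_mult)
  qed (rule S.ring_axioms)
qed

text \<open>One form for the three substitutions that occur: change of coefficients, rescaling of
  variables, and \<open>x_n = 0\<close>. Each applies a ring homomorphism to the coefficients and
  multiplies the coefficient of a monomial by a weight that is multiplicative in the
  monomial.\<close>

definition twist :: "('b, 'm) ring_scheme \<Rightarrow> (monomial \<Rightarrow> 'b) \<Rightarrow> ('a \<Rightarrow> 'b) \<Rightarrow> (monomial \<Rightarrow> 'a) \<Rightarrow> monomial \<Rightarrow> 'b" where
  "twist B w f p = (\<lambda>m. w m \<otimes>\<^bsub>B\<^esub> f (p m))"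

text \<open>Multiplicativity of the weight lets the factor \<open>w m\<close> be distributed over
  each splitting of \<open>m\<close>. The condition on the variables permits a target with fewer of
  them: for \<open>x_n = 0\<close> the weight vanishes on every monomial that contains
  \<open>x_n\<close>.\<close>

lemma (in ring_hom_cring) twist_ring_hom:
  assumes w: "\<And>m. w m \<in> carrier S" "w 0 = \<one>\<^bsub>S\<^esub>" "\<And>a b. w (a + b) = w a \<otimes>\<^bsub>S\<^esub> w b"
    and vars: "\<And>m. Poly_Mapping.keys m \<subseteq> {..<n} \<Longrightarrow> w m \<noteq> \<zero>\<^bsub>S\<^esub> \<Longrightarrow> Poly_Mapping.keys m \<subseteq> {..<k}"
  shows "twist S w h \<in> ring_hom (mpoly R n) (mpoly S k)"
proof (rule ring_hom_memI)
  have nz: "p m \<noteq> \<zero> \<and> w m \<noteq> \<zero>\<^bsub>S\<^esub>" if "p \<in> carrier (mpoly R n)" "twist S w h p m \<noteq> \<zero>\<^bsub>S\<^esub>" for p m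
    using that w mpoly_carrierD(1)[OF that(1), of m] by (auto simp: twist_def)
  fix p assume p: "p \<in> carrier (mpoly R n)"
  note [simp] = mpoly_carrierD(1)[OF p] w(1)
  show "twist S w h p \<in> carrier (mpoly S k)"
  proof (rule mpoly_carrierI)
    show "finite {m. twist S w h p m \<noteq> \<zero>\<^bsub>S\<^esub>}"
      by (rule finite_subset[OF _ mpoly_carrierD(2)[OF p]]) (use nz[OF p] in auto)
    show "Poly_Mapping.keys m \<subseteq> {..<k}" if "twist S w h p m \<noteq> \<zero>\<^bsub>S\<^esub>" for m
      using nz[OF p that] mpoly_carrierD(3)[OF p] vars by blast
  qed (simp add: twist_def)
  fix q assume q: "q \<in> carrier (mpoly R n)"
  note [simp] = mpoly_carrierD(1)[OF q]
  show "twist S w h (p \<oplus>\<^bsub>mpoly R n\<^esub> q) = twist S w h p \<oplus>\<^bsub>mpoly S k\<^esub> twist S w h q"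
    by (simp add: twist_def mpoly_simps S.r_distr)
  show "twist S w h (p \<otimes>\<^bsub>mpoly R n\<^esub> q) = twist S w h p \<otimes>\<^bsub>mpoly S k\<^esub> twist S w h q"
  proof
    fix m
    have "twist S w h (p \<otimes>\<^bsub>mpoly R n\<^esub> q) m = w m \<otimes>\<^bsub>S\<^esub> (\<Oplus>\<^bsub>S\<^esub>ab\<in>splits m. h (p (fst ab)) \<otimes>\<^bsub>S\<^esub> h (q (snd ab)))"
      by (simp add: twist_def mpoly_simps o_def)
    also have "\<dots> = (\<Oplus>\<^bsub>S\<^esub>ab\<in>splits m. w m \<otimes>\<^bsub>S\<^esub> (h (p (fst ab)) \<otimes>\<^bsub>S\<^esub> h (q (snd ab))))"
      by (intro S.finsum_rdistr finite_monomial_splittings) auto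
    also have "\<dots> = (\<Oplus>\<^bsub>S\<^esub>ab\<in>splits m. twist S w h p (fst ab) \<otimes>\<^bsub>S\<^esub> twist S w h q (snd ab))"
      by (intro S.finsum_cong') (auto simp: twist_def w(3) S.m_ac)
    finally show "twist S w h (p \<otimes>\<^bsub>mpoly R n\<^esub> q) m = (twist S w h p \<otimes>\<^bsub>mpoly S k\<^esub> twist S w h q) m"
      by (simp add: mpoly_simps)
  qed
next
  show "twist S w h \<one>\<^bsub>mpoly R n\<^esub> = \<one>\<^bsub>mpoly S k\<^esub>"
    using w by (auto simp: twist_def mpoly_simps fun_eq_iff)
qed

lemma (in ring_hom_cring) coeff_map_hom:
  "(\<lambda>p m. h (p m)) \<in> ring_hom (mpoly R n) (mpoly S n)"
proof (rule ring_hom_cong)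
  show "twist S (\<lambda>m. \<one>\<^bsub>S\<^esub>) h \<in> ring_hom (mpoly R n) (mpoly S n)"
    by (rule twist_ring_hom) auto
  show "ring (mpoly R n)" using R.mpoly_cring by (rule cring.axioms(1))
qed (auto simp: twist_def mpoly_carrierD(1))

lemma (in cring) id_ring_hom_cring: "ring_hom_cring R R (\<lambda>x. x)"
  by unfold_locales (auto intro: ring_hom_memI)

text \<open>With \<open>g\<close> the exponent of \<open>x_n\<close> this is the substitution of
  \<open>c x_n\<close> for \<open>x_n\<close>; with \<open>g\<close> the degree it multiplies every
  variable by \<open>c\<close>.\<close>

definition mscale :: "('a, 'm) ring_scheme \<Rightarrow> (monomial \<Rightarrow> nat) \<Rightarrow> 'a \<Rightarrow> (monomial \<Rightarrow> 'a) \<Rightarrow> monomial \<Rightarrow> 'a" where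
  "mscale A g c p = (\<lambda>m. c [^]\<^bsub>A\<^esub> g m \<otimes>\<^bsub>A\<^esub> p m)"

definition additive_weight :: "(monomial \<Rightarrow> nat) \<Rightarrow> bool" where
  "additive_weight g \<longleftrightarrow> g 0 = 0 \<and> (\<forall>a b. g (a + b) = g a + g b)"

lemma monomial_degree_sum:
  assumes "finite S" "Poly_Mapping.keys m \<subseteq> S"
  shows "monomial_degree m = (\<Sum>i\<in>S. Poly_Mapping.lookup m i)"
  unfolding monomial_degree_def using assms by (intro sum.mono_neutral_left) (auto simp: in_keys_iff)

lemma additive_weight_degree: "additive_weight monomial_degree"
  unfolding additive_weight_def
proof (intro conjI allI)
  fix a b :: monomial
  let ?S = "Poly_Mapping.keys a \<union> Poly_Mapping.keys b"
  show "monomial_degree (a + b) = monomial_degree a + monomial_degree b"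
    by (subst (1 2 3) monomial_degree_sum[of ?S]) (auto simp: keys_add_nat lookup_add sum.distrib)
qed (simp add: monomial_degree_def)

lemma additive_weight_lookup: "additive_weight (\<lambda>m. Poly_Mapping.lookup m i)"
  by (simp add: additive_weight_def lookup_add)

lemma (in cring) mscale_hom:
  assumes "additive_weight g" "c \<in> carrier R"
  shows "mscale R g c \<in> ring_hom (mpoly R n) (mpoly R n)"
proof -
  have "twist R (\<lambda>m. c [^] g m) (\<lambda>x. x) \<in> ring_hom (mpoly R n) (mpoly R n)"
    using assms by (intro ring_hom_cring.twist_ring_hom id_ring_hom_cring) (auto simp: additive_weight_def nat_pow_mult)
  then show ?thesis by (simp add: twist_def[abs_def] mscale_def[abs_def])
qed

lemma (in cring) set_var_zero_hom:
  "set_var_zero R n \<in> ring_hom (mpoly R (Suc n)) (mpoly R n)"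
proof (rule ring_hom_cong)
  show "twist R (\<lambda>m. if Poly_Mapping.lookup m n = 0 then \<one> else \<zero>) (\<lambda>x. x) \<in> ring_hom (mpoly R (Suc n)) (mpoly R n)"
  proof (rule ring_hom_cring.twist_ring_hom[OF id_ring_hom_cring])
    fix m :: monomial
    assume "Poly_Mapping.keys m \<subseteq> {..<Suc n}" and "(if Poly_Mapping.lookup m n = 0 then \<one> else \<zero>) \<noteq> \<zero>"
    then have "Poly_Mapping.keys m \<subseteq> {..<Suc n}" "n \<notin> Poly_Mapping.keys m"
      by (auto simp: in_keys_iff split: if_splits)
    then show "Poly_Mapping.keys m \<subseteq> {..<n}"
      by (metis lessThan_Suc subset_insert)
  qed (auto simp: lookup_add)
  show "ring (mpoly R (Suc n))" using mpoly_cring by (rule cring.axioms(1))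
qed (auto simp: twist_def set_var_zero_def mpoly_carrierD(1))

lemma set_var_zero_id:
  assumes "p \<in> carrier (mpoly A n)"
  shows "set_var_zero A n p = p"
proof
  fix m
  have "p m = \<zero>\<^bsub>A\<^esub>" if "Poly_Mapping.lookup m n \<noteq> 0"
  proof (rule ccontr)
    assume "p m \<noteq> \<zero>\<^bsub>A\<^esub>"
    moreover have "n \<in> Poly_Mapping.keys m" using that by (simp add: in_keys_iff)
    ultimately show False using mpoly_carrierD(3)[OF assms] by blast
  qed
  then show "set_var_zero A n p m = p m" by (auto simp: set_var_zero_def)
qed

text \<open>Subtraction of monomials is truncated in each exponent, so dividing by
  \<open>x_i\<close> can be undone only if \<open>x_i\<close> occurs.\<close>

lemma lookup_single_split:
  assumes "Poly_Mapping.lookup m i \<noteq> 0"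
  shows "Poly_Mapping.single i 1 + (m - Poly_Mapping.single i 1) = (m :: monomial)"
  using assms by (intro poly_mapping_eqI) (auto simp: lookup_add lookup_minus lookup_single when_def)

lemma (in cring) mpoly_var_closed:
  assumes "i < n"
  shows "mpoly_var R i \<in> carrier (mpoly R n)"
  by (rule mpoly_carrierI) (use assms in \<open>auto simp: mpoly_var_def split: if_splits\<close>)

lemma (in cring) mpoly_var_mult:
  assumes p: "p \<in> carrier (mpoly R n)"
  shows "(mpoly_var R i \<otimes>\<^bsub>mpoly R n\<^esub> p) m =
    (if Poly_Mapping.lookup m i = 0 then \<zero> else p (m - Poly_Mapping.single i 1))"
proof (cases "Poly_Mapping.lookup m i = 0")
  case True
  then have "a \<noteq> Poly_Mapping.single i 1" if "(a, b) \<in> splits m" for a b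
    using that by (auto simp: lookup_add)
  then have "(\<Oplus>ab\<in>splits m. mpoly_var R i (fst ab) \<otimes> p (snd ab)) = \<zero>"
    using mpoly_carrierD(1)[OF p] by (intro add.finprod_one_eqI) (auto simp: mpoly_var_def)
  with True show ?thesis by (simp add: mpoly_simps)
next
  case False
  let ?b = "m - Poly_Mapping.single i 1"
  have "(\<Oplus>ab\<in>splits m. mpoly_var R i (fst ab) \<otimes> p (snd ab)) =
      (\<lambda>ab. mpoly_var R i (fst ab) \<otimes> p (snd ab)) (Poly_Mapping.single i 1, ?b)"
    by (rule finsum_single)
       (use mpoly_carrierD(1)[OF p] lookup_single_split[OF False]
        in \<open>auto simp: mpoly_var_def finite_monomial_splittings\<close>)
  then show ?thesis
    using False mpoly_carrierD(1)[OF p] by (simp add: mpoly_simps mpoly_var_def)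
qed

text \<open>Induction on the degree in this form only divides by differences of points, and never by a
  Vandermonde determinant.\<close>

fun horner :: "('a, 'm) ring_scheme \<Rightarrow> 'a \<Rightarrow> 'a list \<Rightarrow> 'a" where
  "horner A x [] = \<zero>\<^bsub>A\<^esub>"
| "horner A x (v # vs) = v \<oplus>\<^bsub>A\<^esub> x \<otimes>\<^bsub>A\<^esub> horner A x vs"

text \<open>Division by \<open>X - x\<close>: the head is the value at \<open>x\<close>, that is the
  remainder, and the tail lists the coefficients of the quotient, lowest degree first.\<close>

fun synthetic_division :: "('a, 'm) ring_scheme \<Rightarrow> 'a \<Rightarrow> 'a list \<Rightarrow> 'a list" where
  "synthetic_division A x [] = []"
| "synthetic_division A x (v # vs) = horner A x (v # vs) # synthetic_division A x vs"

lemma length_synthetic_division [simp]: "length (synthetic_division A x vs) = length vs"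
  by (induction vs) auto

context cring
begin

lemma horner_closed [intro, simp]: "x \<in> carrier R \<Longrightarrow> set vs \<subseteq> carrier R \<Longrightarrow> horner R x vs \<in> carrier R"
  by (induction vs) auto

lemma synthetic_division_closed: "x \<in> carrier R \<Longrightarrow> set vs \<subseteq> carrier R \<Longrightarrow> set (synthetic_division R x vs) \<subseteq> carrier R"
  by (induction vs) auto

text \<open>A polynomial minus its value at \<open>y\<close> is divisible by \<open>X - y\<close>;
  the quotient has one coefficient less, which drives the induction of
  \<open>vandermonde_horner\<close>.\<close>

lemma horner_diff:
  assumes "x \<in> carrier R" "y \<in> carrier R" "v \<in> carrier R" "set vs \<subseteq> carrier R"
  shows "horner R x (v # vs) \<ominus> horner R y (v # vs) = (x \<ominus> y) \<otimes> horner R x (synthetic_division R y vs)"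
  using assms(3,4)
proof (induction vs arbitrary: v)
  case Nil
  then show ?case using assms(1,2) by (simp add: r_neg a_minus_def)
next
  case (Cons w ws)
  let ?a = "horner R x (w # ws)" and ?b = "horner R y (w # ws)" and ?s = "horner R x (synthetic_division R y ws)"
  have cl: "?a \<in> carrier R" "?b \<in> carrier R" "?s \<in> carrier R" "v \<in> carrier R"
    using Cons.prems assms(1,2) synthetic_division_closed by (auto simp del: horner.simps)
  have IH: "?a \<ominus> ?b = (x \<ominus> y) \<otimes> ?s" using Cons by simp
  have a: "?a = ?b \<oplus> (?a \<ominus> ?b)" using cl(1,2) by algebra
  have "(v \<oplus> x \<otimes> ?a) \<ominus> (v \<oplus> y \<otimes> ?b) = x \<otimes> (?a \<ominus> ?b) \<oplus> (x \<ominus> y) \<otimes> ?b"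
    using cl assms(1,2) by algebra
  also have "\<dots> = (x \<ominus> y) \<otimes> (?b \<oplus> x \<otimes> ?s)"
    unfolding IH using cl assms(1,2) by algebra
  finally show ?case by simp
qed

text \<open>Synthetic division can be inverted without dividing: a coefficient \<open>v\<close> is
  the entry for \<open>v # vs\<close> minus \<open>x\<close> times the value of the remaining list
  \<open>vs\<close>.\<close>

lemma synthetic_division_in_ideal:
  assumes "ideal E R" "x \<in> carrier R" "set vs \<subseteq> carrier R" "set (synthetic_division R x vs) \<subseteq> E"
  shows "set vs \<subseteq> E \<and> horner R x vs \<in> E"
  using assms(3,4)
proof (induction vs)
  case Nil
  then show ?case using assms(1) by (simp add: ideal.axioms(1) additive_subgroup.zero_closed)
next
  case (Cons v vs)
  interpret E: ideal E R by fact
  have h: "horner R x vs \<in> E" "set vs \<subseteq> E" "v \<oplus> x \<otimes> horner R x vs \<in> E" using Cons by auto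
  have "v = (v \<oplus> x \<otimes> horner R x vs) \<ominus> x \<otimes> horner R x vs"
    using Cons.prems assms(2) h E.Icarr[OF h(1)] by (simp add: a_minus_def a_assoc r_neg)
  also have "\<dots> \<in> E"
    using h assms(2) by (simp add: a_minus_def E.I_l_closed)
  finally show ?case using h by simp
qed

lemma ideal_Units_cancel:
  assumes "ideal E R" "u \<in> Units R" "x \<in> carrier R" "u \<otimes> x \<in> E"
  shows "x \<in> E"
proof -
  have "inv u \<otimes> (u \<otimes> x) \<in> E"
    by (rule ideal.I_l_closed) (use assms in auto)
  then show ?thesis
    using assms by (simp add: m_assoc[symmetric] Units_closed)
qed

text \<open>Subtract the value at one point \<open>y\<close> and divide by the units
  \<open>x - y\<close>: the quotient takes values in \<open>E\<close> at all other points and is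
  shorter. An infinite set of points stays infinite when \<open>y\<close> is removed, so the number
  of points is never compared with the degree. Membership in an ideal \<open>E\<close> instead of
  vanishing lets the lemma act modulo an ideal.\<close>

lemma vandermonde_horner:
  assumes E: "ideal E R" and "infinite \<Lambda>" "\<Lambda> \<subseteq> carrier R"
    "\<And>x y. x \<in> \<Lambda> \<Longrightarrow> y \<in> \<Lambda> \<Longrightarrow> x \<noteq> y \<Longrightarrow> x \<ominus> y \<in> Units R"
    "set vs \<subseteq> carrier R" "\<And>x. x \<in> \<Lambda> \<Longrightarrow> horner R x vs \<in> E"
  shows "set vs \<subseteq> E"
  using assms(2-)
proof (induction "length vs" arbitrary: vs \<Lambda>)
  case (Suc k)
  interpret E: ideal E R by fact
  obtain v ws where vs: "vs = v # ws" using Suc(2) by (cases vs) auto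
  obtain y where y: "y \<in> \<Lambda>" using Suc.prems(1) by (metis finite.emptyI ex_in_conv)
  have cl: "y \<in> carrier R" "v \<in> carrier R" "set ws \<subseteq> carrier R"
    using y Suc.prems vs by auto
  have "horner R x (synthetic_division R y ws) \<in> E" if x: "x \<in> \<Lambda> - {y}" for x
  proof -
    have xc: "x \<in> carrier R" using x Suc.prems by auto
    have "horner R x vs \<ominus> horner R y vs \<in> E"
      using Suc.prems(5) x y by (simp add: a_minus_def)
    then have "(x \<ominus> y) \<otimes> horner R x (synthetic_division R y ws) \<in> E"
      using horner_diff[OF xc cl(1-3)] vs by simp
    moreover have "x \<ominus> y \<in> Units R" using x y Suc.prems(3) by auto
    ultimately show ?thesis
      using horner_closed[OF xc synthetic_division_closed[OF cl(1) cl(3)]] by (metis ideal_Units_cancel[OF E])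
  qed
  then have "set (synthetic_division R y ws) \<subseteq> E"
    by (rule Suc(1)[of "synthetic_division R y ws" "\<Lambda> - {y}", rotated 5])
       (use Suc.prems(1-3) Suc(2) vs synthetic_division_closed[OF cl(1) cl(3)] in auto)
  then have ws: "set ws \<subseteq> E" "horner R y ws \<in> E"
    using synthetic_division_in_ideal[OF E cl(1,3)] by auto
  have "v \<oplus> y \<otimes> horner R y ws \<in> E" using Suc.prems(5)[OF y] vs by simp
  then have "set (synthetic_division R y vs) \<subseteq> E"
    using \<open>set (synthetic_division R y ws) \<subseteq> E\<close> vs by simp
  then show ?case
    using synthetic_division_in_ideal[OF E cl(1)] Suc.prems(4) by blast
qed simp

lemma finsum_horner:
  assumes "x \<in> carrier R" "\<And>i. i < k \<Longrightarrow> v i \<in> carrier R"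
  shows "(\<Oplus>i\<in>{..<k}. x [^] i \<otimes> v i) = horner R x (map v [0..<k])"
  using assms(2)
proof (induction k arbitrary: v)
  case (Suc k)
  have "(\<Oplus>i\<in>{..<Suc k}. x [^] i \<otimes> v i) = (\<Oplus>i\<in>insert 0 (Suc ` {..<k}). x [^] i \<otimes> v i)"
    by (simp add: lessThan_Suc_eq_insert_0)
  also have "\<dots> = x [^] (0::nat) \<otimes> v 0 \<oplus> (\<Oplus>i\<in>Suc ` {..<k}. x [^] i \<otimes> v i)"
    using assms(1) Suc.prems by (intro finsum_insert) auto
  also have "(\<Oplus>i\<in>Suc ` {..<k}. x [^] i \<otimes> v i) = (\<Oplus>i\<in>{..<k}. x [^] Suc i \<otimes> v (Suc i))"
    using assms(1) Suc.prems by (intro finsum_reindex) auto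
  also have "\<dots> = (\<Oplus>i\<in>{..<k}. x \<otimes> (x [^] i \<otimes> v (Suc i)))"
    using assms(1) Suc.prems by (intro finsum_cong') (auto simp: m_ac)
  also have "\<dots> = x \<otimes> (\<Oplus>i\<in>{..<k}. x [^] i \<otimes> v (Suc i))"
    using assms(1) Suc.prems by (intro finsum_rdistr[symmetric]) auto
  also have "(\<Oplus>i\<in>{..<k}. x [^] i \<otimes> v (Suc i)) = horner R x (map (\<lambda>i. v (Suc i)) [0..<k])"
    using Suc by simp
  finally show ?case
    using Suc.prems by (simp add: upt_conv_Cons map_Suc_upt[symmetric] o_def del: upt_Suc)
qed simp

end

text \<open>The evaluation points are images of elements of a field, where a nonzero difference is a
  unit and stays one in \<open>S\<close>. As \<open>S\<close> is not the zero ring, \<open>h\<close>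
  is injective on the points, so infinitely many images remain.\<close>

lemma (in ring_hom_cring) vandermonde:
  fixes i k :: nat
  assumes K: "field R" and L: "infinite \<Lambda>" "\<Lambda> \<subseteq> carrier R" and S: "\<one>\<^bsub>S\<^esub> \<noteq> \<zero>\<^bsub>S\<^esub>"
    and E: "ideal E S" and v: "\<And>i. i < k \<Longrightarrow> v i \<in> carrier S"
    and in_E: "\<And>c. c \<in> \<Lambda> \<Longrightarrow> (\<Oplus>\<^bsub>S\<^esub>i\<in>{..<k}. h c [^]\<^bsub>S\<^esub> i \<otimes>\<^bsub>S\<^esub> v i) \<in> E" and "i < k"
  shows "v i \<in> E"
proof -
  interpret K: field R by fact
  have unit: "h c \<in> Units S" if "c \<in> carrier R" "c \<noteq> \<zero>" for c
  proof -
    have "c \<in> Units R" using that by (simp add: K.field_Units)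
    then have "h c \<otimes>\<^bsub>S\<^esub> h (inv c) = \<one>\<^bsub>S\<^esub>" "h (inv c) \<in> carrier S"
      using that by (auto simp flip: hom_mult)
    then show ?thesis
      using that S.m_comm[of "h c" "h (inv c)"] by (auto simp: Units_def)
  qed
  have diff: "h c \<ominus>\<^bsub>S\<^esub> h d \<in> Units S" if "c \<in> \<Lambda>" "d \<in> \<Lambda>" "c \<noteq> d" for c d
  proof -
    have cd: "c \<in> carrier R" "d \<in> carrier R" using that L by auto
    have "c = d" if "c \<ominus> d = \<zero>"
      using that cd R.minus_equality[of c "\<ominus> d"] by (simp add: a_minus_def)
    with that have "c \<ominus> d \<noteq> \<zero>" by auto
    then show ?thesis using unit[of "c \<ominus> d"] cd by (simp add: a_minus_def)
  qed
  have "inj_on h \<Lambda>"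
  proof (rule inj_onI, rule ccontr)
    fix c d assume *: "c \<in> \<Lambda>" "d \<in> \<Lambda>" "h c = h d" "c \<noteq> d"
    then have "\<zero>\<^bsub>S\<^esub> \<in> Units S" using diff[of c d] L by (auto simp: S.r_neg a_minus_def)
    then show False using S by (metis S.Units_r_inv S.Units_inv_closed S.l_null)
  qed
  then have "infinite (h ` \<Lambda>)" using L(1) by (simp add: finite_image_iff)
  then have "set (map v [0..<k]) \<subseteq> E"
  proof (rule S.vandermonde_horner[OF E])
    fix x assume "x \<in> h ` \<Lambda>"
    then obtain c where c: "x = h c" "c \<in> \<Lambda>" by auto
    then show "horner S x (map v [0..<k]) \<in> E"
      using in_E[OF c(2)] S.finsum_horner[of "h c" k v] v L by auto
  qed (use L diff v in auto)
  then show ?thesis using \<open>i < k\<close> by auto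
qed

section \<open>Weight components and scalings of polynomials\<close>

definition wcomp :: "('a, 'm) ring_scheme \<Rightarrow> (monomial \<Rightarrow> nat) \<Rightarrow> nat \<Rightarrow> (monomial \<Rightarrow> 'a) \<Rightarrow> monomial \<Rightarrow> 'a" where
  "wcomp A g d p = (\<lambda>m. if g m = d then p m else \<zero>\<^bsub>A\<^esub>)"

lemma hom_component_wcomp: "hom_component A = wcomp A monomial_degree"
  by (simp add: fun_eq_iff hom_component_def wcomp_def)

abbreviation scalar :: "('k, 'a, 'm) module_scheme \<Rightarrow> 'k \<Rightarrow> 'a" where
  "scalar A c \<equiv> c \<odot>\<^bsub>A\<^esub> \<one>\<^bsub>A\<^esub>"

lemma (in algebra) scalar_hom_cring: "ring_hom_cring R M (\<lambda>c. scalar M c)"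
proof (unfold_locales, rule ring_hom_memI)
  fix x y assume "x \<in> carrier R" "y \<in> carrier R"
  then show "(x \<otimes>\<^bsub>R\<^esub> y) \<odot>\<^bsub>M\<^esub> \<one>\<^bsub>M\<^esub> = x \<odot>\<^bsub>M\<^esub> \<one>\<^bsub>M\<^esub> \<otimes>\<^bsub>M\<^esub> (y \<odot>\<^bsub>M\<^esub> \<one>\<^bsub>M\<^esub>)"
    by (simp add: smult_assoc1 smult_assoc2)
qed (auto simp: smult_l_distr)

lemma (in ring_hom_cring) ring_hom_ring: "ring_hom_ring R S h"
  by (intro ring_hom_ringI2 R.ring_axioms S.ring_axioms homh)

lemma (in cring) wcomp_closed:
  assumes "p \<in> carrier (mpoly R n)"
  shows "wcomp R g d p \<in> carrier (mpoly R n)"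
proof (rule mpoly_carrierI)
  show "finite {m. wcomp R g d p m \<noteq> \<zero>}"
    by (rule finite_subset[OF _ mpoly_carrierD(2)[OF assms]]) (auto simp: wcomp_def)
  show "Poly_Mapping.keys m \<subseteq> {..<n}" if "wcomp R g d p m \<noteq> \<zero>" for m
    using that by (intro mpoly_carrierD(3)[OF assms]) (auto simp: wcomp_def split: if_splits)
qed (auto simp: wcomp_def mpoly_carrierD(1)[OF assms])

lemma (in cring) mscale_closed:
  assumes "p \<in> carrier (mpoly R n)" "c \<in> carrier R"
  shows "mscale R g c p \<in> carrier (mpoly R n)"
proof (rule mpoly_carrierI)
  have nz: "p m \<noteq> \<zero>" if "mscale R g c p m \<noteq> \<zero>" for m
    using that assms(2) by (auto simp: mscale_def)
  show "finite {m. mscale R g c p m \<noteq> \<zero>}"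
    by (rule finite_subset[OF _ mpoly_carrierD(2)[OF assms(1)]]) (use nz in auto)
  show "Poly_Mapping.keys m \<subseteq> {..<n}" if "mscale R g c p m \<noteq> \<zero>" for m
    using nz[OF that] mpoly_carrierD(3)[OF assms(1)] by blast
qed (use assms in \<open>auto simp: mscale_def mpoly_carrierD(1)\<close>)

lemma (in cring) mconst_hom_cring: "ring_hom_cring R (mpoly R n) (mconst R)"
proof -
  interpret M: cring "mpoly R n" by (rule mpoly_cring)
  show ?thesis
  proof (unfold_locales, rule ring_hom_memI)
    fix x y assume xy: "x \<in> carrier R" "y \<in> carrier R"
    show "mconst R (x \<otimes> y) = mconst R x \<otimes>\<^bsub>mpoly R n\<^esub> mconst R y"
      using xy by (subst mconst_mult) (auto intro: mpoly_mconst_closed simp: fun_eq_iff)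
  qed (auto intro: mpoly_mconst_closed simp: mpoly_simps fun_eq_iff)
qed

text \<open>Translates between sums of polynomials, to which the Vandermonde argument applies, and
  sums of their coefficients, which arise from specialization.\<close>

lemma (in cring) mpoly_power_sum:
  assumes "x \<in> carrier R" "\<And>i. i < k \<Longrightarrow> q i \<in> carrier (mpoly R n)"
  shows "(\<Oplus>\<^bsub>mpoly R n\<^esub>i\<in>{..<k}. mconst R x [^]\<^bsub>mpoly R n\<^esub> (i::nat) \<otimes>\<^bsub>mpoly R n\<^esub> q i) =
    (\<lambda>m. \<Oplus>i\<in>{..<k}. x [^] i \<otimes> q i m)"
proof
  fix m
  interpret M: cring "mpoly R n" by (rule mpoly_cring)
  interpret C: ring_hom_cring R "mpoly R n" "mconst R" by (rule mconst_hom_cring)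
  have pow: "mconst R x [^]\<^bsub>mpoly R n\<^esub> i = mconst R (x [^] i)" for i :: nat
    using C.hom_pow[OF assms(1), of i] by simp
  have cl: "mconst R x [^]\<^bsub>mpoly R n\<^esub> i \<otimes>\<^bsub>mpoly R n\<^esub> q i \<in> carrier (mpoly R n)" if "i < k" for i
    unfolding pow using assms that by (auto intro!: M.m_closed mpoly_mconst_closed)
  have eq: "(mconst R x [^]\<^bsub>mpoly R n\<^esub> i \<otimes>\<^bsub>mpoly R n\<^esub> q i) m = x [^] i \<otimes> q i m" if "i < k" for i
    unfolding pow using mconst_mult[OF assms(2)[OF that], of "x [^] i"] assms(1) by simp
  have "(\<Oplus>\<^bsub>mpoly R n\<^esub>i\<in>{..<k}. mconst R x [^]\<^bsub>mpoly R n\<^esub> i \<otimes>\<^bsub>mpoly R n\<^esub> q i) m =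
      (\<Oplus>i\<in>{..<k}. (mconst R x [^]\<^bsub>mpoly R n\<^esub> i \<otimes>\<^bsub>mpoly R n\<^esub> q i) m)"
    by (rule mpoly_finsum) (use cl in auto)
  also have "\<dots> = (\<Oplus>i\<in>{..<k}. x [^] i \<otimes> q i m)"
    by (intro finsum_cong') (use eq assms(1) mpoly_carrierD(1)[OF assms(2)] in auto)
  finally show "(\<Oplus>\<^bsub>mpoly R n\<^esub>i\<in>{..<k}. mconst R x [^]\<^bsub>mpoly R n\<^esub> i \<otimes>\<^bsub>mpoly R n\<^esub> q i) m =
      (\<Oplus>i\<in>{..<k}. x [^] i \<otimes> q i m)" .
qed

text \<open>As a function of \<open>c\<close> the scaling is a polynomial whose coefficients are the
  weight components. A single bound \<open>k\<close>, one more than the largest weight that occurs,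
  serves all \<open>c\<close>, as the Vandermonde argument requires.\<close>

lemma (in cring) mscale_sum_wcomp:
  assumes p: "p \<in> carrier (mpoly R n)"
  shows "\<exists>k::nat. (\<forall>c\<in>carrier R. mscale R g c p =
      (\<Oplus>\<^bsub>mpoly R n\<^esub>i\<in>{..<k}. mconst R c [^]\<^bsub>mpoly R n\<^esub> i \<otimes>\<^bsub>mpoly R n\<^esub> wcomp R g i p)) \<and>
    (\<forall>d\<ge>k. wcomp R g d p = \<zero>\<^bsub>mpoly R n\<^esub>)"
proof -
  define k where "k = Suc (Max (insert 0 (g ` {m. p m \<noteq> \<zero>})))"
  have gk: "g m < k" if "p m \<noteq> \<zero>" for m
    using that mpoly_carrierD(2)[OF p] by (simp add: k_def less_Suc_eq_le)
  show ?thesis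
  proof (intro exI[of _ k] conjI ballI allI impI)
  show "wcomp R g d p = \<zero>\<^bsub>mpoly R n\<^esub>" if "d \<ge> k" for d
    using gk that by (fastforce simp: wcomp_def mpoly_simps fun_eq_iff)
  show "mscale R g c p =
      (\<Oplus>\<^bsub>mpoly R n\<^esub>i\<in>{..<k}. mconst R c [^]\<^bsub>mpoly R n\<^esub> i \<otimes>\<^bsub>mpoly R n\<^esub> wcomp R g i p)"
    if c: "c \<in> carrier R" for c
  proof (subst mpoly_power_sum[OF c wcomp_closed[OF p]], rule ext)
    fix m
    have "(\<Oplus>i\<in>{..<k}. c [^] i \<otimes> wcomp R g i p m) = c [^] g m \<otimes> p m"
    proof (cases "p m = \<zero>")
      case True
      then have "(\<Oplus>i\<in>{..<k}. c [^] i \<otimes> wcomp R g i p m) = \<zero>"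
        using c by (intro add.finprod_one_eqI) (auto simp: wcomp_def)
      with True c show ?thesis by simp
    next
      case False
      then have "(\<Oplus>i\<in>{..<k}. c [^] i \<otimes> wcomp R g i p m) = (\<lambda>i. c [^] i \<otimes> wcomp R g i p m) (g m)"
        by (intro finsum_single) (use c gk mpoly_carrierD(1)[OF p] in \<open>auto simp: wcomp_def\<close>)
      then show ?thesis by (simp add: wcomp_def)
    qed
    then show "mscale R g c p m = (\<Oplus>i\<in>{..<k}. c [^] i \<otimes> wcomp R g i p m)"
      by (simp add: mscale_def)
  qed
qed
qed

lemma (in ideal) finsum_in_ideal:
  assumes "\<And>i. i \<in> S \<Longrightarrow> f i \<in> I"
  shows "(\<Oplus>i\<in>S. f i) \<in> I"
proof (cases "finite S")
  case True
  then show ?thesis using assms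
  proof (induction S rule: finite_induct)
    case (insert i S)
    then have "(\<Oplus>i\<in>insert i S. f i) = f i \<oplus> (\<Oplus>i\<in>S. f i)"
      by (intro finsum_insert) (auto intro: Icarr)
    then show ?case using insert by simp
  qed simp
qed simp

lemma (in cring) mscale_in_ideal:
  assumes I: "ideal I (mpoly R n)" and p: "p \<in> I" and "\<And>d. wcomp R g d p \<in> I" and c: "c \<in> carrier R"
  shows "mscale R g c p \<in> I"
proof -
  interpret M: cring "mpoly R n" by (rule mpoly_cring)
  interpret I: ideal I "mpoly R n" by fact
  obtain k where k: "\<And>c. c \<in> carrier R \<Longrightarrow> mscale R g c p =
      (\<Oplus>\<^bsub>mpoly R n\<^esub>i\<in>{..<k::nat}. mconst R c [^]\<^bsub>mpoly R n\<^esub> i \<otimes>\<^bsub>mpoly R n\<^esub> wcomp R g i p)"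
    "\<And>d. d \<ge> k \<Longrightarrow> wcomp R g d p = \<zero>\<^bsub>mpoly R n\<^esub>"
    using mscale_sum_wcomp[OF I.Icarr[OF p], of g] by blast
  have "mconst R c [^]\<^bsub>mpoly R n\<^esub> i \<in> carrier (mpoly R n)" for i :: nat
    by (rule M.nat_pow_closed) (rule mpoly_mconst_closed[OF c])
  then have "(\<Oplus>\<^bsub>mpoly R n\<^esub>i\<in>{..<k::nat}. mconst R c [^]\<^bsub>mpoly R n\<^esub> i \<otimes>\<^bsub>mpoly R n\<^esub> wcomp R g i p) \<in> I"
    using assms(3) by (intro I.finsum_in_ideal I.I_l_closed)
  then show ?thesis by (simp only: k(1)[OF c])
qed

locale algebra_over_infinite_field =
  fixes K :: "'k ring" (structure) and A :: "('k, 'a) module" (structure)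
  assumes field_K: "field K" and algebra_A: "algebra K A"
    and infinite_K: "infinite (carrier K)" and A_nontrivial: "\<one>\<^bsub>A\<^esub> \<noteq> \<zero>\<^bsub>A\<^esub>"
begin

sublocale K: field K by (rule field_K)

sublocale A: cring A using algebra_A by (simp add: algebra_def)

sublocale A: algebra K A by (rule algebra_A)

sublocale S: ring_hom_cring K A "\<lambda>c. scalar A c" by (rule A.scalar_hom_cring)

text \<open>The Vandermonde argument with the points of \<open>K\<close> embedded as constant
  polynomials; the \<open>q i\<close> are the coefficients of a polynomial in a further parameter,
  and \<open>in_E\<close> concerns its values.\<close>

lemma vandermonde_mpoly:
  fixes k :: nat
  assumes E: "ideal E (mpoly A n)" and q: "\<And>i. i < k \<Longrightarrow> q i \<in> carrier (mpoly A n)"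
    and L: "infinite \<Lambda>" "\<Lambda> \<subseteq> carrier K"
    and in_E: "\<And>c. c \<in> \<Lambda> \<Longrightarrow> (\<lambda>m. \<Oplus>\<^bsub>A\<^esub>i\<in>{..<k}. scalar A c [^]\<^bsub>A\<^esub> i \<otimes>\<^bsub>A\<^esub> q i m) \<in> E" and "i < k"
  shows "q i \<in> E"
proof -
  interpret P: cring "mpoly A n" by (rule A.mpoly_cring)
  have D: "ring_hom_cring K (mpoly A n) (\<lambda>c. mconst A (scalar A c))"
  proof unfold_locales
    show "(\<lambda>c. mconst A (scalar A c)) \<in> ring_hom K (mpoly A n)"
      using ring_hom_trans[OF S.homh ring_hom_cring.homh[OF A.mconst_hom_cring]] by (simp add: o_def)
  qed
  show ?thesis
  proof (rule ring_hom_cring.vandermonde[OF D K.field_axioms L _ E q _ \<open>i < k\<close>])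
    show "\<one>\<^bsub>mpoly A n\<^esub> \<noteq> \<zero>\<^bsub>mpoly A n\<^esub>"
      using A_nontrivial by (metis mpoly_simps(2,3))
    fix c assume c: "c \<in> \<Lambda>"
    then have "scalar A c \<in> carrier A" using L by (intro A.smult_closed) blast+
    from A.mpoly_power_sum[of _ k q n, OF this q] in_E[OF c]
    show "(\<Oplus>\<^bsub>mpoly A n\<^esub>i\<in>{..<k}. mconst A (scalar A c) [^]\<^bsub>mpoly A n\<^esub> i \<otimes>\<^bsub>mpoly A n\<^esub> q i) \<in> E"
      by simp
  qed
qed

text \<open>The scalings of \<open>p\<close> are the values of a polynomial whose coefficients are
  the components of \<open>p\<close>. Thus homogeneity can be tested on scalings, which are ring
  homomorphisms and can be checked on generators.\<close>

lemma wcomp_in_ideal: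
  assumes I: "ideal I (mpoly A n)"
    and scale: "\<And>c. c \<in> carrier K \<Longrightarrow> mscale A g (scalar A c) p \<in> I" and p: "p \<in> I"
  shows "wcomp A g d p \<in> I"
proof -
  interpret I: ideal I "mpoly A n" by fact
  obtain k where k: "\<And>c. c \<in> carrier A \<Longrightarrow> mscale A g c p =
      (\<Oplus>\<^bsub>mpoly A n\<^esub>i\<in>{..<k::nat}. mconst A c [^]\<^bsub>mpoly A n\<^esub> i \<otimes>\<^bsub>mpoly A n\<^esub> wcomp A g i p)"
    "\<And>d. d \<ge> k \<Longrightarrow> wcomp A g d p = \<zero>\<^bsub>mpoly A n\<^esub>"
    using A.mscale_sum_wcomp[OF I.Icarr[OF p], of g] by blast
  note cl = A.wcomp_closed[OF I.Icarr[OF p]]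
  show ?thesis
  proof (cases "d < k")
    case True
    show ?thesis
    proof (rule vandermonde_mpoly[OF I _ infinite_K order.refl _ True])
      fix c assume c: "c \<in> carrier K"
      then show "(\<lambda>m. \<Oplus>\<^bsub>A\<^esub>i\<in>{..<k}. scalar A c [^]\<^bsub>A\<^esub> i \<otimes>\<^bsub>A\<^esub> wcomp A g i p m) \<in> I"
        using scale[OF c] k(1)[of "scalar A c"] A.mpoly_power_sum[of "scalar A c" k "\<lambda>i. wcomp A g i p" n] cl by simp
    qed (rule cl)
  qed (simp add: k(2))
qed

text \<open>The preimage of the ideal under the scaling is again an ideal, so it suffices to scale
  generators.\<close>

lemma genideal_scale_closed:
  assumes X: "X \<subseteq> carrier (mpoly A n)" and g: "additive_weight g" and c: "c \<in> carrier A"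
    and sc: "\<And>p. p \<in> X \<Longrightarrow> mscale A g c p \<in> genideal (mpoly A n) X" and p: "p \<in> genideal (mpoly A n) X"
  shows "mscale A g c p \<in> genideal (mpoly A n) X"
proof -
  interpret P: cring "mpoly A n" by (rule A.mpoly_cring)
  interpret T: ring_hom_cring "mpoly A n" "mpoly A n" "mscale A g c"
    by (unfold_locales) (rule A.mscale_hom[OF g c])
  have "genideal (mpoly A n) X \<subseteq> {r \<in> carrier (mpoly A n). mscale A g c r \<in> genideal (mpoly A n) X}"
    using X sc by (intro P.genideal_minimal T.ring_hom_ring[THEN ring_hom_ring.ideal_vimage] P.genideal_ideal) auto
  with p show ?thesis by auto
qed

end

section \<open>Extension of ideals along ring homomorphisms\<close>

lemma (in ring_hom_cring) extend_ideal_comp: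
  assumes g: "ring_hom_cring S T g" and I: "I \<subseteq> carrier (mpoly R n)"
  shows "extend_ideal T n g (extend_ideal S n h I) = extend_ideal T n (\<lambda>x. g (h x)) I"
proof -
  interpret g: ring_hom_cring S T g by fact
  interpret P: cring "mpoly S n" by (rule S.mpoly_cring)
  interpret Q: cring "mpoly T n" by (rule g.S.mpoly_cring)
  interpret G: ring_hom_cring "mpoly S n" "mpoly T n" "\<lambda>p m. g (p m)"
    by unfold_locales (rule g.coeff_map_hom)
  have "(\<lambda>p m. h (p m)) ` I \<subseteq> carrier (mpoly S n)"
    using I ring_hom_closed[OF coeff_map_hom] by blast
  from G.ring_hom_ring[THEN ring_hom_ring.genideal_image, OF this] show ?thesis
    by (simp add: extend_ideal_def image_image)
qed

text \<open>With \<open>n < k\<close> this covers the extension of \<open>H\<close> to the ring that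
  also contains \<open>x_n\<close>, as a polynomial in \<open>n\<close> variables is literally one
  in \<open>k\<close> variables.\<close>

lemma (in ring_hom_cring) extend_ideal_ideal:
  assumes "I \<subseteq> carrier (mpoly R n)" "n \<le> k"
  shows "ideal (extend_ideal S k h I) (mpoly S k)" "(\<lambda>p m. h (p m)) ` I \<subseteq> carrier (mpoly S k)"
    "(\<lambda>p m. h (p m)) ` I \<subseteq> extend_ideal S k h I"
proof -
  interpret P: cring "mpoly S k" by (rule S.mpoly_cring)
  show *: "(\<lambda>p m. h (p m)) ` I \<subseteq> carrier (mpoly S k)"
    using assms mpoly_mono[OF assms(2), of R] ring_hom_closed[OF coeff_map_hom] by blast
  show "ideal (extend_ideal S k h I) (mpoly S k)" unfolding extend_ideal_def by (rule P.genideal_ideal[OF *])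
  show "(\<lambda>p m. h (p m)) ` I \<subseteq> extend_ideal S k h I"
    unfolding extend_ideal_def by (rule P.genideal_self[OF *])
qed

text \<open>The zero of the residue class ring is \<open>I\<close> itself, so that regularity of
  \<open>x_n\<close> modulo \<open>I\<close> becomes saturation of \<open>I\<close> with respect to
  \<open>x_n\<close>. Later arguments work with this form and avoid cosets.\<close>

lemma liftings_iff:
  fixes A :: "('k, 'a) module"
  assumes "cring A"
  shows "I \<in> liftings n H A \<longleftrightarrow> homogeneous_ideal A (Suc n) I \<and>
     (\<forall>p\<in>carrier (mpoly A (Suc n)). mpoly_var A n \<otimes>\<^bsub>mpoly A (Suc n)\<^esub> p \<in> I \<longrightarrow> p \<in> I) \<and>
     set_var_zero A n ` I = extend_ideal A n (\<lambda>c. scalar A c) H"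
proof (cases "ideal I (mpoly A (Suc n))")
  case True
  interpret cring A by fact
  let ?P = "mpoly A (Suc n)"
  interpret P: cring ?P by (rule mpoly_cring)
  interpret I: ideal I ?P by fact
  have coset: "I +>\<^bsub>?P\<^esub> y = I \<longleftrightarrow> y \<in> I" if "y \<in> carrier ?P" for y
    using that I.rcos_const_imp_mem P.a_coset_join2[OF that I.a_subgroup] by blast
  have x: "mpoly_var A n \<in> carrier ?P" by (rule mpoly_var_closed) simp
  have mult: "(I +>\<^bsub>?P\<^esub> mpoly_var A n) \<otimes>\<^bsub>?P Quot I\<^esub> (I +>\<^bsub>?P\<^esub> y) = I +>\<^bsub>?P\<^esub> (mpoly_var A n \<otimes>\<^bsub>?P\<^esub> y)"
    if "y \<in> carrier ?P" for y
    using I.rcoset_mult_add[OF x that] by (simp add: FactRing_def)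
  have carr: "carrier (?P Quot I) = (\<lambda>y. I +>\<^bsub>?P\<^esub> y) ` carrier ?P"
    by (auto simp: FactRing_def A_RCOSETS_def')
  have "non_zero_divisor (?P Quot I) (I +>\<^bsub>?P\<^esub> mpoly_var A n) \<longleftrightarrow>
      (\<forall>p\<in>carrier ?P. mpoly_var A n \<otimes>\<^bsub>?P\<^esub> p \<in> I \<longrightarrow> p \<in> I)"
  proof -
    have "(I +>\<^bsub>?P\<^esub> mpoly_var A n) \<otimes>\<^bsub>?P Quot I\<^esub> (I +>\<^bsub>?P\<^esub> y) = \<zero>\<^bsub>?P Quot I\<^esub> \<longleftrightarrow> mpoly_var A n \<otimes>\<^bsub>?P\<^esub> y \<in> I"
      "I +>\<^bsub>?P\<^esub> y = \<zero>\<^bsub>?P Quot I\<^esub> \<longleftrightarrow> y \<in> I"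
      if "y \<in> carrier ?P" for y
      unfolding mult[OF that] using that x coset by (simp_all add: FactRing_def)
    then show ?thesis
      by (simp only: non_zero_divisor_def carr ball_simps cong: ball_cong)
  qed
  then show ?thesis
    by (simp add: liftings_def)
qed (simp add: liftings_def homogeneous_ideal_def)


section \<open>Liftings\<close>

lemma (in cring) idealI_comm:
  assumes "I \<subseteq> carrier R" "\<zero> \<in> I" "\<And>a b. a \<in> I \<Longrightarrow> b \<in> I \<Longrightarrow> a \<oplus> b \<in> I"
    "\<And>a r. a \<in> I \<Longrightarrow> r \<in> carrier R \<Longrightarrow> r \<otimes> a \<in> I"
  shows "ideal I R"
proof (rule idealI)
  show "subgroup I (add_monoid R)"
  proof (rule subgroup.intro)
    fix a assume a: "a \<in> I"
    then have "(\<ominus> \<one>) \<otimes> a \<in> I" "a \<in> carrier R" using assms by auto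
    then show "inv\<^bsub>add_monoid R\<^esub> a \<in> I" by (simp add: l_minus flip: a_inv_def)
  qed (use assms in auto)
  show "a \<otimes> r \<in> I" if "a \<in> I" "r \<in> carrier R" for a r
    using that assms m_comm[of a r] by auto
qed (use assms ring_axioms in auto)

text \<open>The quotient by \<open>x_n\<close> of the part of \<open>p\<close> that is divisible by
  \<open>x_n\<close>; together with the part free of \<open>x_n\<close> it determines
  \<open>p\<close>, see \<open>var_decompose\<close>.\<close>

definition var_shift :: "nat \<Rightarrow> (monomial \<Rightarrow> 'a) \<Rightarrow> monomial \<Rightarrow> 'a" where
  "var_shift n p = (\<lambda>m. p (m + Poly_Mapping.single n 1))"

text \<open>The coefficient of \<open>x_n ^ j\<close> when \<open>p\<close> is read as a polynomial
  in \<open>x_n\<close> over the ring in the variables before \<open>x_n\<close>.\<close>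

definition var_slice :: "('a, 'm) ring_scheme \<Rightarrow> nat \<Rightarrow> nat \<Rightarrow> (monomial \<Rightarrow> 'a) \<Rightarrow> monomial \<Rightarrow> 'a" where
  "var_slice A n j p = (\<lambda>m. if Poly_Mapping.lookup m n = 0 then p (m + Poly_Mapping.single n j) else \<zero>\<^bsub>A\<^esub>)"

lemma var_slice_0: "var_slice A n 0 = set_var_zero A n"
  by (simp add: fun_eq_iff var_slice_def set_var_zero_def)

lemma finite_shifted_support:
  assumes "finite {m. p m \<noteq> z}"
  shows "finite {m. p (m + (a :: monomial)) \<noteq> z}"
proof -
  have "inj (\<lambda>m. m + a)" by (rule injI) simp
  from finite_vimageI[OF assms this] show ?thesis by (simp add: vimage_def)
qed

context cring
begin

lemma var_shift_closed:
  assumes "p \<in> carrier (mpoly R k)"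
  shows "var_shift n p \<in> carrier (mpoly R k)"
proof (rule mpoly_carrierI)
  show "finite {m. var_shift n p m \<noteq> \<zero>}"
    unfolding var_shift_def by (rule finite_shifted_support) (rule mpoly_carrierD(2)[OF assms])
  show "Poly_Mapping.keys m \<subseteq> {..<k}" if "var_shift n p m \<noteq> \<zero>" for m
    using mpoly_carrierD(3)[OF assms that[unfolded var_shift_def]] by (simp add: keys_add_nat)
qed (simp add: var_shift_def mpoly_carrierD(1)[OF assms])

lemma var_slice_closed:
  assumes "p \<in> carrier (mpoly R (Suc n))"
  shows "var_slice R n j p \<in> carrier (mpoly R n)"
proof (rule mpoly_carrierI)
  show "finite {m. var_slice R n j p m \<noteq> \<zero>}"
    by (rule finite_subset[OF _ finite_shifted_support[OF mpoly_carrierD(2)[OF assms], of "Poly_Mapping.single n j"]])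
       (auto simp: var_slice_def)
  fix m assume *: "var_slice R n j p m \<noteq> \<zero>"
  then have "n \<notin> Poly_Mapping.keys m" "p (m + Poly_Mapping.single n j) \<noteq> \<zero>"
    by (auto simp: var_slice_def in_keys_iff split: if_splits)
  with mpoly_carrierD(3)[OF assms this(2)] show "Poly_Mapping.keys m \<subseteq> {..<n}"
    by (simp add: keys_add_nat lessThan_Suc subset_insert)
qed (simp add: var_slice_def mpoly_carrierD(1)[OF assms])

lemma var_decompose:
  assumes p: "p \<in> carrier (mpoly R k)"
  shows "p = set_var_zero R n p \<oplus>\<^bsub>mpoly R k\<^esub> mpoly_var R n \<otimes>\<^bsub>mpoly R k\<^esub> var_shift n p"
proof
  fix m :: monomial
  have "(m - Poly_Mapping.single n 1) + Poly_Mapping.single n 1 = m" if "Poly_Mapping.lookup m n \<noteq> 0"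
    using lookup_single_split[OF that] by (simp add: add.commute)
  moreover have "(mpoly_var R n \<otimes>\<^bsub>mpoly R k\<^esub> var_shift n p) m =
      (if Poly_Mapping.lookup m n = 0 then \<zero> else var_shift n p (m - Poly_Mapping.single n 1))"
    by (rule mpoly_var_mult[OF var_shift_closed[OF p]])
  ultimately have "(mpoly_var R n \<otimes>\<^bsub>mpoly R k\<^esub> var_shift n p) m = (if Poly_Mapping.lookup m n = 0 then \<zero> else p m)"
    by (simp add: var_shift_def)
  then show "p m = (set_var_zero R n p \<oplus>\<^bsub>mpoly R k\<^esub> mpoly_var R n \<otimes>\<^bsub>mpoly R k\<^esub> var_shift n p) m"
    using mpoly_carrierD(1)[OF p, of m] by (simp add: mpoly_simps(4) set_var_zero_def)
qed

lemma var_slice_var_mult: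
  assumes "p \<in> carrier (mpoly R (Suc n))"
  shows "var_slice R n (Suc j) (mpoly_var R n \<otimes>\<^bsub>mpoly R (Suc n)\<^esub> p) = var_slice R n j p"
proof
  fix m :: monomial
  have "Poly_Mapping.single n (Suc j) = Poly_Mapping.single n j + Poly_Mapping.single n (1::nat)"
    by (simp flip: single_add)
  then have "m + Poly_Mapping.single n (Suc j) - Poly_Mapping.single n 1 = m + Poly_Mapping.single n j"
    by (simp add: add.assoc[symmetric])
  then show "var_slice R n (Suc j) (mpoly_var R n \<otimes>\<^bsub>mpoly R (Suc n)\<^esub> p) m = var_slice R n j p m"
    unfolding var_slice_def mpoly_var_mult[OF assms] by (simp add: lookup_add)
qed

text \<open>The Cauchy product of two polynomials in \<open>x_n\<close>. It will show that the
  polynomials with all slices in a given ideal form an ideal.\<close>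

lemma var_slice_mult:
  assumes p: "p \<in> carrier (mpoly R (Suc n))" and q: "q \<in> carrier (mpoly R (Suc n))"
  shows "var_slice R n k (q \<otimes>\<^bsub>mpoly R (Suc n)\<^esub> p) =
    (\<Oplus>\<^bsub>mpoly R n\<^esub>i\<in>{..k}. var_slice R n i q \<otimes>\<^bsub>mpoly R n\<^esub> var_slice R n (k - i) p)"
proof
  fix m :: monomial
  let ?e = "\<lambda>i. Poly_Mapping.single n i"
  interpret P: cring "mpoly R n" by (rule mpoly_cring)
  note pq = var_slice_closed[OF p] var_slice_closed[OF q] mpoly_carrierD(1)[OF p] mpoly_carrierD(1)[OF q]
  show "var_slice R n k (q \<otimes>\<^bsub>mpoly R (Suc n)\<^esub> p) m =
    (\<Oplus>\<^bsub>mpoly R n\<^esub>i\<in>{..k}. var_slice R n i q \<otimes>\<^bsub>mpoly R n\<^esub> var_slice R n (k - i) p) m"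
  proof (cases "Poly_Mapping.lookup m n = 0")
    \<comment> \<open>Slices are polynomials without \<open>x_n\<close>, so both sides vanish at a
      monomial that contains it.\<close>
    case False
    have "f m = \<zero>" if "f \<in> carrier (mpoly R n)" for f
    proof (rule ccontr)
      assume "f m \<noteq> \<zero>"
      moreover have "n \<in> Poly_Mapping.keys m" using False by (simp add: in_keys_iff)
      ultimately show False using mpoly_carrierD(3)[OF that] by blast
    qed
    moreover have "(\<Oplus>\<^bsub>mpoly R n\<^esub>i\<in>{..k}. var_slice R n i q \<otimes>\<^bsub>mpoly R n\<^esub> var_slice R n (k - i) p) \<in> carrier (mpoly R n)"
      by (rule P.finsum_closed) (use pq in \<open>auto intro: P.m_closed\<close>)
    ultimately have "(\<Oplus>\<^bsub>mpoly R n\<^esub>i\<in>{..k}. var_slice R n i q \<otimes>\<^bsub>mpoly R n\<^esub> var_slice R n (k - i) p) m = \<zero>"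
      by blast
    with False show ?thesis by (simp add: var_slice_def)
  next
    case True
    let ?f = "\<lambda>i ab. q (fst ab + ?e i) \<otimes> p (snd ab + ?e (k - i))"
    have "(\<Oplus>\<^bsub>mpoly R n\<^esub>i\<in>{..k}. var_slice R n i q \<otimes>\<^bsub>mpoly R n\<^esub> var_slice R n (k - i) p) m =
        (\<Oplus>i\<in>{..k}. (var_slice R n i q \<otimes>\<^bsub>mpoly R n\<^esub> var_slice R n (k - i) p) m)"
      using pq by (intro mpoly_finsum P.m_closed) auto
    also have "\<dots> = (\<Oplus>i\<in>{..k}. \<Oplus>ab\<in>splits m. ?f i ab)"
      unfolding mpoly_simps
    proof (intro finsum_cong' refl)
      fix i ab assume "ab \<in> splits m"
      then have "Poly_Mapping.lookup (fst ab) n = 0" "Poly_Mapping.lookup (snd ab) n = 0"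
        using True by (auto simp: lookup_add)
      then show "var_slice R n i q (fst ab) \<otimes> var_slice R n (k - i) p (snd ab) = ?f i ab"
        by (simp add: var_slice_def)
    qed (use pq in \<open>auto intro!: finsum_closed\<close>)
    also have "\<dots> = (\<Oplus>x\<in>{..k} \<times> splits m. ?f (fst x) (snd x))"
      using pq by (intro finsum_Sigma finite_monomial_splittings) auto
    \<comment> \<open>A splitting of \<open>m\<close> times \<open>x_n ^ k\<close> distributes the
      exponent \<open>k\<close> over its two factors: \<open>i\<close> goes to the first and
      \<open>k - i\<close> to the second.\<close>
    also have "\<dots> = (\<Oplus>ab\<in>splits (m + ?e k). q (fst ab) \<otimes> p (snd ab))"
    proof (rule finsum_bij[where h = "\<lambda>x. (fst (snd x) + ?e (fst x), snd (snd x) + ?e (k - fst x))"])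
      let ?g = "\<lambda>ab. (Poly_Mapping.lookup (fst ab) n,
          (fst ab - ?e (Poly_Mapping.lookup (fst ab) n), snd ab - ?e (Poly_Mapping.lookup (snd ab) n)))"
      show "bij_betw (\<lambda>x. (fst (snd x) + ?e (fst x), snd (snd x) + ?e (k - fst x))) ({..k} \<times> splits m) (splits (m + ?e k))"
      proof (rule bij_betw_byWitness[where f' = ?g])
        have 0: "Poly_Mapping.lookup a n = 0" "Poly_Mapping.lookup b n = 0" if "a + b = m" for a b
          using that True by (auto simp: lookup_add)
        show "\<forall>x\<in>{..k} \<times> splits m. ?g (fst (snd x) + ?e (fst x), snd (snd x) + ?e (k - fst x)) = x"
          using 0 by (auto simp: lookup_add)
        have split: "(a - ?e (Poly_Mapping.lookup a n)) + ?e (Poly_Mapping.lookup a n) = a" for a :: monomial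
          by (intro poly_mapping_eqI) (auto simp: lookup_add lookup_minus lookup_single when_def)
        have sum: "Poly_Mapping.lookup a n + Poly_Mapping.lookup b n = k" if "a + b = m + ?e k" for a b
          using arg_cong[OF that, of "\<lambda>m. Poly_Mapping.lookup m n"] True by (simp add: lookup_add)
        show "\<forall>ab\<in>splits (m + ?e k). (fst (snd (?g ab)) + ?e (fst (?g ab)), snd (snd (?g ab)) + ?e (k - fst (?g ab))) = ab"
        proof (rule ballI)
          fix ab assume "ab \<in> splits (m + ?e k)"
          then obtain a b where ab: "ab = (a, b)" "a + b = m + ?e k" by auto
          have "k - Poly_Mapping.lookup a n = Poly_Mapping.lookup b n" using sum[OF ab(2)] by simp
          then show "(fst (snd (?g ab)) + ?e (fst (?g ab)), snd (snd (?g ab)) + ?e (k - fst (?g ab))) = ab"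
            by (simp add: ab(1) split)
        qed
        have ek: "?e i + ?e (k - i) = ?e k" if "i \<le> k" for i
          using that by (simp flip: single_add)
        show "(\<lambda>x. (fst (snd x) + ?e (fst x), snd (snd x) + ?e (k - fst x))) ` ({..k} \<times> splits m) \<subseteq> splits (m + ?e k)"
        proof (rule image_subsetI)
          fix x assume "x \<in> {..k} \<times> splits m"
          then obtain i a b where x: "x = (i, (a, b))" "i \<le> k" "a + b = m" by auto
          have "(a + ?e i) + (b + ?e (k - i)) = (a + b) + (?e i + ?e (k - i))" by (simp only: ac_simps)
          with x ek[OF x(2)] show "(fst (snd x) + ?e (fst x), snd (snd x) + ?e (k - fst x)) \<in> splits (m + ?e k)"
            by simp
        qed
        show "?g ` splits (m + ?e k) \<subseteq> {..k} \<times> splits m"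
        proof (rule image_subsetI)
          fix ab assume "ab \<in> splits (m + ?e k)"
          then obtain a b where ab: "ab = (a, b)" "a + b = m + ?e k" by auto
          let ?i = "Poly_Mapping.lookup a n" and ?j = "Poly_Mapping.lookup b n"
          have "(a - ?e ?i) + (b - ?e ?j) + ?e k = (a - ?e ?i) + (b - ?e ?j) + (?e ?i + ?e ?j)"
            using sum[OF ab(2)] by (simp flip: single_add)
          also have "\<dots> = ((a - ?e ?i) + ?e ?i) + ((b - ?e ?j) + ?e ?j)" by (simp only: ac_simps)
          also have "\<dots> = m + ?e k" by (simp only: split ab(2))
          finally have "(a - ?e ?i) + (b - ?e ?j) = m" by simp
          moreover have "?i \<le> k" using sum[OF ab(2)] by simp
          ultimately show "?g ab \<in> {..k} \<times> splits m" by (simp add: ab(1))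
        qed
      qed
    qed (use pq in auto)
    finally show ?thesis using True by (simp add: var_slice_def mpoly_simps(1))
  qed
qed

end

text \<open>Let \<open>p\<close> in \<open>J\<close> be homogeneous. Some \<open>q\<close> in
  \<open>I\<close> agrees with it at \<open>x_n = 0\<close>, since both ideals restrict to the
  extension of \<open>H\<close>. The difference is divisible by \<open>x_n\<close>, the quotient
  lies in \<open>J\<close> because \<open>J\<close> is saturated, and its degree is smaller by one;
  induction on the degree gives the missing inclusion.\<close>

lemma lifting_eqI:
  fixes A :: "('k, 'a) module"
  assumes A: "cring A" and I: "I \<in> liftings n H A" and J: "J \<in> liftings n H A" and IJ: "I \<subseteq> J"
  shows "I = J"
proof
  interpret A: cring A by fact
  let ?P = "mpoly A (Suc n)"
  interpret P: cring ?P by (rule A.mpoly_cring)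
  have I': "ideal I ?P" "\<And>p d. p \<in> I \<Longrightarrow> hom_component A d p \<in> I"
    "set_var_zero A n ` I = extend_ideal A n (\<lambda>c. scalar A c) H"
    using I by (auto simp: liftings_iff[OF A] homogeneous_ideal_def)
  have J': "ideal J ?P" "\<And>p d. p \<in> J \<Longrightarrow> hom_component A d p \<in> J"
    "set_var_zero A n ` J = extend_ideal A n (\<lambda>c. scalar A c) H"
    "\<And>p. p \<in> carrier ?P \<Longrightarrow> mpoly_var A n \<otimes>\<^bsub>?P\<^esub> p \<in> J \<Longrightarrow> p \<in> J"
    using J by (auto simp: liftings_iff[OF A] homogeneous_ideal_def)
  interpret I: ideal I ?P by (rule I'(1))
  interpret J: ideal J ?P by (rule J'(1))
  have x: "mpoly_var A n \<in> carrier ?P" by (rule A.mpoly_var_closed) simp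
  have step: "\<exists>q\<in>I. \<exists>s\<in>J. p = q \<oplus>\<^bsub>?P\<^esub> mpoly_var A n \<otimes>\<^bsub>?P\<^esub> s \<and>
      (\<forall>m. s m \<noteq> \<zero>\<^bsub>A\<^esub> \<longrightarrow> Suc (monomial_degree m) = d)"
    if p: "p \<in> J" and hom: "\<And>m. p m \<noteq> \<zero>\<^bsub>A\<^esub> \<Longrightarrow> monomial_degree m = d" for p d
  proof -
    obtain q where q: "q \<in> I" "set_var_zero A n q = set_var_zero A n p"
      using p I'(3) J'(3) by (metis imageE imageI)
    \<comment> \<open>Passing to the component of degree \<open>d\<close> keeps \<open>q\<close> in
      \<open>I\<close> and makes the difference homogeneous, so that the degree really
      drops.\<close>
    define q' where "q' = hom_component A d q"
    define r where "r = p \<ominus>\<^bsub>?P\<^esub> q'"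
    have q': "q' \<in> I" "q' \<in> J" unfolding q'_def using I'(2)[OF q(1)] IJ by auto
    have pc: "p \<in> carrier ?P" and qc: "q' \<in> carrier ?P" using p q' by (auto intro: J.Icarr)
    have r: "r \<in> J" unfolding r_def a_minus_def using p q'(2) by simp
    have rc: "r \<in> carrier ?P" using r by (rule J.Icarr)
    have rm: "r m = p m \<ominus>\<^bsub>A\<^esub> q' m" for m unfolding r_def by (rule A.mpoly_minus[OF pc qc])
    have pmc: "p m \<in> carrier A" for m by (rule mpoly_carrierD(1)[OF pc])
    have r0: "r m = \<zero>\<^bsub>A\<^esub>" if "Poly_Mapping.lookup m n = 0" for m
    proof -
      have "q m = p m" using fun_cong[OF q(2), of m] that by (simp add: set_var_zero_def)
      then have "q' m = p m" using hom[of m] by (cases "p m = \<zero>\<^bsub>A\<^esub>") (auto simp: q'_def hom_component_def)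
      then show ?thesis using pmc[of m] by (simp add: rm)
    qed
    have rd: "monomial_degree m = d" if "r m \<noteq> \<zero>\<^bsub>A\<^esub>" for m
    proof (rule ccontr)
      assume "monomial_degree m \<noteq> d"
      then have "p m = \<zero>\<^bsub>A\<^esub>" "q' m = \<zero>\<^bsub>A\<^esub>" using hom by (auto simp: q'_def hom_component_def)
      with that show False by (simp add: rm)
    qed
    have "set_var_zero A n r = \<zero>\<^bsub>?P\<^esub>"
      using r0 by (auto simp: set_var_zero_def mpoly_simps(3))
    then have rs: "r = mpoly_var A n \<otimes>\<^bsub>?P\<^esub> var_shift n r"
      using A.var_decompose[OF rc, of n] P.m_closed[OF x A.var_shift_closed[OF rc]] by simp
    have "var_shift n r \<in> J"
      by (rule J'(4)) (use r rs A.var_shift_closed[OF rc] in auto)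
    moreover have "p = q' \<oplus>\<^bsub>?P\<^esub> r"
      unfolding r_def using pc qc by algebra
    then have "p = q' \<oplus>\<^bsub>?P\<^esub> mpoly_var A n \<otimes>\<^bsub>?P\<^esub> var_shift n r" using rs by simp
    moreover have "Suc (monomial_degree m) = d" if "var_shift n r m \<noteq> \<zero>\<^bsub>A\<^esub>" for m
    proof -
      have "monomial_degree (m + Poly_Mapping.single n 1) = monomial_degree m + monomial_degree (Poly_Mapping.single n (1::nat))"
        using additive_weight_degree by (simp add: additive_weight_def)
      moreover have "monomial_degree (Poly_Mapping.single n (1::nat)) = 1"
        by (simp add: monomial_degree_def)
      ultimately show ?thesis using rd[of "m + Poly_Mapping.single n 1"] that by (simp add: var_shift_def)
    qed
    ultimately show ?thesis using q'(1) by blast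
  qed
  have hom: "p \<in> I" if "p \<in> J" "\<And>m. p m \<noteq> \<zero>\<^bsub>A\<^esub> \<Longrightarrow> monomial_degree m = d" for p d
    using that
  proof (induction d arbitrary: p)
    case (0 p)
    obtain q s where qs: "q \<in> I" "s \<in> J" "p = q \<oplus>\<^bsub>?P\<^esub> mpoly_var A n \<otimes>\<^bsub>?P\<^esub> s"
      "\<forall>m. s m \<noteq> \<zero>\<^bsub>A\<^esub> \<longrightarrow> Suc (monomial_degree m) = 0" using step[of p 0] 0 by blast
    \<comment> \<open>No monomial satisfies \<open>Suc (monomial_degree m) = 0\<close>, so
      \<open>s\<close> has no terms.\<close>
    then have "s = \<zero>\<^bsub>?P\<^esub>" by (auto simp: mpoly_simps(3))
    then show ?case using qs(1,3) x I.Icarr by simp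
  next
    case (Suc d p)
    obtain q s where qs: "q \<in> I" "s \<in> J" "p = q \<oplus>\<^bsub>?P\<^esub> mpoly_var A n \<otimes>\<^bsub>?P\<^esub> s"
      "\<forall>m. s m \<noteq> \<zero>\<^bsub>A\<^esub> \<longrightarrow> Suc (monomial_degree m) = Suc d" using step[of p "Suc d"] Suc.prems by blast
    then have "s \<in> I" using Suc.IH by blast
    then show ?case unfolding qs(3) using qs(1) x by (intro I.a_closed I.I_l_closed)
  qed
  show "J \<subseteq> I"
  proof
    fix p assume p: "p \<in> J"
    obtain k where k: "\<And>c. c \<in> carrier A \<Longrightarrow> mscale A monomial_degree c p =
        (\<Oplus>\<^bsub>?P\<^esub>i\<in>{..<k::nat}. mconst A c [^]\<^bsub>?P\<^esub> i \<otimes>\<^bsub>?P\<^esub> wcomp A monomial_degree i p)"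
      using A.mscale_sum_wcomp[OF J.Icarr[OF p], of monomial_degree] by blast
    have "wcomp A monomial_degree d p \<in> I" for d
    proof (rule hom)
      show "wcomp A monomial_degree d p \<in> J" using J'(2)[OF p] by (simp add: hom_component_wcomp)
      show "monomial_degree m = d" if "wcomp A monomial_degree d p m \<noteq> \<zero>\<^bsub>A\<^esub>" for m
        using that by (auto simp: wcomp_def split: if_splits)
    qed
    \<comment> \<open>Scaling by one changes nothing, so the formula for scalings writes
      \<open>p\<close> as a combination of its components.\<close>
    then have "mscale A monomial_degree \<one>\<^bsub>A\<^esub> p \<in> I"
      unfolding k[OF A.one_closed]
      by (intro I.finsum_in_ideal I.I_l_closed P.nat_pow_closed A.mpoly_mconst_closed A.one_closed)
    moreover have "mscale A monomial_degree \<one>\<^bsub>A\<^esub> p = p"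
      using mpoly_carrierD(1)[OF J.Icarr[OF p]] by (simp add: mscale_def)
    ultimately show "p \<in> I" by simp
  qed
qed (rule IJ)

context algebra_over_infinite_field
begin

text \<open>Elements of \<open>H\<close> scaled by \<open>c\<close> stay in \<open>H\<close>, hence
  so do the generators of the extension and the extension itself; homogeneity follows from stability
  under all scalings.\<close>

lemma extend_ideal_homogeneous:
  assumes H: "homogeneous_ideal K n H" and "n \<le> k"
  shows "homogeneous_ideal A k (extend_ideal A k (\<lambda>c. scalar A c) H)"
proof -
  have HI: "ideal H (mpoly K n)" using H by (simp add: homogeneous_ideal_def)
  then have Hc: "H \<subseteq> carrier (mpoly K n)" by (auto dest: ideal.Icarr)
  note ext = S.extend_ideal_ideal[OF Hc \<open>n \<le> k\<close>]
  have "mscale A monomial_degree (scalar A c) p \<in> extend_ideal A k (\<lambda>c. scalar A c) H"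
    if c: "c \<in> carrier K" and p: "p \<in> (\<lambda>p m. scalar A (p m)) ` H" for c p
  proof -
    obtain q where q: "q \<in> H" "p = (\<lambda>m. scalar A (q m))" using p by blast
    have qm: "q m \<in> carrier K" for m using q Hc mpoly_carrierD(1) by blast
    have "mscale A monomial_degree (scalar A c) p m = scalar A (mscale K monomial_degree c q m)" for m
      unfolding q(2) mscale_def S.hom_pow[OF c, symmetric]
      by (rule S.hom_mult[symmetric]) (use c qm in auto)
    moreover have "mscale K monomial_degree c q \<in> H"
      by (rule K.mscale_in_ideal[OF HI q(1) _ c])
         (use H q in \<open>auto simp: homogeneous_ideal_def hom_component_wcomp\<close>)
    ultimately have "mscale A monomial_degree (scalar A c) p \<in> (\<lambda>p m. scalar A (p m)) ` H"
      by (intro image_eqI[of _ _ "mscale K monomial_degree c q"]) auto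
    then show ?thesis using ext(3) by blast
  qed
  then have "mscale A monomial_degree (scalar A c) p \<in> extend_ideal A k (\<lambda>c. scalar A c) H"
    if "c \<in> carrier K" "p \<in> extend_ideal A k (\<lambda>c. scalar A c) H" for c p
    using that genideal_scale_closed[OF ext(2) additive_weight_degree, of "scalar A c" p]
    by (simp add: extend_ideal_def)
  then show ?thesis
    unfolding homogeneous_ideal_def hom_component_wcomp
    using wcomp_in_ideal[OF ext(1)] ext(1) by blast
qed

text \<open>A polynomial lies in the extended ideal exactly if its coefficients with respect to
  \<open>x_n\<close> all lie in the extension of \<open>H\<close> to the ring without
  \<open>x_n\<close>. Multiplication by \<open>x_n\<close> only shifts these coefficients, hence
  saturation; substituting \<open>x_n = 0\<close> keeps the first of them, hence condition
  (b).\<close>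

lemma extend_ideal_lifting:
  assumes H: "homogeneous_ideal K n H"
  shows "extend_ideal A (Suc n) (\<lambda>c. scalar A c) H \<in> liftings n H A"
proof -
  let ?P = "mpoly A (Suc n)" and ?Q = "mpoly A n" and ?X = "(\<lambda>p m. scalar A (p m)) ` H"
  let ?J = "extend_ideal A (Suc n) (\<lambda>c. scalar A c) H"
  let ?E = "extend_ideal A n (\<lambda>c. scalar A c) H"
  interpret P: cring ?P by (rule A.mpoly_cring)
  interpret Q: cring ?Q by (rule A.mpoly_cring)
  have "ideal H (mpoly K n)" using H by (simp add: homogeneous_ideal_def)
  then have Hc: "H \<subseteq> carrier (mpoly K n)" by (auto dest: ideal.Icarr)
  note extJ = S.extend_ideal_ideal[OF Hc le_SucI[OF order.refl]] and extE = S.extend_ideal_ideal[OF Hc order.refl]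
  interpret J: ideal ?J ?P by (rule extJ(1))
  interpret E: ideal ?E ?Q by (rule extE(1))
  have x: "mpoly_var A n \<in> carrier ?P" by (rule A.mpoly_var_closed) simp
  have QP: "carrier ?Q \<subseteq> carrier ?P" by (rule mpoly_mono) simp
  have EJ: "?E \<subseteq> ?J"
  proof -
    have "ring_hom_ring ?Q ?P (\<lambda>x. x)"
      using QP by (intro ring_hom_ringI2 P.ring_axioms Q.ring_axioms ring_hom_memI)
        (auto simp: mpoly_ops_eq[of A n "Suc n"])
    from ring_hom_ring.ideal_vimage[OF this extJ(1)]
    have "ideal {r \<in> carrier ?Q. r \<in> ?J} ?Q" .
    then have "genideal ?Q ?X \<subseteq> {r \<in> carrier ?Q. r \<in> ?J}"
      using extJ(3) extE(2) by (intro Q.genideal_minimal) blast+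
    then show ?thesis by (auto simp: extend_ideal_def)
  qed
  have slice: "var_slice A n j p \<in> ?E" if "p \<in> ?J" for p j
  proof -
    \<comment> \<open>The polynomials with all slices in \<open>?E\<close> form an ideal, and it
      contains the generators, whose slices of positive index vanish.\<close>
    have "ideal {p \<in> carrier ?P. \<forall>j. var_slice A n j p \<in> ?E} ?P"
    proof (rule P.idealI_comm)
      show "\<zero>\<^bsub>?P\<^esub> \<in> {p \<in> carrier ?P. \<forall>j. var_slice A n j p \<in> ?E}"
      proof -
        have "var_slice A n j \<zero>\<^bsub>?P\<^esub> = \<zero>\<^bsub>?Q\<^esub>" for j by (simp add: var_slice_def mpoly_simps(3))
        then show ?thesis using E.zero_closed P.zero_closed by simp
      qed
      fix a b assume "a \<in> {p \<in> carrier ?P. \<forall>j. var_slice A n j p \<in> ?E}" 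
        "b \<in> {p \<in> carrier ?P. \<forall>j. var_slice A n j p \<in> ?E}"
      moreover have "var_slice A n j (a \<oplus>\<^bsub>?P\<^esub> b) = var_slice A n j a \<oplus>\<^bsub>?Q\<^esub> var_slice A n j b" for j
        by (auto simp: var_slice_def mpoly_simps(4))
      ultimately show "a \<oplus>\<^bsub>?P\<^esub> b \<in> {p \<in> carrier ?P. \<forall>j. var_slice A n j p \<in> ?E}"
        by (simp add: P.a_closed)
    next
      fix p q assume p: "p \<in> {p \<in> carrier ?P. \<forall>j. var_slice A n j p \<in> ?E}" and q: "q \<in> carrier ?P"
      have "var_slice A n j (q \<otimes>\<^bsub>?P\<^esub> p) \<in> ?E" for j
        using p q by (subst A.var_slice_mult) (auto intro!: E.finsum_in_ideal E.I_l_closed A.var_slice_closed)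
      with p q show "q \<otimes>\<^bsub>?P\<^esub> p \<in> {p \<in> carrier ?P. \<forall>j. var_slice A n j p \<in> ?E}"
        by simp
    qed blast
    moreover have "?X \<subseteq> {p \<in> carrier ?P. \<forall>j. var_slice A n j p \<in> ?E}"
    proof
      fix p assume p: "p \<in> ?X"
      then have pQ: "p \<in> carrier ?Q" using extE(2) by blast
      have "var_slice A n j p \<in> ?E" for j
      proof (cases "j = 0")
        case True
        then show ?thesis using p extE(3) set_var_zero_id[OF pQ] by (auto simp: var_slice_0)
      next
        case False
        have "p (m + Poly_Mapping.single n j) = \<zero>\<^bsub>A\<^esub>" for m
        proof (rule ccontr)
          assume "p (m + Poly_Mapping.single n j) \<noteq> \<zero>\<^bsub>A\<^esub>"
          from mpoly_carrierD(3)[OF pQ this] show False using False by (simp add: keys_add_nat)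
        qed
        then have "var_slice A n j p = \<zero>\<^bsub>?Q\<^esub>" by (auto simp: var_slice_def mpoly_simps(3))
        then show ?thesis by simp
      qed
      then show "p \<in> {p \<in> carrier ?P. \<forall>j. var_slice A n j p \<in> ?E}" using pQ QP by auto
    qed
    ultimately have "?J \<subseteq> {p \<in> carrier ?P. \<forall>j. var_slice A n j p \<in> ?E}"
      unfolding extend_ideal_def by (rule P.genideal_minimal)
    with that show ?thesis by blast
  qed
  \<comment> \<open>Induction on a strict bound \<open>k\<close> for the exponent of
    \<open>x_n\<close>: remove the slice of index 0 and divide the rest by
    \<open>x_n\<close>.\<close>
  have from_slices: "p \<in> ?J" if "p \<in> carrier ?P" "\<And>m. Poly_Mapping.lookup m n \<ge> k \<Longrightarrow> p m = \<zero>\<^bsub>A\<^esub>"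
    "\<And>j. var_slice A n j p \<in> ?E" for k p
    using that
  proof (induction k arbitrary: p)
    case (0 p)
    then have "p = \<zero>\<^bsub>?P\<^esub>" by (auto simp: mpoly_simps(3))
    then show ?case by simp
  next
    case (Suc k p)
    have "var_shift n p \<in> ?J"
    proof (rule Suc.IH)
      show "var_shift n p \<in> carrier ?P" by (rule A.var_shift_closed) fact
      show "var_shift n p m = \<zero>\<^bsub>A\<^esub>" if "k \<le> Poly_Mapping.lookup m n" for m
        using Suc.prems(2)[of "m + Poly_Mapping.single n 1"] that by (simp add: var_shift_def lookup_add)
      have "var_slice A n j (var_shift n p) = var_slice A n (Suc j) p" for j
      proof -
        have "Poly_Mapping.single n (Suc j) = Poly_Mapping.single n j + Poly_Mapping.single n (1::nat)"
          by (simp flip: single_add)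
        then show ?thesis by (simp add: var_slice_def var_shift_def fun_eq_iff add.assoc)
      qed
      then show "var_slice A n j (var_shift n p) \<in> ?E" for j using Suc.prems(3) by simp
    qed
    then have "mpoly_var A n \<otimes>\<^bsub>?P\<^esub> var_shift n p \<in> ?J" using x by (rule J.I_l_closed)
    moreover have "set_var_zero A n p \<in> ?J" using Suc.prems(3)[of 0] EJ by (auto simp: var_slice_0)
    ultimately show ?case
      by (subst A.var_decompose[OF Suc.prems(1), of n]) (rule J.a_closed)
  qed
  have J_iff: "p \<in> ?J" if p: "p \<in> carrier ?P" and s: "\<And>j. var_slice A n j p \<in> ?E" for p
  proof (rule from_slices[OF p _ s])
    fix m assume "Suc (Max (insert 0 ((\<lambda>m. Poly_Mapping.lookup m n) ` {m. p m \<noteq> \<zero>\<^bsub>A\<^esub>}))) \<le> Poly_Mapping.lookup m n"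
    then show "p m = \<zero>\<^bsub>A\<^esub>"
      using mpoly_carrierD(2)[OF p] by (auto simp: Suc_le_eq)
  qed
  have "p \<in> ?J" if p: "p \<in> carrier ?P" and xp: "mpoly_var A n \<otimes>\<^bsub>?P\<^esub> p \<in> ?J" for p
  proof (rule J_iff[OF p])
    show "var_slice A n j p \<in> ?E" for j
      using slice[OF xp, of "Suc j"] by (simp add: A.var_slice_var_mult[OF p])
  qed
  moreover have "set_var_zero A n ` ?J = ?E"
  proof
    show "set_var_zero A n ` ?J \<subseteq> ?E" using slice[of _ 0] by (auto simp: var_slice_0)
    show "?E \<subseteq> set_var_zero A n ` ?J"
    proof
      fix p assume p: "p \<in> ?E"
      have "p = set_var_zero A n p" using set_var_zero_id[OF E.Icarr[OF p]] by simp
      with p EJ show "p \<in> set_var_zero A n ` ?J" by blast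
    qed
  qed
  ultimately show ?thesis
    using extend_ideal_homogeneous[OF H le_SucI[OF order.refl]] by (simp add: liftings_iff[OF A.is_cring])
qed

end


section \<open>Hilbert's basis theorem\<close>

definition (in UP_cring) leading_coeffs :: "(nat \<Rightarrow> 'a) set \<Rightarrow> nat \<Rightarrow> 'a set" where
  "leading_coeffs I d = {coeff P q d | q. q \<in> I \<and> (\<forall>m>d. coeff P q m = \<zero>)}"

context UP_cring
begin

lemma leading_coeffs_ideal:
  assumes "ideal I P"
  shows "ideal (leading_coeffs I d) R"
proof (rule R.idealI_comm)
  interpret I: ideal I P by fact
  show "leading_coeffs I d \<subseteq> carrier R"
    by (auto simp: leading_coeffs_def I.Icarr)
  show "\<zero> \<in> leading_coeffs I d"
    unfolding leading_coeffs_def using I.zero_closed by (auto intro!: exI[of _ "\<zero>\<^bsub>P\<^esub>"])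
  fix a b assume "a \<in> leading_coeffs I d"
  then obtain p where p: "p \<in> I" "a = coeff P p d" "\<forall>m>d. coeff P p m = \<zero>"
    by (auto simp: leading_coeffs_def)
  {
    assume "b \<in> leading_coeffs I d"
    then obtain q where q: "q \<in> I" "b = coeff P q d" "\<forall>m>d. coeff P q m = \<zero>"
      by (auto simp: leading_coeffs_def)
    show "a \<oplus> b \<in> leading_coeffs I d"
      unfolding leading_coeffs_def using p q
      by (auto intro!: exI[of _ "p \<oplus>\<^bsub>P\<^esub> q"] simp: I.Icarr)
  }
  assume b: "b \<in> carrier R"
  have "monom P b 0 \<otimes>\<^bsub>P\<^esub> p \<in> I" using p b by (intro I.I_l_closed) auto
  then have "b \<odot>\<^bsub>P\<^esub> p \<in> I" using p b by (simp add: monom_mult_is_smult I.Icarr)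
  then show "b \<otimes> a \<in> leading_coeffs I d"
    unfolding leading_coeffs_def using p b
    by (auto intro!: exI[of _ "b \<odot>\<^bsub>P\<^esub> p"] simp: I.Icarr)
qed

lemma leading_coeffs_Suc:
  assumes "ideal I P"
  shows "leading_coeffs I d \<subseteq> leading_coeffs I (Suc d)"
proof
  interpret I: ideal I P by fact
  fix a assume "a \<in> leading_coeffs I d"
  then obtain p where p: "p \<in> I" "a = coeff P p d" "\<forall>m>d. coeff P p m = \<zero>"
    by (auto simp: leading_coeffs_def)
  have pc: "p \<in> carrier P" using p(1) by (rule I.Icarr)
  have cf: "coeff P (monom P \<one> 1 \<otimes>\<^bsub>P\<^esub> p) (Suc m) = coeff P p m" for m
    using coeff_monom_mult[OF R.one_closed pc, of 1 m] pc by simp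
  have "monom P \<one> 1 \<otimes>\<^bsub>P\<^esub> p \<in> I" using p(1) by (intro I.I_l_closed) auto
  moreover have "coeff P (monom P \<one> 1 \<otimes>\<^bsub>P\<^esub> p) m = \<zero>" if "m > Suc d" for m
    using that cf[of "m - 1"] p(3) by (cases m) auto
  moreover have "a = coeff P (monom P \<one> 1 \<otimes>\<^bsub>P\<^esub> p) (Suc d)" by (simp only: cf p(2))
  ultimately show "a \<in> leading_coeffs I (Suc d)"
    unfolding leading_coeffs_def by blast
qed

lemma leading_coeffs_mono:
  assumes "ideal I P" "d \<le> e"
  shows "leading_coeffs I d \<subseteq> leading_coeffs I e"
  using assms(2) leading_coeffs_Suc[OF assms(1)] by (rule lift_Suc_mono_le[rotated])

text \<open>Subtracting an element of \<open>J\<close> with the same coefficient at the top lowers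
  the degree and stays in \<open>I\<close>, because \<open>J\<close> is contained in
  \<open>I\<close>.\<close>

lemma ideal_subset_of_leading_coeffs:
  assumes I: "ideal I P" and J: "ideal J P" and sub: "J \<subseteq> I"
    and lead: "\<And>d. leading_coeffs I d \<subseteq> leading_coeffs J d"
  shows "I \<subseteq> J"
proof -
  interpret I: ideal I P by fact
  interpret J: ideal J P by fact
  have step: "\<exists>q\<in>J. p \<ominus>\<^bsub>P\<^esub> q \<in> I \<and> (\<forall>m\<ge>d. coeff P (p \<ominus>\<^bsub>P\<^esub> q) m = \<zero>)"
    if p: "p \<in> I" "\<forall>m>d. coeff P p m = \<zero>" for p d
  proof -
    have "coeff P p d \<in> leading_coeffs I d" using p by (auto simp: leading_coeffs_def)
    then have "coeff P p d \<in> leading_coeffs J d" using lead by blast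
    then obtain q where q: "q \<in> J" "coeff P p d = coeff P q d" "\<forall>m>d. coeff P q m = \<zero>"
      by (auto simp: leading_coeffs_def)
    have c: "p \<in> carrier P" "q \<in> carrier P" using p(1) q(1) by (auto intro: I.Icarr J.Icarr)
    have "coeff P (p \<ominus>\<^bsub>P\<^esub> q) m = \<zero>" if "m \<ge> d" for m
    proof (cases "m = d")
      case True
      have "coeff P q d \<in> carrier R" using c by simp
      then show ?thesis using c q(2) True by (simp add: a_minus_def R.r_neg)
    next
      case False
      then show ?thesis using c q(3) p(2) that by (simp add: a_minus_def)
    qed
    moreover have "p \<ominus>\<^bsub>P\<^esub> q \<in> I" using p(1) q(1) sub by (auto simp: a_minus_def)
    ultimately show ?thesis using q(1) by blast
  qed
  have main: "p \<in> J" if "p \<in> I" "\<forall>m>d. coeff P p m = \<zero>" for p d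
    using that
  proof (induction d arbitrary: p)
    case (0 p)
    obtain q where q: "q \<in> J" "p \<ominus>\<^bsub>P\<^esub> q \<in> I" "\<forall>m\<ge>0. coeff P (p \<ominus>\<^bsub>P\<^esub> q) m = \<zero>"
      using step[OF 0] by blast
    have c: "p \<in> carrier P" "q \<in> carrier P" using 0(1) q(1) by (auto intro: I.Icarr J.Icarr)
    have "p \<ominus>\<^bsub>P\<^esub> q = \<zero>\<^bsub>P\<^esub>" by (rule up_eqI) (use c q(3) in auto)
    then show ?case using q(1) c by simp
  next
    case (Suc d p)
    obtain q where q: "q \<in> J" "p \<ominus>\<^bsub>P\<^esub> q \<in> I" "\<forall>m\<ge>Suc d. coeff P (p \<ominus>\<^bsub>P\<^esub> q) m = \<zero>"
      using step[OF Suc.prems] by blast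
    have c: "p \<in> carrier P" "q \<in> carrier P" using Suc.prems(1) q(1) by (auto intro: I.Icarr J.Icarr)
    have "p \<ominus>\<^bsub>P\<^esub> q \<in> J" by (rule Suc.IH) (use q in auto)
    then have "(p \<ominus>\<^bsub>P\<^esub> q) \<oplus>\<^bsub>P\<^esub> q \<in> J" using q(1) by (rule J.a_closed)
    moreover have "(p \<ominus>\<^bsub>P\<^esub> q) \<oplus>\<^bsub>P\<^esub> q = p" using c by (simp add: a_minus_def P.a_assoc P.l_neg)
    ultimately show ?case by simp
  qed
  show ?thesis
  proof
    fix p assume p: "p \<in> I"
    then have "\<forall>m>deg R p. coeff P p m = \<zero>" by (auto intro: deg_aboveD I.Icarr)
    with p show "p \<in> J" by (rule main)
  qed
qed

text \<open>The universal property concerns Noetherian algebras, so the family over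
  \<open>R[T]\<close> can be classified only once \<open>R[T]\<close> is known to be
  Noetherian.\<close>

theorem hilbert_basis:
  assumes "noetherian_ring R"
  shows "noetherian_ring P"
proof (rule P.noetherian_ringI)
  interpret N: noetherian_ring R by fact
  fix I assume I: "ideal I P"
  interpret I: ideal I P by fact
  \<comment> \<open>In a Noetherian ring the union of a chain of ideals belongs to the chain, so the
    ideals of leading coefficients are constant from some \<open>D\<close> on.\<close>
  have "\<Union>(range (leading_coeffs I)) \<in> range (leading_coeffs I)"
  proof (rule N.ideal_chain_is_trivial)
    show "subset.chain {I. ideal I R} (range (leading_coeffs I))"
      unfolding subset_chain_def
    proof (intro conjI ballI)
      fix X Y assume "X \<in> range (leading_coeffs I)" "Y \<in> range (leading_coeffs I)"
      then obtain d e where "X = leading_coeffs I d" "Y = leading_coeffs I e" by blast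
      then show "X \<subseteq> Y \<or> Y \<subseteq> X"
        using leading_coeffs_mono[OF I, of d e] leading_coeffs_mono[OF I, of e d] linear[of d e] by blast
    qed (use leading_coeffs_ideal[OF I] in auto)
  qed simp
  then obtain D where D: "\<And>d. leading_coeffs I d \<subseteq> leading_coeffs I D" by blast
  \<comment> \<open>For each degree, a finite part of \<open>I\<close> that forces the leading
    coefficients in every ideal containing it; only the degrees up to \<open>D\<close> will be
    used.\<close>
  have "\<exists>S. finite S \<and> S \<subseteq> I \<and> (\<forall>J. ideal J P \<and> S \<subseteq> J \<longrightarrow> leading_coeffs I d \<subseteq> leading_coeffs J d)" for d
  proof -
    obtain A where A: "A \<subseteq> carrier R" "finite A" "leading_coeffs I d = genideal R A"
      using N.finetely_gen[OF leading_coeffs_ideal[OF I]] by blast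
    have "\<forall>a\<in>A. \<exists>q. q \<in> I \<and> (\<forall>m>d. coeff P q m = \<zero>) \<and> a = coeff P q d"
      using R.genideal_self[OF A(1)] by (auto simp: leading_coeffs_def simp flip: A(3))
    then obtain f where f: "\<forall>a\<in>A. f a \<in> I \<and> (\<forall>m>d. coeff P (f a) m = \<zero>) \<and> a = coeff P (f a) d"
      by metis
    have "leading_coeffs I d \<subseteq> leading_coeffs J d" if "ideal J P" "f ` A \<subseteq> J" for J
      unfolding A(3)
    proof (rule R.genideal_minimal[OF leading_coeffs_ideal[OF that(1)]])
      show "A \<subseteq> leading_coeffs J d" using f that(2) unfolding leading_coeffs_def by blast
    qed
    then show ?thesis using A(2) f by (intro exI[of _ "f ` A"]) auto
  qed
  then obtain S where S: "\<And>d. finite (S d)" "\<And>d. S d \<subseteq> I"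
    "\<And>d J. ideal J P \<Longrightarrow> S d \<subseteq> J \<Longrightarrow> leading_coeffs I d \<subseteq> leading_coeffs J d"
    by metis
  define F where "F = (\<Union>d\<le>D. S d)"
  have F: "finite F" "F \<subseteq> I" using S(1,2) by (auto simp: F_def)
  have Fc: "F \<subseteq> carrier P" using F(2) I.Icarr by blast
  have J: "ideal (genideal P F) P" by (rule P.genideal_ideal[OF Fc])
  have JI: "genideal P F \<subseteq> I" by (rule P.genideal_minimal[OF I F(2)])
  have low: "leading_coeffs I d \<subseteq> leading_coeffs (genideal P F) d" if "d \<le> D" for d
    using that P.genideal_self[OF Fc] by (intro S(3) J) (auto simp: F_def)
  have "I \<subseteq> genideal P F"
  proof (rule ideal_subset_of_leading_coeffs[OF I J JI])
    show "leading_coeffs I d \<subseteq> leading_coeffs (genideal P F) d" for d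
    proof (cases "d \<le> D")
      case False
      then show ?thesis
        using D[of d] low[of D] leading_coeffs_mono[OF J, of D d] by auto
    qed (rule low)
  qed
  with JI F(1) Fc show "\<exists>A\<subseteq>carrier P. finite A \<and> I = genideal P A" by blast
qed

end

section \<open>Ideals and algebra structures under surjections and isomorphisms\<close>

lemma (in ring) genideal_of_ideal:
  assumes "ideal I R"
  shows "genideal R I = I"
proof -
  have "I \<subseteq> carrier R" using assms by (auto dest: ideal.Icarr)
  then show ?thesis using genideal_minimal[OF assms order.refl] genideal_self by blast
qed

lemma (in ring_hom_ring) genideal_image_surj:
  assumes "X \<subseteq> carrier R" "h ` carrier R = carrier S"
  shows "h ` genideal R X = genideal S (h ` X)"
  using genideal_image[OF assms(1)] S.genideal_of_ideal[OF ideal_image_surj[OF R.genideal_ideal[OF assms(1)] assms(2)]]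
  by simp

lemma (in ring_hom_ring) noetherian_ring_image:
  assumes "noetherian_ring R" "h ` carrier R = carrier S"
  shows "noetherian_ring S"
proof (rule S.noetherian_ringI)
  interpret N: noetherian_ring R by fact
  fix I assume I: "ideal I S"
  then have Ic: "I \<subseteq> carrier S" by (auto dest: ideal.Icarr)
  obtain A where A: "A \<subseteq> carrier R" "finite A" "{r \<in> carrier R. h r \<in> I} = genideal R A"
    using N.finetely_gen[OF ideal_vimage[OF I]] by blast
  have "I = h ` {r \<in> carrier R. h r \<in> I}" using Ic by (auto simp flip: assms(2))
  also have "\<dots> = genideal S (h ` A)" unfolding A(3) by (rule genideal_image_surj[OF A(1) assms(2)])
  finally show "\<exists>A\<subseteq>carrier S. finite A \<and> I = genideal S A"
    using A by (intro exI[of _ "h ` A"]) auto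
qed

lemma extend_ideal_cong:
  assumes "I \<subseteq> carrier (mpoly A n)" "\<And>x. x \<in> carrier A \<Longrightarrow> f x = g x"
  shows "extend_ideal B k f I = extend_ideal B k g I"
proof -
  have "(\<lambda>m. f (p m)) = (\<lambda>m. g (p m))" if "p \<in> I" for p
    using assms that mpoly_carrierD(1) by blast
  then have "(\<lambda>p m. f (p m)) ` I = (\<lambda>p m. g (p m)) ` I" by (rule image_cong[OF refl])
  then show ?thesis by (simp add: extend_ideal_def)
qed

lemma (in cring) extend_ideal_id:
  assumes "ideal I (mpoly R n)"
  shows "extend_ideal R n (\<lambda>x. x) I = I"
proof -
  interpret P: cring "mpoly R n" by (rule mpoly_cring)
  show ?thesis using P.genideal_of_ideal[OF assms] by (simp add: extend_ideal_def)
qed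

lemma ring_iso_cring:
  assumes "cring A" "f \<in> ring_iso A B" "f \<one>\<^bsub>A\<^esub> = \<one>\<^bsub>B\<^esub>" "f \<zero>\<^bsub>A\<^esub> = \<zero>\<^bsub>B\<^esub>"
  shows "cring (B :: ('a, 'm) ring_scheme)"
  using cring.ring_iso_imp_img_cring[OF assms(1,2)] assms(3,4) by simp

lemma alg_iso_noetherian:
  fixes A :: "('k, 'a) module" and B :: "('k, 'b) module"
  assumes K: "cring K" and A: "noetherian_algebra K A" and f: "f \<in> ring_iso A B"
    and zero: "f \<zero>\<^bsub>A\<^esub> = \<zero>\<^bsub>B\<^esub>"
    and sm: "\<And>c x. c \<in> carrier K \<Longrightarrow> x \<in> carrier A \<Longrightarrow> f (c \<odot>\<^bsub>A\<^esub> x) = c \<odot>\<^bsub>B\<^esub> f x"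
  shows "noetherian_algebra K B"
proof -
  interpret A: algebra K A using A by (simp add: noetherian_algebra_def)
  have A1: "\<one>\<^bsub>A\<^esub> \<noteq> \<zero>\<^bsub>A\<^esub>" using A by (simp add: noetherian_algebra_def)
  have one: "f \<one>\<^bsub>A\<^esub> = \<one>\<^bsub>B\<^esub>" using f by (simp add: ring_iso_def ring_hom_one)
  have B: "cring B" by (rule ring_iso_cring[OF A.M_cring f one zero])
  interpret B: cring B by (rule B)
  have bij: "bij_betw f (carrier A) (carrier B)" and hom: "f \<in> ring_hom A B"
    using f by (auto simp: ring_iso_def)
  have surj: "f ` carrier A = carrier B" using bij by (simp add: bij_betw_def)
  have alg: "algebra K B"
  proof (rule algebraI[OF K B])
    fix a b x y assume ab: "a \<in> carrier K" "x \<in> carrier B"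
    then obtain u where u: "u \<in> carrier A" "x = f u" using surj by blast
    show "a \<odot>\<^bsub>B\<^esub> x \<in> carrier B"
      using sm[OF ab(1) u(1)] u ab ring_hom_closed[OF hom, of "a \<odot>\<^bsub>A\<^esub> u"] by simp
    {
      assume b: "b \<in> carrier K"
      show "(a \<oplus>\<^bsub>K\<^esub> b) \<odot>\<^bsub>B\<^esub> x = a \<odot>\<^bsub>B\<^esub> x \<oplus>\<^bsub>B\<^esub> b \<odot>\<^bsub>B\<^esub> x"
        using ab b u sm[of "a \<oplus>\<^bsub>K\<^esub> b" u] sm[of a u] sm[of b u] ring_hom_add[OF hom, of "a \<odot>\<^bsub>A\<^esub> u" "b \<odot>\<^bsub>A\<^esub> u"]
        by (simp add: A.smult_l_distr)
      show "(a \<otimes>\<^bsub>K\<^esub> b) \<odot>\<^bsub>B\<^esub> x = a \<odot>\<^bsub>B\<^esub> (b \<odot>\<^bsub>B\<^esub> x)"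
        using ab b u sm[of "a \<otimes>\<^bsub>K\<^esub> b" u] sm[of a "b \<odot>\<^bsub>A\<^esub> u"] sm[of b u] by (simp add: A.smult_assoc1)
    }
    assume "y \<in> carrier B"
    then obtain v where v: "v \<in> carrier A" "y = f v" using surj by blast
    show "a \<odot>\<^bsub>B\<^esub> (x \<oplus>\<^bsub>B\<^esub> y) = a \<odot>\<^bsub>B\<^esub> x \<oplus>\<^bsub>B\<^esub> a \<odot>\<^bsub>B\<^esub> y"
      using ab u v sm[of a "u \<oplus>\<^bsub>A\<^esub> v"] sm[of a u] sm[of a v] ring_hom_add[OF hom, of u v]
        ring_hom_add[OF hom, of "a \<odot>\<^bsub>A\<^esub> u" "a \<odot>\<^bsub>A\<^esub> v"] by (simp add: A.smult_r_distr)
    show "(a \<odot>\<^bsub>B\<^esub> x) \<otimes>\<^bsub>B\<^esub> y = a \<odot>\<^bsub>B\<^esub> (x \<otimes>\<^bsub>B\<^esub> y)"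
      using ab u v sm[of a "u \<otimes>\<^bsub>A\<^esub> v"] sm[of a u] ring_hom_mult[OF hom, of u v]
        ring_hom_mult[OF hom, of "a \<odot>\<^bsub>A\<^esub> u" v] by (simp add: A.smult_assoc2)
  next
    fix x assume "x \<in> carrier B"
    then obtain u where u: "u \<in> carrier A" "x = f u" using surj by blast
    show "\<one>\<^bsub>K\<^esub> \<odot>\<^bsub>B\<^esub> x = x" using sm[of "\<one>\<^bsub>K\<^esub>" u] u by simp
  qed
  have "ring_hom_ring A B f"
    by (intro ring_hom_ringI2 B.ring_axioms hom) (simp add: A.M_cring cring.axioms(1))
  then have "noetherian_ring B"
    using A surj by (auto intro: ring_hom_ring.noetherian_ring_image simp: noetherian_algebra_def)
  moreover have "\<one>\<^bsub>B\<^esub> \<noteq> \<zero>\<^bsub>B\<^esub>"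
  proof
    assume "\<one>\<^bsub>B\<^esub> = \<zero>\<^bsub>B\<^esub>"
    then have "f \<one>\<^bsub>A\<^esub> = f \<zero>\<^bsub>A\<^esub>" by (simp add: one zero)
    moreover have "\<one>\<^bsub>A\<^esub> \<in> carrier A" "\<zero>\<^bsub>A\<^esub> \<in> carrier A"
      using cring.cring_simprules[OF A.M_cring] by auto
    ultimately show False using bij A1 by (auto simp: bij_betw_def inj_on_def)
  qed
  ultimately show ?thesis using alg by (simp add: noetherian_algebra_def)
qed

text \<open>Transport of structure along the injection \<open>g\<close>, by which an algebra with
  elements of another type gets a copy among the elements of the type of \<open>R\<close>.\<close>

definition alg_copy :: "('b \<Rightarrow> 'a) \<Rightarrow> ('k, 'b) module \<Rightarrow> ('k, 'a) module" where
  "alg_copy g B =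
    \<lparr>carrier = g ` carrier B,
     monoid.mult = (\<lambda>x y. g (inv_into (carrier B) g x \<otimes>\<^bsub>B\<^esub> inv_into (carrier B) g y)),
     one = g \<one>\<^bsub>B\<^esub>, zero = g \<zero>\<^bsub>B\<^esub>,
     add = (\<lambda>x y. g (inv_into (carrier B) g x \<oplus>\<^bsub>B\<^esub> inv_into (carrier B) g y)),
     smult = (\<lambda>c x. g (c \<odot>\<^bsub>B\<^esub> inv_into (carrier B) g x))\<rparr>"

lemma alg_copy:
  fixes B :: "('k, 'b) module"
  assumes "inj_on g (carrier B)"
  shows "g \<in> ring_iso B (alg_copy g B)" "g \<zero>\<^bsub>B\<^esub> = \<zero>\<^bsub>alg_copy g B\<^esub>"
    "x \<in> carrier B \<Longrightarrow> g (c \<odot>\<^bsub>B\<^esub> x) = c \<odot>\<^bsub>alg_copy g B\<^esub> g x"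
  using assms by (auto simp: alg_copy_def ring_iso_def bij_betw_def intro!: ring_hom_memI)


section \<open>Classifying morphisms\<close>

text \<open>An isomorphism maps the coefficients of polynomials bijectively, hence respects every
  clause of the definition of a lifting. It is needed to move a lifting to a copy of its
  algebra.\<close>

lemma liftings_iso:
  fixes A :: "('k, 'a) module" and B :: "('k, 'b) module"
  assumes A: "algebra K A" and B: "algebra K B" and g: "g \<in> ring_iso A B"
    and sm: "\<And>c x. c \<in> carrier K \<Longrightarrow> x \<in> carrier A \<Longrightarrow> g (c \<odot>\<^bsub>A\<^esub> x) = c \<odot>\<^bsub>B\<^esub> g x"
    and H: "H \<subseteq> carrier (mpoly K n)" and I: "I \<in> liftings n H A"
  shows "(\<lambda>p m. g (p m)) ` I \<in> liftings n H B"
proof -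
  interpret K: cring K using A by (simp add: algebra_def module_def)
  interpret A: cring A using A by (simp add: algebra_def)
  interpret A: algebra K A by (rule A)
  interpret B: cring B using B by (simp add: algebra_def)
  interpret B: algebra K B by (rule B)
  have bij: "bij_betw g (carrier A) (carrier B)" and hom: "g \<in> ring_hom A B"
    using g by (auto simp: ring_iso_def)
  interpret g: ring_hom_cring A B g by unfold_locales (rule hom)
  let ?G = "\<lambda>p m. g (p m)" and ?g' = "inv_into (carrier A) g"
  have g': "?g' \<in> ring_iso B A" by (rule ring_iso_set_sym[OF A.ring_axioms g])
  interpret g': ring_hom_cring B A ?g' by unfold_locales (use g' in \<open>simp add: ring_iso_def\<close>)
  have gg': "g (?g' y) = y" if "y \<in> carrier B" for y
    using that bij by (metis bij_betw_def f_inv_into_f)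
  have G: "ring_hom_ring (mpoly A k) (mpoly B k) ?G" for k
    by (intro ring_hom_ringI2 g.coeff_map_hom cring.axioms(1) A.mpoly_cring B.mpoly_cring)
  have surj: "?G ` carrier (mpoly A k) = carrier (mpoly B k)" for k
  proof
    show "?G ` carrier (mpoly A k) \<subseteq> carrier (mpoly B k)"
      using ring_hom_closed[OF g.coeff_map_hom] by blast
    show "carrier (mpoly B k) \<subseteq> ?G ` carrier (mpoly A k)"
    proof
      fix q assume q: "q \<in> carrier (mpoly B k)"
      have "q = ?G (\<lambda>m. ?g' (q m))" using gg' mpoly_carrierD(1)[OF q] by simp
      moreover have "(\<lambda>m. ?g' (q m)) \<in> carrier (mpoly A k)"
        using ring_hom_closed[OF g'.coeff_map_hom q] by simp
      ultimately show "q \<in> ?G ` carrier (mpoly A k)" by (rule image_eqI)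
    qed
  qed
  have inj: "p = q" if "p \<in> carrier (mpoly A k)" "q \<in> carrier (mpoly A k)" "?G p = ?G q" for p q k
  proof
    fix m
    have "g (p m) = g (q m)" using that(3) by (rule fun_cong)
    then show "p m = q m"
      using bij mpoly_carrierD(1)[OF that(1)] mpoly_carrierD(1)[OF that(2)] by (auto simp: bij_betw_def inj_on_def)
  qed
  let ?P = "mpoly A (Suc n)" and ?Q = "mpoly B (Suc n)"
  have I': "ideal I ?P" "\<And>p d. p \<in> I \<Longrightarrow> hom_component A d p \<in> I"
    "set_var_zero A n ` I = extend_ideal A n (\<lambda>c. scalar A c) H"
    "\<And>p. p \<in> carrier ?P \<Longrightarrow> mpoly_var A n \<otimes>\<^bsub>?P\<^esub> p \<in> I \<Longrightarrow> p \<in> I"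
    using I by (auto simp: liftings_iff[OF A.is_cring] homogeneous_ideal_def)
  have Ic: "p \<in> carrier ?P" if "p \<in> I" for p using ideal.Icarr[OF I'(1) that] .
  have x: "mpoly_var A n \<in> carrier ?P" by (rule A.mpoly_var_closed) simp
  have Gx: "?G (mpoly_var A n) = mpoly_var B n"
    by (auto simp: mpoly_var_def)
  have "homogeneous_ideal B (Suc n) (?G ` I)"
    unfolding homogeneous_ideal_def
  proof (intro conjI ballI allI)
    show "ideal (?G ` I) ?Q"
      by (rule ring_hom_ring.ideal_image_surj[OF G I'(1) surj])
    fix q d assume "q \<in> ?G ` I"
    then obtain p where p: "p \<in> I" "q = ?G p" by blast
    have "hom_component B d q = ?G (hom_component A d p)"
      by (auto simp: p(2) hom_component_def)
    then show "hom_component B d q \<in> ?G ` I" using I'(2)[OF p(1), of d] by blast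
  qed
  moreover have "q \<in> ?G ` I" if q: "q \<in> carrier ?Q" "mpoly_var B n \<otimes>\<^bsub>?Q\<^esub> q \<in> ?G ` I" for q
  proof -
    obtain p where p: "p \<in> carrier ?P" "q = ?G p" using q(1) surj[of "Suc n"] by blast
    obtain r where r: "r \<in> I" "mpoly_var B n \<otimes>\<^bsub>?Q\<^esub> q = ?G r" using q(2) by blast
    interpret P: cring ?P by (rule A.mpoly_cring)
    have "?G (mpoly_var A n \<otimes>\<^bsub>?P\<^esub> p) = ?G r"
      using ring_hom_mult[OF g.coeff_map_hom x p(1)] Gx p(2) r(2) by simp
    then have "mpoly_var A n \<otimes>\<^bsub>?P\<^esub> p = r"
      by (rule inj[OF P.m_closed[OF x p(1)] Ic[OF r(1)]])
    then have "p \<in> I" using I'(4)[OF p(1)] r(1) by simp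
    then show ?thesis using p(2) by blast
  qed
  moreover have "set_var_zero B n ` ?G ` I = extend_ideal B n (\<lambda>c. scalar B c) H"
  proof -
    interpret SA: ring_hom_cring K A "\<lambda>c. scalar A c" by (rule A.scalar_hom_cring)
    have "set_var_zero B n (?G p) = ?G (set_var_zero A n p)" for p
      by (auto simp: set_var_zero_def)
    then have "set_var_zero B n ` ?G ` I = ?G ` extend_ideal A n (\<lambda>c. scalar A c) H"
      by (simp add: image_image flip: I'(3))
    also have "\<dots> = genideal (mpoly B n) (?G ` (\<lambda>p m. scalar A (p m)) ` H)"
      unfolding extend_ideal_def
      by (rule ring_hom_ring.genideal_image_surj[OF G SA.extend_ideal_ideal(2)[OF H order.refl] surj])
    also have "?G ` (\<lambda>p m. scalar A (p m)) ` H = (\<lambda>p m. scalar B (p m)) ` H"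
    proof -
      have "?G ((\<lambda>m. scalar A (p m))) = (\<lambda>m. scalar B (p m))" if "p \<in> H" for p
      proof
        fix m
        have "p m \<in> carrier K" using that H mpoly_carrierD(1) by blast
        then show "g (scalar A (p m)) = scalar B (p m)" using sm[of "p m" "\<one>\<^bsub>A\<^esub>"] by simp
      qed
      then show ?thesis by (simp add: image_image)
    qed
    finally show ?thesis by (simp add: extend_ideal_def)
  qed
  ultimately show ?thesis
    by (auto simp: liftings_iff[OF B.is_cring])
qed

locale lifting_scheme =
  fixes K :: "'k ring" and n :: nat and H :: "(monomial \<Rightarrow> 'k) set"
    and R :: "('k, 'a) module" and U :: "(monomial \<Rightarrow> 'a) set"
  assumes field_K: "field K" and infinite_K: "infinite (carrier K)"
    and H: "homogeneous_ideal K n H" and scheme: "scheme_of_liftings K n H R U"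
begin

sublocale K: field K by (rule field_K)

lemma noetherian_R: "noetherian_algebra K R"
  using scheme by (simp add: scheme_of_liftings_def)

sublocale R: algebra_over_infinite_field K R
  using noetherian_R field_K infinite_K
  by (intro algebra_over_infinite_field.intro) (simp_all add: noetherian_algebra_def)

lemma H_carrier: "H \<subseteq> carrier (mpoly K n)"
  using H by (auto simp: homogeneous_ideal_def dest: ideal.Icarr)

lemma U_lifting: "U \<in> liftings n H R"
  using scheme by (simp add: scheme_of_liftings_def)

lemma U_carrier: "U \<subseteq> carrier (mpoly R (Suc n))"
  using U_lifting by (auto simp: liftings_def homogeneous_ideal_def dest: ideal.Icarr)

lemma base_change_lifting:
  "f \<in> alg_hom K R R \<Longrightarrow> base_change n R f U \<in> liftings n H R"
  using scheme noetherian_R by (auto simp: scheme_of_liftings_def bij_betw_def)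

lemma base_change_inj:
  "f \<in> alg_hom K R R \<Longrightarrow> g \<in> alg_hom K R R \<Longrightarrow> base_change n R f U = base_change n R g U \<Longrightarrow> f = g"
  using scheme noetherian_R by (auto simp: scheme_of_liftings_def bij_betw_def inj_on_def)

text \<open>Morphisms are \<open>extensional\<close>, so a composition has to be cut down to the
  carrier.\<close>

lemma alg_hom_compose:
  fixes A :: "('k, 'b) module" and B :: "('k, 'c) module"
  assumes f: "f \<in> alg_hom K R A" and g: "g \<in> ring_hom A B"
    "\<And>c x. c \<in> carrier K \<Longrightarrow> x \<in> carrier A \<Longrightarrow> g (c \<odot>\<^bsub>A\<^esub> x) = c \<odot>\<^bsub>B\<^esub> g x"
  shows "restrict (\<lambda>x. g (f x)) (carrier R) \<in> alg_hom K R B"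
proof -
  have fh: "f \<in> ring_hom R A" and fs: "\<And>c x. c \<in> carrier K \<Longrightarrow> x \<in> carrier R \<Longrightarrow> f (c \<odot>\<^bsub>R\<^esub> x) = c \<odot>\<^bsub>A\<^esub> f x"
    using f by (auto simp: alg_hom_def)
  have "restrict (\<lambda>x. g (f x)) (carrier R) \<in> ring_hom R B"
    by (rule ring_hom_cong[OF ring_hom_trans[OF fh g(1)]]) (auto simp: R.A.ring_axioms)
  then show ?thesis
    using fs g(2) ring_hom_closed[OF fh] by (auto simp: alg_hom_def)
qed

lemma alg_homD:
  assumes "f \<in> alg_hom K R A"
  shows "f \<in> ring_hom R A" "\<And>c x. c \<in> carrier K \<Longrightarrow> x \<in> carrier R \<Longrightarrow> f (c \<odot>\<^bsub>R\<^esub> x) = c \<odot>\<^bsub>A\<^esub> f x"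
    "f \<in> extensional (carrier R)"
  using assms by (auto simp: alg_hom_def)

text \<open>The universal property is only assumed for algebras over the type of \<open>R\<close>; a copy in that
  type carries it over to any algebra that is not larger.\<close>

lemma classifying_morphism:
  fixes B :: "('k, 'b) module" and g :: "'b \<Rightarrow> 'a"
  assumes B: "noetherian_algebra K B" and g: "inj_on g (carrier B)" and I: "I \<in> liftings n H B"
  shows "\<exists>f\<in>alg_hom K R B. base_change n B f U = I"
proof -
  let ?C = "alg_copy g B"
  have gi: "g \<in> ring_iso B ?C" and gz: "g \<zero>\<^bsub>B\<^esub> = \<zero>\<^bsub>?C\<^esub>"
    and gs: "\<And>c x. x \<in> carrier B \<Longrightarrow> g (c \<odot>\<^bsub>B\<^esub> x) = c \<odot>\<^bsub>?C\<^esub> g x"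
    using alg_copy[OF g] by auto
  have C: "noetherian_algebra K ?C"
    by (rule alg_iso_noetherian[OF K.is_cring B gi gz gs])
  have algB: "algebra K B" and algC: "algebra K ?C"
    using B C by (auto simp: noetherian_algebra_def)
  interpret B: cring B using algB by (simp add: algebra_def)
  interpret C: cring ?C using algC by (simp add: algebra_def)
  have bij: "bij_betw (\<lambda>f. base_change n ?C f U) (alg_hom K R ?C) (liftings n H ?C)"
    using scheme C by (simp add: scheme_of_liftings_def)
  have "(\<lambda>p m. g (p m)) ` I \<in> liftings n H ?C"
    by (rule liftings_iso[OF algB algC gi gs H_carrier I])
  then obtain f where f: "f \<in> alg_hom K R ?C" "base_change n ?C f U = (\<lambda>p m. g (p m)) ` I"
    unfolding bij_betw_imp_surj_on[OF bij, symmetric] by (elim imageE) metis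
  \<comment> \<open>The inverse of the copying map leads from the copy back to
    \<open>B\<close>.\<close>
  let ?g' = "inv_into (carrier B) g"
  have g': "?g' \<in> ring_iso ?C B" by (rule ring_iso_set_sym[OF B.ring_axioms gi])
  have g'h: "?g' \<in> ring_hom ?C B" using g' by (simp add: ring_iso_def)
  have g's: "?g' (c \<odot>\<^bsub>?C\<^esub> x) = c \<odot>\<^bsub>B\<^esub> ?g' x" if cx: "c \<in> carrier K" "x \<in> carrier ?C" for c x
  proof -
    obtain y where y: "y \<in> carrier B" "x = g y" using cx(2) by (auto simp: alg_copy_def)
    have "c \<odot>\<^bsub>B\<^esub> y \<in> carrier B" using algB cx(1) y(1) by (meson algebra.axioms(1) module.smult_closed)
    then show ?thesis
      using gs[OF y(1), of c] y by (simp add: inv_into_f_f[OF g] flip: gs)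
  qed
  define h where "h = restrict (\<lambda>x. ?g' (f x)) (carrier R)"
  have h: "h \<in> alg_hom K R B"
    unfolding h_def by (rule alg_hom_compose[OF f(1) g'h g's])
  have fc: "ring_hom_cring R ?C f"
    using alg_homD(1)[OF f(1)] by unfold_locales
  interpret fc: ring_hom_cring R ?C f by (rule fc)
  interpret g'c: ring_hom_cring ?C B ?g' by unfold_locales (rule g'h)
  have Iid: "ideal I (mpoly B (Suc n))" using I by (simp add: liftings_def homogeneous_ideal_def)
  have "base_change n B h U = extend_ideal B (Suc n) (\<lambda>x. ?g' (f x)) U"
    unfolding base_change_def by (rule extend_ideal_cong[OF U_carrier]) (simp add: h_def)
  also have "\<dots> = extend_ideal B (Suc n) ?g' (base_change n ?C f U)"
    unfolding base_change_def by (rule fc.extend_ideal_comp[symmetric, OF g'c.ring_hom_cring_axioms U_carrier])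
  also have "\<dots> = extend_ideal B (Suc n) (\<lambda>x. x) I"
  proof -
    have "(\<lambda>p m. ?g' (p m)) ` (\<lambda>p m. g (p m)) ` I = (\<lambda>p m. p m) ` I"
      unfolding image_image
    proof (rule image_cong[OF refl], rule ext)
      fix p m assume "p \<in> I"
      then have "p m \<in> carrier B" using ideal.Icarr[OF Iid] mpoly_carrierD(1) by blast
      then show "?g' (g (p m)) = p m" by (rule inv_into_f_f[OF g])
    qed
    then show ?thesis unfolding f(2) extend_ideal_def by simp
  qed
  also have "\<dots> = I" by (rule B.extend_ideal_id[OF Iid])
  finally show ?thesis using h by blast
qed

end

section \<open>The ground field and the polynomial algebra as \<open>K\<close>-algebras\<close>

lemma base_algebra_simps [simp]:
  "carrier (base_algebra K) = carrier K" "monoid.mult (base_algebra K) = monoid.mult K"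
  "one (base_algebra K) = one K" "zero (base_algebra K) = zero K" "ring.add (base_algebra K) = ring.add K"
  "smult (base_algebra K) = monoid.mult K"
  by (simp_all add: base_algebra_def ring.defs module.defs)

text \<open>Polynomials of bounded degree are finite sequences, and the polynomial ring is a
  countable union of sets of such sequences; over an infinite ring its cardinality does not exceed
  that of the ring. This provides the copy of \<open>R[T]\<close> in the type of
  \<open>R\<close>.\<close>

lemma inj_on_UP:
  assumes inf: "infinite (carrier R)"
  shows "\<exists>g :: (nat \<Rightarrow> 'a) \<Rightarrow> 'a. inj_on g (carrier (UP (R :: ('a, 'm) ring_scheme)))"
proof -
  let ?c = "carrier R"
  define F where "F k = {p :: nat \<Rightarrow> 'a. (\<forall>i. p i \<in> ?c) \<and> (\<forall>i\<ge>k. p i = \<zero>\<^bsub>R\<^esub>)}" for k :: nat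
  have F: "(card_of (F k), card_of ?c) \<in> ordLeq" for k
  proof (induction k)
    case 0
    obtain a where "a \<in> ?c" using inf by (metis ex_in_conv finite.emptyI)
    moreover have "F 0 \<subseteq> {\<lambda>i. \<zero>\<^bsub>R\<^esub>}" by (auto simp: F_def)
    ultimately have "inj_on (\<lambda>_. a) (F 0)" "(\<lambda>_. a) ` F 0 \<subseteq> ?c" by (auto simp: inj_on_def)
    then show ?case using card_of_ordLeq by blast
  next
    case (Suc k)
    \<comment> \<open>Splitting off the coefficient of index \<open>k\<close> embeds the sequences
      of length \<open>k + 1\<close> into a product.\<close>
    have "inj_on (\<lambda>p. (p(k := \<zero>\<^bsub>R\<^esub>), p k)) (F (Suc k))"
    proof (rule inj_onI)
      fix p q assume "(p(k := \<zero>\<^bsub>R\<^esub>), p k) = (q(k := \<zero>\<^bsub>R\<^esub>), q k)"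
      then have "p(k := \<zero>\<^bsub>R\<^esub>, k := p k) = q(k := \<zero>\<^bsub>R\<^esub>, k := q k)" by simp
      then show "p = q" by simp
    qed
    moreover have "(\<lambda>p. (p(k := \<zero>\<^bsub>R\<^esub>), p k)) ` F (Suc k) \<subseteq> F k \<times> ?c"
    proof -
      have "\<zero>\<^bsub>R\<^esub> \<in> ?c" if "p \<in> F (Suc k)" for p
        using that by (metis (mono_tags, lifting) F_def mem_Collect_eq order_refl)
      then show ?thesis by (auto simp: F_def not_less_eq_eq)
    qed
    ultimately have "(card_of (F (Suc k)), card_of (F k \<times> ?c)) \<in> ordLeq"
      by (auto simp flip: card_of_ordLeq)
    moreover have "(card_of (F k \<times> ?c), card_of ?c) \<in> ordLeq"
      by (rule card_of_Times_ordLeq_infinite_Field) (use inf Suc card_of_Card_order in \<open>auto simp: Field_card_of card_of_mono1\<close>)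
    ultimately show ?case by (rule ordLeq_transitive)
  qed
  have "carrier (UP R) \<subseteq> (\<Union>k\<in>(UNIV :: nat set). F k)"
  proof
    fix p assume "p \<in> carrier (UP R)"
    then have "(\<forall>i. p i \<in> ?c) \<and> (\<exists>k. bound \<zero>\<^bsub>R\<^esub> k p)" by (auto simp: UP_def up_def)
    then obtain k where "\<forall>i. p i \<in> ?c" "\<And>i. k < i \<Longrightarrow> p i = \<zero>\<^bsub>R\<^esub>" by (auto simp: bound_def)
    then have "p \<in> F (Suc k)" by (auto simp: F_def)
    then show "p \<in> (\<Union>k\<in>(UNIV :: nat set). F k)" by blast
  qed
  then have "(card_of (carrier (UP R)), card_of (\<Union>k\<in>(UNIV :: nat set). F k)) \<in> ordLeq"
    by (rule card_of_mono1)
  moreover have "(card_of (\<Union>k\<in>(UNIV :: nat set). F k), card_of ?c) \<in> ordLeq"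
    by (rule card_of_UNION_ordLeq_infinite[OF inf]) (use inf F in \<open>auto simp: infinite_iff_card_of_nat\<close>)
  ultimately have "(card_of (carrier (UP R)), card_of ?c) \<in> ordLeq" by (rule ordLeq_transitive)
  then show ?thesis by (auto simp flip: card_of_ordLeq)
qed

lemma base_algebra_noetherian:
  assumes "field K"
  shows "noetherian_algebra K (base_algebra K)"
proof -
  interpret K: field K by fact
  have id: "(\<lambda>x. x) \<in> ring_iso K (base_algebra K)"
    by (auto simp: ring_iso_def bij_betw_def intro!: ring_hom_memI)
  interpret B: cring "base_algebra K" by (rule ring_iso_cring[OF K.is_cring id]) simp_all
  have nK: "noetherian_ring K"
  proof (rule K.noetherian_ringI)
    fix I assume "ideal I K"
    then have "I = {\<zero>\<^bsub>K\<^esub>} \<or> I = carrier K" using K.all_ideals by blast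
    then show "\<exists>A\<subseteq>carrier K. finite A \<and> I = genideal K A"
      using K.genideal_zero K.genideal_one
      by (elim disjE) (intro exI[of _ "{\<zero>\<^bsub>K\<^esub>}"], simp, intro exI[of _ "{\<one>\<^bsub>K\<^esub>}"], simp)
  qed
  have h: "ring_hom_ring K (base_algebra K) (\<lambda>x. x)"
    by (intro ring_hom_ringI2 K.ring_axioms B.ring_axioms) (use id in \<open>simp add: ring_iso_def\<close>)
  have "noetherian_ring (base_algebra K)"
    by (rule ring_hom_ring.noetherian_ring_image[OF h nK]) simp
  moreover have "algebra K (base_algebra K)"
    by (rule algebraI) (auto simp: K.is_cring B.is_cring K.l_distr K.r_distr K.m_assoc)
  ultimately show ?thesis by (simp add: noetherian_algebra_def)
qed

text \<open>The record \<open>UP A\<close> has its scalars in \<open>A\<close>; here the same ring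
  carries scalars in \<open>K\<close>.\<close>

definition poly_algebra :: "('k, 'a) module \<Rightarrow> ('k, nat \<Rightarrow> 'a) module" where
  "poly_algebra A = \<lparr>carrier = carrier (UP A), monoid.mult = monoid.mult (UP A), one = one (UP A),
     zero = zero (UP A), add = ring.add (UP A), smult = (\<lambda>c p i. c \<odot>\<^bsub>A\<^esub> p i)\<rparr>"

lemma poly_algebra_simps [simp]:
  "carrier (poly_algebra A) = carrier (UP A)" "monoid.mult (poly_algebra A) = monoid.mult (UP A)"
  "one (poly_algebra A) = one (UP A)" "zero (poly_algebra A) = zero (UP A)"
  "ring.add (poly_algebra A) = ring.add (UP A)"
  by (simp_all add: poly_algebra_def)

context algebra_over_infinite_field
begin

lemma UP_A: "UP_cring A"
  by (simp add: UP_cring_def A.is_cring)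

lemma poly_algebra_smult:
  assumes "c \<in> carrier K" "p \<in> carrier (UP A)"
  shows "c \<odot>\<^bsub>poly_algebra A\<^esub> p = scalar A c \<odot>\<^bsub>UP A\<^esub> p"
proof -
  interpret P: UP_cring A "UP A" by (rule UP_A) simp
  have "scalar A c \<in> carrier A" using assms by simp
  then have "scalar A c \<odot>\<^bsub>UP A\<^esub> p = (\<lambda>i. scalar A c \<otimes>\<^bsub>A\<^esub> p i)"
    using assms by (simp add: UP_def)
  also have "\<dots> = (\<lambda>i. c \<odot>\<^bsub>A\<^esub> p i)"
  proof
    fix i
    have "p i \<in> carrier A" using assms(2) by (auto simp: UP_def)
    then show "scalar A c \<otimes>\<^bsub>A\<^esub> p i = c \<odot>\<^bsub>A\<^esub> p i" using assms(1) by (simp add: A.smult_assoc2)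
  qed
  finally show ?thesis by (simp add: poly_algebra_def)
qed

lemma poly_algebra_cring: "cring (poly_algebra A)"
proof -
  interpret P: UP_cring A "UP A" by (rule UP_A) simp
  show ?thesis
    by (rule ring_iso_cring[of "UP A" "\<lambda>x. x"])
       (auto simp: ring_iso_def bij_betw_def P.UP_cring intro!: ring_hom_memI)
qed

lemma poly_algebra_algebra: "algebra K (poly_algebra A)"
proof -
  interpret P: UP_cring A "UP A" by (rule UP_A) simp
  show ?thesis
  proof (rule algebraI)
    fix a b x y assume a: "a \<in> carrier K" and x: "x \<in> carrier (poly_algebra A)"
    have s: "scalar A a \<in> carrier A" using a by simp
    show "a \<odot>\<^bsub>poly_algebra A\<^esub> x \<in> carrier (poly_algebra A)"
      using a x s by (simp add: poly_algebra_smult P.UP_smult_closed)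
    {
      assume b: "b \<in> carrier K"
      have t: "scalar A b \<in> carrier A" using b by simp
      show "(a \<oplus>\<^bsub>K\<^esub> b) \<odot>\<^bsub>poly_algebra A\<^esub> x = a \<odot>\<^bsub>poly_algebra A\<^esub> x \<oplus>\<^bsub>poly_algebra A\<^esub> b \<odot>\<^bsub>poly_algebra A\<^esub> x"
        using a b x s t by (simp add: poly_algebra_smult A.smult_l_distr P.UP_smult_l_distr)
      show "(a \<otimes>\<^bsub>K\<^esub> b) \<odot>\<^bsub>poly_algebra A\<^esub> x = a \<odot>\<^bsub>poly_algebra A\<^esub> (b \<odot>\<^bsub>poly_algebra A\<^esub> x)"
        using a b x s t S.hom_mult[OF a b] by (simp add: poly_algebra_smult P.UP_smult_assoc1 P.UP_smult_closed)
    }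
    assume y: "y \<in> carrier (poly_algebra A)"
    show "a \<odot>\<^bsub>poly_algebra A\<^esub> (x \<oplus>\<^bsub>poly_algebra A\<^esub> y) =
        a \<odot>\<^bsub>poly_algebra A\<^esub> x \<oplus>\<^bsub>poly_algebra A\<^esub> a \<odot>\<^bsub>poly_algebra A\<^esub> y"
      using a x y s by (simp add: poly_algebra_smult P.UP_smult_r_distr)
    show "(a \<odot>\<^bsub>poly_algebra A\<^esub> x) \<otimes>\<^bsub>poly_algebra A\<^esub> y = a \<odot>\<^bsub>poly_algebra A\<^esub> (x \<otimes>\<^bsub>poly_algebra A\<^esub> y)"
      using a x y s by (simp add: poly_algebra_smult P.UP_smult_assoc2)
  next
    fix x assume "x \<in> carrier (poly_algebra A)"
    then show "\<one>\<^bsub>K\<^esub> \<odot>\<^bsub>poly_algebra A\<^esub> x = x"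
      by (simp add: poly_algebra_smult P.UP_smult_one)
  qed (rule K.is_cring poly_algebra_cring)+
qed

lemma poly_algebra_noetherian:
  assumes "noetherian_ring A"
  shows "noetherian_algebra K (poly_algebra A)"
proof -
  interpret P: UP_cring A "UP A" by (rule UP_A) simp
  interpret S: cring "poly_algebra A" by (rule poly_algebra_cring)
  have h: "ring_hom_ring (UP A) (poly_algebra A) (\<lambda>x. x)"
    by (intro ring_hom_ringI2 P.UP_ring S.ring_axioms ring_hom_memI) auto
  have "noetherian_ring (poly_algebra A)"
    by (rule ring_hom_ring.noetherian_ring_image[OF h P.hilbert_basis[OF assms]]) simp
  moreover have "\<one>\<^bsub>UP A\<^esub> \<noteq> \<zero>\<^bsub>UP A\<^esub>"
  proof
    assume "\<one>\<^bsub>UP A\<^esub> = \<zero>\<^bsub>UP A\<^esub>"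
    then have "\<one>\<^bsub>A\<^esub> = \<zero>\<^bsub>A\<^esub>" using P.coeff_one[of 0] P.coeff_zero[of 0] by (simp del: P.coeff_zero P.coeff_one)
    with A_nontrivial show False by simp
  qed
  ultimately show ?thesis
    using poly_algebra_algebra by (simp add: noetherian_algebra_def)
qed

lemma inj_scalar: "inj_on (\<lambda>c. scalar A c) (carrier K)"
proof (rule inj_onI)
  fix c d assume cd: "c \<in> carrier K" "d \<in> carrier K" "scalar A c = scalar A d"
  show "c = d"
  proof (rule ccontr)
    assume "c \<noteq> d"
    then have u: "c \<ominus>\<^bsub>K\<^esub> d \<in> Units K" using cd by (simp add: K.field_Units)
    have "scalar A (c \<ominus>\<^bsub>K\<^esub> d) = \<zero>\<^bsub>A\<^esub>"
      using cd by (simp add: a_minus_def A.smult_l_distr A.smult_l_minus A.r_neg)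
    moreover have "scalar A ((c \<ominus>\<^bsub>K\<^esub> d) \<otimes>\<^bsub>K\<^esub> inv\<^bsub>K\<^esub> (c \<ominus>\<^bsub>K\<^esub> d)) =
        scalar A (c \<ominus>\<^bsub>K\<^esub> d) \<otimes>\<^bsub>A\<^esub> scalar A (inv\<^bsub>K\<^esub> (c \<ominus>\<^bsub>K\<^esub> d))"
      using u cd by (intro S.hom_mult) auto
    ultimately have "\<one>\<^bsub>A\<^esub> = \<zero>\<^bsub>A\<^esub> \<otimes>\<^bsub>A\<^esub> scalar A (inv\<^bsub>K\<^esub> (c \<ominus>\<^bsub>K\<^esub> d))"
      using u by (simp only: K.Units_r_inv) simp
    then show False using u A_nontrivial by simp
  qed
qed

lemma infinite_A: "infinite (carrier A)"
proof
  assume "finite (carrier A)"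
  moreover have "(\<lambda>c. scalar A c) ` carrier K \<subseteq> carrier A" by auto
  ultimately show False using infinite_K inj_scalar finite_imageD finite_subset by blast
qed

text \<open>Specialization of the variable \<open>T\<close> to the image of \<open>c\<close> in
  \<open>A\<close>.\<close>

definition poly_eval :: "'k \<Rightarrow> (nat \<Rightarrow> 'a) \<Rightarrow> 'a" where
  "poly_eval c = eval A A id (scalar A c)"

lemma poly_eval_hom:
  assumes "c \<in> carrier K"
  shows "poly_eval c \<in> ring_hom (poly_algebra A) A"
    "a \<in> carrier A \<Longrightarrow> poly_eval c (monom (UP A) a i) = scalar A c [^]\<^bsub>A\<^esub> i \<otimes>\<^bsub>A\<^esub> a"
    "d \<in> carrier K \<Longrightarrow> p \<in> carrier (UP A) \<Longrightarrow> poly_eval c (d \<odot>\<^bsub>poly_algebra A\<^esub> p) = d \<odot>\<^bsub>A\<^esub> poly_eval c p"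
proof -
  interpret P: UP_cring A "UP A" by (rule UP_A) simp
  interpret E: UP_pre_univ_prop A A id "UP A"
    by (rule UP_pre_univ_propI) (auto simp: A.is_cring)
  have s: "scalar A c \<in> carrier A" using assms by simp
  have hom: "poly_eval c \<in> ring_hom (UP A) A"
    unfolding poly_eval_def by (rule E.eval_ring_hom[OF s])
  then show "poly_eval c \<in> ring_hom (poly_algebra A) A"
    by (auto intro!: ring_hom_memI simp: ring_hom_closed ring_hom_mult ring_hom_add ring_hom_one)
  show mon: "poly_eval c (monom (UP A) a i) = scalar A c [^]\<^bsub>A\<^esub> i \<otimes>\<^bsub>A\<^esub> a" if "a \<in> carrier A" for a i
    unfolding poly_eval_def using E.eval_monom[OF that s, of i] s that by (simp add: A.m_comm)
  assume d: "d \<in> carrier K" and p: "p \<in> carrier (UP A)"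
  have sd: "scalar A d \<in> carrier A" using d by simp
  have "d \<odot>\<^bsub>poly_algebra A\<^esub> p = monom (UP A) (scalar A d) 0 \<otimes>\<^bsub>UP A\<^esub> p"
    using d p sd by (simp add: poly_algebra_smult P.monom_mult_is_smult)
  then have "poly_eval c (d \<odot>\<^bsub>poly_algebra A\<^esub> p) = poly_eval c (monom (UP A) (scalar A d) 0) \<otimes>\<^bsub>A\<^esub> poly_eval c p"
    using ring_hom_mult[OF hom, of "monom (UP A) (scalar A d) 0" p] p sd by simp
  then show "poly_eval c (d \<odot>\<^bsub>poly_algebra A\<^esub> p) = d \<odot>\<^bsub>A\<^esub> poly_eval c p"
    using mon[OF sd, of 0] sd d ring_hom_closed[OF hom p] by (simp add: A.smult_assoc2)
qed

text \<open>The bound \<open>k\<close> may exceed the degree, so that all coefficients of a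
  polynomial over \<open>R[T]\<close> can be evaluated with the same number of terms.\<close>

lemma poly_eval_sum:
  assumes c: "c \<in> carrier K" and p: "p \<in> carrier (UP A)" and k: "\<And>i. i \<ge> k \<Longrightarrow> p i = \<zero>\<^bsub>A\<^esub>"
  shows "poly_eval c p = (\<Oplus>\<^bsub>A\<^esub>i\<in>{..<k}. scalar A c [^]\<^bsub>A\<^esub> i \<otimes>\<^bsub>A\<^esub> p i)"
proof -
  interpret P: UP_cring A "UP A" by (rule UP_A) simp
  interpret T: cring "poly_algebra A" by (rule poly_algebra_cring)
  interpret E: ring_hom_cring "poly_algebra A" A "poly_eval c"
    by unfold_locales (rule poly_eval_hom(1)[OF c])
  have pi: "p i \<in> carrier A" for i using p by (auto simp: UP_def)
  have "p = (\<Oplus>\<^bsub>UP A\<^esub>i\<in>{..<k}. monom (UP A) (p i) i)"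
  proof (rule P.up_eqI[OF _ p])
    show "(\<Oplus>\<^bsub>UP A\<^esub>i\<in>{..<k}. monom (UP A) (p i) i) \<in> carrier (UP A)"
      using pi by (intro P.P.finsum_closed) auto
    fix j
    have cf: "coeff (UP A) p j = p j" using p by (simp add: UP_def)
    have "coeff (UP A) (\<Oplus>\<^bsub>UP A\<^esub>i\<in>{..<k}. monom (UP A) (p i) i) j =
        (\<Oplus>\<^bsub>A\<^esub>i\<in>{..<k}. coeff (UP A) (monom (UP A) (p i) i) j)"
      using pi by (intro P.coeff_finsum) auto
    also have "\<dots> = (\<Oplus>\<^bsub>A\<^esub>i\<in>{..<k}. if i = j then p i else \<zero>\<^bsub>A\<^esub>)"
      using pi by (intro A.finsum_cong') auto
    also have "\<dots> = p j"
    proof (cases "j < k")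
      case True
      then show ?thesis using pi by (subst A.finsum_single[of _ j]) auto
    next
      case False
      then have "(\<Oplus>\<^bsub>A\<^esub>i\<in>{..<k}. if i = j then p i else \<zero>\<^bsub>A\<^esub>) = \<zero>\<^bsub>A\<^esub>"
        by (intro A.add.finprod_one_eqI) auto
      then show ?thesis using k False by simp
    qed
    finally show "coeff (UP A) p j = coeff (UP A) (\<Oplus>\<^bsub>UP A\<^esub>i\<in>{..<k}. monom (UP A) (p i) i) j"
      by (simp add: cf)
  qed
  \<comment> \<open>\<open>finsum\<close> depends only on carrier, addition and zero, which the two
    records share.\<close>
  moreover have "(\<Oplus>\<^bsub>UP A\<^esub>i\<in>{..<k}. monom (UP A) (p i) i) = (\<Oplus>\<^bsub>poly_algebra A\<^esub>i\<in>{..<k}. monom (UP A) (p i) i)"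
    by (simp add: finsum_def finprod_def)
  ultimately have "p = (\<Oplus>\<^bsub>poly_algebra A\<^esub>i\<in>{..<k}. monom (UP A) (p i) i)" by simp
  then have "poly_eval c p = (\<Oplus>\<^bsub>A\<^esub>i\<in>{..<k}. poly_eval c (monom (UP A) (p i) i))"
    using pi E.hom_finsum[of "\<lambda>i. monom (UP A) (p i) i" "{..<k}"] by (simp add: o_def Pi_def)
  also have "\<dots> = (\<Oplus>\<^bsub>A\<^esub>i\<in>{..<k}. scalar A c [^]\<^bsub>A\<^esub> i \<otimes>\<^bsub>A\<^esub> p i)"
    using pi c by (intro A.finsum_cong') (auto simp: poly_eval_hom(2))
  finally show ?thesis .
qed

end


section \<open>The one-parameter family of a lifting\<close>

context lifting_scheme
begin

abbreviation RT :: "('k, nat \<Rightarrow> 'a) module" where "RT \<equiv> poly_algebra R"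

abbreviation xdeg :: "monomial \<Rightarrow> nat" where "xdeg \<equiv> (\<lambda>m. Poly_Mapping.lookup m n)"

definition specialize :: "'k \<Rightarrow> (monomial \<Rightarrow> nat \<Rightarrow> 'a) \<Rightarrow> monomial \<Rightarrow> 'a" where
  "specialize c p = (\<lambda>m. R.poly_eval c (p m))"

text \<open>Sets \<open>T = c\<close> and undoes the substitution of \<open>c x_n\<close> for
  \<open>x_n\<close>; a polynomial in the fibre of the family at \<open>c\<close> thereby returns to
  the coordinates of \<open>U\<close>.\<close>

definition untwist :: "'k \<Rightarrow> (monomial \<Rightarrow> nat \<Rightarrow> 'a) \<Rightarrow> monomial \<Rightarrow> 'a" where
  "untwist c p = mscale R xdeg (scalar R (inv\<^bsub>K\<^esub> c)) (specialize c p)"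

text \<open>The family over \<open>R[T]\<close> with fibre \<open>U(x\<^sub>0, \<dots>, x\<^sub>n\<^sub>-\<^sub>1, T x\<^sub>n)\<close>. As \<open>K\<close> is infinite, its closure over
  \<open>T = 0\<close> consists of the polynomials that restrict to the fibres at all nonzero values of \<open>T\<close>.\<close>

definition twisted_lifting :: "(monomial \<Rightarrow> nat \<Rightarrow> 'a) set" where
  "twisted_lifting = {p \<in> carrier (mpoly RT (Suc n)). \<forall>c\<in>carrier K - {\<zero>\<^bsub>K\<^esub>}. untwist c p \<in> U}"

text \<open>The substitution of \<open>T x_n\<close> for \<open>x_n\<close>: a term with exponent
  \<open>j\<close> of \<open>x_n\<close> receives the factor \<open>T ^ j\<close>.\<close>

definition homogenize :: "(monomial \<Rightarrow> 'a) \<Rightarrow> monomial \<Rightarrow> nat \<Rightarrow> 'a" where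
  "homogenize f = (\<lambda>m. monom (UP R) (f m) (xdeg m))"

lemma xdeg_weight: "additive_weight xdeg"
  by (rule additive_weight_lookup)

lemma RT_cring: "cring RT"
  by (rule R.poly_algebra_cring)

lemma RT_algebra: "algebra K RT"
  by (rule R.poly_algebra_algebra)

lemma nonzero_Units: "c \<in> carrier K - {\<zero>\<^bsub>K\<^esub>} \<Longrightarrow> c \<in> Units K"
  by (simp add: K.field_Units)

lemma poly_eval_hom_cring: "c \<in> carrier K \<Longrightarrow> ring_hom_cring RT R (R.poly_eval c)"
  by (intro ring_hom_cringI RT_cring R.A.is_cring R.poly_eval_hom(1))

lemma specialize_hom: "c \<in> carrier K \<Longrightarrow> specialize c \<in> ring_hom (mpoly RT k) (mpoly R k)"
  using ring_hom_cring.coeff_map_hom[OF poly_eval_hom_cring] by (simp add: specialize_def[abs_def])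

lemma untwist_hom:
  assumes c: "c \<in> carrier K - {\<zero>\<^bsub>K\<^esub>}"
  shows "untwist c \<in> ring_hom (mpoly RT k) (mpoly R k)"
proof -
  have "mscale R xdeg (scalar R (inv\<^bsub>K\<^esub> c)) \<in> ring_hom (mpoly R k) (mpoly R k)"
    using nonzero_Units[OF c] by (intro R.A.mscale_hom xdeg_weight R.A.smult_closed K.Units_inv_closed R.A.one_closed)
  then have "mscale R xdeg (scalar R (inv\<^bsub>K\<^esub> c)) \<circ> specialize c \<in> ring_hom (mpoly RT k) (mpoly R k)"
    using specialize_hom[of c k] c by (intro ring_hom_trans) auto
  then show ?thesis by (simp add: o_def untwist_def[abs_def])
qed

lemma scalar_inv:
  assumes c: "c \<in> carrier K - {\<zero>\<^bsub>K\<^esub>}" and a: "a \<in> carrier R"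
  shows "scalar R c [^]\<^bsub>R\<^esub> (i::nat) \<otimes>\<^bsub>R\<^esub> (scalar R (inv\<^bsub>K\<^esub> c) [^]\<^bsub>R\<^esub> i \<otimes>\<^bsub>R\<^esub> a) = a"
    "scalar R (inv\<^bsub>K\<^esub> c) [^]\<^bsub>R\<^esub> i \<otimes>\<^bsub>R\<^esub> (scalar R c [^]\<^bsub>R\<^esub> i \<otimes>\<^bsub>R\<^esub> a) = a"
proof -
  have u: "c \<in> Units K" using c by (rule nonzero_Units)
  have s: "scalar R c \<in> carrier R" "scalar R (inv\<^bsub>K\<^esub> c) \<in> carrier R" using c u by auto
  have "scalar R c \<otimes>\<^bsub>R\<^esub> scalar R (inv\<^bsub>K\<^esub> c) = scalar R (c \<otimes>\<^bsub>K\<^esub> inv\<^bsub>K\<^esub> c)"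
    by (rule R.S.hom_mult[symmetric]) (use c u in auto)
  then have 1: "scalar R c \<otimes>\<^bsub>R\<^esub> scalar R (inv\<^bsub>K\<^esub> c) = \<one>\<^bsub>R\<^esub>" using u by simp
  have 2: "scalar R c [^]\<^bsub>R\<^esub> i \<otimes>\<^bsub>R\<^esub> scalar R (inv\<^bsub>K\<^esub> c) [^]\<^bsub>R\<^esub> i = \<one>\<^bsub>R\<^esub>"
    using s by (simp add: 1 flip: R.A.nat_pow_distrib)
  have p: "scalar R c [^]\<^bsub>R\<^esub> i \<in> carrier R" "scalar R (inv\<^bsub>K\<^esub> c) [^]\<^bsub>R\<^esub> i \<in> carrier R" using s by auto
  show "scalar R c [^]\<^bsub>R\<^esub> i \<otimes>\<^bsub>R\<^esub> (scalar R (inv\<^bsub>K\<^esub> c) [^]\<^bsub>R\<^esub> i \<otimes>\<^bsub>R\<^esub> a) = a"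
    using p a 2 by (simp flip: R.A.m_assoc)
  show "scalar R (inv\<^bsub>K\<^esub> c) [^]\<^bsub>R\<^esub> i \<otimes>\<^bsub>R\<^esub> (scalar R c [^]\<^bsub>R\<^esub> i \<otimes>\<^bsub>R\<^esub> a) = a"
    using p a 2 by (simp add: R.A.m_comm[OF p(2) p(1)] flip: R.A.m_assoc)
qed

lemma mscale_untwist:
  assumes c: "c \<in> carrier K - {\<zero>\<^bsub>K\<^esub>}" and p: "p \<in> carrier (mpoly RT k)"
  shows "mscale R xdeg (scalar R c) (untwist c p) = specialize c p"
proof
  fix m
  have "specialize c p m \<in> carrier R"
    using ring_hom_closed[OF specialize_hom p, of c] c mpoly_carrierD(1) by blast
  then show "mscale R xdeg (scalar R c) (untwist c p) m = specialize c p m"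
    by (simp only: mscale_def untwist_def scalar_inv(1)[OF c])
qed

lemma homogenize_closed:
  assumes f: "f \<in> carrier (mpoly R k)"
  shows "homogenize f \<in> carrier (mpoly RT k)"
proof (rule mpoly_carrierI)
  interpret P: UP_cring R "UP R" by (rule R.UP_A) simp
  note fm = mpoly_carrierD(1)[OF f]
  show "homogenize f m \<in> carrier RT" for m using fm by (simp add: homogenize_def)
  have nz: "f m \<noteq> \<zero>\<^bsub>R\<^esub>" if "homogenize f m \<noteq> \<zero>\<^bsub>RT\<^esub>" for m
    using that by (auto simp: homogenize_def)
  show "finite {m. homogenize f m \<noteq> \<zero>\<^bsub>RT\<^esub>}"
    by (rule finite_subset[OF _ mpoly_carrierD(2)[OF f]]) (use nz in blast)
  show "Poly_Mapping.keys m \<subseteq> {..<k}" if "homogenize f m \<noteq> \<zero>\<^bsub>RT\<^esub>" for m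
    by (rule mpoly_carrierD(3)[OF f nz[OF that]])
qed

lemma specialize_homogenize:
  assumes f: "f \<in> carrier (mpoly R k)" and c: "c \<in> carrier K"
  shows "specialize c (homogenize f) = mscale R xdeg (scalar R c) f"
  by (rule ext) (simp add: specialize_def homogenize_def mscale_def R.poly_eval_hom(2)[OF c] mpoly_carrierD(1)[OF f])

lemma untwist_homogenize:
  assumes f: "f \<in> carrier (mpoly R k)" and c: "c \<in> carrier K - {\<zero>\<^bsub>K\<^esub>}"
  shows "untwist c (homogenize f) = f"
proof
  fix m
  have "c \<in> carrier K" using c by simp
  then show "untwist c (homogenize f) m = f m"
    by (simp only: untwist_def specialize_homogenize[OF f] mscale_def scalar_inv(2)[OF c mpoly_carrierD(1)[OF f]])
qed

lemma homogenize_in_twisted: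
  assumes "f \<in> U"
  shows "homogenize f \<in> twisted_lifting"
proof -
  have "f \<in> carrier (mpoly R (Suc n))" using assms U_carrier by blast
  then show ?thesis
    using assms by (simp add: twisted_lifting_def homogenize_closed untwist_homogenize)
qed

lemma U_props:
  "ideal U (mpoly R (Suc n))" "\<And>p d. p \<in> U \<Longrightarrow> hom_component R d p \<in> U"
  "set_var_zero R n ` U = extend_ideal R n (\<lambda>c. scalar R c) H"
  "\<And>p. p \<in> carrier (mpoly R (Suc n)) \<Longrightarrow> mpoly_var R n \<otimes>\<^bsub>mpoly R (Suc n)\<^esub> p \<in> U \<Longrightarrow> p \<in> U"
  using U_lifting by (auto simp: liftings_iff[OF R.A.is_cring] homogeneous_ideal_def)

text \<open>An intersection of preimages of \<open>U\<close> under the ring homomorphisms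
  \<open>untwist c\<close>.\<close>

lemma twisted_lifting_ideal: "ideal twisted_lifting (mpoly RT (Suc n))"
proof -
  interpret RT: cring RT by (rule RT_cring)
  interpret Q: cring "mpoly RT (Suc n)" by (rule RT.mpoly_cring)
  interpret P: cring "mpoly R (Suc n)" by (rule R.A.mpoly_cring)
  interpret U: ideal U "mpoly R (Suc n)" by (rule U_props(1))
  show ?thesis
  proof (rule Q.idealI_comm)
    have "untwist c \<zero>\<^bsub>mpoly RT (Suc n)\<^esub> = \<zero>\<^bsub>mpoly R (Suc n)\<^esub>" if "c \<in> carrier K - {\<zero>\<^bsub>K\<^esub>}" for c
      by (rule ring_hom_zero[OF untwist_hom[OF that] Q.ring_axioms P.ring_axioms])
    then show "\<zero>\<^bsub>mpoly RT (Suc n)\<^esub> \<in> twisted_lifting"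
      by (simp add: twisted_lifting_def)
    fix a b assume a: "a \<in> twisted_lifting"
    {
      assume b: "b \<in> twisted_lifting"
      have "untwist c (a \<oplus>\<^bsub>mpoly RT (Suc n)\<^esub> b) \<in> U" if c: "c \<in> carrier K - {\<zero>\<^bsub>K\<^esub>}" for c
        using a b c by (subst ring_hom_add[OF untwist_hom[OF c]]) (auto simp: twisted_lifting_def)
      then show "a \<oplus>\<^bsub>mpoly RT (Suc n)\<^esub> b \<in> twisted_lifting"
        using a b by (auto simp: twisted_lifting_def)
    }
    assume b: "b \<in> carrier (mpoly RT (Suc n))"
    have "untwist c (b \<otimes>\<^bsub>mpoly RT (Suc n)\<^esub> a) \<in> U" if c: "c \<in> carrier K - {\<zero>\<^bsub>K\<^esub>}" for c
      using a b c ring_hom_closed[OF untwist_hom[OF c] b]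
      by (subst ring_hom_mult[OF untwist_hom[OF c]]) (auto simp: twisted_lifting_def intro: U.I_l_closed)
    then show "b \<otimes>\<^bsub>mpoly RT (Suc n)\<^esub> a \<in> twisted_lifting"
      using a b by (auto simp: twisted_lifting_def)
  qed (auto simp: twisted_lifting_def)
qed

lemma poly_eval_zero: "c \<in> carrier K \<Longrightarrow> R.poly_eval c \<zero>\<^bsub>RT\<^esub> = \<zero>\<^bsub>R\<^esub>"
  using ring_hom_zero[OF R.poly_eval_hom(1)] RT_cring R.A.ring_axioms by (simp add: cring.axioms(1))

lemma twisted_lifting_homogeneous: "homogeneous_ideal RT (Suc n) twisted_lifting"
  unfolding homogeneous_ideal_def
proof (intro conjI ballI allI twisted_lifting_ideal)
  fix p d assume p: "p \<in> twisted_lifting"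
  have "untwist c (hom_component RT d p) = hom_component R d (untwist c p)" if c: "c \<in> carrier K - {\<zero>\<^bsub>K\<^esub>}" for c
    using poly_eval_zero[of c] c nonzero_Units[OF c]
    by (auto simp: untwist_def specialize_def hom_component_def mscale_def fun_eq_iff)
  moreover have "hom_component RT d p \<in> carrier (mpoly RT (Suc n))"
    using p by (simp add: hom_component_wcomp cring.wcomp_closed[OF RT_cring] twisted_lifting_def)
  ultimately show "hom_component RT d p \<in> twisted_lifting"
    using p U_props(2) by (auto simp: twisted_lifting_def)
qed

text \<open>Untwisting takes \<open>x_n\<close> to a unit multiple of \<open>x_n\<close>, so
  saturation passes from \<open>U\<close> to each of the preimages that define the family.\<close>

lemma twisted_lifting_saturated:
  assumes p: "p \<in> carrier (mpoly RT (Suc n))" and xp: "mpoly_var RT n \<otimes>\<^bsub>mpoly RT (Suc n)\<^esub> p \<in> twisted_lifting"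
  shows "p \<in> twisted_lifting"
proof -
  interpret RT: cring RT by (rule RT_cring)
  interpret P: cring "mpoly R (Suc n)" by (rule R.A.mpoly_cring)
  interpret U: ideal U "mpoly R (Suc n)" by (rule U_props(1))
  have "untwist c p \<in> U" if c: "c \<in> carrier K - {\<zero>\<^bsub>K\<^esub>}" for c
  proof -
    have cK: "c \<in> carrier K" and s: "scalar R c \<in> carrier R" "scalar R (inv\<^bsub>K\<^esub> c) \<in> carrier R"
      using c nonzero_Units[OF c] by auto
    have u: "untwist c p \<in> carrier (mpoly R (Suc n))" by (rule ring_hom_closed[OF untwist_hom[OF c] p])
    have "R.poly_eval c \<one>\<^bsub>RT\<^esub> = \<one>\<^bsub>R\<^esub>" by (rule ring_hom_one[OF R.poly_eval_hom(1)[OF cK]])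
    then have "specialize c (mpoly_var RT n) = mpoly_var R n"
      using poly_eval_zero[OF cK] by (auto simp: specialize_def mpoly_var_def)
    then have "untwist c (mpoly_var RT n) = mscale R xdeg (scalar R (inv\<^bsub>K\<^esub> c)) (mpoly_var R n)"
      by (simp add: untwist_def)
    also have "\<dots> = (\<lambda>m. scalar R (inv\<^bsub>K\<^esub> c) \<otimes>\<^bsub>R\<^esub> mpoly_var R n m)"
      using s by (auto simp: mscale_def mpoly_var_def fun_eq_iff)
    also have "\<dots> = mconst R (scalar R (inv\<^bsub>K\<^esub> c)) \<otimes>\<^bsub>mpoly R (Suc n)\<^esub> mpoly_var R n"
      by (rule R.A.mconst_mult[OF R.A.mpoly_var_closed s(2), symmetric]) simp
    finally have ux: "untwist c (mpoly_var RT n) = mconst R (scalar R (inv\<^bsub>K\<^esub> c)) \<otimes>\<^bsub>mpoly R (Suc n)\<^esub> mpoly_var R n" .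
    have x: "mpoly_var R n \<in> carrier (mpoly R (Suc n))" by (rule R.A.mpoly_var_closed) simp
    have mc: "mconst R (scalar R (inv\<^bsub>K\<^esub> c)) \<in> carrier (mpoly R (Suc n))"
      "mconst R (scalar R c) \<in> carrier (mpoly R (Suc n))"
      by (rule R.A.mpoly_mconst_closed[OF s(2)], rule R.A.mpoly_mconst_closed[OF s(1)])
    have "untwist c (mpoly_var RT n \<otimes>\<^bsub>mpoly RT (Suc n)\<^esub> p) \<in> U"
      using xp c by (auto simp: twisted_lifting_def)
    then have "untwist c (mpoly_var RT n) \<otimes>\<^bsub>mpoly R (Suc n)\<^esub> untwist c p \<in> U"
      using ring_hom_mult[OF untwist_hom[OF c] RT.mpoly_var_closed p] by simp
    then have "mconst R (scalar R (inv\<^bsub>K\<^esub> c)) \<otimes>\<^bsub>mpoly R (Suc n)\<^esub> (mpoly_var R n \<otimes>\<^bsub>mpoly R (Suc n)\<^esub> untwist c p) \<in> U"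
      unfolding ux using P.m_assoc[OF mc(1) x u] by simp
    \<comment> \<open>Multiplication by the constant \<open>c\<close> removes the factor that
      \<open>x_n\<close> has acquired.\<close>
    then have "mconst R (scalar R c) \<otimes>\<^bsub>mpoly R (Suc n)\<^esub> (mconst R (scalar R (inv\<^bsub>K\<^esub> c)) \<otimes>\<^bsub>mpoly R (Suc n)\<^esub>
        (mpoly_var R n \<otimes>\<^bsub>mpoly R (Suc n)\<^esub> untwist c p)) \<in> U"
      by (rule U.I_l_closed) (rule mc(2))
    moreover have "mconst R (scalar R c) \<otimes>\<^bsub>mpoly R (Suc n)\<^esub> (mconst R (scalar R (inv\<^bsub>K\<^esub> c)) \<otimes>\<^bsub>mpoly R (Suc n)\<^esub> q) = q"
      if q: "q \<in> carrier (mpoly R (Suc n))" for q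
    proof
      fix m
      show "(mconst R (scalar R c) \<otimes>\<^bsub>mpoly R (Suc n)\<^esub> (mconst R (scalar R (inv\<^bsub>K\<^esub> c)) \<otimes>\<^bsub>mpoly R (Suc n)\<^esub> q)) m = q m"
        unfolding R.A.mconst_mult[OF P.m_closed[OF mc(1) q] s(1)]
        unfolding R.A.mconst_mult[OF q s(2)]
        using scalar_inv(1)[OF c mpoly_carrierD(1)[OF q], where i = 1] s by simp
    qed
    ultimately have "mpoly_var R n \<otimes>\<^bsub>mpoly R (Suc n)\<^esub> untwist c p \<in> U"
      using P.m_closed[OF x u] by simp
    then show ?thesis by (rule U_props(4)[OF u])
  qed
  with p show ?thesis by (simp add: twisted_lifting_def)
qed

definition const :: "'a \<Rightarrow> nat \<Rightarrow> 'a" where "const a = monom (UP R) a 0"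

lemma const_hom_cring: "ring_hom_cring R RT const"
proof -
  interpret P: UP_cring R "UP R" by (rule R.UP_A) simp
  show ?thesis
    by (intro ring_hom_cringI R.A.is_cring RT_cring)
       (auto simp: const_def P.monom_mult_is_smult P.monom_mult_smult intro!: ring_hom_memI)
qed

lemma const_scalar: "c \<in> carrier K \<Longrightarrow> const (scalar R c) = scalar RT c"
proof -
  interpret P: UP_cring R "UP R" by (rule R.UP_A) simp
  assume c: "c \<in> carrier K"
  then have s: "scalar R c \<in> carrier R" by simp
  show ?thesis
    using P.monom_mult_is_smult[OF s P.UP_one_closed] R.poly_algebra_smult[OF c P.UP_one_closed] s
    by (simp add: const_def)
qed

text \<open>Here \<open>c = 0\<close> is included, since \<open>homogenize f\<close> is a member of
  the family that can be specialized everywhere. The fibre at zero will be determined from this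
  inclusion.\<close>

lemma twisted_lifting_specialize_ge:
  assumes f: "f \<in> U" and c: "c \<in> carrier K"
  shows "mscale R xdeg (scalar R c) f \<in> specialize c ` twisted_lifting"
proof -
  have "f \<in> carrier (mpoly R (Suc n))" using f U_carrier by blast
  from specialize_homogenize[OF this c] show ?thesis
    using homogenize_in_twisted[OF f] by (metis imageI)
qed

text \<open>Zero to the power zero is one, so precisely the terms without \<open>x_n\<close>
  survive.\<close>

lemma mscale_zero:
  assumes f: "f \<in> carrier (mpoly R (Suc n))"
  shows "mscale R xdeg \<zero>\<^bsub>R\<^esub> f = set_var_zero R n f"
  using mpoly_carrierD(1)[OF f] by (auto simp: mscale_def set_var_zero_def fun_eq_iff R.A.nat_pow_zero)

lemma extend_H_in_specialize:
  assumes p: "p \<in> H"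
  shows "\<exists>f\<in>U. set_var_zero R n f = (\<lambda>m. scalar R (p m))"
proof -
  have "(\<lambda>m. scalar R (p m)) \<in> extend_ideal R n (\<lambda>c. scalar R c) H"
    using p R.S.extend_ideal_ideal(3)[OF H_carrier order.refl] by blast
  then show ?thesis unfolding U_props(3)[symmetric] by (metis imageE)
qed

lemma RT_infinite_field: "algebra_over_infinite_field K RT"
proof (rule algebra_over_infinite_field.intro[OF field_K RT_algebra infinite_K])
  have "noetherian_algebra K RT"
    by (rule R.poly_algebra_noetherian) (use noetherian_R in \<open>simp add: noetherian_algebra_def\<close>)
  then show "\<one>\<^bsub>RT\<^esub> \<noteq> \<zero>\<^bsub>RT\<^esub>" by (simp add: noetherian_algebra_def)
qed

text \<open>Condition (b) for the family. A generator from \<open>H\<close> is reached by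
  homogenizing a lift of it in \<open>U\<close>. Conversely let \<open>q\<close> be a member of the
  family at \<open>x_n = 0\<close>. Its values at nonzero \<open>c\<close> lie in the extension of
  \<open>H\<close> to \<open>R\<close>; by the Vandermonde argument so do its coefficients with
  respect to \<open>T\<close>, and from these \<open>q\<close> is reassembled over
  \<open>R[T]\<close>.\<close>

lemma set_var_zero_twisted:
  "set_var_zero RT n ` twisted_lifting = extend_ideal RT n (\<lambda>c. scalar RT c) H" (is "?L = ?E")
proof
  interpret RT: cring RT by (rule RT_cring)
  interpret RTK: algebra_over_infinite_field K RT by (rule RT_infinite_field)
  interpret Q: cring "mpoly RT n" by (rule RT.mpoly_cring)
  interpret E: ideal ?E "mpoly RT n" by (rule RTK.S.extend_ideal_ideal(1)[OF H_carrier order.refl])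
  have svz: "ring_hom_ring (mpoly RT (Suc n)) (mpoly RT n) (set_var_zero RT n)"
    by (intro ring_hom_ringI2 cring.axioms(1)[OF RT.mpoly_cring] RT.set_var_zero_hom)
  have surj: "set_var_zero RT n ` carrier (mpoly RT (Suc n)) = carrier (mpoly RT n)"
  proof
    show "set_var_zero RT n ` carrier (mpoly RT (Suc n)) \<subseteq> carrier (mpoly RT n)"
      using ring_hom_closed[OF RT.set_var_zero_hom] by blast
    show "carrier (mpoly RT n) \<subseteq> set_var_zero RT n ` carrier (mpoly RT (Suc n))"
    proof
      fix q assume q: "q \<in> carrier (mpoly RT n)"
      then have "q \<in> carrier (mpoly RT (Suc n))" using mpoly_mono[of n "Suc n" RT] by auto
      with set_var_zero_id[OF q, symmetric] show "q \<in> set_var_zero RT n ` carrier (mpoly RT (Suc n))"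
        by (rule image_eqI)
    qed
  qed
  show "?E \<subseteq> ?L"
    unfolding extend_ideal_def
  proof (rule Q.genideal_minimal)
    show "ideal ?L (mpoly RT n)"
      by (rule ring_hom_ring.ideal_image_surj[OF svz twisted_lifting_ideal surj])
    show "(\<lambda>p m. scalar RT (p m)) ` H \<subseteq> ?L"
    proof (rule image_subsetI)
      fix p assume p: "p \<in> H"
      obtain f where f: "f \<in> U" "set_var_zero R n f = (\<lambda>m. scalar R (p m))"
        using extend_H_in_specialize[OF p] by blast
      have pm: "p m \<in> carrier K" for m using p H_carrier mpoly_carrierD(1) by blast
      \<comment> \<open>Only terms free of \<open>x_n\<close> count, and on these
        \<open>homogenize\<close> is the inclusion of constants.\<close>
      have "set_var_zero RT n (homogenize f) m = scalar RT (p m)" for m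
      proof (cases "xdeg m = 0")
        case True
        then have "f m = scalar R (p m)" using fun_cong[OF f(2), of m] by (simp add: set_var_zero_def)
        then show ?thesis using True const_scalar[OF pm[of m]] by (simp add: set_var_zero_def homogenize_def const_def)
      next
        case False
        have "set_var_zero K n p = p" using p H_carrier by (intro set_var_zero_id) blast
        from fun_cong[OF this, of m] have "p m = \<zero>\<^bsub>K\<^esub>" using False by (simp add: set_var_zero_def)
        moreover have "scalar RT \<zero>\<^bsub>K\<^esub> = \<zero>\<^bsub>RT\<^esub>" by (rule RTK.A.smult_l_null) (rule RT.one_closed)
        ultimately show ?thesis using False by (simp only: set_var_zero_def if_False)
      qed
      then have "(\<lambda>m. scalar RT (p m)) = set_var_zero RT n (homogenize f)" by auto
      then show "(\<lambda>m. scalar RT (p m)) \<in> ?L" using homogenize_in_twisted[OF f(1)] by (rule image_eqI)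
    qed
  qed
  show "?L \<subseteq> ?E"
  proof (rule image_subsetI)
    interpret P: UP_cring R "UP R" by (rule R.UP_A) simp
    fix p assume p: "p \<in> twisted_lifting"
    let ?ER = "extend_ideal R n (\<lambda>c. scalar R c) H"
    define q where "q = set_var_zero RT n p"
    have pc: "p \<in> carrier (mpoly RT (Suc n))" using p by (simp add: twisted_lifting_def)
    have q: "q \<in> carrier (mpoly RT n)" unfolding q_def by (rule ring_hom_closed[OF RT.set_var_zero_hom pc])
    have qm: "q m \<in> carrier (UP R)" for m using mpoly_carrierD(1)[OF q] by simp
    have qmi: "q m i \<in> carrier R" for m i using qm[of m] by (auto simp: UP_def)
    have "specialize c q \<in> ?ER" if c: "c \<in> carrier K - {\<zero>\<^bsub>K\<^esub>}" for c
    proof -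
      have cK: "c \<in> carrier K" using c by simp
      have s: "scalar R (inv\<^bsub>K\<^esub> c) \<in> carrier R" using nonzero_Units[OF c] by simp
      have "untwist c p \<in> U" using p c by (simp add: twisted_lifting_def)
      then have "set_var_zero R n (untwist c p) \<in> ?ER" unfolding U_props(3)[symmetric] by (rule imageI)
      \<comment> \<open>The rescaling in \<open>untwist\<close> is invisible on terms without
        \<open>x_n\<close>.\<close>
      moreover have "set_var_zero R n (untwist c p) = specialize c q"
      proof
        fix m
        have "R.poly_eval c (p m) \<in> carrier R"
          using ring_hom_closed[OF R.poly_eval_hom(1)[OF cK] mpoly_carrierD(1)[OF pc]] .
        then show "set_var_zero R n (untwist c p) m = specialize c q m"
          using poly_eval_zero[OF cK] s
          by (simp add: set_var_zero_def untwist_def mscale_def specialize_def q_def del: poly_algebra_simps)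
      qed
      ultimately show ?thesis by simp
    qed
    moreover
    \<comment> \<open>Greater than the degree in \<open>T\<close> of every nonzero coefficient of
      \<open>q\<close>.\<close>
    define k where "k = Suc (Max (insert 0 ((\<lambda>m. deg R (q m)) ` {m. q m \<noteq> \<zero>\<^bsub>RT\<^esub>})))"
    have k: "q m i = \<zero>\<^bsub>R\<^esub>" if "i \<ge> k" for m i
    proof (cases "q m = \<zero>\<^bsub>RT\<^esub>")
      case True
      then show ?thesis by (simp add: UP_def)
    next
      case False
      then have "deg R (q m) < k"
        using mpoly_carrierD(2)[OF q] by (auto simp: k_def less_Suc_eq_le)
      then have "coeff (UP R) (q m) i = \<zero>\<^bsub>R\<^esub>" using that qm[of m] by (intro P.deg_aboveD) auto
      then show ?thesis using qm[of m] by (simp add: UP_def)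
    qed
    \<comment> \<open>The coefficient of \<open>T ^ i\<close> in \<open>q\<close>, a polynomial over
      \<open>R\<close>.\<close>
    define r where "r i = (\<lambda>m. q m i)" for i
    have rc: "r i \<in> carrier (mpoly R n)" for i
    proof (rule mpoly_carrierI)
      have nz: "q m \<noteq> \<zero>\<^bsub>RT\<^esub>" if "r i m \<noteq> \<zero>\<^bsub>R\<^esub>" for m
        using that by (auto simp: r_def UP_def)
      show "finite {m. r i m \<noteq> \<zero>\<^bsub>R\<^esub>}"
        by (rule finite_subset[OF _ mpoly_carrierD(2)[OF q]]) (use nz in blast)
      show "Poly_Mapping.keys m \<subseteq> {..<n}" if "r i m \<noteq> \<zero>\<^bsub>R\<^esub>" for m
        by (rule mpoly_carrierD(3)[OF q nz[OF that]])
    qed (simp add: r_def qmi)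
    have "specialize c q = (\<lambda>m. \<Oplus>\<^bsub>R\<^esub>i\<in>{..<k}. scalar R c [^]\<^bsub>R\<^esub> i \<otimes>\<^bsub>R\<^esub> r i m)" if "c \<in> carrier K" for c
      unfolding specialize_def r_def by (rule ext) (rule R.poly_eval_sum[OF that qm k])
    ultimately have inE: "(\<lambda>m. \<Oplus>\<^bsub>R\<^esub>i\<in>{..<k}. scalar R c [^]\<^bsub>R\<^esub> i \<otimes>\<^bsub>R\<^esub> r i m) \<in> ?ER"
      if "c \<in> carrier K - {\<zero>\<^bsub>K\<^esub>}" for c using that by simp
    have r: "r i \<in> ?ER" if "i < k" for i
    proof (rule R.vandermonde_mpoly[OF R.S.extend_ideal_ideal(1)[OF H_carrier order.refl] rc _ _ inE that])
      show "infinite (carrier K - {\<zero>\<^bsub>K\<^esub>})" using infinite_K by simp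
    qed auto
    have cr: "(\<lambda>m. const (r i m)) \<in> ?E" if "i < k" for i
    proof -
      interpret c: ring_hom_cring R RT const by (rule const_hom_cring)
      have "(\<lambda>m. const (r i m)) \<in> extend_ideal RT n const ?ER"
      proof -
        have "?ER \<subseteq> carrier (mpoly R n)"
          using R.S.extend_ideal_ideal(1)[OF H_carrier order.refl] by (auto dest: ideal.Icarr)
        from c.extend_ideal_ideal(3)[OF this order.refl] show ?thesis using r[OF that] by blast
      qed
      also have "extend_ideal RT n const ?ER = extend_ideal RT n (\<lambda>x. const (scalar R x)) H"
        by (rule R.S.extend_ideal_comp[OF const_hom_cring H_carrier])
      also have "\<dots> = ?E" by (rule extend_ideal_cong[OF H_carrier const_scalar])
      finally show ?thesis .
    qed
    let ?t = "monom (UP R) \<one>\<^bsub>R\<^esub> 1"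
    have t: "?t \<in> carrier RT" by simp
    have crc: "(\<lambda>m. const (r i m)) \<in> carrier (mpoly RT n)" for i
      using ring_hom_closed[OF ring_hom_cring.coeff_map_hom[OF const_hom_cring] rc] .
    \<comment> \<open>Reassembling \<open>q\<close> from the \<open>r i\<close> and the powers of
      \<open>T\<close> makes it a combination of elements of the extension of \<open>H\<close> to
      \<open>R[T]\<close>.\<close>
    have "q = (\<lambda>m. \<Oplus>\<^bsub>RT\<^esub>i\<in>{..<k}. ?t [^]\<^bsub>RT\<^esub> i \<otimes>\<^bsub>RT\<^esub> const (r i m))"
    proof
      fix m
      have pow: "?t [^]\<^bsub>RT\<^esub> i \<otimes>\<^bsub>RT\<^esub> const (r i m) = monom (UP R) (r i m) i" for i
      proof -
        have "?t [^]\<^bsub>RT\<^esub> i = ?t [^]\<^bsub>UP R\<^esub> i" by (simp add: nat_pow_def)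
        also have "\<dots> = monom (UP R) \<one>\<^bsub>R\<^esub> i" using P.monom_pow[of "\<one>\<^bsub>R\<^esub>" 1 i] by simp
        finally show ?thesis
          using P.monom_mult[of "\<one>\<^bsub>R\<^esub>" "r i m" i 0] qmi[of m i] by (simp add: const_def r_def)
      qed
      have mc: "(\<lambda>i. monom (UP R) (r i m) i) \<in> {..<k} \<rightarrow> carrier (UP R)" using qmi by (simp add: r_def)
      have "(\<Oplus>\<^bsub>RT\<^esub>i\<in>{..<k}. monom (UP R) (r i m) i) = (\<Oplus>\<^bsub>UP R\<^esub>i\<in>{..<k}. monom (UP R) (r i m) i)"
        by (simp add: finsum_def finprod_def)
      also have "\<dots> = q m"
      proof (rule P.up_eqI[OF _ P.P.finsum_closed[OF mc] qm])
        fix j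
        have "coeff (UP R) (\<Oplus>\<^bsub>UP R\<^esub>i\<in>{..<k}. monom (UP R) (r i m) i) j =
            (\<Oplus>\<^bsub>R\<^esub>i\<in>{..<k}. coeff (UP R) (monom (UP R) (r i m) i) j)"
          by (rule P.coeff_finsum[OF finite_lessThan mc])
        also have "\<dots> = (\<Oplus>\<^bsub>R\<^esub>i\<in>{..<k}. if i = j then q m i else \<zero>\<^bsub>R\<^esub>)"
          using qmi by (intro R.A.finsum_cong') (auto simp: r_def)
        also have "\<dots> = q m j"
        proof (cases "j < k")
          case True
          then show ?thesis using qmi by (subst R.A.finsum_single[of _ j]) auto
        next
          case False
          then have "(\<Oplus>\<^bsub>R\<^esub>i\<in>{..<k}. if i = j then q m i else \<zero>\<^bsub>R\<^esub>) = \<zero>\<^bsub>R\<^esub>"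
            by (intro R.A.add.finprod_one_eqI) auto
          then show ?thesis using k False by simp
        qed
        also have "\<dots> = coeff (UP R) (q m) j" using qm by (simp add: UP_def)
        finally show "coeff (UP R) (\<Oplus>\<^bsub>UP R\<^esub>i\<in>{..<k}. monom (UP R) (r i m) i) j = coeff (UP R) (q m) j" .
      qed
      finally show "q m = (\<Oplus>\<^bsub>RT\<^esub>i\<in>{..<k}. ?t [^]\<^bsub>RT\<^esub> i \<otimes>\<^bsub>RT\<^esub> const (r i m))"
        by (simp only: pow)
    qed
    also have "\<dots> = (\<Oplus>\<^bsub>mpoly RT n\<^esub>i\<in>{..<k}. mconst RT ?t [^]\<^bsub>mpoly RT n\<^esub> i \<otimes>\<^bsub>mpoly RT n\<^esub> (\<lambda>m. const (r i m)))"
      by (rule RT.mpoly_power_sum[OF t crc, symmetric])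
    also have "\<dots> \<in> ?E"
      using cr by (intro E.finsum_in_ideal E.I_l_closed Q.nat_pow_closed RT.mpoly_mconst_closed[OF t]) auto
    finally show "set_var_zero RT n p \<in> ?E" by (simp add: q_def)
  qed
qed

section \<open>The endomorphisms of \<open>R\<close> defined by the family\<close>

lemma twisted_lifting_lifting: "twisted_lifting \<in> liftings n H RT"
  unfolding liftings_iff[OF RT_cring]
  using twisted_lifting_homogeneous twisted_lifting_saturated set_var_zero_twisted by blast

text \<open>A choice by \<open>SOME\<close>, since over \<open>R[T]\<close> only the existence half
  of the universal property has been transferred; uniqueness will be used over \<open>R\<close>
  alone.\<close>

definition coaction :: "'a \<Rightarrow> nat \<Rightarrow> 'a" where
  "coaction = (SOME f. f \<in> alg_hom K R RT \<and> base_change n RT f U = twisted_lifting)"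

lemma coaction: "coaction \<in> alg_hom K R RT" "base_change n RT coaction U = twisted_lifting"
proof -
  have N: "noetherian_algebra K RT"
    by (rule R.poly_algebra_noetherian) (use noetherian_R in \<open>simp add: noetherian_algebra_def\<close>)
  obtain g :: "(nat \<Rightarrow> 'a) \<Rightarrow> 'a" where g: "inj_on g (carrier (UP R))" using inj_on_UP[OF R.infinite_A] by blast
  have "\<exists>f. f \<in> alg_hom K R RT \<and> base_change n RT f U = twisted_lifting"
    using classifying_morphism[OF N _ twisted_lifting_lifting, of g] g by auto
  from someI_ex[OF this] show "coaction \<in> alg_hom K R RT" "base_change n RT coaction U = twisted_lifting"
    unfolding coaction_def by auto
qed

text \<open>The endomorphism of \<open>R\<close> by which \<open>c\<close> acts; for
  \<open>c = 0\<close> it classifies the limit of the family.\<close>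

definition act :: "'k \<Rightarrow> 'a \<Rightarrow> 'a" where
  "act c = restrict (\<lambda>x. R.poly_eval c (coaction x)) (carrier R)"

lemma act_alg_hom:
  assumes "c \<in> carrier K"
  shows "act c \<in> alg_hom K R R"
  unfolding act_def
  by (rule alg_hom_compose[OF coaction(1) R.poly_eval_hom(1)[OF assms]]) (simp add: R.poly_eval_hom(3)[OF assms])

lemma act_hom_cring:
  assumes "c \<in> carrier K"
  shows "ring_hom_cring R R (act c)"
  by (intro ring_hom_cringI R.A.is_cring alg_homD(1)[OF act_alg_hom[OF assms]])

text \<open>Functoriality of base change: the family is the base change of \<open>U\<close> along
  \<open>coaction\<close>, so specializing it at \<open>T = c\<close> is base change along the
  composition.\<close>

lemma base_change_act:
  assumes c: "c \<in> carrier K"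
  shows "base_change n R (act c) U = genideal (mpoly R (Suc n)) (specialize c ` twisted_lifting)"
proof -
  interpret co: ring_hom_cring R RT coaction
    by (intro ring_hom_cringI R.A.is_cring RT_cring alg_homD(1)[OF coaction(1)])
  have "base_change n R (act c) U = extend_ideal R (Suc n) (\<lambda>x. R.poly_eval c (coaction x)) U"
    unfolding base_change_def by (rule extend_ideal_cong[OF U_carrier]) (simp add: act_def)
  also have "\<dots> = extend_ideal R (Suc n) (R.poly_eval c) (base_change n RT coaction U)"
    unfolding base_change_def by (rule co.extend_ideal_comp[symmetric, OF poly_eval_hom_cring[OF c] U_carrier])
  also have "\<dots> = genideal (mpoly R (Suc n)) (specialize c ` twisted_lifting)"
    unfolding coaction(2) extend_ideal_def specialize_def ..
  finally show ?thesis .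
qed

lemma mscale_U_carrier:
  assumes "c \<in> carrier R"
  shows "mscale R xdeg c ` U \<subseteq> carrier (mpoly R (Suc n))"
  using U_carrier R.A.mscale_closed[OF _ assms] by blast

lemma specialize_twisted_carrier:
  assumes "c \<in> carrier K"
  shows "specialize c ` twisted_lifting \<subseteq> carrier (mpoly R (Suc n))"
  using ring_hom_closed[OF specialize_hom[OF assms]] by (auto simp: twisted_lifting_def)

lemma base_change_act_nonzero:
  assumes c: "c \<in> carrier K - {\<zero>\<^bsub>K\<^esub>}"
  shows "base_change n R (act c) U = genideal (mpoly R (Suc n)) (mscale R xdeg (scalar R c) ` U)"
proof -
  have cK: "c \<in> carrier K" using c by simp
  have "specialize c ` twisted_lifting = mscale R xdeg (scalar R c) ` U"
  proof
    show "specialize c ` twisted_lifting \<subseteq> mscale R xdeg (scalar R c) ` U"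
    proof (rule image_subsetI)
      fix p assume "p \<in> twisted_lifting"
      then have p: "p \<in> carrier (mpoly RT (Suc n))" "untwist c p \<in> U" using c by (auto simp: twisted_lifting_def)
      then show "specialize c p \<in> mscale R xdeg (scalar R c) ` U"
        using mscale_untwist[OF c p(1)] by (metis imageI)
    qed
    show "mscale R xdeg (scalar R c) ` U \<subseteq> specialize c ` twisted_lifting"
      using twisted_lifting_specialize_ge[OF _ cK] by blast
  qed
  then show ?thesis by (simp add: base_change_act[OF cK])
qed

text \<open>Every element of \<open>H\<close> is, over \<open>R\<close>, the restriction to
  \<open>x_n = 0\<close> of an element of \<open>U\<close>, so the trivial lifting is contained in
  the fibre at zero. Both are liftings, hence they are equal by \<open>lifting_eqI\<close>.\<close>

lemma base_change_act_zero:
  "base_change n R (act \<zero>\<^bsub>K\<^esub>) U = extend_ideal R (Suc n) (\<lambda>c. scalar R c) H"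
proof (rule lifting_eqI[symmetric, OF R.A.is_cring R.extend_ideal_lifting[OF H]])
  interpret P: cring "mpoly R (Suc n)" by (rule R.A.mpoly_cring)
  note carr = specialize_twisted_carrier[OF K.zero_closed]
  show "base_change n R (act \<zero>\<^bsub>K\<^esub>) U \<in> liftings n H R"
    by (rule base_change_lifting[OF act_alg_hom]) simp
  show "extend_ideal R (Suc n) (\<lambda>c. scalar R c) H \<subseteq> base_change n R (act \<zero>\<^bsub>K\<^esub>) U"
    unfolding base_change_act[OF K.zero_closed] extend_ideal_def
  proof (rule P.genideal_minimal[OF P.genideal_ideal[OF carr]], rule image_subsetI)
    fix p assume "p \<in> H"
    then obtain f where f: "f \<in> U" "set_var_zero R n f = (\<lambda>m. scalar R (p m))"
      using extend_H_in_specialize by blast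
    have "mscale R xdeg (scalar R \<zero>\<^bsub>K\<^esub>) f \<in> specialize \<zero>\<^bsub>K\<^esub> ` twisted_lifting"
      by (rule twisted_lifting_specialize_ge[OF f(1) K.zero_closed])
    moreover have "mscale R xdeg (scalar R \<zero>\<^bsub>K\<^esub>) f = (\<lambda>m. scalar R (p m))"
      using mscale_zero[of f] f U_carrier by auto
    ultimately show "(\<lambda>m. scalar R (p m)) \<in> genideal (mpoly R (Suc n)) (specialize \<zero>\<^bsub>K\<^esub> ` twisted_lifting)"
      using P.genideal_self[OF carr] by auto
  qed
qed

text \<open>Scaling \<open>x_n\<close> by one changes nothing, so the identity of \<open>R\<close>
  classifies the same lifting.\<close>

lemma act_one: "x \<in> carrier R \<Longrightarrow> act \<one>\<^bsub>K\<^esub> x = x"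
proof -
  interpret P: cring "mpoly R (Suc n)" by (rule R.A.mpoly_cring)
  assume x: "x \<in> carrier R"
  have id: "restrict (\<lambda>x. x) (carrier R) \<in> alg_hom K R R"
    by (auto simp: alg_hom_def intro!: ring_hom_memI)
  have "base_change n R (restrict (\<lambda>x. x) (carrier R)) U = extend_ideal R (Suc n) (\<lambda>x. x) U"
    unfolding base_change_def by (rule extend_ideal_cong[OF U_carrier]) simp
  also have "\<dots> = U" by (rule R.A.extend_ideal_id[OF U_props(1)])
  also have "U = genideal (mpoly R (Suc n)) (mscale R xdeg (scalar R \<one>\<^bsub>K\<^esub>) ` U)"
  proof -
    have "mscale R xdeg \<one>\<^bsub>R\<^esub> f = f" if "f \<in> U" for f
    proof
      fix m
      have "f m \<in> carrier R" using that U_carrier mpoly_carrierD(1) by blast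
      then show "mscale R xdeg \<one>\<^bsub>R\<^esub> f m = f m" by (simp add: mscale_def)
    qed
    then have "mscale R xdeg (scalar R \<one>\<^bsub>K\<^esub>) ` U = U" by simp
    then show ?thesis using P.genideal_of_ideal[OF U_props(1)] by simp
  qed
  also have "\<dots> = base_change n R (act \<one>\<^bsub>K\<^esub>) U"
    by (rule base_change_act_nonzero[symmetric]) simp
  finally have "restrict (\<lambda>x. x) (carrier R) = act \<one>\<^bsub>K\<^esub>"
    by (rule base_change_inj[OF id act_alg_hom[OF K.one_closed]])
  then have "act \<one>\<^bsub>K\<^esub> x = restrict (\<lambda>x. x) (carrier R) x" by simp
  then show ?thesis using x by simp
qed

text \<open>Both sides classify \<open>U\<close> with \<open>x_n\<close> scaled by the product, and
  uniqueness over \<open>R\<close> applies: \<open>act b\<close> fixes the scalars from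
  \<open>K\<close>, so applying it to the coefficients commutes with scaling by \<open>c\<close>.
  Nonzero elements are enough for the Vandermonde arguments that follow.\<close>

lemma act_act:
  assumes b: "b \<in> carrier K - {\<zero>\<^bsub>K\<^esub>}" and c: "c \<in> carrier K - {\<zero>\<^bsub>K\<^esub>}" and x: "x \<in> carrier R"
  shows "act b (act c x) = act (b \<otimes>\<^bsub>K\<^esub> c) x"
proof -
  interpret P: cring "mpoly R (Suc n)" by (rule R.A.mpoly_cring)
  have bK: "b \<in> carrier K" and cK: "c \<in> carrier K" using b c by auto
  have bc: "b \<otimes>\<^bsub>K\<^esub> c \<in> carrier K - {\<zero>\<^bsub>K\<^esub>}" using b c by (auto simp: K.integral_iff)
  interpret b: ring_hom_cring R R "act b" by (rule act_hom_cring[OF bK])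
  interpret c: ring_hom_cring R R "act c" by (rule act_hom_cring[OF cK])
  let ?s = "\<lambda>d. mscale R xdeg (scalar R d)"
  have s: "scalar R b \<in> carrier R" "scalar R c \<in> carrier R" using bK cK by auto
  have B: "ring_hom_ring (mpoly R (Suc n)) (mpoly R (Suc n)) (\<lambda>p m. act b (p m))"
    by (intro ring_hom_ringI2 P.ring_axioms b.coeff_map_hom)
  have C: "ring_hom_ring (mpoly R (Suc n)) (mpoly R (Suc n)) (?s c)"
    by (intro ring_hom_ringI2 P.ring_axioms R.A.mscale_hom[OF xdeg_weight s(2)])
  have actb: "act b (scalar R d) = scalar R d" if "d \<in> carrier K" for d
    using alg_homD(2)[OF act_alg_hom[OF bK] that R.A.one_closed] by simp
  have comm: "(\<lambda>m. act b (?s c f m)) = ?s c (\<lambda>m. act b (f m))" if "f \<in> U" for f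
  proof
    fix m
    have "f m \<in> carrier R" using that U_carrier mpoly_carrierD(1) by blast
    then show "act b (?s c f m) = ?s c (\<lambda>m. act b (f m)) m"
      using s(2) actb[OF cK] by (simp add: mscale_def)
  qed
  let ?f = "restrict (\<lambda>x. act b (act c x)) (carrier R)"
  have pow: "v [^]\<^bsub>R\<^esub> i \<otimes>\<^bsub>R\<^esub> (u [^]\<^bsub>R\<^esub> i \<otimes>\<^bsub>R\<^esub> a) = (u \<otimes>\<^bsub>R\<^esub> v) [^]\<^bsub>R\<^esub> i \<otimes>\<^bsub>R\<^esub> a"
    if "u \<in> carrier R" "v \<in> carrier R" "a \<in> carrier R" for u v a and i :: nat
    using that by (simp add: R.A.nat_pow_distrib R.A.m_ac)
  have f: "?f \<in> alg_hom K R R"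
    by (rule alg_hom_compose[OF act_alg_hom[OF cK] b.homh]) (rule alg_homD(2)[OF act_alg_hom[OF bK]])
  have "base_change n R ?f U = extend_ideal R (Suc n) (\<lambda>x. act b (act c x)) U"
    unfolding base_change_def by (rule extend_ideal_cong[OF U_carrier]) simp
  also have "\<dots> = extend_ideal R (Suc n) (act b) (base_change n R (act c) U)"
    unfolding base_change_def
    by (rule c.extend_ideal_comp[symmetric, OF b.ring_hom_cring_axioms U_carrier])
  also have "\<dots> = genideal (mpoly R (Suc n)) ((\<lambda>p m. act b (p m)) ` ?s c ` U)"
    unfolding extend_ideal_def base_change_act_nonzero[OF c]
    by (rule ring_hom_ring.genideal_image[OF B mscale_U_carrier[OF s(2)]])
  also have "(\<lambda>p m. act b (p m)) ` ?s c ` U = ?s c ` (\<lambda>p m. act b (p m)) ` U"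
    unfolding image_image by (rule image_cong[OF refl comm])
  also have "genideal (mpoly R (Suc n)) \<dots> = genideal (mpoly R (Suc n)) (?s c ` base_change n R (act b) U)"
    unfolding base_change_def extend_ideal_def
    by (rule ring_hom_ring.genideal_image[symmetric, OF C b.extend_ideal_ideal(2)[OF U_carrier order.refl]])
  also have "\<dots> = genideal (mpoly R (Suc n)) (?s c ` ?s b ` U)"
    unfolding base_change_act_nonzero[OF b]
    by (rule ring_hom_ring.genideal_image[OF C mscale_U_carrier[OF s(1)]])
  also have "?s c ` ?s b ` U = ?s (b \<otimes>\<^bsub>K\<^esub> c) ` U"
    unfolding image_image
  proof (rule image_cong[OF refl], rule ext)
    fix f m assume "f \<in> U"
    then have "f m \<in> carrier R" using U_carrier mpoly_carrierD(1) by blast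
    then show "?s c (?s b f) m = ?s (b \<otimes>\<^bsub>K\<^esub> c) f m"
      unfolding mscale_def R.S.hom_mult[OF bK cK] by (rule pow[OF s])
  qed
  also have "genideal (mpoly R (Suc n)) \<dots> = base_change n R (act (b \<otimes>\<^bsub>K\<^esub> c)) U"
    by (rule base_change_act_nonzero[OF bc, symmetric])
  finally have "?f = act (b \<otimes>\<^bsub>K\<^esub> c)"
    by (rule base_change_inj[OF f act_alg_hom[OF K.m_closed[OF bK cK]]])
  from fun_cong[OF this, of x] show ?thesis using x by simp
qed

end


section \<open>The grading of the scheme of liftings\<close>

lemma mpoly_base_algebra: "mpoly (base_algebra K) n = mpoly K n"
  unfolding mpoly_def base_algebra_simps finsum_def finprod_def monoid.simps partial_object.simps ..

text \<open>A grading given by its projections, the form in which a coaction supplies it, instead of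
  by its homogeneous parts. \<open>comp_0\<close> says that the part of degree 0 consists of
  scalars. In \<open>comp_sum\<close> any bound is allowed beyond which the components
  vanish.\<close>

locale connected_graded_algebra = algebra_over_infinite_field K R
  for K :: "'k ring" and R :: "('k, 'a) module" +
  fixes comp :: "nat \<Rightarrow> 'a \<Rightarrow> 'a"
  assumes comp_closed: "x \<in> carrier R \<Longrightarrow> comp j x \<in> carrier R"
    and comp_add: "x \<in> carrier R \<Longrightarrow> y \<in> carrier R \<Longrightarrow> comp j (x \<oplus>\<^bsub>R\<^esub> y) = comp j x \<oplus>\<^bsub>R\<^esub> comp j y"
    and comp_smult: "c \<in> carrier K \<Longrightarrow> x \<in> carrier R \<Longrightarrow> comp j (c \<odot>\<^bsub>R\<^esub> x) = c \<odot>\<^bsub>R\<^esub> comp j x"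
    and comp_mult: "x \<in> carrier R \<Longrightarrow> y \<in> carrier R \<Longrightarrow>
      comp k (x \<otimes>\<^bsub>R\<^esub> y) = (\<Oplus>\<^bsub>R\<^esub>i\<in>{..k}. comp i x \<otimes>\<^bsub>R\<^esub> comp (k - i) y)"
    and comp_comp: "x \<in> carrier R \<Longrightarrow> comp i (comp j x) = (if i = j then comp j x else \<zero>\<^bsub>R\<^esub>)"
    and comp_finite: "x \<in> carrier R \<Longrightarrow> \<exists>k. \<forall>i\<ge>k. comp i x = \<zero>\<^bsub>R\<^esub>"
    and comp_sum: "x \<in> carrier R \<Longrightarrow> (\<And>i. i \<ge> k \<Longrightarrow> comp i x = \<zero>\<^bsub>R\<^esub>) \<Longrightarrow> x = (\<Oplus>\<^bsub>R\<^esub>i\<in>{..<k}. comp i x)"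
    and comp_0: "x \<in> carrier R \<Longrightarrow> \<exists>c\<in>carrier K. comp 0 x = scalar R c"
    and noetherian: "noetherian_ring R"

context lifting_scheme
begin

text \<open>Elements of \<open>UP R\<close> are coefficient functions, so this is the coefficient of
  \<open>T ^ j\<close>.\<close>

definition weight_comp :: "nat \<Rightarrow> 'a \<Rightarrow> 'a" where "weight_comp j x = coaction x j"

lemma coaction_closed: "x \<in> carrier R \<Longrightarrow> coaction x \<in> carrier (UP R)"
  using ring_hom_closed[OF alg_homD(1)[OF coaction(1)]] by simp

lemma weight_comp_closed: "x \<in> carrier R \<Longrightarrow> weight_comp j x \<in> carrier R"
  using coaction_closed[of x] by (auto simp: weight_comp_def UP_def)

lemma weight_comp_finite: "x \<in> carrier R \<Longrightarrow> \<exists>k. \<forall>i\<ge>k. weight_comp i x = \<zero>\<^bsub>R\<^esub>"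
proof -
  assume x: "x \<in> carrier R"
  interpret P: UP_cring R "UP R" by (rule R.UP_A) simp
  have "coeff (UP R) (coaction x) i = \<zero>\<^bsub>R\<^esub>" if "deg R (coaction x) < i" for i
    by (rule P.deg_aboveD[OF that coaction_closed[OF x]])
  then have "weight_comp i x = \<zero>\<^bsub>R\<^esub>" if "Suc (deg R (coaction x)) \<le> i" for i
    using that coaction_closed[OF x] by (simp add: UP_def weight_comp_def)
  then show ?thesis by blast
qed

lemma act_sum:
  assumes "c \<in> carrier K" "x \<in> carrier R" "\<And>i. i \<ge> k \<Longrightarrow> weight_comp i x = \<zero>\<^bsub>R\<^esub>"
  shows "act c x = (\<Oplus>\<^bsub>R\<^esub>i\<in>{..<k}. scalar R c [^]\<^bsub>R\<^esub> i \<otimes>\<^bsub>R\<^esub> weight_comp i x)"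
  using R.poly_eval_sum[OF assms(1) coaction_closed[OF assms(2)], of k] assms(2,3)
  by (simp add: act_def weight_comp_def)

text \<open>The Vandermonde argument for the zero ideal, applied to differences. It permits the
  comparison of coefficients in an identity valid for all nonzero \<open>c\<close>.\<close>

lemma vandermonde_zero:
  fixes k :: nat
  assumes v: "\<And>i. i < k \<Longrightarrow> v i \<in> carrier R" and w: "\<And>i. i < k \<Longrightarrow> w i \<in> carrier R"
    and eq: "\<And>c. c \<in> carrier K - {\<zero>\<^bsub>K\<^esub>} \<Longrightarrow> (\<Oplus>\<^bsub>R\<^esub>i\<in>{..<k}. scalar R c [^]\<^bsub>R\<^esub> i \<otimes>\<^bsub>R\<^esub> v i) =
      (\<Oplus>\<^bsub>R\<^esub>i\<in>{..<k}. scalar R c [^]\<^bsub>R\<^esub> i \<otimes>\<^bsub>R\<^esub> w i)" and "i < k"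
  shows "v i = w i"
proof -
  have "v i \<ominus>\<^bsub>R\<^esub> w i \<in> {\<zero>\<^bsub>R\<^esub>}"
  proof (rule R.S.vandermonde[OF field_K _ _ R.A_nontrivial R.A.zeroideal _ _ \<open>i < k\<close>])
    show "infinite (carrier K - {\<zero>\<^bsub>K\<^esub>})" using infinite_K by simp
    fix c assume c: "c \<in> carrier K - {\<zero>\<^bsub>K\<^esub>}"
    then have s: "scalar R c [^]\<^bsub>R\<^esub> i \<in> carrier R" for i :: nat by simp
    have "(\<Oplus>\<^bsub>R\<^esub>i\<in>{..<k}. scalar R c [^]\<^bsub>R\<^esub> i \<otimes>\<^bsub>R\<^esub> v i) =
        (\<Oplus>\<^bsub>R\<^esub>i\<in>{..<k}. scalar R c [^]\<^bsub>R\<^esub> i \<otimes>\<^bsub>R\<^esub> (v i \<ominus>\<^bsub>R\<^esub> w i) \<oplus>\<^bsub>R\<^esub> scalar R c [^]\<^bsub>R\<^esub> i \<otimes>\<^bsub>R\<^esub> w i)"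
    proof (rule R.A.finsum_cong'[OF refl])
      fix i assume "i \<in> {..<k}"
      then have "v i \<in> carrier R" "w i \<in> carrier R" using v w by auto
      then show "scalar R c [^]\<^bsub>R\<^esub> i \<otimes>\<^bsub>R\<^esub> v i =
          scalar R c [^]\<^bsub>R\<^esub> i \<otimes>\<^bsub>R\<^esub> (v i \<ominus>\<^bsub>R\<^esub> w i) \<oplus>\<^bsub>R\<^esub> scalar R c [^]\<^bsub>R\<^esub> i \<otimes>\<^bsub>R\<^esub> w i"
        using s[of i] by (simp add: R.A.r_minus a_minus_def R.A.r_distr R.A.a_assoc R.A.l_neg)
    qed (use v w s in auto)
    also have "\<dots> = (\<Oplus>\<^bsub>R\<^esub>i\<in>{..<k}. scalar R c [^]\<^bsub>R\<^esub> i \<otimes>\<^bsub>R\<^esub> (v i \<ominus>\<^bsub>R\<^esub> w i)) \<oplus>\<^bsub>R\<^esub>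
        (\<Oplus>\<^bsub>R\<^esub>i\<in>{..<k}. scalar R c [^]\<^bsub>R\<^esub> i \<otimes>\<^bsub>R\<^esub> w i)"
      using v w s by (intro R.A.finsum_addf) auto
    finally have e: "(\<Oplus>\<^bsub>R\<^esub>i\<in>{..<k}. scalar R c [^]\<^bsub>R\<^esub> i \<otimes>\<^bsub>R\<^esub> w i) =
        (\<Oplus>\<^bsub>R\<^esub>i\<in>{..<k}. scalar R c [^]\<^bsub>R\<^esub> i \<otimes>\<^bsub>R\<^esub> (v i \<ominus>\<^bsub>R\<^esub> w i)) \<oplus>\<^bsub>R\<^esub>
        (\<Oplus>\<^bsub>R\<^esub>i\<in>{..<k}. scalar R c [^]\<^bsub>R\<^esub> i \<otimes>\<^bsub>R\<^esub> w i)"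
      using eq[OF c] by simp
    have cl: "(\<Oplus>\<^bsub>R\<^esub>i\<in>{..<k}. scalar R c [^]\<^bsub>R\<^esub> i \<otimes>\<^bsub>R\<^esub> w i) \<in> carrier R"
      "(\<Oplus>\<^bsub>R\<^esub>i\<in>{..<k}. scalar R c [^]\<^bsub>R\<^esub> i \<otimes>\<^bsub>R\<^esub> (v i \<ominus>\<^bsub>R\<^esub> w i)) \<in> carrier R"
      using v w s by (auto intro!: R.A.finsum_closed)
    show "(\<Oplus>\<^bsub>R\<^esub>i\<in>{..<k}. scalar R c [^]\<^bsub>R\<^esub> i \<otimes>\<^bsub>R\<^esub> (v i \<ominus>\<^bsub>R\<^esub> w i)) \<in> {\<zero>\<^bsub>R\<^esub>}"
      using e R.A.add.r_cancel_one'[OF cl] by (simp only: singleton_iff)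
  qed (use v w in auto)
  then have "v i \<ominus>\<^bsub>R\<^esub> w i = \<zero>\<^bsub>R\<^esub>" by simp
  then show ?thesis using v[OF \<open>i < k\<close>] w[OF \<open>i < k\<close>] by simp
qed

lemma act_closed: "c \<in> carrier K \<Longrightarrow> x \<in> carrier R \<Longrightarrow> act c x \<in> carrier R"
  by (rule ring_hom_closed[OF alg_homD(1)[OF act_alg_hom]])

lemma act_scalar: "b \<in> carrier K \<Longrightarrow> c \<in> carrier K \<Longrightarrow> act b (scalar R c) = scalar R c"
  using alg_homD(2)[OF act_alg_hom _ R.A.one_closed] ring_hom_one[OF alg_homD(1)[OF act_alg_hom]] by simp

text \<open>Both sides of \<open>act_act\<close> are polynomials in \<open>c\<close>; this compares
  their coefficients of index \<open>j\<close>.\<close>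

lemma act_weight_comp:
  assumes b: "b \<in> carrier K - {\<zero>\<^bsub>K\<^esub>}" and x: "x \<in> carrier R"
  shows "act b (weight_comp j x) = scalar R b [^]\<^bsub>R\<^esub> j \<otimes>\<^bsub>R\<^esub> weight_comp j x"
proof -
  obtain k0 where k0: "\<And>i. i \<ge> k0 \<Longrightarrow> weight_comp i x = \<zero>\<^bsub>R\<^esub>" using weight_comp_finite[OF x] by blast
  \<comment> \<open>Large enough that the index \<open>j\<close> itself is within the range to be
    compared.\<close>
  define k where "k = k0 + Suc j"
  have k: "\<And>i. i \<ge> k \<Longrightarrow> weight_comp i x = \<zero>\<^bsub>R\<^esub>" "j < k" using k0 by (auto simp: k_def)
  have bK: "b \<in> carrier K" using b by simp
  have sb: "scalar R b \<in> carrier R" using bK by simp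
  interpret b: ring_hom_cring R R "act b" by (rule act_hom_cring[OF bK])
  note wc = weight_comp_closed[OF x]
  show ?thesis
  proof (rule vandermonde_zero[OF _ _ _ k(2), of "\<lambda>i. act b (weight_comp i x)" "\<lambda>i. scalar R b [^]\<^bsub>R\<^esub> i \<otimes>\<^bsub>R\<^esub> weight_comp i x"])
    show "act b (weight_comp i x) \<in> carrier R" for i by (rule act_closed[OF bK wc])
    show "scalar R b [^]\<^bsub>R\<^esub> i \<otimes>\<^bsub>R\<^esub> weight_comp i x \<in> carrier R" for i using sb wc by simp
    fix c assume c: "c \<in> carrier K - {\<zero>\<^bsub>K\<^esub>}"
    then have cK: "c \<in> carrier K" by simp
    have sc: "scalar R c \<in> carrier R" using cK by simp
    have t: "(\<lambda>i. scalar R c [^]\<^bsub>R\<^esub> i \<otimes>\<^bsub>R\<^esub> weight_comp i x) \<in> {..<k} \<rightarrow> carrier R" using sc wc by auto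
    have "(\<Oplus>\<^bsub>R\<^esub>i\<in>{..<k}. scalar R c [^]\<^bsub>R\<^esub> i \<otimes>\<^bsub>R\<^esub> act b (weight_comp i x)) =
        (\<Oplus>\<^bsub>R\<^esub>i\<in>{..<k}. act b (scalar R c [^]\<^bsub>R\<^esub> i \<otimes>\<^bsub>R\<^esub> weight_comp i x))"
    proof (rule R.A.finsum_cong'[OF refl])
      fix i :: nat
      have "act b (scalar R c [^]\<^bsub>R\<^esub> i \<otimes>\<^bsub>R\<^esub> weight_comp i x) =
          act b (scalar R c) [^]\<^bsub>R\<^esub> i \<otimes>\<^bsub>R\<^esub> act b (weight_comp i x)"
        using sc wc[of i] by (simp add: b.hom_pow)
      then show "scalar R c [^]\<^bsub>R\<^esub> i \<otimes>\<^bsub>R\<^esub> act b (weight_comp i x) = act b (scalar R c [^]\<^bsub>R\<^esub> i \<otimes>\<^bsub>R\<^esub> weight_comp i x)"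
        by (simp only: act_scalar[OF bK cK])
    qed (use t b.hom_closed in auto)
    also have "\<dots> = act b (\<Oplus>\<^bsub>R\<^esub>i\<in>{..<k}. scalar R c [^]\<^bsub>R\<^esub> i \<otimes>\<^bsub>R\<^esub> weight_comp i x)"
      using b.hom_finsum[OF t] by (simp add: o_def)
    also have "\<dots> = act b (act c x)" by (simp only: act_sum[OF cK x k(1)])
    also have "\<dots> = act (b \<otimes>\<^bsub>K\<^esub> c) x" by (rule act_act[OF b c x])
    also have "\<dots> = (\<Oplus>\<^bsub>R\<^esub>i\<in>{..<k}. scalar R (b \<otimes>\<^bsub>K\<^esub> c) [^]\<^bsub>R\<^esub> i \<otimes>\<^bsub>R\<^esub> weight_comp i x)"
      by (rule act_sum[OF K.m_closed[OF bK cK] x k(1)])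
    also have "\<dots> = (\<Oplus>\<^bsub>R\<^esub>i\<in>{..<k}. scalar R c [^]\<^bsub>R\<^esub> i \<otimes>\<^bsub>R\<^esub> (scalar R b [^]\<^bsub>R\<^esub> i \<otimes>\<^bsub>R\<^esub> weight_comp i x))"
    proof (rule R.A.finsum_cong'[OF refl])
      have pow: "(u \<otimes>\<^bsub>R\<^esub> v) [^]\<^bsub>R\<^esub> i \<otimes>\<^bsub>R\<^esub> a = v [^]\<^bsub>R\<^esub> i \<otimes>\<^bsub>R\<^esub> (u [^]\<^bsub>R\<^esub> i \<otimes>\<^bsub>R\<^esub> a)"
        if "u \<in> carrier R" "v \<in> carrier R" "a \<in> carrier R" for u v a and i :: nat
        using that by (simp add: R.A.nat_pow_distrib R.A.m_ac)
      show "scalar R (b \<otimes>\<^bsub>K\<^esub> c) [^]\<^bsub>R\<^esub> i \<otimes>\<^bsub>R\<^esub> weight_comp i x =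
          scalar R c [^]\<^bsub>R\<^esub> i \<otimes>\<^bsub>R\<^esub> (scalar R b [^]\<^bsub>R\<^esub> i \<otimes>\<^bsub>R\<^esub> weight_comp i x)" for i :: nat
        unfolding R.S.hom_mult[OF bK cK] by (rule pow[OF sb sc wc])
    qed (use sb sc wc in auto)
    finally show "(\<Oplus>\<^bsub>R\<^esub>i\<in>{..<k}. scalar R c [^]\<^bsub>R\<^esub> i \<otimes>\<^bsub>R\<^esub> act b (weight_comp i x)) =
        (\<Oplus>\<^bsub>R\<^esub>i\<in>{..<k}. scalar R c [^]\<^bsub>R\<^esub> i \<otimes>\<^bsub>R\<^esub> (scalar R b [^]\<^bsub>R\<^esub> i \<otimes>\<^bsub>R\<^esub> weight_comp i x))" .
  qed
qed

text \<open>\<open>act c\<close> multiplies \<open>weight_comp j x\<close> by the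
  \<open>j\<close>-th power of \<open>c\<close>, so as a polynomial in \<open>c\<close> its image
  has a single term.\<close>

lemma weight_comp_comp:
  assumes x: "x \<in> carrier R"
  shows "weight_comp i (weight_comp j x) = (if i = j then weight_comp j x else \<zero>\<^bsub>R\<^esub>)"
proof -
  let ?y = "weight_comp j x"
  have y: "?y \<in> carrier R" by (rule weight_comp_closed[OF x])
  obtain k0 where k0: "\<And>i. i \<ge> k0 \<Longrightarrow> weight_comp i ?y = \<zero>\<^bsub>R\<^esub>" using weight_comp_finite[OF y] by blast
  define k where "k = k0 + Suc (i + j)"
  have k: "\<And>i. i \<ge> k \<Longrightarrow> weight_comp i ?y = \<zero>\<^bsub>R\<^esub>" "j < k" "i < k" using k0 by (auto simp: k_def)
  show ?thesis
  proof (rule vandermonde_zero[OF _ _ _ k(3), of "\<lambda>i. weight_comp i ?y" "\<lambda>i. if i = j then ?y else \<zero>\<^bsub>R\<^esub>"])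
    fix c assume c: "c \<in> carrier K - {\<zero>\<^bsub>K\<^esub>}"
    then have cK: "c \<in> carrier K" by simp
    have sc: "scalar R c [^]\<^bsub>R\<^esub> i \<in> carrier R" for i :: nat using cK by simp
    have "(\<Oplus>\<^bsub>R\<^esub>i\<in>{..<k}. scalar R c [^]\<^bsub>R\<^esub> i \<otimes>\<^bsub>R\<^esub> weight_comp i ?y) = act c ?y"
      by (rule act_sum[OF cK y k(1), symmetric])
    also have "\<dots> = scalar R c [^]\<^bsub>R\<^esub> j \<otimes>\<^bsub>R\<^esub> ?y" by (rule act_weight_comp[OF c x])
    also have "\<dots> = (\<Oplus>\<^bsub>R\<^esub>i\<in>{..<k}. scalar R c [^]\<^bsub>R\<^esub> i \<otimes>\<^bsub>R\<^esub> (if i = j then ?y else \<zero>\<^bsub>R\<^esub>))"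
      using sc y k(2) R.A.finsum_single[of "{..<k}" j "\<lambda>i. scalar R c [^]\<^bsub>R\<^esub> i \<otimes>\<^bsub>R\<^esub> (if i = j then ?y else \<zero>\<^bsub>R\<^esub>)"] by simp
    finally show "(\<Oplus>\<^bsub>R\<^esub>i\<in>{..<k}. scalar R c [^]\<^bsub>R\<^esub> i \<otimes>\<^bsub>R\<^esub> weight_comp i ?y) =
        (\<Oplus>\<^bsub>R\<^esub>i\<in>{..<k}. scalar R c [^]\<^bsub>R\<^esub> i \<otimes>\<^bsub>R\<^esub> (if i = j then ?y else \<zero>\<^bsub>R\<^esub>))" .
  qed (use y weight_comp_closed in auto)
qed

text \<open>At \<open>c = 0\<close> all terms of \<open>act_sum\<close> vanish except the one of
  index 0.\<close>

lemma weight_comp_0: "x \<in> carrier R \<Longrightarrow> weight_comp 0 x = act \<zero>\<^bsub>K\<^esub> x"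
proof -
  assume x: "x \<in> carrier R"
  obtain k0 where k0: "\<And>i. i \<ge> k0 \<Longrightarrow> weight_comp i x = \<zero>\<^bsub>R\<^esub>" using weight_comp_finite[OF x] by blast
  have k: "\<And>i. i \<ge> Suc k0 \<Longrightarrow> weight_comp i x = \<zero>\<^bsub>R\<^esub>" using k0 by auto
  note wc = weight_comp_closed[OF x]
  have "act \<zero>\<^bsub>K\<^esub> x = (\<Oplus>\<^bsub>R\<^esub>i\<in>{..<Suc k0}. scalar R \<zero>\<^bsub>K\<^esub> [^]\<^bsub>R\<^esub> i \<otimes>\<^bsub>R\<^esub> weight_comp i x)"
    by (rule act_sum[OF K.zero_closed x k])
  also have "\<dots> = scalar R \<zero>\<^bsub>K\<^esub> [^]\<^bsub>R\<^esub> (0::nat) \<otimes>\<^bsub>R\<^esub> weight_comp 0 x"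
    using wc by (intro R.A.finsum_single) (auto simp: R.A.nat_pow_zero)
  finally show ?thesis using wc by simp
qed

definition origin_morphism :: "'a \<Rightarrow> 'k" where
  "origin_morphism = (THE f. f \<in> alg_hom K R (base_algebra K) \<and>
     base_change n (base_algebra K) f U = genideal (mpoly K (Suc n)) H)"

text \<open>If a morphism to \<open>K\<close> classifies the trivial lifting, its composition with
  the inclusion of \<open>K\<close> in \<open>R\<close> classifies the extension of that lifting to
  \<open>R\<close>, as \<open>act \<zero>\<close> does; uniqueness over \<open>R\<close> identifies
  the two. As the inclusion of \<open>K\<close> is injective, the morphism itself is unique and the
  description by \<open>THE\<close> is meaningful.\<close>

lemma origin_morphism:
  "origin_morphism \<in> alg_hom K R (base_algebra K)"
  "x \<in> carrier R \<Longrightarrow> scalar R (origin_morphism x) = act \<zero>\<^bsub>K\<^esub> x"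
proof -
  let ?B = "base_algebra K" and ?J = "genideal (mpoly K (Suc n)) H"
  have N: "noetherian_algebra K ?B" by (rule base_algebra_noetherian[OF field_K])
  interpret B: algebra_over_infinite_field K ?B
    using N field_K infinite_K by (intro algebra_over_infinite_field.intro) (simp_all add: noetherian_algebra_def)
  have "extend_ideal ?B (Suc n) (\<lambda>c. scalar ?B c) H = extend_ideal ?B (Suc n) (\<lambda>c. c) H"
    by (rule extend_ideal_cong[OF H_carrier]) simp
  then have ext: "extend_ideal ?B (Suc n) (\<lambda>c. scalar ?B c) H = ?J"
    by (simp only: extend_ideal_def mpoly_base_algebra image_ident)
  have "?J \<in> liftings n H ?B" using B.extend_ideal_lifting[OF H] unfolding ext .
  \<comment> \<open>The scalars inject \<open>K\<close> into the type of \<open>R\<close>, so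
    \<open>K\<close> has a copy there.\<close>
  then obtain f0 where f0: "f0 \<in> alg_hom K R ?B" "base_change n ?B f0 U = ?J"
    using classifying_morphism[OF N, of "\<lambda>c. scalar R c" ?J] R.inj_scalar by auto
  have Hc: "H \<subseteq> carrier (mpoly K (Suc n))" using H_carrier mpoly_mono[of n "Suc n" K] by auto
  have scB: "ring_hom_cring ?B R (\<lambda>c. scalar R c)"
    using R.S.homh by (intro ring_hom_cringI B.A.is_cring R.A.is_cring)
      (auto intro!: ring_hom_memI simp: R.S.hom_mult R.S.hom_add R.A.smult_l_distr)
  have scalar_f: "scalar R (f x) = act \<zero>\<^bsub>K\<^esub> x"
    if f: "f \<in> alg_hom K R ?B" "base_change n ?B f U = ?J" and x: "x \<in> carrier R" for f x
  proof -
    interpret f: ring_hom_cring R ?B f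
      by (intro ring_hom_cringI R.A.is_cring B.A.is_cring alg_homD(1)[OF f(1)])
    let ?g = "restrict (\<lambda>x. scalar R (f x)) (carrier R)"
    have g: "?g \<in> alg_hom K R R"
      by (rule alg_hom_compose[OF f(1) ring_hom_cring.homh[OF scB]]) (simp add: R.A.smult_assoc1)
    have "base_change n R ?g U = extend_ideal R (Suc n) (\<lambda>x. scalar R (f x)) U"
      unfolding base_change_def by (rule extend_ideal_cong[OF U_carrier]) simp
    also have "\<dots> = extend_ideal R (Suc n) (\<lambda>c. scalar R c) ?J"
      unfolding f(2)[symmetric] base_change_def by (rule f.extend_ideal_comp[symmetric, OF scB U_carrier])
    also have "\<dots> = extend_ideal R (Suc n) (\<lambda>c. scalar R c) H"
    proof -
      have "ring_hom_ring (mpoly K (Suc n)) (mpoly R (Suc n)) (\<lambda>p m. scalar R (p m))"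
        by (intro ring_hom_ringI2 R.S.coeff_map_hom cring.axioms(1) K.mpoly_cring R.A.mpoly_cring)
      from ring_hom_ring.genideal_image[OF this Hc] show ?thesis by (simp add: extend_ideal_def)
    qed
    also have "\<dots> = base_change n R (act \<zero>\<^bsub>K\<^esub>) U" by (rule base_change_act_zero[symmetric])
    finally have "?g = act \<zero>\<^bsub>K\<^esub>" by (rule base_change_inj[OF g act_alg_hom[OF K.zero_closed]])
    from fun_cong[OF this, of x] show ?thesis using x by simp
  qed
  have "origin_morphism = f0"
    unfolding origin_morphism_def
  proof (rule the_equality)
    fix f assume f: "f \<in> alg_hom K R ?B \<and> base_change n ?B f U = ?J"
    show "f = f0"
    proof (rule extensionalityI)
      show "f \<in> extensional (carrier R)" "f0 \<in> extensional (carrier R)"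
        using f f0(1) by (auto simp: alg_hom_def)
      fix x assume x: "x \<in> carrier R"
      have "scalar R (f x) = scalar R (f0 x)"
        using f f0 scalar_f[of f x] scalar_f[of f0 x] x by simp
      moreover have "f x \<in> carrier K" "f0 x \<in> carrier K"
        using f f0(1) x ring_hom_closed[OF alg_homD(1)] by fastforce+
      ultimately show "f x = f0 x" using inj_onD[OF R.inj_scalar] by blast
    qed
  qed (use f0 in blast)
  then show "origin_morphism \<in> alg_hom K R ?B" "x \<in> carrier R \<Longrightarrow> scalar R (origin_morphism x) = act \<zero>\<^bsub>K\<^esub> x"
    using f0 scalar_f by auto
qed

lemma origin_morphism_closed: "x \<in> carrier R \<Longrightarrow> origin_morphism x \<in> carrier K"
  using ring_hom_closed[OF alg_homD(1)[OF origin_morphism(1)]] by simp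

text \<open>The kernel of the classifying morphism can be computed after including \<open>K\<close>
  in \<open>R\<close>, where the morphism becomes the projection to degree 0.\<close>

lemma lifting_point_eq:
  "lifting_point K n R U (genideal (mpoly K (Suc n)) H) = {x \<in> carrier R. weight_comp 0 x = \<zero>\<^bsub>R\<^esub>}"
proof -
  have "origin_morphism x = \<zero>\<^bsub>K\<^esub> \<longleftrightarrow> weight_comp 0 x = \<zero>\<^bsub>R\<^esub>" if x: "x \<in> carrier R" for x
  proof -
    have z: "scalar R \<zero>\<^bsub>K\<^esub> = \<zero>\<^bsub>R\<^esub>" by simp
    have "origin_morphism x = \<zero>\<^bsub>K\<^esub> \<longleftrightarrow> scalar R (origin_morphism x) = scalar R \<zero>\<^bsub>K\<^esub>"
      using inj_onD[OF R.inj_scalar] origin_morphism_closed[OF x] K.zero_closed by metis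
    then show ?thesis
      by (simp only: z origin_morphism(2)[OF x] weight_comp_0[OF x])
  qed
  then show ?thesis
    by (auto simp: lifting_point_def a_kernel_def' simp flip: origin_morphism_def)
qed

text \<open>The coaction is a ring homomorphism, which gives \<open>comp_add\<close> and
  \<open>comp_mult\<close>, the latter because multiplication in \<open>R[T]\<close> convolves
  coefficients. That \<open>act \<one>\<close> is the identity gives \<open>comp_sum\<close>, and
  the factorization of \<open>act \<zero>\<close> through \<open>K\<close> gives
  \<open>comp_0\<close>.\<close>

sublocale graded: connected_graded_algebra K R weight_comp
proof (intro connected_graded_algebra.intro connected_graded_algebra_axioms.intro)
  fix x y and j :: nat assume x: "x \<in> carrier R"
  show "weight_comp j x \<in> carrier R" by (rule weight_comp_closed[OF x])
  show "\<exists>k. \<forall>i\<ge>k. weight_comp i x = \<zero>\<^bsub>R\<^esub>" by (rule weight_comp_finite[OF x])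
  show "weight_comp i (weight_comp j x) = (if i = j then weight_comp j x else \<zero>\<^bsub>R\<^esub>)" for i
    by (rule weight_comp_comp[OF x])
  show "x = (\<Oplus>\<^bsub>R\<^esub>i\<in>{..<k}. weight_comp i x)" if "\<And>i. i \<ge> k \<Longrightarrow> weight_comp i x = \<zero>\<^bsub>R\<^esub>" for k
  proof -
    have "x = act \<one>\<^bsub>K\<^esub> x" using act_one[OF x] by simp
    also have "\<dots> = (\<Oplus>\<^bsub>R\<^esub>i\<in>{..<k}. scalar R \<one>\<^bsub>K\<^esub> [^]\<^bsub>R\<^esub> i \<otimes>\<^bsub>R\<^esub> weight_comp i x)"
      by (rule act_sum[OF K.one_closed x that])
    also have "\<dots> = (\<Oplus>\<^bsub>R\<^esub>i\<in>{..<k}. weight_comp i x)"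
      using weight_comp_closed[OF x] by (intro R.A.finsum_cong') auto
    finally show ?thesis .
  qed
  show "\<exists>c\<in>carrier K. weight_comp 0 x = scalar R c"
    using origin_morphism_closed[OF x] origin_morphism(2)[OF x] weight_comp_0[OF x] by metis
  show "weight_comp j (c \<odot>\<^bsub>R\<^esub> x) = c \<odot>\<^bsub>R\<^esub> weight_comp j x" if "c \<in> carrier K" for c
    using alg_homD(2)[OF coaction(1) that x] by (simp add: weight_comp_def poly_algebra_def)
  assume y: "y \<in> carrier R"
  have c: "coaction x \<in> up R" "coaction y \<in> up R"
    using coaction_closed[OF x] coaction_closed[OF y] by (auto simp: UP_def)
  show "weight_comp j (x \<oplus>\<^bsub>R\<^esub> y) = weight_comp j x \<oplus>\<^bsub>R\<^esub> weight_comp j y"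
    using ring_hom_add[OF alg_homD(1)[OF coaction(1)] x y] c by (simp add: weight_comp_def UP_def)
  show "weight_comp j (x \<otimes>\<^bsub>R\<^esub> y) = (\<Oplus>\<^bsub>R\<^esub>i\<in>{..j}. weight_comp i x \<otimes>\<^bsub>R\<^esub> weight_comp (j - i) y)"
    using ring_hom_mult[OF alg_homD(1)[OF coaction(1)] x y] c by (simp add: weight_comp_def UP_def)
next
  show "noetherian_ring R" using noetherian_R by (simp add: noetherian_algebra_def)
qed (rule R.algebra_over_infinite_field_axioms)

end


section \<open>Irreducible components\<close>

lemma topspace_zariski: "ring R \<Longrightarrow> topspace (zariski_topology R) = Spec R"
proof -
  assume "ring R"
  have "\<not> carrier R \<subseteq> P" if "P \<in> Spec R" for P
  proof -
    interpret primeideal P R using that by (simp add: Spec_def)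
    show ?thesis using I_notcarr a_subset by blast
  qed
  then have "openin (zariski_topology R) (Spec R)"
    unfolding openin_zariski_topology by (intro exI[of _ "carrier R"]) auto
  moreover have "W \<subseteq> Spec R" if "openin (zariski_topology R) W" for W
    using that unfolding openin_zariski_topology by auto
  ultimately show ?thesis by (simp add: openin_subset openin_topspace subset_antisym)
qed

lemma closedin_zariski:
  assumes "ring R"
  shows "closedin (zariski_topology R) C \<longleftrightarrow> (\<exists>S\<subseteq>carrier R. C = {P \<in> Spec R. S \<subseteq> P})"
  unfolding closedin_def topspace_zariski[OF assms] openin_zariski_topology
proof safe
  fix S assume "C \<subseteq> Spec R" "S \<subseteq> carrier R" "Spec R - C = {P \<in> Spec R. \<not> S \<subseteq> P}"
  then show "\<exists>S\<subseteq>carrier R. C = {P \<in> Spec R. S \<subseteq> P}" by (intro exI[of _ S]) blast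
next
  fix S assume "S \<subseteq> carrier R"
  then show "\<exists>T\<subseteq>carrier R. Spec R - {P \<in> Spec R. S \<subseteq> P} = {P \<in> Spec R. \<not> T \<subseteq> P}"
    by (intro exI[of _ S]) blast
qed

lemma (in cring) primeidealI_comm:
  assumes "ideal I R" "\<one> \<notin> I" "\<And>a b. a \<in> carrier R \<Longrightarrow> b \<in> carrier R \<Longrightarrow> a \<otimes> b \<in> I \<Longrightarrow> a \<in> I \<or> b \<in> I"
  shows "primeideal I R"
  using assms is_cring by (intro primeidealI) auto

text \<open>The set of primes above a prime \<open>Q\<close> is irreducible; if \<open>Q\<close> is
  contained in the intersection of \<open>Z\<close>, this set contains \<open>Z\<close> and equals
  it by maximality. Taking a homogeneous prime for \<open>Q\<close> will place the irrelevant ideal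
  in \<open>Z\<close>.\<close>

lemma (in cring) irreducible_component_generic:
  assumes Z: "irreducible_component (zariski_topology R) Z"
  shows "primeideal (\<Inter>Z) R" "\<And>Q. primeideal Q R \<Longrightarrow> Q \<subseteq> \<Inter>Z \<Longrightarrow> Z = {P \<in> Spec R. Q \<subseteq> P}"
proof -
  note closed = closedin_zariski[OF ring_axioms]
  have irr: "irreducible_in (zariski_topology R) Z"
    and max: "\<And>Y. irreducible_in (zariski_topology R) Y \<Longrightarrow> Z \<subseteq> Y \<Longrightarrow> Y = Z"
    using Z by (auto simp: irreducible_component_def)
  have ZS: "Z \<subseteq> Spec R" and Zne: "Z \<noteq> {}"
    and split: "\<And>C D. closedin (zariski_topology R) C \<Longrightarrow> closedin (zariski_topology R) D \<Longrightarrow> Z \<subseteq> C \<union> D \<Longrightarrow> Z \<subseteq> C \<or> Z \<subseteq> D"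
    using irr by (auto simp: irreducible_in_def topspace_zariski[OF ring_axioms])
  have pr: "primeideal P R" if "P \<in> Z" for P using that ZS by (auto simp: Spec_def)
  show "primeideal (\<Inter>Z) R"
  proof (rule primeidealI_comm)
    show "ideal (\<Inter>Z) R"
      by (rule i_Intersect[OF _ Zne]) (use pr primeideal.axioms(1) in blast)
    obtain P where P: "P \<in> Z" using Zne by blast
    show "\<one> \<notin> \<Inter>Z"
    proof
      assume "\<one> \<in> \<Inter>Z"
      then have "\<one> \<in> P" using P by blast
      then show False
        using primeideal.I_notcarr[OF pr[OF P]] ideal.one_imp_carrier[OF primeideal.axioms(1)[OF pr[OF P]]] by simp
    qed
    fix a b assume ab: "a \<in> carrier R" "b \<in> carrier R" "a \<otimes> b \<in> \<Inter>Z"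
    \<comment> \<open>If a product lies in every member of \<open>Z\<close>, then \<open>Z\<close>
      is covered by the two closed sets on which one of the factors vanishes.\<close>
    have "Z \<subseteq> {P \<in> Spec R. {a} \<subseteq> P} \<union> {P \<in> Spec R. {b} \<subseteq> P}"
    proof
      fix P assume P: "P \<in> Z"
      then have "a \<in> P \<or> b \<in> P" using primeideal.I_prime[OF pr[OF P] ab(1,2)] ab(3) by blast
      then show "P \<in> {P \<in> Spec R. {a} \<subseteq> P} \<union> {P \<in> Spec R. {b} \<subseteq> P}" using P ZS by blast
    qed
    moreover have "closedin (zariski_topology R) {P \<in> Spec R. {x} \<subseteq> P}" if "x \<in> carrier R" for x
      unfolding closed using that by (intro exI[of _ "{x}"]) auto
    ultimately have "Z \<subseteq> {P \<in> Spec R. {a} \<subseteq> P} \<or> Z \<subseteq> {P \<in> Spec R. {b} \<subseteq> P}"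
      using ab split by blast
    then show "a \<in> \<Inter>Z \<or> b \<in> \<Inter>Z" by blast
  qed
  show "Z = {P \<in> Spec R. Q \<subseteq> P}" if Q: "primeideal Q R" "Q \<subseteq> \<Inter>Z" for Q
  proof -
    have "irreducible_in (zariski_topology R) {P \<in> Spec R. Q \<subseteq> P}"
      unfolding irreducible_in_def topspace_zariski[OF ring_axioms]
    proof (intro conjI allI impI)
      have QS: "Q \<in> {P \<in> Spec R. Q \<subseteq> P}" using Q(1) by (simp add: Spec_def)
      then show "{P \<in> Spec R. Q \<subseteq> P} \<noteq> {}" by blast
      fix C D assume "closedin (zariski_topology R) C \<and> closedin (zariski_topology R) D \<and> {P \<in> Spec R. Q \<subseteq> P} \<subseteq> C \<union> D"
      then obtain S T where "C = {P \<in> Spec R. S \<subseteq> P}" "D = {P \<in> Spec R. T \<subseteq> P}" "{P \<in> Spec R. Q \<subseteq> P} \<subseteq> C \<union> D"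
        unfolding closed by blast
      then show "{P \<in> Spec R. Q \<subseteq> P} \<subseteq> C \<or> {P \<in> Spec R. Q \<subseteq> P} \<subseteq> D" using QS by blast
    qed blast
    from max[OF this] show ?thesis using Q(2) ZS by blast
  qed
qed

context connected_graded_algebra
begin

definition irrelevant :: "'a set" where
  "irrelevant = {x \<in> carrier R. comp 0 x = \<zero>\<^bsub>R\<^esub>}"

lemma comp_zero [simp]: "comp j \<zero>\<^bsub>R\<^esub> = \<zero>\<^bsub>R\<^esub>"
  using comp_smult[of "\<zero>\<^bsub>K\<^esub>" "\<zero>\<^bsub>R\<^esub>" j] comp_closed[of "\<zero>\<^bsub>R\<^esub>" j] by simp

lemma comp_finsum:
  assumes "\<And>i. i \<in> I \<Longrightarrow> f i \<in> carrier R"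
  shows "comp j (\<Oplus>\<^bsub>R\<^esub>i\<in>I. f i) = (\<Oplus>\<^bsub>R\<^esub>i\<in>I. comp j (f i))"
proof (cases "finite I")
  case True
  then show ?thesis using assms
  proof (induction I rule: finite_induct)
    case (insert i I)
    have "(\<Oplus>\<^bsub>R\<^esub>i\<in>insert i I. f i) = f i \<oplus>\<^bsub>R\<^esub> (\<Oplus>\<^bsub>R\<^esub>i\<in>I. f i)"
      using insert by (intro A.finsum_insert) auto
    moreover have "(\<Oplus>\<^bsub>R\<^esub>i\<in>insert i I. comp j (f i)) = comp j (f i) \<oplus>\<^bsub>R\<^esub> (\<Oplus>\<^bsub>R\<^esub>i\<in>I. comp j (f i))"
      using insert comp_closed by (intro A.finsum_insert) auto
    moreover have "(\<Oplus>\<^bsub>R\<^esub>i\<in>I. f i) \<in> carrier R" using insert by (intro A.finsum_closed) auto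
    ultimately show ?case using insert by (simp add: comp_add)
  qed simp
qed simp

lemma comp_0_mult:
  "x \<in> carrier R \<Longrightarrow> y \<in> carrier R \<Longrightarrow> comp 0 (x \<otimes>\<^bsub>R\<^esub> y) = comp 0 x \<otimes>\<^bsub>R\<^esub> comp 0 y"
  by (simp add: comp_mult comp_closed)

text \<open>Not among the axioms of the grading. The component of degree \<open>j\<close> of
  \<open>\<one> \<otimes> comp j \<one>\<close> shows that \<open>comp 0 \<one>\<close> fixes every
  component of one, hence fixes one, their sum.\<close>

lemma comp_0_one [simp]: "comp 0 \<one>\<^bsub>R\<^esub> = \<one>\<^bsub>R\<^esub>"
proof -
  let ?e = "comp 0 \<one>\<^bsub>R\<^esub>"
  have c: "comp j \<one>\<^bsub>R\<^esub> \<in> carrier R" for j by (simp add: comp_closed)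
  have e: "?e \<otimes>\<^bsub>R\<^esub> comp j \<one>\<^bsub>R\<^esub> = comp j \<one>\<^bsub>R\<^esub>" for j
  proof -
    have "comp j \<one>\<^bsub>R\<^esub> = comp j (\<one>\<^bsub>R\<^esub> \<otimes>\<^bsub>R\<^esub> comp j \<one>\<^bsub>R\<^esub>)" using c by (simp add: comp_comp)
    also have "\<dots> = (\<Oplus>\<^bsub>R\<^esub>i\<in>{..j}. comp i \<one>\<^bsub>R\<^esub> \<otimes>\<^bsub>R\<^esub> comp (j - i) (comp j \<one>\<^bsub>R\<^esub>))"
      using c by (intro comp_mult) auto
    also have "\<dots> = comp 0 \<one>\<^bsub>R\<^esub> \<otimes>\<^bsub>R\<^esub> comp (j - 0) (comp j \<one>\<^bsub>R\<^esub>)"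
      using c by (intro A.finsum_single) (auto simp: comp_comp)
    finally show ?thesis by (simp add: comp_comp)
  qed
  obtain k where k: "\<And>i. i \<ge> k \<Longrightarrow> comp i \<one>\<^bsub>R\<^esub> = \<zero>\<^bsub>R\<^esub>" using comp_finite[OF A.one_closed] by blast
  have 1: "\<one>\<^bsub>R\<^esub> = (\<Oplus>\<^bsub>R\<^esub>i\<in>{..<k}. comp i \<one>\<^bsub>R\<^esub>)" by (rule comp_sum[OF A.one_closed k])
  have "?e = ?e \<otimes>\<^bsub>R\<^esub> (\<Oplus>\<^bsub>R\<^esub>i\<in>{..<k}. comp i \<one>\<^bsub>R\<^esub>)" using 1 c by simp
  also have "\<dots> = (\<Oplus>\<^bsub>R\<^esub>i\<in>{..<k}. ?e \<otimes>\<^bsub>R\<^esub> comp i \<one>\<^bsub>R\<^esub>)" using c by (intro A.finsum_rdistr) auto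
  also have "\<dots> = \<one>\<^bsub>R\<^esub>" by (simp only: e 1[symmetric])
  finally show ?thesis .
qed

lemma comp_0_scalar: "c \<in> carrier K \<Longrightarrow> comp 0 (scalar R c) = scalar R c"
  by (simp add: comp_smult)

lemma scalar_Units: "c \<in> carrier K \<Longrightarrow> c \<noteq> \<zero>\<^bsub>K\<^esub> \<Longrightarrow> scalar R c \<in> Units R"
proof -
  assume c: "c \<in> carrier K" "c \<noteq> \<zero>\<^bsub>K\<^esub>"
  then have u: "c \<in> Units K" by (simp add: K.field_Units)
  then have "scalar R c \<otimes>\<^bsub>R\<^esub> scalar R (inv\<^bsub>K\<^esub> c) = scalar R (c \<otimes>\<^bsub>K\<^esub> inv\<^bsub>K\<^esub> c)"
    using c by (intro S.hom_mult[symmetric]) auto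
  then have "scalar R c \<otimes>\<^bsub>R\<^esub> scalar R (inv\<^bsub>K\<^esub> c) = \<one>\<^bsub>R\<^esub>" using u by simp
  moreover have "scalar R (inv\<^bsub>K\<^esub> c) \<in> carrier R" "scalar R c \<in> carrier R" using u c by auto
  ultimately show ?thesis using A.m_comm[of "scalar R c" "scalar R (inv\<^bsub>K\<^esub> c)"] by (auto simp: Units_def)
qed

lemma comp_0_zero_or_Units: "x \<in> carrier R \<Longrightarrow> comp 0 x = \<zero>\<^bsub>R\<^esub> \<or> comp 0 x \<in> Units R"
proof -
  assume "x \<in> carrier R"
  then obtain c where "c \<in> carrier K" "comp 0 x = scalar R c" using comp_0 by blast
  then show ?thesis using scalar_Units[of c] by (cases "c = \<zero>\<^bsub>K\<^esub>") auto
qed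

lemma irrelevant_ideal: "ideal irrelevant R"
  by (rule A.idealI_comm) (auto simp: irrelevant_def comp_add comp_0_mult comp_closed)

lemma Units_not_in_prime: "primeideal P R \<Longrightarrow> u \<in> Units R \<Longrightarrow> u \<notin> P"
proof
  assume P: "primeideal P R" and u: "u \<in> Units R" "u \<in> P"
  interpret P: primeideal P R by fact
  have "inv\<^bsub>R\<^esub> u \<otimes>\<^bsub>R\<^esub> u \<in> P" using u by (intro P.I_l_closed) auto
  then show False using u P.one_imp_carrier P.I_notcarr by simp
qed

text \<open>\<open>comp 0\<close> is multiplicative, and its values are zero or units.\<close>

lemma irrelevant_prime: "primeideal irrelevant R"
proof (rule A.primeidealI_comm[OF irrelevant_ideal])
  show "\<one>\<^bsub>R\<^esub> \<notin> irrelevant" using A_nontrivial by (simp add: irrelevant_def)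
  fix a b assume ab: "a \<in> carrier R" "b \<in> carrier R" "a \<otimes>\<^bsub>R\<^esub> b \<in> irrelevant"
  then have z: "comp 0 a \<otimes>\<^bsub>R\<^esub> comp 0 b = \<zero>\<^bsub>R\<^esub>" by (simp add: irrelevant_def comp_0_mult)
  have "comp 0 b = \<zero>\<^bsub>R\<^esub>" if "comp 0 a \<in> Units R"
  proof -
    have "inv\<^bsub>R\<^esub> (comp 0 a) \<otimes>\<^bsub>R\<^esub> (comp 0 a \<otimes>\<^bsub>R\<^esub> comp 0 b) = comp 0 b"
      using that ab comp_closed by (simp flip: A.m_assoc)
    then show ?thesis using z that by simp
  qed
  then show "a \<in> irrelevant \<or> b \<in> irrelevant"
    using comp_0_zero_or_Units[OF ab(1)] ab by (auto simp: irrelevant_def)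
qed

text \<open>For an ideal \<open>P\<close>, the largest homogeneous ideal contained in it.\<close>

definition homogeneous_core :: "'a set \<Rightarrow> 'a set" where
  "homogeneous_core P = {x \<in> carrier R. \<forall>i. comp i x \<in> P}"

text \<open>For primality take the lowest components of \<open>a\<close> and \<open>b\<close>
  outside \<open>P\<close>, in degrees \<open>i\<close> and \<open>j\<close>: modulo
  \<open>P\<close> only their product contributes to the component of degree \<open>i + j\<close> of
  the product. The core is irrelevant because a component of degree 0 that lies in \<open>P\<close>
  is not a unit and therefore zero.\<close>

lemma homogeneous_core_prime:
  assumes P: "primeideal P R"
  shows "primeideal (homogeneous_core P) R" "homogeneous_core P \<subseteq> P" "homogeneous_core P \<subseteq> irrelevant"
proof -
  interpret P: primeideal P R by fact
  show "homogeneous_core P \<subseteq> P"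
  proof
    fix x assume x: "x \<in> homogeneous_core P"
    then have xc: "x \<in> carrier R" by (simp add: homogeneous_core_def)
    obtain k where "\<And>i. i \<ge> k \<Longrightarrow> comp i x = \<zero>\<^bsub>R\<^esub>" using comp_finite[OF xc] by blast
    from comp_sum[OF xc this] have "x = (\<Oplus>\<^bsub>R\<^esub>i\<in>{..<k}. comp i x)" .
    also have "\<dots> \<in> P" using x by (intro P.finsum_in_ideal) (simp add: homogeneous_core_def)
    finally show "x \<in> P" .
  qed
  show "homogeneous_core P \<subseteq> irrelevant"
    using comp_0_zero_or_Units Units_not_in_prime[OF P] by (auto simp: homogeneous_core_def irrelevant_def)
  show "primeideal (homogeneous_core P) R"
  proof (rule A.primeidealI_comm)
    show "ideal (homogeneous_core P) R"
    proof (rule A.idealI_comm)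
      fix a r assume a: "a \<in> homogeneous_core P" and r: "r \<in> carrier R"
      then have ac: "a \<in> carrier R" by (simp add: homogeneous_core_def)
      have "comp i (r \<otimes>\<^bsub>R\<^esub> a) \<in> P" for i
        unfolding comp_mult[OF r ac] using a r comp_closed
        by (intro P.finsum_in_ideal P.I_l_closed) (auto simp: homogeneous_core_def)
      then show "r \<otimes>\<^bsub>R\<^esub> a \<in> homogeneous_core P" using ac r by (simp add: homogeneous_core_def)
    qed (auto simp: homogeneous_core_def comp_add)
    show "\<one>\<^bsub>R\<^esub> \<notin> homogeneous_core P"
      using \<open>homogeneous_core P \<subseteq> P\<close> Units_not_in_prime[OF P A.Units_one_closed] by blast
    fix a b assume a: "a \<in> carrier R" and b: "b \<in> carrier R" and ab: "a \<otimes>\<^bsub>R\<^esub> b \<in> homogeneous_core P"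
    show "a \<in> homogeneous_core P \<or> b \<in> homogeneous_core P"
    proof (rule ccontr)
      assume "\<not> ?thesis"
      then have ex: "\<exists>i. comp i a \<notin> P" "\<exists>i. comp i b \<notin> P" using a b by (auto simp: homogeneous_core_def)
      define i where "i = (LEAST i. comp i a \<notin> P)"
      define j where "j = (LEAST j. comp j b \<notin> P)"
      have i: "comp i a \<notin> P" "\<And>i'. i' < i \<Longrightarrow> comp i' a \<in> P"
        using LeastI_ex[OF ex(1)] not_less_Least by (auto simp: i_def)
      have j: "comp j b \<notin> P" "\<And>j'. j' < j \<Longrightarrow> comp j' b \<in> P"
        using LeastI_ex[OF ex(2)] not_less_Least by (auto simp: j_def)
      let ?f = "\<lambda>l. comp l a \<otimes>\<^bsub>R\<^esub> comp (i + j - l) b"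
      have fc: "?f l \<in> carrier R" for l using a b comp_closed by simp
      have "(\<Oplus>\<^bsub>R\<^esub>l\<in>{..i + j}. ?f l) \<in> P"
        unfolding comp_mult[OF a b, symmetric] using ab by (simp add: homogeneous_core_def)
      moreover have "(\<Oplus>\<^bsub>R\<^esub>l\<in>{..i + j}. ?f l) = ?f i \<oplus>\<^bsub>R\<^esub> (\<Oplus>\<^bsub>R\<^esub>l\<in>{..i + j} - {i}. ?f l)"
      proof -
        have "{..i + j} = insert i ({..i + j} - {i})" by auto
        then have "(\<Oplus>\<^bsub>R\<^esub>l\<in>{..i + j}. ?f l) = (\<Oplus>\<^bsub>R\<^esub>l\<in>insert i ({..i + j} - {i}). ?f l)" by simp
        also have "\<dots> = ?f i \<oplus>\<^bsub>R\<^esub> (\<Oplus>\<^bsub>R\<^esub>l\<in>{..i + j} - {i}. ?f l)"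
          using fc fc[of i] by (intro A.finsum_insert) (simp_all add: Pi_def a b comp_closed)
        finally show ?thesis .
      qed
      moreover have rest: "(\<Oplus>\<^bsub>R\<^esub>l\<in>{..i + j} - {i}. ?f l) \<in> P"
      proof (rule P.finsum_in_ideal)
        fix l assume "l \<in> {..i + j} - {i}"
        \<comment> \<open>As \<open>l\<close> differs from \<open>i\<close>, it is below
          \<open>i\<close> or the complementary degree is below \<open>j\<close>.\<close>
        then consider "l < i" | "i + j - l < j" by fastforce
        then show "?f l \<in> P"
        proof cases
          case 1 then show ?thesis using i(2) b comp_closed by (intro P.I_r_closed) auto
        next
          case 2 then show ?thesis using j(2) a comp_closed by (intro P.I_l_closed) auto
        qed
      qed
      ultimately have "?f i \<oplus>\<^bsub>R\<^esub> (\<Oplus>\<^bsub>R\<^esub>l\<in>{..i + j} - {i}. ?f l) \<in> P" by simp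
      moreover have "u \<in> P" if "u \<in> carrier R" "v \<in> P" "u \<oplus>\<^bsub>R\<^esub> v \<in> P" for u v
      proof -
        have "(u \<oplus>\<^bsub>R\<^esub> v) \<ominus>\<^bsub>R\<^esub> v \<in> P" unfolding a_minus_def by (rule P.a_closed[OF that(3) P.a_inv_closed[OF that(2)]])
        moreover have "(u \<oplus>\<^bsub>R\<^esub> v) \<ominus>\<^bsub>R\<^esub> v = u"
          using that(1) P.Icarr[OF that(2)] by (simp add: a_minus_def A.a_assoc A.r_neg)
        ultimately show ?thesis by (simp only:)
      qed
      ultimately have "?f i \<in> P" using fc[of i] rest by blast
      then have "comp i a \<otimes>\<^bsub>R\<^esub> comp j b \<in> P" by simp
      then show False using P.I_prime[of "comp i a" "comp j b"] i(1) j(1) a b comp_closed by blast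
    qed
  qed
qed

text \<open>A component is the set of primes above the homogeneous core of its generic point, and
  the irrelevant ideal is above that core.\<close>

theorem irrelevant_in_components:
  assumes "irreducible_component (zariski_topology R) Z"
  shows "irrelevant \<in> Z"
proof -
  note gen = A.irreducible_component_generic[OF assms]
  note core = homogeneous_core_prime[OF gen(1)]
  have "Z = {P \<in> Spec R. homogeneous_core (\<Inter>Z) \<subseteq> P}" by (rule gen(2)[OF core(1,2)])
  moreover have "irrelevant \<in> {P \<in> Spec R. homogeneous_core (\<Inter>Z) \<subseteq> P}"
    using core(3) irrelevant_prime by (simp add: Spec_def)
  ultimately show ?thesis by simp
qed

end


section \<open>Dimensions of vector spaces\<close>

text \<open>Gaussian elimination by induction on the number of equations: an equation with a nonzero
  coefficient at \<open>x0\<close> is solved for that unknown and eliminated from the others. Used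
  for the invariance of dimension and again for counting power products.\<close>

lemma (in field) homogeneous_system:
  assumes "finite Y" "finite X" "card Y < card X" "\<And>y x. y \<in> Y \<Longrightarrow> x \<in> X \<Longrightarrow> a y x \<in> carrier R"
  shows "\<exists>c. (\<forall>x\<in>X. c x \<in> carrier R) \<and> (\<exists>x\<in>X. c x \<noteq> \<zero>) \<and> (\<forall>y\<in>Y. (\<Oplus>x\<in>X. a y x \<otimes> c x) = \<zero>)"
  using assms
proof (induction Y arbitrary: X a rule: finite_induct)
  case (empty X a)
  then obtain x0 where "x0 \<in> X" by (metis card.empty ex_in_conv less_irrefl)
  then show ?case by (intro exI[of _ "\<lambda>_. \<one>"]) auto
next
  case (insert y Y X a)
  show ?case
  proof (cases "\<forall>x\<in>X. a y x = \<zero>")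
    case True
    have "\<exists>c. (\<forall>x\<in>X. c x \<in> carrier R) \<and> (\<exists>x\<in>X. c x \<noteq> \<zero>) \<and> (\<forall>y\<in>Y. (\<Oplus>x\<in>X. a y x \<otimes> c x) = \<zero>)"
      using insert by (intro insert.IH) auto
    then obtain c where c: "\<forall>x\<in>X. c x \<in> carrier R" "\<exists>x\<in>X. c x \<noteq> \<zero>" "\<forall>y\<in>Y. (\<Oplus>x\<in>X. a y x \<otimes> c x) = \<zero>" by blast
    have "(\<Oplus>x\<in>X. a y x \<otimes> c x) = \<zero>"
      using True c(1) by (intro add.finprod_one_eqI) auto
    with c show ?thesis by blast
  next
    case False
    then obtain x0 where x0: "x0 \<in> X" "a y x0 \<noteq> \<zero>" by blast
    let ?X = "X - {x0}"
    have a: "a z x \<in> carrier R" if "z \<in> insert y Y" "x \<in> X" for z x using insert.prems(3) that by blast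
    have u: "a y x0 \<in> Units R" using x0 a by (simp add: field_Units)
    \<comment> \<open>The multiple of equation \<open>y\<close> that removes \<open>x0\<close> from
      equation \<open>z\<close>.\<close>
    define b where "b z = a z x0 \<otimes> inv (a y x0)" for z
    have b: "b z \<in> carrier R" if "z \<in> insert y Y" for z using a[OF that x0(1)] u by (simp add: b_def)
    have "\<exists>c. (\<forall>x\<in>?X. c x \<in> carrier R) \<and> (\<exists>x\<in>?X. c x \<noteq> \<zero>) \<and>
        (\<forall>z\<in>Y. (\<Oplus>x\<in>?X. (a z x \<ominus> b z \<otimes> a y x) \<otimes> c x) = \<zero>)"
      using insert.prems insert.hyps x0 a b by (intro insert.IH) auto
    then obtain c where c: "\<forall>x\<in>?X. c x \<in> carrier R" "\<exists>x\<in>?X. c x \<noteq> \<zero>"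
      "\<forall>z\<in>Y. (\<Oplus>x\<in>?X. (a z x \<ominus> b z \<otimes> a y x) \<otimes> c x) = \<zero>" by blast
    define S where "S = (\<Oplus>x\<in>?X. a y x \<otimes> c x)"
    have S: "S \<in> carrier R" unfolding S_def using a c(1) by (intro finsum_closed) auto
    have eq: "(\<Oplus>x\<in>?X. a z x \<otimes> c x) = b z \<otimes> S" if z: "z \<in> insert y Y" for z
    proof (cases "z = y")
      case True
      have "b y = \<one>" using u by (simp add: b_def)
      then show ?thesis using True S by (simp add: S_def)
    next
      case False
      then have zY: "z \<in> Y" using z by simp
      have cl: "a z x \<in> carrier R" "a y x \<in> carrier R" "c x \<in> carrier R" if "x \<in> ?X" for x
        using that a z c(1) by auto
      have "(\<Oplus>x\<in>?X. a z x \<otimes> c x) = (\<Oplus>x\<in>?X. (a z x \<ominus> b z \<otimes> a y x) \<otimes> c x \<oplus> b z \<otimes> (a y x \<otimes> c x))"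
      proof (intro finsum_cong')
        fix x assume "x \<in> ?X"
        note cl[OF this] b[OF z]
        then show "a z x \<otimes> c x = (a z x \<ominus> b z \<otimes> a y x) \<otimes> c x \<oplus> b z \<otimes> (a y x \<otimes> c x)" by algebra
      qed (use cl b[OF z] in auto)
      also have "\<dots> = (\<Oplus>x\<in>?X. (a z x \<ominus> b z \<otimes> a y x) \<otimes> c x) \<oplus> (\<Oplus>x\<in>?X. b z \<otimes> (a y x \<otimes> c x))"
        using cl b[OF z] by (intro finsum_addf) auto
      also have "(\<Oplus>x\<in>?X. b z \<otimes> (a y x \<otimes> c x)) = b z \<otimes> S"
        unfolding S_def using cl b[OF z] insert.prems(1) by (intro finsum_rdistr[symmetric]) auto
      finally show ?thesis using c(3) zY S b[OF z] by simp
    qed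
    \<comment> \<open>The unknown \<open>x0\<close> is determined by equation \<open>y\<close>; the
      other equations then hold because of \<open>eq\<close>.\<close>
    define d where "d = c(x0 := \<ominus> (inv (a y x0) \<otimes> S))"
    have "(\<Oplus>x\<in>X. a z x \<otimes> d x) = \<zero>" if z: "z \<in> insert y Y" for z
    proof -
      have "X = insert x0 ?X" using x0(1) by blast
      then have "(\<Oplus>x\<in>X. a z x \<otimes> d x) = (\<Oplus>x\<in>insert x0 ?X. a z x \<otimes> d x)" by simp
      also have "\<dots> = a z x0 \<otimes> d x0 \<oplus> (\<Oplus>x\<in>?X. a z x \<otimes> d x)"
        using insert.prems(1) a[OF z] x0(1) c(1) u S by (intro finsum_insert) (auto simp: d_def)
      also have "(\<Oplus>x\<in>?X. a z x \<otimes> d x) = (\<Oplus>x\<in>?X. a z x \<otimes> c x)"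
        using a[OF z] c(1) by (intro finsum_cong') (auto simp: d_def)
      also have "a z x0 \<otimes> d x0 = \<ominus> (b z \<otimes> S)"
        using a[OF z x0(1)] u S by (simp add: d_def b_def r_minus m_assoc)
      finally show ?thesis using eq[OF z] b[OF z] S by (simp add: l_neg)
    qed
    moreover have "\<forall>x\<in>X. d x \<in> carrier R" using c(1) u S by (auto simp: d_def)
    moreover have "\<exists>x\<in>X. d x \<noteq> \<zero>" using c(2) by (auto simp: d_def)
    ultimately show ?thesis by blast
  qed
qed

text \<open>If \<open>C\<close> had more elements than \<open>B\<close>, their coordinates with
  respect to \<open>B\<close> would satisfy a nontrivial linear relation, giving zero a second
  representation in terms of \<open>C\<close>.\<close>

lemma is_basis_card_le:
  fixes K :: "'k ring" and V :: "('k, 'v) module"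
  assumes K: "field K" and V: "module K V" and B: "is_basis K V B" and C: "is_basis K V C"
  shows "card C \<le> card B"
proof (rule ccontr)
  interpret K: field K by fact
  interpret V: abelian_group V using V by (simp add: module_def)
  interpret V: module K V by fact
  assume "\<not> ?thesis"
  then have less: "card B < card C" by simp
  have fin: "finite B" "finite C" and sub: "B \<subseteq> carrier V" "C \<subseteq> carrier V"
    using B C by (auto simp: is_basis_def)
  have "\<forall>x\<in>C. \<exists>m. m \<in> B \<rightarrow>\<^sub>E carrier K \<and> x = (\<Oplus>\<^bsub>V\<^esub>b\<in>B. m b \<odot>\<^bsub>V\<^esub> b)"
    using B sub(2) by (auto simp: is_basis_def) (meson subsetD)
  then obtain m where m: "\<And>x. x \<in> C \<Longrightarrow> m x \<in> B \<rightarrow>\<^sub>E carrier K" "\<And>x. x \<in> C \<Longrightarrow> x = (\<Oplus>\<^bsub>V\<^esub>b\<in>B. m x b \<odot>\<^bsub>V\<^esub> b)"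
    by metis
  have mc: "m x b \<in> carrier K" if "x \<in> C" "b \<in> B" for x b using m(1)[OF that(1)] that(2) by blast
  obtain c where c: "\<forall>x\<in>C. c x \<in> carrier K" "\<exists>x\<in>C. c x \<noteq> \<zero>\<^bsub>K\<^esub>"
    "\<forall>b\<in>B. (\<Oplus>\<^bsub>K\<^esub>x\<in>C. m x b \<otimes>\<^bsub>K\<^esub> c x) = \<zero>\<^bsub>K\<^esub>"
    using K.homogeneous_system[OF fin less, of "\<lambda>b x. m x b"] mc by blast
  have "(\<Oplus>\<^bsub>V\<^esub>x\<in>C. c x \<odot>\<^bsub>V\<^esub> x) = (\<Oplus>\<^bsub>V\<^esub>x\<in>C. \<Oplus>\<^bsub>V\<^esub>b\<in>B. (m x b \<otimes>\<^bsub>K\<^esub> c x) \<odot>\<^bsub>V\<^esub> b)"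
  proof (rule V.finsum_cong'[OF refl])
    fix x assume x: "x \<in> C"
    have "c x \<odot>\<^bsub>V\<^esub> x = c x \<odot>\<^bsub>V\<^esub> (\<Oplus>\<^bsub>V\<^esub>b\<in>B. m x b \<odot>\<^bsub>V\<^esub> b)" using m(2)[OF x] by simp
    also have "\<dots> = (\<Oplus>\<^bsub>V\<^esub>b\<in>B. c x \<odot>\<^bsub>V\<^esub> (m x b \<odot>\<^bsub>V\<^esub> b))"
      using c(1) x sub(1) mc[OF x] fin by (intro V.finsum_smult_ldistr) auto
    also have "\<dots> = (\<Oplus>\<^bsub>V\<^esub>b\<in>B. (m x b \<otimes>\<^bsub>K\<^esub> c x) \<odot>\<^bsub>V\<^esub> b)"
    proof (rule V.finsum_cong'[OF refl])
      fix b assume b: "b \<in> B"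
      show "c x \<odot>\<^bsub>V\<^esub> (m x b \<odot>\<^bsub>V\<^esub> b) = (m x b \<otimes>\<^bsub>K\<^esub> c x) \<odot>\<^bsub>V\<^esub> b"
        using V.smult_assoc1[of "c x" "m x b" b] K.m_comm[of "c x" "m x b"] c(1) x b sub(1) mc[OF x b] by auto
    qed (use c(1) x sub(1) mc in auto)
    finally show "c x \<odot>\<^bsub>V\<^esub> x = (\<Oplus>\<^bsub>V\<^esub>b\<in>B. (m x b \<otimes>\<^bsub>K\<^esub> c x) \<odot>\<^bsub>V\<^esub> b)" .
  qed (use c(1) sub mc in \<open>auto intro!: V.finsum_closed\<close>)
  also have "\<dots> = (\<Oplus>\<^bsub>V\<^esub>b\<in>B. \<Oplus>\<^bsub>V\<^esub>x\<in>C. (m x b \<otimes>\<^bsub>K\<^esub> c x) \<odot>\<^bsub>V\<^esub> b)"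
    using fin sub c(1) mc by (intro V.finsum_swap) auto
  also have "\<dots> = \<zero>\<^bsub>V\<^esub>"
  proof (rule V.add.finprod_one_eqI)
    fix b assume b: "b \<in> B"
    have smul: "(\<Oplus>\<^bsub>V\<^esub>x\<in>I. f x \<odot>\<^bsub>V\<^esub> b) = (\<Oplus>\<^bsub>K\<^esub>x\<in>I. f x) \<odot>\<^bsub>V\<^esub> b"
      if "finite I" "\<And>x. x \<in> I \<Longrightarrow> f x \<in> carrier K" for I and f :: "'v \<Rightarrow> 'k"
      using that
    proof (induction I rule: finite_induct)
      case empty
      then show ?case using b sub by auto
    next
      case (insert x I)
      have "(\<Oplus>\<^bsub>K\<^esub>x\<in>insert x I. f x) = f x \<oplus>\<^bsub>K\<^esub> (\<Oplus>\<^bsub>K\<^esub>x\<in>I. f x)"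
        using insert by (intro K.finsum_insert) auto
      moreover have "(\<Oplus>\<^bsub>V\<^esub>x\<in>insert x I. f x \<odot>\<^bsub>V\<^esub> b) = f x \<odot>\<^bsub>V\<^esub> b \<oplus>\<^bsub>V\<^esub> (\<Oplus>\<^bsub>V\<^esub>x\<in>I. f x \<odot>\<^bsub>V\<^esub> b)"
        using insert b sub(1) by (intro V.finsum_insert) auto
      moreover have "(\<Oplus>\<^bsub>K\<^esub>x\<in>I. f x) \<in> carrier K" using insert by (intro K.finsum_closed) auto
      ultimately show ?case using insert b sub(1) by (auto simp: V.smult_l_distr)
    qed
    have "(\<Oplus>\<^bsub>V\<^esub>x\<in>C. (m x b \<otimes>\<^bsub>K\<^esub> c x) \<odot>\<^bsub>V\<^esub> b) = (\<Oplus>\<^bsub>K\<^esub>x\<in>C. m x b \<otimes>\<^bsub>K\<^esub> c x) \<odot>\<^bsub>V\<^esub> b"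
      using fin(2) mc b c(1) by (intro smul) auto
    then show "(\<Oplus>\<^bsub>V\<^esub>x\<in>C. (m x b \<otimes>\<^bsub>K\<^esub> c x) \<odot>\<^bsub>V\<^esub> b) = \<zero>\<^bsub>V\<^esub>"
      using c(3) b sub(1) by auto
  qed
  finally have zero: "(\<Oplus>\<^bsub>V\<^esub>x\<in>C. c x \<odot>\<^bsub>V\<^esub> x) = \<zero>\<^bsub>V\<^esub>" .
  have "\<exists>!d. d \<in> C \<rightarrow>\<^sub>E carrier K \<and> \<zero>\<^bsub>V\<^esub> = (\<Oplus>\<^bsub>V\<^esub>b\<in>C. d b \<odot>\<^bsub>V\<^esub> b)"
    using C V.zero_closed unfolding is_basis_def by blast
  moreover have "restrict c C \<in> C \<rightarrow>\<^sub>E carrier K" using c(1) by auto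
  moreover have "\<zero>\<^bsub>V\<^esub> = (\<Oplus>\<^bsub>V\<^esub>x\<in>C. restrict c C x \<odot>\<^bsub>V\<^esub> x)"
  proof -
    have "(\<Oplus>\<^bsub>V\<^esub>x\<in>C. restrict c C x \<odot>\<^bsub>V\<^esub> x) = (\<Oplus>\<^bsub>V\<^esub>x\<in>C. c x \<odot>\<^bsub>V\<^esub> x)"
      using c(1) sub by (intro V.finsum_cong') auto
    with zero show ?thesis by simp
  qed
  moreover have "restrict (\<lambda>_. \<zero>\<^bsub>K\<^esub>) C \<in> C \<rightarrow>\<^sub>E carrier K" by auto
  moreover have "\<zero>\<^bsub>V\<^esub> = (\<Oplus>\<^bsub>V\<^esub>x\<in>C. restrict (\<lambda>_. \<zero>\<^bsub>K\<^esub>) C x \<odot>\<^bsub>V\<^esub> x)"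
    using sub by (intro V.add.finprod_one_eqI[symmetric]) auto
  ultimately have "restrict c C = restrict (\<lambda>_. \<zero>\<^bsub>K\<^esub>) C" by blast
  then have "restrict c C x = restrict (\<lambda>_. \<zero>\<^bsub>K\<^esub>) C x" for x by (simp only:)
  then have "c x = \<zero>\<^bsub>K\<^esub>" if "x \<in> C" for x using that by (metis restrict_apply')
  then show False using c(2) by blast
qed

text \<open>All finite bases have the same number of elements, so the choice by \<open>SOME\<close>
  does not matter.\<close>

lemma vdim_eq:
  fixes K :: "'k ring" and V :: "('k, 'v) module"
  assumes "field K" "module K V" "is_basis K V B"
  shows "vdim K V = card B"
proof -
  have "is_basis K V (SOME B. is_basis K V B)" using assms(3) by (rule someI)
  then have "card (SOME B. is_basis K V B) = card B"
    using is_basis_card_le[OF assms(1,2)] assms(3) by (intro antisym) auto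
  then show ?thesis using assms(3) by (auto simp: vdim_def)
qed

lemma dual_space_simps:
  "carrier (dual_space K V) = {\<phi> \<in> carrier V \<rightarrow>\<^sub>E carrier K.
       (\<forall>v\<in>carrier V. \<forall>w\<in>carrier V. \<phi> (v \<oplus>\<^bsub>V\<^esub> w) = \<phi> v \<oplus>\<^bsub>K\<^esub> \<phi> w) \<and>
       (\<forall>c\<in>carrier K. \<forall>v\<in>carrier V. \<phi> (c \<odot>\<^bsub>V\<^esub> v) = c \<otimes>\<^bsub>K\<^esub> \<phi> v)}"
  "ring.zero (dual_space K V) = (\<lambda>v\<in>carrier V. \<zero>\<^bsub>K\<^esub>)"
  "ring.add (dual_space K V) = (\<lambda>\<phi> \<psi>. \<lambda>v\<in>carrier V. \<phi> v \<oplus>\<^bsub>K\<^esub> \<psi> v)"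
  "smult (dual_space K V) = (\<lambda>c \<phi>. \<lambda>v\<in>carrier V. c \<otimes>\<^bsub>K\<^esub> \<phi> v)"
  by (simp_all add: dual_space_def)

lemma dual_space_module:
  fixes K :: "'k ring" and V :: "('k, 'v) module"
  assumes V: "module K V"
  shows "module K (dual_space K V)"
proof -
  interpret K: cring K using V by (simp add: module_def)
  interpret V: abelian_group V using V by (simp add: module_def)
  interpret V: module K V by fact
  let ?D = "dual_space K V"
  have cl: "\<phi> v \<in> carrier K" if "\<phi> \<in> carrier ?D" "v \<in> carrier V" for \<phi> v
    using that by (auto simp: dual_space_simps)
  have ext: "\<phi> = \<psi>" if "\<phi> \<in> carrier ?D" "\<psi> \<in> carrier ?D" "\<And>v. v \<in> carrier V \<Longrightarrow> \<phi> v = \<psi> v" for \<phi> \<psi>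
    using that(1,2) by (intro extensionalityI[OF _ _ that(3)]) (auto simp: dual_space_simps PiE_def)
  have add_closed: "\<phi> \<oplus>\<^bsub>?D\<^esub> \<psi> \<in> carrier ?D" if "\<phi> \<in> carrier ?D" "\<psi> \<in> carrier ?D" for \<phi> \<psi>
    using that by (auto simp: dual_space_simps K.r_distr K.a_ac Pi_def PiE_def)
  have smult_closed: "c \<odot>\<^bsub>?D\<^esub> \<phi> \<in> carrier ?D" if "\<phi> \<in> carrier ?D" "c \<in> carrier K" for c \<phi>
    using that by (auto simp: dual_space_simps K.r_distr K.m_lcomm Pi_def PiE_def)
  have zero_closed: "\<zero>\<^bsub>?D\<^esub> \<in> carrier ?D"
    by (auto simp: dual_space_simps)
  show ?thesis
  proof (rule moduleI[OF K.is_cring])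
    show "abelian_group ?D"
    proof (rule abelian_groupI)
      fix \<phi> assume p: "\<phi> \<in> carrier ?D"
      show "\<exists>\<psi>\<in>carrier ?D. \<psi> \<oplus>\<^bsub>?D\<^esub> \<phi> = \<zero>\<^bsub>?D\<^esub>"
      proof (rule bexI)
        show "(\<ominus>\<^bsub>K\<^esub> \<one>\<^bsub>K\<^esub>) \<odot>\<^bsub>?D\<^esub> \<phi> \<in> carrier ?D" by (rule smult_closed[OF p]) simp
        show "(\<ominus>\<^bsub>K\<^esub> \<one>\<^bsub>K\<^esub>) \<odot>\<^bsub>?D\<^esub> \<phi> \<oplus>\<^bsub>?D\<^esub> \<phi> = \<zero>\<^bsub>?D\<^esub>"
          using cl[OF p] by (auto simp: dual_space_simps(2-) K.l_minus K.l_neg fun_eq_iff restrict_def)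
      qed
      show "\<zero>\<^bsub>?D\<^esub> \<oplus>\<^bsub>?D\<^esub> \<phi> = \<phi>"
        by (rule ext[OF add_closed[OF zero_closed p] p]) (simp add: dual_space_simps(2-) cl[OF p])
      fix \<psi> assume q: "\<psi> \<in> carrier ?D"
      show "\<phi> \<oplus>\<^bsub>?D\<^esub> \<psi> = \<psi> \<oplus>\<^bsub>?D\<^esub> \<phi>"
        by (auto simp: dual_space_simps(2-) fun_eq_iff restrict_def K.a_comm cl[OF p] cl[OF q])
      fix \<chi> assume r: "\<chi> \<in> carrier ?D"
      show "\<phi> \<oplus>\<^bsub>?D\<^esub> \<psi> \<oplus>\<^bsub>?D\<^esub> \<chi> = \<phi> \<oplus>\<^bsub>?D\<^esub> (\<psi> \<oplus>\<^bsub>?D\<^esub> \<chi>)"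
        by (auto simp: dual_space_simps(2-) fun_eq_iff restrict_def K.a_assoc cl[OF p] cl[OF q] cl[OF r])
    qed (use add_closed zero_closed in auto)
    fix c \<phi> assume c: "c \<in> carrier K" and p: "\<phi> \<in> carrier ?D"
    show "c \<odot>\<^bsub>?D\<^esub> \<phi> \<in> carrier ?D" by (rule smult_closed[OF p c])
    {
      fix d assume d: "d \<in> carrier K"
      show "(c \<oplus>\<^bsub>K\<^esub> d) \<odot>\<^bsub>?D\<^esub> \<phi> = c \<odot>\<^bsub>?D\<^esub> \<phi> \<oplus>\<^bsub>?D\<^esub> d \<odot>\<^bsub>?D\<^esub> \<phi>"
        using c d by (auto simp: dual_space_simps(2-) fun_eq_iff restrict_def K.l_distr cl[OF p])
      show "(c \<otimes>\<^bsub>K\<^esub> d) \<odot>\<^bsub>?D\<^esub> \<phi> = c \<odot>\<^bsub>?D\<^esub> (d \<odot>\<^bsub>?D\<^esub> \<phi>)"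
        using c d by (auto simp: dual_space_simps(2-) fun_eq_iff restrict_def K.m_assoc cl[OF p])
    }
    fix \<psi> assume q: "\<psi> \<in> carrier ?D"
    show "c \<odot>\<^bsub>?D\<^esub> (\<phi> \<oplus>\<^bsub>?D\<^esub> \<psi>) = c \<odot>\<^bsub>?D\<^esub> \<phi> \<oplus>\<^bsub>?D\<^esub> c \<odot>\<^bsub>?D\<^esub> \<psi>"
      using c by (auto simp: dual_space_simps(2-) fun_eq_iff restrict_def K.r_distr cl[OF p] cl[OF q])
  next
    fix \<phi> assume p: "\<phi> \<in> carrier ?D"
    show "\<one>\<^bsub>K\<^esub> \<odot>\<^bsub>?D\<^esub> \<phi> = \<phi>"
      by (rule ext[OF smult_closed[OF p] p]) (simp_all add: dual_space_simps(2-) cl[OF p])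
  qed
qed

text \<open>The coordinate functions form the dual basis. It gives the dimension of the tangent
  space, which is defined as the dual of the cotangent space.\<close>

lemma dual_space_basis:
  fixes K :: "'k ring" and V :: "('k, 'v) module"
  assumes K: "field K" and V: "module K V" and B: "is_basis K V B"
  shows "\<exists>D. is_basis K (dual_space K V) D \<and> card D = card B"
proof -
  interpret K: field K by fact
  interpret V: abelian_group V using V by (simp add: module_def)
  interpret V: module K V by fact
  let ?D = "dual_space K V"
  interpret D: abelian_group ?D using dual_space_module[OF V] by (simp add: module_def)
  interpret D: module K ?D by (rule dual_space_module[OF V])
  have fin: "finite B" and sub: "B \<subseteq> carrier V"
    and uniq: "\<And>v. v \<in> carrier V \<Longrightarrow> \<exists>!c. c \<in> B \<rightarrow>\<^sub>E carrier K \<and> v = (\<Oplus>\<^bsub>V\<^esub>b\<in>B. c b \<odot>\<^bsub>V\<^esub> b)"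
    using B by (auto simp: is_basis_def)
  \<comment> \<open>The coordinates of \<open>v\<close>; their uniqueness makes them linear in
    \<open>v\<close>.\<close>
  define co where "co v = (THE c. c \<in> B \<rightarrow>\<^sub>E carrier K \<and> v = (\<Oplus>\<^bsub>V\<^esub>b\<in>B. c b \<odot>\<^bsub>V\<^esub> b))" for v
  have co: "co v \<in> B \<rightarrow>\<^sub>E carrier K" "v = (\<Oplus>\<^bsub>V\<^esub>b\<in>B. co v b \<odot>\<^bsub>V\<^esub> b)" if "v \<in> carrier V" for v
    using theI'[OF uniq[OF that]] by (auto simp: co_def)
  have coI: "co v b = c b"
    if "v = (\<Oplus>\<^bsub>V\<^esub>b\<in>B. c b \<odot>\<^bsub>V\<^esub> b)" "\<And>b. b \<in> B \<Longrightarrow> c b \<in> carrier K" "v \<in> carrier V" "b \<in> B" for v c b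
  proof -
    have "(\<Oplus>\<^bsub>V\<^esub>b\<in>B. restrict c B b \<odot>\<^bsub>V\<^esub> b) = (\<Oplus>\<^bsub>V\<^esub>b\<in>B. c b \<odot>\<^bsub>V\<^esub> b)"
      using that(2) sub by (intro V.finsum_cong') auto
    then have "restrict c B \<in> B \<rightarrow>\<^sub>E carrier K \<and> v = (\<Oplus>\<^bsub>V\<^esub>b\<in>B. restrict c B b \<odot>\<^bsub>V\<^esub> b)"
      using that by auto
    then have "co v = restrict c B" using uniq[OF that(3)] co[OF that(3)] by blast
    then show ?thesis using that(4) by simp
  qed
  have cob: "co v b \<in> carrier K" if "v \<in> carrier V" "b \<in> B" for v b using co(1)[OF that(1)] that(2) by blast
  have co_add: "co (v \<oplus>\<^bsub>V\<^esub> w) b = co v b \<oplus>\<^bsub>K\<^esub> co w b" if "v \<in> carrier V" "w \<in> carrier V" "b \<in> B" for v w b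
  proof (rule coI)
    have "v \<oplus>\<^bsub>V\<^esub> w = (\<Oplus>\<^bsub>V\<^esub>b\<in>B. co v b \<odot>\<^bsub>V\<^esub> b) \<oplus>\<^bsub>V\<^esub> (\<Oplus>\<^bsub>V\<^esub>b\<in>B. co w b \<odot>\<^bsub>V\<^esub> b)"
      using co(2)[OF that(1)] co(2)[OF that(2)] by simp
    also have "\<dots> = (\<Oplus>\<^bsub>V\<^esub>b\<in>B. co v b \<odot>\<^bsub>V\<^esub> b \<oplus>\<^bsub>V\<^esub> co w b \<odot>\<^bsub>V\<^esub> b)"
      using cob that sub by (intro V.finsum_addf[symmetric]) auto
    also have "\<dots> = (\<Oplus>\<^bsub>V\<^esub>b\<in>B. (co v b \<oplus>\<^bsub>K\<^esub> co w b) \<odot>\<^bsub>V\<^esub> b)"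
      using cob that sub by (intro V.finsum_cong') (auto simp: V.smult_l_distr subset_iff)
    finally show "v \<oplus>\<^bsub>V\<^esub> w = (\<Oplus>\<^bsub>V\<^esub>b\<in>B. (co v b \<oplus>\<^bsub>K\<^esub> co w b) \<odot>\<^bsub>V\<^esub> b)" .
  qed (use that cob in auto)
  have co_smult: "co (c \<odot>\<^bsub>V\<^esub> v) b = c \<otimes>\<^bsub>K\<^esub> co v b" if "v \<in> carrier V" "c \<in> carrier K" "b \<in> B" for c v b
  proof (rule coI)
    have "c \<odot>\<^bsub>V\<^esub> v = c \<odot>\<^bsub>V\<^esub> (\<Oplus>\<^bsub>V\<^esub>b\<in>B. co v b \<odot>\<^bsub>V\<^esub> b)" using co(2)[OF that(1)] by simp
    also have "\<dots> = (\<Oplus>\<^bsub>V\<^esub>b\<in>B. c \<odot>\<^bsub>V\<^esub> (co v b \<odot>\<^bsub>V\<^esub> b))"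
      using cob that sub fin by (intro V.finsum_smult_ldistr) auto
    also have "\<dots> = (\<Oplus>\<^bsub>V\<^esub>b\<in>B. (c \<otimes>\<^bsub>K\<^esub> co v b) \<odot>\<^bsub>V\<^esub> b)"
      using cob that sub by (intro V.finsum_cong') (auto simp: V.smult_assoc1 subset_iff)
    finally show "c \<odot>\<^bsub>V\<^esub> v = (\<Oplus>\<^bsub>V\<^esub>b\<in>B. (c \<otimes>\<^bsub>K\<^esub> co v b) \<odot>\<^bsub>V\<^esub> b)" .
  qed (use that cob in auto)
  have co_basis: "co b b' = (if b = b' then \<one>\<^bsub>K\<^esub> else \<zero>\<^bsub>K\<^esub>)" if "b \<in> B" "b' \<in> B" for b b'
  proof (rule coI)
    have bV: "b \<in> carrier V" using that(1) sub by blast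
    have "(\<Oplus>\<^bsub>V\<^esub>b'\<in>B. (if b = b' then \<one>\<^bsub>K\<^esub> else \<zero>\<^bsub>K\<^esub>) \<odot>\<^bsub>V\<^esub> b') = (if b = b then \<one>\<^bsub>K\<^esub> else \<zero>\<^bsub>K\<^esub>) \<odot>\<^bsub>V\<^esub> b"
      using that(1) sub fin bV by (intro V.finsum_single) auto
    then show "b = (\<Oplus>\<^bsub>V\<^esub>b'\<in>B. (if b = b' then \<one>\<^bsub>K\<^esub> else \<zero>\<^bsub>K\<^esub>) \<odot>\<^bsub>V\<^esub> b')" using bV by simp
  qed (use that sub in auto)
  define \<delta> where "\<delta> b = (\<lambda>v\<in>carrier V. co v b)" for b
  have \<delta>: "\<delta> b \<in> carrier ?D" if "b \<in> B" for b
    using that cob co_add co_smult by (auto simp: \<delta>_def dual_space_simps(1))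
  have inj: "inj_on \<delta> B"
  proof (rule inj_onI, rule ccontr)
    fix b b' assume bb: "b \<in> B" "b' \<in> B" "\<delta> b = \<delta> b'" "b \<noteq> b'"
    have "\<delta> b b = \<delta> b' b" using bb(3) by simp
    moreover have "b \<in> carrier V" using bb(1) sub by blast
    ultimately have "co b b = co b b'" by (simp add: \<delta>_def)
    then show False using co_basis bb K.one_not_zero by simp
  qed
  have dsum: "(\<Oplus>\<^bsub>?D\<^esub>i\<in>I. f i) v = (\<Oplus>\<^bsub>K\<^esub>i\<in>I. f i v)"
    if "finite I" "\<And>i. i \<in> I \<Longrightarrow> f i \<in> carrier ?D" "v \<in> carrier V" for I and f :: "'v \<Rightarrow> 'v \<Rightarrow> 'k" and v
    using that(1,2)
  proof (induction I rule: finite_induct)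
    case empty
    then show ?case using that(3) by (simp add: dual_space_simps(2))
  next
    case (insert i I)
    have fv: "f j v \<in> carrier K" if "j \<in> insert i I" for j
      using insert.prems[OF that] \<open>v \<in> carrier V\<close> by (auto simp: dual_space_simps(1))
    have "(\<Oplus>\<^bsub>?D\<^esub>i\<in>insert i I. f i) = f i \<oplus>\<^bsub>?D\<^esub> (\<Oplus>\<^bsub>?D\<^esub>i\<in>I. f i)"
      using insert by (intro D.finsum_insert) auto
    moreover have "(\<Oplus>\<^bsub>K\<^esub>i\<in>insert i I. f i v) = f i v \<oplus>\<^bsub>K\<^esub> (\<Oplus>\<^bsub>K\<^esub>i\<in>I. f i v)"
      using insert.hyps fv by (intro K.finsum_insert) auto
    ultimately show ?case using insert that(3) by (simp add: dual_space_simps(3))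
  qed
  have comb: "(\<Oplus>\<^bsub>?D\<^esub>b\<in>B. c b \<odot>\<^bsub>?D\<^esub> \<delta> b) v = (\<Oplus>\<^bsub>K\<^esub>b\<in>B. c b \<otimes>\<^bsub>K\<^esub> co v b)"
    if "\<And>b. b \<in> B \<Longrightarrow> c b \<in> carrier K" "v \<in> carrier V" for c v
  proof -
    have "(\<Oplus>\<^bsub>?D\<^esub>b\<in>B. c b \<odot>\<^bsub>?D\<^esub> \<delta> b) v = (\<Oplus>\<^bsub>K\<^esub>b\<in>B. (c b \<odot>\<^bsub>?D\<^esub> \<delta> b) v)"
      using that \<delta> fin by (intro dsum) auto
    then show ?thesis using that(2) by (simp add: dual_space_simps(4) \<delta>_def)
  qed
  have comb_basis: "(\<Oplus>\<^bsub>?D\<^esub>b\<in>B. c b \<odot>\<^bsub>?D\<^esub> \<delta> b) b' = c b'"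
    if c: "\<And>b. b \<in> B \<Longrightarrow> c b \<in> carrier K" and b': "b' \<in> B" for c b'
  proof -
    have bV: "b' \<in> carrier V" using b' sub by blast
    have "(\<Oplus>\<^bsub>K\<^esub>b\<in>B. c b \<otimes>\<^bsub>K\<^esub> co b' b) = c b' \<otimes>\<^bsub>K\<^esub> co b' b'"
      using c b' fin co_basis[OF b'] by (intro K.finsum_single) auto
    then show ?thesis using comb[of c b', OF c bV] co_basis[OF b' b'] c[OF b'] by simp
  qed
  have "is_basis K ?D (\<delta> ` B)"
    unfolding is_basis_def
  proof (intro conjI ballI)
    show "finite (\<delta> ` B)" using fin by simp
    show "\<delta> ` B \<subseteq> carrier ?D" using \<delta> by blast
    fix \<phi> assume p: "\<phi> \<in> carrier ?D"
    have pc: "\<phi> v \<in> carrier K" if "v \<in> carrier V" for v using p that by (auto simp: dual_space_simps(1))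
    have padd: "\<phi> (v \<oplus>\<^bsub>V\<^esub> w) = \<phi> v \<oplus>\<^bsub>K\<^esub> \<phi> w" "c \<in> carrier K \<Longrightarrow> \<phi> (c \<odot>\<^bsub>V\<^esub> v) = c \<otimes>\<^bsub>K\<^esub> \<phi> v"
      if "v \<in> carrier V" "w \<in> carrier V" for v w c using p that by (auto simp: dual_space_simps(1))
    have psum: "\<phi> (\<Oplus>\<^bsub>V\<^esub>b\<in>I. f b) = (\<Oplus>\<^bsub>K\<^esub>b\<in>I. \<phi> (f b))"
      if "finite I" "\<And>b. b \<in> I \<Longrightarrow> f b \<in> carrier V" for I and f :: "'v \<Rightarrow> 'v"
      using that
    proof (induction I rule: finite_induct)
      case empty
      have "\<phi> (\<zero>\<^bsub>K\<^esub> \<odot>\<^bsub>V\<^esub> \<zero>\<^bsub>V\<^esub>) = \<zero>\<^bsub>K\<^esub>" using padd(2)[of "\<zero>\<^bsub>V\<^esub>" "\<zero>\<^bsub>V\<^esub>" "\<zero>\<^bsub>K\<^esub>"] pc by simp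
      then show ?case by simp
    next
      case (insert b I)
      have "(\<Oplus>\<^bsub>V\<^esub>b\<in>insert b I. f b) = f b \<oplus>\<^bsub>V\<^esub> (\<Oplus>\<^bsub>V\<^esub>b\<in>I. f b)"
        using insert by (intro V.finsum_insert) auto
      moreover have "(\<Oplus>\<^bsub>K\<^esub>b\<in>insert b I. \<phi> (f b)) = \<phi> (f b) \<oplus>\<^bsub>K\<^esub> (\<Oplus>\<^bsub>K\<^esub>b\<in>I. \<phi> (f b))"
        using insert pc by (intro K.finsum_insert) auto
      moreover have "(\<Oplus>\<^bsub>V\<^esub>b\<in>I. f b) \<in> carrier V" using insert by (intro V.finsum_closed) auto
      ultimately show ?case using insert padd(1) by simp
    qed
    let ?g = "inv_into B \<delta>"
    have g: "?g (\<delta> b) = b" if "b \<in> B" for b using inj that by simp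
    have reindex: "(\<Oplus>\<^bsub>?D\<^esub>d\<in>\<delta> ` B. c d \<odot>\<^bsub>?D\<^esub> d) = (\<Oplus>\<^bsub>?D\<^esub>b\<in>B. c (\<delta> b) \<odot>\<^bsub>?D\<^esub> \<delta> b)"
      if "\<And>d. d \<in> \<delta> ` B \<Longrightarrow> c d \<in> carrier K" for c
      using that \<delta> inj by (intro D.finsum_reindex) auto
    show "\<exists>!c. c \<in> \<delta> ` B \<rightarrow>\<^sub>E carrier K \<and> \<phi> = (\<Oplus>\<^bsub>?D\<^esub>d\<in>\<delta> ` B. c d \<odot>\<^bsub>?D\<^esub> d)"
    proof (rule ex1I)
      let ?c = "restrict (\<lambda>d. \<phi> (?g d)) (\<delta> ` B)"
      have cB: "?c (\<delta> b) = \<phi> b" if "b \<in> B" for b using g[OF that] that by simp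
      have pB: "\<phi> b \<in> carrier K" if "b \<in> B" for b using that sub pc by blast
      have cc: "?c \<in> \<delta> ` B \<rightarrow>\<^sub>E carrier K" using cB pB by auto
      have "(\<Oplus>\<^bsub>?D\<^esub>d\<in>\<delta> ` B. ?c d \<odot>\<^bsub>?D\<^esub> d) = (\<Oplus>\<^bsub>?D\<^esub>b\<in>B. ?c (\<delta> b) \<odot>\<^bsub>?D\<^esub> \<delta> b)"
        using cc by (intro reindex) blast
      also have "\<dots> = (\<Oplus>\<^bsub>?D\<^esub>b\<in>B. \<phi> b \<odot>\<^bsub>?D\<^esub> \<delta> b)"
        using cB pB \<delta> by (intro D.finsum_cong') auto
      also have "\<dots> = \<phi>"
      proof (rule extensionalityI[of _ "carrier V"])
        have "(\<Oplus>\<^bsub>?D\<^esub>b\<in>B. \<phi> b \<odot>\<^bsub>?D\<^esub> \<delta> b) \<in> carrier ?D" using pB \<delta> by (intro D.finsum_closed) auto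
        then show "(\<Oplus>\<^bsub>?D\<^esub>b\<in>B. \<phi> b \<odot>\<^bsub>?D\<^esub> \<delta> b) \<in> extensional (carrier V)"
          by (auto simp: dual_space_simps(1) PiE_def)
        show "\<phi> \<in> extensional (carrier V)" using p by (auto simp: dual_space_simps(1) PiE_def)
        fix v assume v: "v \<in> carrier V"
        have "\<phi> v = \<phi> (\<Oplus>\<^bsub>V\<^esub>b\<in>B. co v b \<odot>\<^bsub>V\<^esub> b)" using co(2)[OF v] by simp
        also have "\<dots> = (\<Oplus>\<^bsub>K\<^esub>b\<in>B. \<phi> (co v b \<odot>\<^bsub>V\<^esub> b))"
          using fin cob[OF v] sub by (intro psum) auto
        also have "\<dots> = (\<Oplus>\<^bsub>K\<^esub>b\<in>B. \<phi> b \<otimes>\<^bsub>K\<^esub> co v b)"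
        proof (rule K.finsum_cong'[OF refl])
          fix b assume b: "b \<in> B"
          then have bV: "b \<in> carrier V" using sub by blast
          show "\<phi> (co v b \<odot>\<^bsub>V\<^esub> b) = \<phi> b \<otimes>\<^bsub>K\<^esub> co v b"
            using padd(2)[OF bV bV cob[OF v b]] K.m_comm[OF cob[OF v b] pc[OF bV]] by simp
        qed (use pB cob[OF v] in auto)
        also have "\<dots> = (\<Oplus>\<^bsub>?D\<^esub>b\<in>B. \<phi> b \<odot>\<^bsub>?D\<^esub> \<delta> b) v" using comb[of \<phi> v, OF pB v] by simp
        finally show "(\<Oplus>\<^bsub>?D\<^esub>b\<in>B. \<phi> b \<odot>\<^bsub>?D\<^esub> \<delta> b) v = \<phi> v" by simp
      qed
      finally show "?c \<in> \<delta> ` B \<rightarrow>\<^sub>E carrier K \<and> \<phi> = (\<Oplus>\<^bsub>?D\<^esub>d\<in>\<delta> ` B. ?c d \<odot>\<^bsub>?D\<^esub> d)" using cc by simp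
      fix c assume c: "c \<in> \<delta> ` B \<rightarrow>\<^sub>E carrier K \<and> \<phi> = (\<Oplus>\<^bsub>?D\<^esub>d\<in>\<delta> ` B. c d \<odot>\<^bsub>?D\<^esub> d)"
      have ccl: "c (\<delta> b) \<in> carrier K" if "b \<in> B" for b using c that by blast
      have "\<phi> = (\<Oplus>\<^bsub>?D\<^esub>b\<in>B. c (\<delta> b) \<odot>\<^bsub>?D\<^esub> \<delta> b)" using c reindex[of c] by (metis PiE_mem)
      then have "\<phi> b = c (\<delta> b)" if "b \<in> B" for b using comb_basis[of "\<lambda>b. c (\<delta> b)", OF ccl that] by (simp only:)
      then show "c = ?c" using c g by (intro extensionalityI[of _ "\<delta> ` B"]) (auto simp: PiE_def)
    qed
  qed
  moreover have "card (\<delta> ` B) = card B" using inj by (rule card_image)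
  ultimately show ?thesis by blast
qed


section \<open>Generators of a connected graded algebra\<close>

context connected_graded_algebra
begin

definition lincomb :: "'a set \<Rightarrow> ('a \<Rightarrow> 'k) \<Rightarrow> 'a" where
  "lincomb T c = (\<Oplus>\<^bsub>R\<^esub>t\<in>T. c t \<odot>\<^bsub>R\<^esub> t)"

abbreviation irrelevant_square :: "'a set" where
  "irrelevant_square \<equiv> ideal_prod R irrelevant irrelevant"

lemma irrelevant_carrier: "irrelevant \<subseteq> carrier R"
  by (auto simp: irrelevant_def)

lemma irrelevant_square_ideal: "ideal irrelevant_square R"
  by (rule A.ideal_prod_is_ideal[OF irrelevant_ideal irrelevant_ideal])

lemma lincomb_closed:
  "T \<subseteq> carrier R \<Longrightarrow> (\<And>t. t \<in> T \<Longrightarrow> c t \<in> carrier K) \<Longrightarrow> lincomb T c \<in> carrier R"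
  unfolding lincomb_def by (rule A.finsum_closed) auto

lemma lincomb_irrelevant:
  "T \<subseteq> irrelevant \<Longrightarrow> (\<And>t. t \<in> T \<Longrightarrow> c t \<in> carrier K) \<Longrightarrow> lincomb T c \<in> irrelevant"
  unfolding lincomb_def
  by (rule ideal.finsum_in_ideal[OF irrelevant_ideal]) (auto simp: irrelevant_def comp_smult)

lemma lincomb_add:
  assumes "T \<subseteq> carrier R" "\<And>t. t \<in> T \<Longrightarrow> c t \<in> carrier K" "\<And>t. t \<in> T \<Longrightarrow> d t \<in> carrier K"
  shows "lincomb T (\<lambda>t. c t \<oplus>\<^bsub>K\<^esub> d t) = lincomb T c \<oplus>\<^bsub>R\<^esub> lincomb T d"
proof -
  have "lincomb T (\<lambda>t. c t \<oplus>\<^bsub>K\<^esub> d t) = (\<Oplus>\<^bsub>R\<^esub>t\<in>T. c t \<odot>\<^bsub>R\<^esub> t \<oplus>\<^bsub>R\<^esub> d t \<odot>\<^bsub>R\<^esub> t)"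
    unfolding lincomb_def using assms by (intro A.finsum_cong') (auto simp: A.smult_l_distr subset_iff)
  also have "\<dots> = lincomb T c \<oplus>\<^bsub>R\<^esub> lincomb T d"
    unfolding lincomb_def using assms by (intro A.finsum_addf) auto
  finally show ?thesis .
qed

lemma lincomb_smult:
  assumes "finite T" "T \<subseteq> carrier R" "\<And>t. t \<in> T \<Longrightarrow> c t \<in> carrier K" "a \<in> carrier K"
  shows "lincomb T (\<lambda>t. a \<otimes>\<^bsub>K\<^esub> c t) = a \<odot>\<^bsub>R\<^esub> lincomb T c"
proof -
  have "lincomb T (\<lambda>t. a \<otimes>\<^bsub>K\<^esub> c t) = (\<Oplus>\<^bsub>R\<^esub>t\<in>T. a \<odot>\<^bsub>R\<^esub> (c t \<odot>\<^bsub>R\<^esub> t))"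
    unfolding lincomb_def using assms by (intro A.finsum_cong') (auto simp: A.smult_assoc1 subset_iff)
  also have "\<dots> = a \<odot>\<^bsub>R\<^esub> lincomb T c"
    unfolding lincomb_def using assms by (intro A.finsum_smult_ldistr[symmetric]) auto
  finally show ?thesis .
qed

text \<open>Spanning of the irrelevant ideal modulo its square, in \<open>R\<close> itself; the
  passage to the local ring is made in \<open>cotangent_basis\<close>.\<close>

definition spans_cotangent :: "'a set \<Rightarrow> bool" where
  "spans_cotangent T \<longleftrightarrow> (\<forall>x\<in>irrelevant. \<exists>c. (\<forall>t\<in>T. c t \<in> carrier K) \<and> x \<ominus>\<^bsub>R\<^esub> lincomb T c \<in> irrelevant_square)"

lemma comp_irrelevant: "x \<in> carrier R \<Longrightarrow> 0 < i \<Longrightarrow> comp i x \<in> irrelevant"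
  by (simp add: irrelevant_def comp_comp comp_closed)

text \<open>Generators of a homogeneous ideal may be replaced by their components; those of degree 0
  are left out because they vanish on the irrelevant ideal.\<close>

lemma homogeneous_generators:
  "\<exists>G. finite G \<and> G \<subseteq> irrelevant \<and> (\<forall>g\<in>G. \<exists>d. comp d g = g) \<and> irrelevant = genideal R G"
proof -
  interpret N: noetherian_ring R by (rule noetherian)
  obtain B where B: "B \<subseteq> carrier R" "finite B" "irrelevant = genideal R B"
    using N.finetely_gen[OF irrelevant_ideal] by blast
  have BM: "B \<subseteq> irrelevant" using A.genideal_self[OF B(1)] B(3) by simp
  have "\<forall>b\<in>B. \<exists>k. \<forall>i\<ge>k. comp i b = \<zero>\<^bsub>R\<^esub>" using comp_finite B(1) by blast
  then obtain k where k: "\<And>b i. b \<in> B \<Longrightarrow> i \<ge> k b \<Longrightarrow> comp i b = \<zero>\<^bsub>R\<^esub>" by metis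
  define G where "G = (\<Union>b\<in>B. (\<lambda>i. comp i b) ` {1..<k b})"
  have Gf: "finite G" using B(2) by (simp add: G_def)
  have GM: "G \<subseteq> irrelevant" using B(1) comp_irrelevant by (auto simp: G_def)
  have Gh: "\<exists>d. comp d g = g" if "g \<in> G" for g
  proof -
    obtain b i where "b \<in> B" "g = comp i b" using \<open>g \<in> G\<close> by (auto simp: G_def)
    then have "comp i g = g" using B(1) comp_comp[of b i i] by auto
    then show ?thesis by blast
  qed
  have Gc: "G \<subseteq> carrier R" using GM irrelevant_carrier by blast
  interpret G: ideal "genideal R G" R by (rule A.genideal_ideal[OF Gc])
  have "b \<in> genideal R G" if b: "b \<in> B" for b
  proof -
    have "b = (\<Oplus>\<^bsub>R\<^esub>i\<in>{..<k b}. comp i b)"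
      by (rule comp_sum) (use b B(1) k in auto)
    also have "\<dots> \<in> genideal R G"
    proof (rule G.finsum_in_ideal)
      fix i assume i: "i \<in> {..<k b}"
      show "comp i b \<in> genideal R G"
      proof (cases "i = 0")
        case True
        then have "comp i b = \<zero>\<^bsub>R\<^esub>" using b BM by (auto simp: irrelevant_def)
        then show ?thesis by simp
      next
        case False
        then have "i \<in> {1..<k b}" using i by auto
        then have "comp i b \<in> G" unfolding G_def using b by blast
        then show ?thesis using A.genideal_self[OF Gc] by blast
      qed
    qed
    finally show ?thesis .
  qed
  then have "genideal R B \<subseteq> genideal R G" by (intro A.genideal_minimal G.is_ideal) blast
  moreover have "genideal R G \<subseteq> irrelevant" by (rule A.genideal_minimal[OF irrelevant_ideal GM])
  ultimately have "irrelevant = genideal R G" using B(3) by blast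
  with Gf GM Gh show ?thesis by blast
qed

text \<open>The elements congruent to a linear combination of \<open>G\<close> modulo the square
  form an ideal: multiplication by \<open>y\<close> may be replaced by multiplication by the scalar
  \<open>comp 0 y\<close>, since \<open>y\<close> minus this scalar is irrelevant and its product
  with an irrelevant combination lies in the square.\<close>

lemma generators_span:
  assumes fin: "finite G" and GM: "G \<subseteq> irrelevant" and gen: "irrelevant = genideal R G"
  shows "spans_cotangent G"
proof -
  interpret Q: ideal irrelevant_square R by (rule irrelevant_square_ideal)
  interpret M: ideal irrelevant R by (rule irrelevant_ideal)
  have Gc: "G \<subseteq> carrier R" using GM irrelevant_carrier by blast
  let ?Y = "{x \<in> carrier R. \<exists>c. (\<forall>t\<in>G. c t \<in> carrier K) \<and> x \<ominus>\<^bsub>R\<^esub> lincomb G c \<in> irrelevant_square}"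
  have "ideal ?Y R"
  proof (rule A.idealI_comm)
    have "lincomb G (\<lambda>_. \<zero>\<^bsub>K\<^esub>) = \<zero>\<^bsub>R\<^esub>"
      unfolding lincomb_def using Gc by (intro A.add.finprod_one_eqI) auto
    then show "\<zero>\<^bsub>R\<^esub> \<in> ?Y" by (auto intro!: exI[of _ "\<lambda>_. \<zero>\<^bsub>K\<^esub>"] simp: a_minus_def)
    fix x y assume "x \<in> ?Y"
    then obtain c where x: "x \<in> carrier R" and c: "\<And>t. t \<in> G \<Longrightarrow> c t \<in> carrier K" "x \<ominus>\<^bsub>R\<^esub> lincomb G c \<in> irrelevant_square" by blast
    have lc: "lincomb G c \<in> carrier R" by (rule lincomb_closed[OF Gc c(1)])
    {
      assume "y \<in> ?Y"
      then obtain d where y: "y \<in> carrier R" and d: "\<And>t. t \<in> G \<Longrightarrow> d t \<in> carrier K" "y \<ominus>\<^bsub>R\<^esub> lincomb G d \<in> irrelevant_square" by blast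
      have ld: "lincomb G d \<in> carrier R" by (rule lincomb_closed[OF Gc d(1)])
      have "(x \<ominus>\<^bsub>R\<^esub> lincomb G c) \<oplus>\<^bsub>R\<^esub> (y \<ominus>\<^bsub>R\<^esub> lincomb G d) \<in> irrelevant_square" by (rule Q.a_closed[OF c(2) d(2)])
      moreover have "(x \<ominus>\<^bsub>R\<^esub> lincomb G c) \<oplus>\<^bsub>R\<^esub> (y \<ominus>\<^bsub>R\<^esub> lincomb G d) = (x \<oplus>\<^bsub>R\<^esub> y) \<ominus>\<^bsub>R\<^esub> (lincomb G c \<oplus>\<^bsub>R\<^esub> lincomb G d)"
        using x y lc ld by algebra
      ultimately have "(x \<oplus>\<^bsub>R\<^esub> y) \<ominus>\<^bsub>R\<^esub> lincomb G (\<lambda>t. c t \<oplus>\<^bsub>K\<^esub> d t) \<in> irrelevant_square"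
        by (simp only: lincomb_add[OF Gc c(1) d(1)])
      then show "x \<oplus>\<^bsub>R\<^esub> y \<in> ?Y"
        using x y c(1) d(1) by (auto intro!: exI[of _ "\<lambda>t. c t \<oplus>\<^bsub>K\<^esub> d t"])
    }
    assume y: "y \<in> carrier R"
    obtain a where a: "a \<in> carrier K" "comp 0 y = scalar R a" using comp_0[OF y] by blast
    have sa: "scalar R a \<in> carrier R" using a by simp
    have "y \<ominus>\<^bsub>R\<^esub> scalar R a \<in> irrelevant"
    proof -
      have "comp 0 (\<ominus>\<^bsub>R\<^esub> \<one>\<^bsub>R\<^esub> \<otimes>\<^bsub>R\<^esub> scalar R a) = comp 0 (\<ominus>\<^bsub>R\<^esub> \<one>\<^bsub>R\<^esub>) \<otimes>\<^bsub>R\<^esub> scalar R a"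
        using sa by (simp add: comp_0_mult comp_0_scalar[OF a(1)])
      moreover have "comp 0 (\<ominus>\<^bsub>R\<^esub> \<one>\<^bsub>R\<^esub>) = \<ominus>\<^bsub>R\<^esub> \<one>\<^bsub>R\<^esub>"
      proof -
        have "comp 0 (\<ominus>\<^bsub>R\<^esub> \<one>\<^bsub>R\<^esub>) \<oplus>\<^bsub>R\<^esub> \<one>\<^bsub>R\<^esub> = \<zero>\<^bsub>R\<^esub>"
          using comp_add[of "\<ominus>\<^bsub>R\<^esub> \<one>\<^bsub>R\<^esub>" "\<one>\<^bsub>R\<^esub>" 0] by (simp add: A.l_neg)
        then show ?thesis using A.minus_equality[of "comp 0 (\<ominus>\<^bsub>R\<^esub> \<one>\<^bsub>R\<^esub>)" "\<one>\<^bsub>R\<^esub>"] comp_closed by simp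
      qed
      ultimately have "comp 0 (\<ominus>\<^bsub>R\<^esub> scalar R a) = \<ominus>\<^bsub>R\<^esub> scalar R a" using sa by (simp add: A.l_minus)
      then have "comp 0 (y \<ominus>\<^bsub>R\<^esub> scalar R a) = scalar R a \<oplus>\<^bsub>R\<^esub> \<ominus>\<^bsub>R\<^esub> scalar R a"
        unfolding a_minus_def using comp_add[OF y A.a_inv_closed[OF sa]] a(2) by simp
      then have "comp 0 (y \<ominus>\<^bsub>R\<^esub> scalar R a) = \<zero>\<^bsub>R\<^esub>" by (simp only: A.r_neg[OF sa])
      moreover have "y \<ominus>\<^bsub>R\<^esub> scalar R a \<in> carrier R" by (rule A.minus_closed[OF y sa])
      ultimately show ?thesis unfolding irrelevant_def by blast
    qed
    then have 1: "(y \<ominus>\<^bsub>R\<^esub> scalar R a) \<otimes>\<^bsub>R\<^esub> lincomb G c \<in> irrelevant_square"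
      using lincomb_irrelevant[OF GM c(1)] by (rule ideal_prod.prod)
    have "y \<otimes>\<^bsub>R\<^esub> (x \<ominus>\<^bsub>R\<^esub> lincomb G c) \<in> irrelevant_square" by (rule Q.I_l_closed[OF c(2) y])
    from Q.a_closed[OF this 1]
    have "y \<otimes>\<^bsub>R\<^esub> (x \<ominus>\<^bsub>R\<^esub> lincomb G c) \<oplus>\<^bsub>R\<^esub> (y \<ominus>\<^bsub>R\<^esub> scalar R a) \<otimes>\<^bsub>R\<^esub> lincomb G c \<in> irrelevant_square" .
    \<comment> \<open>The two members of the square add up to \<open>y x\<close> minus the scalar
      multiple of the combination.\<close>
    moreover have "y \<otimes>\<^bsub>R\<^esub> (x \<ominus>\<^bsub>R\<^esub> l) \<oplus>\<^bsub>R\<^esub> (y \<ominus>\<^bsub>R\<^esub> s) \<otimes>\<^bsub>R\<^esub> l = y \<otimes>\<^bsub>R\<^esub> x \<ominus>\<^bsub>R\<^esub> s \<otimes>\<^bsub>R\<^esub> l"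
      if "l \<in> carrier R" "s \<in> carrier R" for l s
      using x y that by algebra
    ultimately have "y \<otimes>\<^bsub>R\<^esub> x \<ominus>\<^bsub>R\<^esub> scalar R a \<otimes>\<^bsub>R\<^esub> lincomb G c \<in> irrelevant_square"
      using lc sa by simp
    moreover have "scalar R a \<otimes>\<^bsub>R\<^esub> lincomb G c = lincomb G (\<lambda>t. a \<otimes>\<^bsub>K\<^esub> c t)"
      using lincomb_smult[OF fin Gc c(1) a(1)] lc a(1) by (simp add: A.smult_assoc2)
    ultimately show "y \<otimes>\<^bsub>R\<^esub> x \<in> ?Y"
      using x y a(1) c(1) by (auto intro!: exI[of _ "\<lambda>t. a \<otimes>\<^bsub>K\<^esub> c t"])
  qed blast
  moreover have "G \<subseteq> ?Y"
  proof
    fix g assume g: "g \<in> G"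
    then have gc: "g \<in> carrier R" using Gc by blast
    have "lincomb G (\<lambda>t. if t = g then \<one>\<^bsub>K\<^esub> else \<zero>\<^bsub>K\<^esub>) = (if g = g then \<one>\<^bsub>K\<^esub> else \<zero>\<^bsub>K\<^esub>) \<odot>\<^bsub>R\<^esub> g"
      unfolding lincomb_def using g gc Gc by (intro A.finsum_single fin) auto
    then have "lincomb G (\<lambda>t. if t = g then \<one>\<^bsub>K\<^esub> else \<zero>\<^bsub>K\<^esub>) = g" using gc by simp
    then have "g \<ominus>\<^bsub>R\<^esub> lincomb G (\<lambda>t. if t = g then \<one>\<^bsub>K\<^esub> else \<zero>\<^bsub>K\<^esub>) \<in> irrelevant_square"
      using gc by (simp add: A.r_neg a_minus_def)
    then show "g \<in> ?Y" using gc by (auto intro!: exI[of _ "\<lambda>t. if t = g then \<one>\<^bsub>K\<^esub> else \<zero>\<^bsub>K\<^esub>"])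
  qed
  ultimately have "irrelevant \<subseteq> ?Y" unfolding gen by (rule A.genideal_minimal)
  then show ?thesis unfolding spans_cotangent_def by blast
qed

lemma lincomb_remove:
  assumes fin: "finite T" and Tc: "T \<subseteq> carrier R" and c: "\<And>t. t \<in> T \<Longrightarrow> c t \<in> carrier K" and s: "s \<in> T"
  shows "lincomb T c = c s \<odot>\<^bsub>R\<^esub> s \<oplus>\<^bsub>R\<^esub> lincomb (T - {s}) c"
proof -
  have "T = insert s (T - {s})" using s by blast
  then have "lincomb T c = (\<Oplus>\<^bsub>R\<^esub>t\<in>insert s (T - {s}). c t \<odot>\<^bsub>R\<^esub> t)" by (simp add: lincomb_def)
  also have "\<dots> = c s \<odot>\<^bsub>R\<^esub> s \<oplus>\<^bsub>R\<^esub> lincomb (T - {s}) c"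
    unfolding lincomb_def using assms by (intro A.finsum_insert) auto
  finally show ?thesis .
qed

text \<open>Among the finite homogeneous sets that span modulo the square, take one of least size: a
  relation with nonzero coefficient at \<open>s\<close> would express \<open>s\<close> by the
  others, so that \<open>s\<close> could be dropped. Dropping elements, unlike a general change of
  basis, preserves homogeneity.\<close>

lemma minimal_generators:
  "\<exists>T. finite T \<and> T \<subseteq> irrelevant \<and> (\<forall>t\<in>T. \<exists>d. comp d t = t) \<and> spans_cotangent T \<and>
     (\<forall>c. (\<forall>t\<in>T. c t \<in> carrier K) \<longrightarrow> lincomb T c \<in> irrelevant_square \<longrightarrow> (\<forall>t\<in>T. c t = \<zero>\<^bsub>K\<^esub>))"
proof -
  let ?P = "\<lambda>T. finite T \<and> T \<subseteq> irrelevant \<and> (\<forall>t\<in>T. \<exists>d. comp d t = t) \<and> spans_cotangent T"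
  interpret Q: ideal irrelevant_square R by (rule irrelevant_square_ideal)
  obtain G where "?P G" using homogeneous_generators generators_span by blast
  then obtain T where T: "?P T" and min: "\<And>T'. ?P T' \<Longrightarrow> card T \<le> card T'"
    using ex_has_least_nat[of ?P G card] by blast
  have Tc: "T \<subseteq> carrier R" using T irrelevant_carrier by blast
  have fin: "finite T" using T by blast
  have "\<forall>t\<in>T. c t = \<zero>\<^bsub>K\<^esub>" if c: "\<forall>t\<in>T. c t \<in> carrier K" and lc: "lincomb T c \<in> irrelevant_square" for c
  proof (rule ccontr)
    assume "\<not> ?thesis"
    then obtain s where s: "s \<in> T" "c s \<noteq> \<zero>\<^bsub>K\<^esub>" by blast
    have sU: "c s \<in> Units K" using s c by (simp add: K.field_Units)
    have sc: "s \<in> carrier R" using s Tc by blast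
    let ?T = "T - {s}"
    have "spans_cotangent ?T"
      unfolding spans_cotangent_def
    proof
      fix x assume x: "x \<in> irrelevant"
      then have xc: "x \<in> carrier R" using irrelevant_carrier by blast
      obtain d where d: "\<And>t. t \<in> T \<Longrightarrow> d t \<in> carrier K" "x \<ominus>\<^bsub>R\<^esub> lincomb T d \<in> irrelevant_square"
        using T x unfolding spans_cotangent_def by blast
      \<comment> \<open>Chosen so that adding \<open>a\<close> times the relation \<open>c\<close>
        to \<open>d\<close> cancels the coefficient of \<open>s\<close>.\<close>
      define a where "a = \<ominus>\<^bsub>K\<^esub> (d s \<otimes>\<^bsub>K\<^esub> inv\<^bsub>K\<^esub> (c s))"
      have a: "a \<in> carrier K" using d(1)[OF s(1)] sU by (simp add: a_def)
      let ?e = "\<lambda>t. d t \<oplus>\<^bsub>K\<^esub> a \<otimes>\<^bsub>K\<^esub> c t"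
      have ac: "a \<otimes>\<^bsub>K\<^esub> c t \<in> carrier K" if "t \<in> T" for t using a c that by simp
      have e: "?e t \<in> carrier K" if "t \<in> T" for t using d(1)[OF that] ac[OF that] by simp
      have es: "?e s = \<zero>\<^bsub>K\<^esub>"
        using d(1)[OF s(1)] sU c s(1) by (simp add: a_def K.l_minus K.m_assoc K.r_neg)
      have ld: "lincomb T d \<in> carrier R" by (rule lincomb_closed[OF Tc d(1)])
      have "lincomb T ?e = lincomb T d \<oplus>\<^bsub>R\<^esub> lincomb T (\<lambda>t. a \<otimes>\<^bsub>K\<^esub> c t)"
        by (rule lincomb_add[OF Tc d(1) ac])
      also have "lincomb T (\<lambda>t. a \<otimes>\<^bsub>K\<^esub> c t) = a \<odot>\<^bsub>R\<^esub> lincomb T c"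
        using c by (intro lincomb_smult fin Tc a) auto
      finally have le: "lincomb T ?e = lincomb T d \<oplus>\<^bsub>R\<^esub> a \<odot>\<^bsub>R\<^esub> lincomb T c" .
      have "scalar R a \<otimes>\<^bsub>R\<^esub> lincomb T c \<in> irrelevant_square" using a lc by (intro Q.I_l_closed) auto
      then have alc: "a \<odot>\<^bsub>R\<^esub> lincomb T c \<in> irrelevant_square"
        using a Q.Icarr[OF lc] by (simp add: A.smult_assoc2)
      have lT: "lincomb ?T ?e \<in> carrier R" using Tc e by (intro lincomb_closed) auto
      have "lincomb T ?e = ?e s \<odot>\<^bsub>R\<^esub> s \<oplus>\<^bsub>R\<^esub> lincomb ?T ?e"
        by (rule lincomb_remove[OF fin Tc e s(1)])
      then have rem: "lincomb T ?e = lincomb ?T ?e" using es sc lT by simp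
      have "(x \<ominus>\<^bsub>R\<^esub> lincomb T d) \<ominus>\<^bsub>R\<^esub> a \<odot>\<^bsub>R\<^esub> lincomb T c \<in> irrelevant_square"
        unfolding a_minus_def[of R _ "a \<odot>\<^bsub>R\<^esub> lincomb T c"] by (rule Q.a_closed[OF d(2) Q.a_inv_closed[OF alc]])
      moreover have "(x \<ominus>\<^bsub>R\<^esub> u) \<ominus>\<^bsub>R\<^esub> v = x \<ominus>\<^bsub>R\<^esub> (u \<oplus>\<^bsub>R\<^esub> v)" if "u \<in> carrier R" "v \<in> carrier R" for u v
        using xc that by algebra
      ultimately have r: "x \<ominus>\<^bsub>R\<^esub> lincomb ?T ?e \<in> irrelevant_square"
        using ld Q.Icarr[OF alc] le rem by simp
      show "\<exists>c. (\<forall>t\<in>?T. c t \<in> carrier K) \<and> x \<ominus>\<^bsub>R\<^esub> lincomb ?T c \<in> irrelevant_square"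
      proof (rule exI[of _ ?e], rule conjI)
        show "\<forall>t\<in>?T. ?e t \<in> carrier K" using e by blast
      qed (rule r)
    qed
    then have "?P ?T" using T by auto
    then have "card T \<le> card ?T" by (rule min)
    then show False using fin s(1) by (metis card_Diff1_less not_le)
  qed
  with T show ?thesis by blast
qed

text \<open>The graded Nakayama lemma, by induction on the degree. Modulo the square a component is
  a linear combination of \<open>T\<close>, and the part of degree \<open>d\<close> of a product of
  irrelevant elements involves only components of degree less than \<open>d\<close>. For
  \<open>Q\<close> the image of a polynomial ring will be taken.\<close>

lemma generated_by_cotangent_basis:
  assumes TM: "T \<subseteq> irrelevant" and hom: "\<And>t. t \<in> T \<Longrightarrow> \<exists>d. comp d t = t" and span: "spans_cotangent T"
    and Q: "\<And>c. c \<in> carrier K \<Longrightarrow> scalar R c \<in> Q" "T \<subseteq> Q" "Q \<subseteq> carrier R"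
    and Qa: "\<And>x y. x \<in> Q \<Longrightarrow> y \<in> Q \<Longrightarrow> x \<oplus>\<^bsub>R\<^esub> y \<in> Q"
    and Qm: "\<And>x y. x \<in> Q \<Longrightarrow> y \<in> Q \<Longrightarrow> x \<otimes>\<^bsub>R\<^esub> y \<in> Q"
  shows "carrier R \<subseteq> Q"
proof -
  have Tc: "T \<subseteq> carrier R" using TM irrelevant_carrier by blast
  have Q0: "\<zero>\<^bsub>R\<^esub> \<in> Q" using Q(1)[of "\<zero>\<^bsub>K\<^esub>"] by simp
  have Qsum: "(\<Oplus>\<^bsub>R\<^esub>i\<in>I. f i) \<in> Q" if "\<And>i. i \<in> I \<Longrightarrow> f i \<in> Q" for I and f :: "'i \<Rightarrow> 'a"
  proof (cases "finite I")
    case True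
    then show ?thesis using that
    proof (induction I rule: finite_induct)
      case (insert i I)
      have "(\<Oplus>\<^bsub>R\<^esub>i\<in>insert i I. f i) = f i \<oplus>\<^bsub>R\<^esub> (\<Oplus>\<^bsub>R\<^esub>i\<in>I. f i)"
        using insert Q(3) by (intro A.finsum_insert) auto
      then show ?case using insert Qa by simp
    qed (simp add: Q0)
  qed (simp add: Q0)
  have comps: "comp d x \<in> Q" if "x \<in> carrier R" for d x
    using that
  proof (induction d arbitrary: x rule: less_induct)
    case (less d x)
    show ?case
    proof (cases "d = 0")
      case True
      then show ?thesis using comp_0[OF less.prems] Q(1) by auto
    next
      case False
      have sq: "comp d m \<in> Q \<and> m \<in> carrier R" if "m \<in> irrelevant_square" for m
        using that
      proof (induction m rule: ideal_prod.induct)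
        case (prod i j)
        then have ij: "i \<in> carrier R" "j \<in> carrier R" "comp 0 i = \<zero>\<^bsub>R\<^esub>" "comp 0 j = \<zero>\<^bsub>R\<^esub>"
          by (auto simp: irrelevant_def)
        have "comp a i \<otimes>\<^bsub>R\<^esub> comp (d - a) j \<in> Q" if "a \<in> {..d}" for a
        proof -
          \<comment> \<open>For the extreme indices one factor is a component of degree 0 of an
            irrelevant element, so the term is zero.\<close>
          have "a = 0 \<or> a = d \<or> (a < d \<and> d - a < d)" using that by auto
          then consider "a = 0" | "a = d" | "a < d" "d - a < d" by blast
          then show ?thesis
          proof cases
            case 3
            then show ?thesis using less.IH ij Qm by blast
          qed (use ij comp_closed Q0 in auto)
        qed
        then have "(\<Oplus>\<^bsub>R\<^esub>a\<in>{..d}. comp a i \<otimes>\<^bsub>R\<^esub> comp (d - a) j) \<in> Q" by (rule Qsum)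
        then show ?case using comp_mult[OF ij(1,2), of d] ij by simp
      next
        case (sum m1 m2)
        then show ?case using Qa comp_add by simp
      qed
      have y: "comp d x \<in> irrelevant" using False less.prems by (intro comp_irrelevant) auto
      then have yc: "comp d x \<in> carrier R" using irrelevant_carrier by blast
      obtain c where c: "\<And>t. t \<in> T \<Longrightarrow> c t \<in> carrier K" "comp d x \<ominus>\<^bsub>R\<^esub> lincomb T c \<in> irrelevant_square"
        using span y unfolding spans_cotangent_def by blast
      have lc: "lincomb T c \<in> carrier R" by (rule lincomb_closed[OF Tc c(1)])
      note m = sq[OF c(2)]
      have "comp d x = (comp d x \<ominus>\<^bsub>R\<^esub> lincomb T c) \<oplus>\<^bsub>R\<^esub> lincomb T c"
        using yc lc by (simp add: a_minus_def A.a_assoc A.l_neg)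
      then have "comp d (comp d x) = comp d (comp d x \<ominus>\<^bsub>R\<^esub> lincomb T c) \<oplus>\<^bsub>R\<^esub> comp d (lincomb T c)"
        using comp_add[of "comp d x \<ominus>\<^bsub>R\<^esub> lincomb T c" "lincomb T c" d] m lc by simp
      then have "comp d x = comp d (comp d x \<ominus>\<^bsub>R\<^esub> lincomb T c) \<oplus>\<^bsub>R\<^esub> comp d (lincomb T c)"
        using comp_comp[OF less.prems, of d d] by simp
      moreover have "comp d (lincomb T c) \<in> Q"
      proof -
        have "comp d (lincomb T c) = (\<Oplus>\<^bsub>R\<^esub>t\<in>T. comp d (c t \<odot>\<^bsub>R\<^esub> t))"
          unfolding lincomb_def using Tc c(1) by (intro comp_finsum) auto
        also have "\<dots> \<in> Q"
        proof (rule Qsum)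
          fix t assume t: "t \<in> T"
          then have tc: "t \<in> carrier R" using Tc by blast
          obtain e where e: "comp e t = t" using hom[OF t] by blast
          \<comment> \<open>As \<open>t\<close> is homogeneous, its component of degree
            \<open>d\<close> is \<open>t\<close> or zero, in either case in
            \<open>Q\<close>.\<close>
          have "comp d t = (if d = e then t else \<zero>\<^bsub>R\<^esub>)" using comp_comp[OF tc, of d e] e by auto
          then have "comp d t \<in> Q" using t Q(2) Q0 by auto
          then have "scalar R (c t) \<otimes>\<^bsub>R\<^esub> comp d t \<in> Q" using Q(1)[OF c(1)[OF t]] Qm by blast
          moreover have "scalar R (c t) \<otimes>\<^bsub>R\<^esub> comp d t = comp d (c t \<odot>\<^bsub>R\<^esub> t)"
            using c(1)[OF t] tc comp_closed[OF tc] by (simp add: comp_smult A.smult_assoc2)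
          ultimately show "comp d (c t \<odot>\<^bsub>R\<^esub> t) \<in> Q" by simp
        qed
        finally show ?thesis .
      qed
      ultimately show ?thesis using m Qa by metis
    qed
  qed
  show ?thesis
  proof
    fix x assume x: "x \<in> carrier R"
    obtain k where "\<And>i. i \<ge> k \<Longrightarrow> comp i x = \<zero>\<^bsub>R\<^esub>" using comp_finite[OF x] by blast
    from comp_sum[OF x this] have "x = (\<Oplus>\<^bsub>R\<^esub>i\<in>{..<k}. comp i x)" .
    also have "\<dots> \<in> Q" by (rule Qsum) (rule comps[OF x])
    finally show "x \<in> Q" .
  qed
qed

end


section \<open>Localization\<close>

locale localization = primeideal P R for P and R (structure)
begin

lemma not_in_P_mult: "s \<in> carrier R - P \<Longrightarrow> t \<in> carrier R - P \<Longrightarrow> s \<otimes> t \<in> carrier R - P"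
  using I_prime by blast

lemma one_not_in_P: "\<one> \<in> carrier R - P"
  using I_notcarr one_imp_carrier by auto

lemma fraction_rel_iff:
  "((a, s), (b, t)) \<in> fraction_rel R P \<longleftrightarrow> a \<in> carrier R \<and> b \<in> carrier R \<and> s \<in> carrier R - P \<and> t \<in> carrier R - P \<and>
     (\<exists>u\<in>carrier R - P. u \<otimes> (t \<otimes> a) = u \<otimes> (s \<otimes> b))"
  by (simp add: fraction_rel_def)

lemma fraction_rel_sym: "((a, s), (b, t)) \<in> fraction_rel R P \<Longrightarrow> ((b, t), (a, s)) \<in> fraction_rel R P"
  unfolding fraction_rel_iff by metis

lemma fraction_rel_trans:
  assumes "((a, s), (b, t)) \<in> fraction_rel R P" "((b, t), (c, r)) \<in> fraction_rel R P"
  shows "((a, s), (c, r)) \<in> fraction_rel R P"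
proof -
  obtain u v where u: "u \<in> carrier R - P" "u \<otimes> (t \<otimes> a) = u \<otimes> (s \<otimes> b)"
    and v: "v \<in> carrier R - P" "v \<otimes> (r \<otimes> b) = v \<otimes> (t \<otimes> c)"
    and c: "a \<in> carrier R" "b \<in> carrier R" "c \<in> carrier R" "s \<in> carrier R - P" "t \<in> carrier R - P" "r \<in> carrier R - P"
    using assms unfolding fraction_rel_iff by blast
  have cl: "u \<in> carrier R" "v \<in> carrier R" "s \<in> carrier R" "t \<in> carrier R" "r \<in> carrier R" using u v c by auto
  \<comment> \<open>The two relations are multiplied by \<open>v r\<close> and by
    \<open>u s\<close>; the middle denominator \<open>t\<close>, which lies outside
    \<open>P\<close>, joins the cancelled factor.\<close>
  have "(u \<otimes> v \<otimes> t) \<otimes> (r \<otimes> a) = (v \<otimes> r) \<otimes> (u \<otimes> (t \<otimes> a))" using cl c by (simp add: m_ac)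
  also have "\<dots> = (u \<otimes> s) \<otimes> (v \<otimes> (r \<otimes> b))" unfolding u(2) using cl c by (simp add: m_ac)
  also have "\<dots> = (u \<otimes> v \<otimes> t) \<otimes> (s \<otimes> c)" unfolding v(2) using cl c by (simp add: m_ac)
  finally have "(u \<otimes> v \<otimes> t) \<otimes> (r \<otimes> a) = (u \<otimes> v \<otimes> t) \<otimes> (s \<otimes> c)" .
  moreover have "u \<otimes> v \<otimes> t \<in> carrier R - P" using u v c by (intro not_in_P_mult)
  ultimately show ?thesis unfolding fraction_rel_iff using c by blast
qed

lemma fraction_rel_refl: "a \<in> carrier R \<Longrightarrow> s \<in> carrier R - P \<Longrightarrow> ((a, s), (a, s)) \<in> fraction_rel R P"
  unfolding fraction_rel_iff using one_not_in_P by blast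

lemma fraction_eq_iff:
  assumes "a \<in> carrier R" "s \<in> carrier R - P"
  shows "fraction R P a s = fraction R P b t \<longleftrightarrow> ((a, s), (b, t)) \<in> fraction_rel R P"
proof
  assume "fraction R P a s = fraction R P b t"
  moreover have "(a, s) \<in> fraction R P a s" using fraction_rel_refl[OF assms] by (simp add: fraction_def)
  ultimately have "(a, s) \<in> fraction R P b t" by (simp only:)
  then have "((b, t), (a, s)) \<in> fraction_rel R P" by (simp only: fraction_def Image_singleton_iff)
  then show "((a, s), (b, t)) \<in> fraction_rel R P" by (rule fraction_rel_sym)
next
  assume *: "((a, s), (b, t)) \<in> fraction_rel R P"
  show "fraction R P a s = fraction R P b t"
    unfolding fraction_def
  proof (intro subset_antisym subsetI)
    fix x assume "x \<in> fraction_rel R P `` {(a, s)}"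
    then show "x \<in> fraction_rel R P `` {(b, t)}"
      using fraction_rel_trans[OF fraction_rel_sym[OF *], of "fst x" "snd x"] by simp
  next
    fix x assume "x \<in> fraction_rel R P `` {(b, t)}"
    then show "x \<in> fraction_rel R P `` {(a, s)}"
      using fraction_rel_trans[OF *, of "fst x" "snd x"] by simp
  qed
qed

lemma fraction_eqI:
  assumes "a \<in> carrier R" "s \<in> carrier R - P" "b \<in> carrier R" "t \<in> carrier R - P" "t \<otimes> a = s \<otimes> b"
  shows "fraction R P a s = fraction R P b t"
  unfolding fraction_eq_iff[OF assms(1,2)] fraction_rel_iff
  using assms one_not_in_P by (intro conjI bexI[of _ \<one>]) simp_all

lemma mem_fraction: "(b, t) \<in> fraction R P a s \<longleftrightarrow> ((a, s), (b, t)) \<in> fraction_rel R P"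
  by (simp add: fraction_def)

text \<open>Operations on fractions are unions over all representatives; such a union collapses once
  the value does not depend on the representative.\<close>

lemma UN_fraction_const:
  assumes "a \<in> carrier R" "s \<in> carrier R - P" "\<And>b t. ((a, s), (b, t)) \<in> fraction_rel R P \<Longrightarrow> f b t = z"
  shows "(\<Union>(b, t)\<in>fraction R P a s. f b t) = z"
proof -
  have "f b t = z" if "(b, t) \<in> fraction R P a s" for b t
    using assms(3) that by (simp add: mem_fraction)
  moreover have "(a, s) \<in> fraction R P a s"
    using fraction_rel_refl[OF assms(1,2)] by (simp add: mem_fraction)
  ultimately show ?thesis by fast
qed

lemma fraction_mult_cong:
  assumes "((a, s), (a', s')) \<in> fraction_rel R P" "((b, t), (b', t')) \<in> fraction_rel R P"
  shows "fraction R P (a \<otimes> b) (s \<otimes> t) = fraction R P (a' \<otimes> b') (s' \<otimes> t')"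
proof -
  obtain u v where u: "u \<in> carrier R - P" "u \<otimes> (s' \<otimes> a) = u \<otimes> (s \<otimes> a')"
    and v: "v \<in> carrier R - P" "v \<otimes> (t' \<otimes> b) = v \<otimes> (t \<otimes> b')"
    and c: "a \<in> carrier R" "a' \<in> carrier R" "b \<in> carrier R" "b' \<in> carrier R"
      "s \<in> carrier R - P" "t \<in> carrier R - P" "s' \<in> carrier R - P" "t' \<in> carrier R - P"
    using assms unfolding fraction_rel_iff by blast
  have cl: "u \<in> carrier R" "v \<in> carrier R" "s \<in> carrier R" "t \<in> carrier R" "s' \<in> carrier R" "t' \<in> carrier R"
    using u v c by auto
  have "(u \<otimes> v) \<otimes> ((s' \<otimes> t') \<otimes> (a \<otimes> b)) = (u \<otimes> (s' \<otimes> a)) \<otimes> (v \<otimes> (t' \<otimes> b))" using cl c by (simp add: m_ac)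
  also have "\<dots> = (u \<otimes> v) \<otimes> ((s \<otimes> t) \<otimes> (a' \<otimes> b'))" unfolding u(2) v(2) using cl c by (simp add: m_ac)
  finally have eq: "(u \<otimes> v) \<otimes> ((s' \<otimes> t') \<otimes> (a \<otimes> b)) = (u \<otimes> v) \<otimes> ((s \<otimes> t) \<otimes> (a' \<otimes> b'))" .
  have "s \<otimes> t \<in> carrier R - P" "s' \<otimes> t' \<in> carrier R - P" "u \<otimes> v \<in> carrier R - P"
    using u v c not_in_P_mult by blast+
  moreover have "a \<otimes> b \<in> carrier R" "a' \<otimes> b' \<in> carrier R" using c by auto
  ultimately have "((a \<otimes> b, s \<otimes> t), (a' \<otimes> b', s' \<otimes> t')) \<in> fraction_rel R P"
    unfolding fraction_rel_iff using eq by blast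
  then show ?thesis by (subst fraction_eq_iff) (auto simp: fraction_rel_iff)
qed

lemma fraction_add_cong:
  assumes "((a, s), (a', s')) \<in> fraction_rel R P" "((b, t), (b', t')) \<in> fraction_rel R P"
  shows "fraction R P ((a \<otimes> t) \<oplus> (b \<otimes> s)) (s \<otimes> t) = fraction R P ((a' \<otimes> t') \<oplus> (b' \<otimes> s')) (s' \<otimes> t')"
proof -
  obtain u v where u: "u \<in> carrier R - P" "u \<otimes> (s' \<otimes> a) = u \<otimes> (s \<otimes> a')"
    and v: "v \<in> carrier R - P" "v \<otimes> (t' \<otimes> b) = v \<otimes> (t \<otimes> b')"
    and c: "a \<in> carrier R" "a' \<in> carrier R" "b \<in> carrier R" "b' \<in> carrier R"
      "s \<in> carrier R - P" "t \<in> carrier R - P" "s' \<in> carrier R - P" "t' \<in> carrier R - P"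
    using assms unfolding fraction_rel_iff by blast
  have cl: "u \<in> carrier R" "v \<in> carrier R" "s \<in> carrier R" "t \<in> carrier R" "s' \<in> carrier R" "t' \<in> carrier R"
    using u v c by auto
  have "(u \<otimes> v) \<otimes> ((s' \<otimes> t') \<otimes> ((a \<otimes> t) \<oplus> (b \<otimes> s))) =
      (v \<otimes> t \<otimes> t') \<otimes> (u \<otimes> (s' \<otimes> a)) \<oplus> (u \<otimes> s \<otimes> s') \<otimes> (v \<otimes> (t' \<otimes> b))"
    using cl c by (simp add: m_ac r_distr)
  also have "\<dots> = (u \<otimes> v) \<otimes> ((s \<otimes> t) \<otimes> ((a' \<otimes> t') \<oplus> (b' \<otimes> s')))"
    unfolding u(2) v(2) using cl c by (simp add: m_ac r_distr)
  finally have eq: "(u \<otimes> v) \<otimes> ((s' \<otimes> t') \<otimes> ((a \<otimes> t) \<oplus> (b \<otimes> s))) = (u \<otimes> v) \<otimes> ((s \<otimes> t) \<otimes> ((a' \<otimes> t') \<oplus> (b' \<otimes> s')))" .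
  have "s \<otimes> t \<in> carrier R - P" "s' \<otimes> t' \<in> carrier R - P" "u \<otimes> v \<in> carrier R - P"
    using u v c not_in_P_mult by blast+
  moreover have "(a \<otimes> t) \<oplus> (b \<otimes> s) \<in> carrier R" "(a' \<otimes> t') \<oplus> (b' \<otimes> s') \<in> carrier R" using c cl by auto
  ultimately have "(((a \<otimes> t) \<oplus> (b \<otimes> s), s \<otimes> t), ((a' \<otimes> t') \<oplus> (b' \<otimes> s'), s' \<otimes> t')) \<in> fraction_rel R P"
    unfolding fraction_rel_iff using eq by blast
  then show ?thesis by (subst fraction_eq_iff) (auto simp: fraction_rel_iff)
qed

end

locale algebra_localization =
  fixes K :: "'k ring" and R :: "('k, 'a) module" (structure) and P :: "'a set"
  assumes algebra_R: "algebra K R" and prime_P: "primeideal P R"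
begin

sublocale K: cring K using algebra_R by (simp add: algebra_def module_def)

sublocale localization P R unfolding localization_def by (rule prime_P)

sublocale A: algebra K R by (rule algebra_R)

abbreviation B :: "('k, ('a \<times> 'a) set) module" where "B \<equiv> local_ring R P"

abbreviation fr :: "'a \<Rightarrow> 'a \<Rightarrow> ('a \<times> 'a) set" where "fr \<equiv> fraction R P"

lemma local_carrier: "carrier B = {fr a s | a s. a \<in> carrier R \<and> s \<in> carrier R - P}"
  by (simp add: local_ring_def)

lemma local_one: "\<one>\<^bsub>B\<^esub> = fr \<one> \<one>" and local_zero: "\<zero>\<^bsub>B\<^esub> = fr \<zero> \<one>"
  by (simp_all add: local_ring_def)

lemma local_mult:
  assumes a: "a \<in> carrier R" "s \<in> carrier R - P" and b: "b \<in> carrier R" "t \<in> carrier R - P"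
  shows "fr a s \<otimes>\<^bsub>B\<^esub> fr b t = fr (a \<otimes> b) (s \<otimes> t)"
proof -
  have "fr a s \<otimes>\<^bsub>B\<^esub> fr b t = (\<Union>(a', s')\<in>fr a s. \<Union>(b', t')\<in>fr b t. fr (a' \<otimes> b') (s' \<otimes> t'))"
    by (simp add: local_ring_def)
  also have "\<dots> = fr (a \<otimes> b) (s \<otimes> t)"
    by (rule UN_fraction_const[OF a], rule UN_fraction_const[OF b], rule fraction_mult_cong) (erule fraction_rel_sym)+
  finally show ?thesis .
qed

lemma local_add:
  assumes a: "a \<in> carrier R" "s \<in> carrier R - P" and b: "b \<in> carrier R" "t \<in> carrier R - P"
  shows "fr a s \<oplus>\<^bsub>B\<^esub> fr b t = fr ((a \<otimes> t) \<oplus> (b \<otimes> s)) (s \<otimes> t)"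
proof -
  have "fr a s \<oplus>\<^bsub>B\<^esub> fr b t = (\<Union>(a', s')\<in>fr a s. \<Union>(b', t')\<in>fr b t. fr ((a' \<otimes> t') \<oplus> (b' \<otimes> s')) (s' \<otimes> t'))"
    by (simp add: local_ring_def)
  also have "\<dots> = fr ((a \<otimes> t) \<oplus> (b \<otimes> s)) (s \<otimes> t)"
    by (rule UN_fraction_const[OF a], rule UN_fraction_const[OF b], rule fraction_add_cong) (erule fraction_rel_sym)+
  finally show ?thesis .
qed

lemma local_smult:
  assumes c: "c \<in> carrier K" and a: "a \<in> carrier R" "s \<in> carrier R - P"
  shows "c \<odot>\<^bsub>B\<^esub> fr a s = fr (c \<odot>\<^bsub>R\<^esub> a) s"
proof -
  have "c \<odot>\<^bsub>B\<^esub> fr a s = (\<Union>(a', s')\<in>fr a s. fr (c \<odot>\<^bsub>R\<^esub> a') s')"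
    by (simp add: local_ring_def)
  also have "\<dots> = fr (c \<odot>\<^bsub>R\<^esub> a) s"
  proof (rule UN_fraction_const[OF a])
    fix b t assume "((a, s), (b, t)) \<in> fraction_rel R P"
    then obtain u where u: "u \<in> carrier R - P" "u \<otimes> (t \<otimes> a) = u \<otimes> (s \<otimes> b)" "b \<in> carrier R" "t \<in> carrier R - P"
      unfolding fraction_rel_iff by blast
    have sc: "scalar R c \<in> carrier R" using c by simp
    have sm: "c \<odot>\<^bsub>R\<^esub> x = scalar R c \<otimes> x" if "x \<in> carrier R" for x using c that by (simp add: A.smult_assoc2)
    have cl: "u \<in> carrier R" "t \<in> carrier R" "s \<in> carrier R" using u a by auto
    have "u \<otimes> (t \<otimes> (scalar R c \<otimes> a)) = scalar R c \<otimes> (u \<otimes> (t \<otimes> a))"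
      using cl a sc by (simp add: m_ac)
    also have "\<dots> = u \<otimes> (s \<otimes> (scalar R c \<otimes> b))"
      unfolding u(2) using cl u(3) sc by (simp add: m_ac)
    finally have "u \<otimes> (s \<otimes> (c \<odot>\<^bsub>R\<^esub> b)) = u \<otimes> (t \<otimes> (c \<odot>\<^bsub>R\<^esub> a))"
      by (simp only: sm[OF u(3)] sm[OF a(1)])
    moreover have "c \<odot>\<^bsub>R\<^esub> a \<in> carrier R" "c \<odot>\<^bsub>R\<^esub> b \<in> carrier R" using c a u(3) by auto
    ultimately have "((c \<odot>\<^bsub>R\<^esub> b, t), (c \<odot>\<^bsub>R\<^esub> a, s)) \<in> fraction_rel R P"
      unfolding fraction_rel_iff using u(1,4) a(2) by blast
    then show "fr (c \<odot>\<^bsub>R\<^esub> b) t = fr (c \<odot>\<^bsub>R\<^esub> a) s"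
      by (subst fraction_eq_iff) (auto simp: fraction_rel_iff)
  qed
  finally show ?thesis .
qed

lemma mult_notin: "s \<in> carrier R \<Longrightarrow> s \<notin> P \<Longrightarrow> t \<in> carrier R \<Longrightarrow> t \<notin> P \<Longrightarrow> s \<otimes> t \<notin> P"
  using I_prime by blast

lemma one_notin: "\<one> \<notin> P"
  using one_not_in_P by simp

lemma local_cases:
  assumes "x \<in> carrier B"
  obtains a s where "a \<in> carrier R" "s \<in> carrier R" "s \<notin> P" "x = fr a s"
  using assms by (auto simp: local_carrier)

lemma local_ops:
  assumes "a \<in> carrier R" "s \<in> carrier R" "s \<notin> P" "b \<in> carrier R" "t \<in> carrier R" "t \<notin> P"
  shows "fr a s \<otimes>\<^bsub>B\<^esub> fr b t = fr (a \<otimes> b) (s \<otimes> t)"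
    "fr a s \<oplus>\<^bsub>B\<^esub> fr b t = fr ((a \<otimes> t) \<oplus> (b \<otimes> s)) (s \<otimes> t)"
  using assms by (simp_all add: local_mult local_add)

lemma local_eqI:
  assumes "a \<in> carrier R" "s \<in> carrier R" "s \<notin> P" "b \<in> carrier R" "t \<in> carrier R" "t \<notin> P" "t \<otimes> a = s \<otimes> b"
  shows "fr a s = fr b t"
  using assms by (intro fraction_eqI) auto

lemma local_fr_closed: "a \<in> carrier R \<Longrightarrow> s \<in> carrier R \<Longrightarrow> s \<notin> P \<Longrightarrow> fr a s \<in> carrier B"
  by (auto simp: local_carrier)

lemma local_cring: "cring B"
proof (rule cringI)
  show "abelian_group B"
  proof (rule abelian_groupI)
    fix x y z assume "x \<in> carrier B" "y \<in> carrier B" "z \<in> carrier B"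
    then obtain a s b t c r where c: "a \<in> carrier R" "s \<in> carrier R" "s \<notin> P" "x = fr a s"
      "b \<in> carrier R" "t \<in> carrier R" "t \<notin> P" "y = fr b t" "c \<in> carrier R" "r \<in> carrier R" "r \<notin> P" "z = fr c r"
      by (elim local_cases)
    show "x \<oplus>\<^bsub>B\<^esub> y \<in> carrier B" using c by (simp add: local_ops local_fr_closed mult_notin)
    show "x \<oplus>\<^bsub>B\<^esub> y = y \<oplus>\<^bsub>B\<^esub> x"
      using c by (simp add: local_ops a_comm m_comm)
    show "x \<oplus>\<^bsub>B\<^esub> y \<oplus>\<^bsub>B\<^esub> z = x \<oplus>\<^bsub>B\<^esub> (y \<oplus>\<^bsub>B\<^esub> z)"
    proof -
      have e: "((a \<otimes> t) \<oplus> (b \<otimes> s)) \<otimes> r \<oplus> c \<otimes> (s \<otimes> t) = a \<otimes> (t \<otimes> r) \<oplus> ((b \<otimes> r) \<oplus> (c \<otimes> t)) \<otimes> s"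
        using c(1,2,5,6,9,10) by algebra
      show ?thesis using c by (simp add: local_ops mult_notin e m_assoc)
    qed
  next
    fix x assume "x \<in> carrier B"
    then obtain a s where c: "a \<in> carrier R" "s \<in> carrier R" "s \<notin> P" "x = fr a s" by (elim local_cases)
    show "\<zero>\<^bsub>B\<^esub> \<oplus>\<^bsub>B\<^esub> x = x"
      using c by (simp add: local_zero local_ops one_notin)
    show "\<exists>y\<in>carrier B. y \<oplus>\<^bsub>B\<^esub> x = \<zero>\<^bsub>B\<^esub>"
    proof (rule bexI)
      show "fr (\<ominus> a) s \<in> carrier B" using c by (simp add: local_fr_closed)
      have "fr (\<ominus> a) s \<oplus>\<^bsub>B\<^esub> x = fr \<zero> (s \<otimes> s)" using c by (simp add: local_ops l_minus l_neg)
      also have "\<dots> = fr \<zero> \<one>" using c by (intro local_eqI) (auto simp: mult_notin one_notin)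
      finally show "fr (\<ominus> a) s \<oplus>\<^bsub>B\<^esub> x = \<zero>\<^bsub>B\<^esub>" by (simp add: local_zero)
    qed
  qed (simp add: local_zero local_fr_closed one_notin)
  show "comm_monoid B"
  proof (rule comm_monoidI)
    fix x y z assume "x \<in> carrier B" "y \<in> carrier B" "z \<in> carrier B"
    then obtain a s b t c r where c: "a \<in> carrier R" "s \<in> carrier R" "s \<notin> P" "x = fr a s"
      "b \<in> carrier R" "t \<in> carrier R" "t \<notin> P" "y = fr b t" "c \<in> carrier R" "r \<in> carrier R" "r \<notin> P" "z = fr c r"
      by (elim local_cases)
    show "x \<otimes>\<^bsub>B\<^esub> y \<in> carrier B" using c by (simp add: local_ops local_fr_closed mult_notin)
    show "x \<otimes>\<^bsub>B\<^esub> y = y \<otimes>\<^bsub>B\<^esub> x" using c by (simp add: local_ops m_comm)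
    show "x \<otimes>\<^bsub>B\<^esub> y \<otimes>\<^bsub>B\<^esub> z = x \<otimes>\<^bsub>B\<^esub> (y \<otimes>\<^bsub>B\<^esub> z)" using c by (simp add: local_ops mult_notin m_assoc)
  next
    fix x assume "x \<in> carrier B"
    then obtain a s where c: "a \<in> carrier R" "s \<in> carrier R" "s \<notin> P" "x = fr a s" by (elim local_cases)
    show "\<one>\<^bsub>B\<^esub> \<otimes>\<^bsub>B\<^esub> x = x" using c by (simp add: local_one local_ops one_notin)
  qed (simp add: local_one local_fr_closed one_notin)
  fix x y z assume "x \<in> carrier B" "y \<in> carrier B" "z \<in> carrier B"
  then obtain a s b t c r where c: "a \<in> carrier R" "s \<in> carrier R" "s \<notin> P" "x = fr a s"
    "b \<in> carrier R" "t \<in> carrier R" "t \<notin> P" "y = fr b t" "c \<in> carrier R" "r \<in> carrier R" "r \<notin> P" "z = fr c r"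
    by (elim local_cases)
  \<comment> \<open>The right side carries an additional factor \<open>r\<close> in numerator and
    denominator.\<close>
  have "fr (((a \<otimes> t) \<oplus> (b \<otimes> s)) \<otimes> c) (s \<otimes> t \<otimes> r) =
      fr ((a \<otimes> c) \<otimes> (t \<otimes> r) \<oplus> (b \<otimes> c) \<otimes> (s \<otimes> r)) ((s \<otimes> r) \<otimes> (t \<otimes> r))"
  proof (rule local_eqI)
    show "(s \<otimes> r) \<otimes> (t \<otimes> r) \<otimes> (((a \<otimes> t) \<oplus> (b \<otimes> s)) \<otimes> c) =
        s \<otimes> t \<otimes> r \<otimes> ((a \<otimes> c) \<otimes> (t \<otimes> r) \<oplus> (b \<otimes> c) \<otimes> (s \<otimes> r))"
      using c(1,2,5,6,9,10) by algebra
  qed (use c in \<open>simp_all add: mult_notin\<close>)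
  then show "(x \<oplus>\<^bsub>B\<^esub> y) \<otimes>\<^bsub>B\<^esub> z = x \<otimes>\<^bsub>B\<^esub> z \<oplus>\<^bsub>B\<^esub> y \<otimes>\<^bsub>B\<^esub> z"
    using c by (simp add: local_ops mult_notin)
qed

definition loc :: "'a \<Rightarrow> ('a \<times> 'a) set" where "loc a = fr a \<one>"

lemma loc_hom: "loc \<in> ring_hom R B"
  by (rule ring_hom_memI) (auto simp: loc_def local_ops local_one local_fr_closed one_notin)

lemma loc_hom_cring: "ring_hom_cring R B loc"
  by (intro ring_hom_cringI is_cring local_cring loc_hom)

lemma loc_smult: "c \<in> carrier K \<Longrightarrow> a \<in> carrier R \<Longrightarrow> loc (c \<odot>\<^bsub>R\<^esub> a) = c \<odot>\<^bsub>B\<^esub> loc a"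
  by (simp add: loc_def local_smult one_notin)

lemma local_algebra: "algebra K B"
proof (rule algebraI[OF K.is_cring local_cring])
  interpret B: cring B by (rule local_cring)
  fix c d x y assume cK: "c \<in> carrier K" and x: "x \<in> carrier B"
  obtain a s where a: "a \<in> carrier R" "s \<in> carrier R" "s \<notin> P" "x = fr a s" using x by (elim local_cases)
  have sm: "k \<odot>\<^bsub>B\<^esub> z = loc (scalar R k) \<otimes>\<^bsub>B\<^esub> z" if k: "k \<in> carrier K" and z: "z \<in> carrier B" for k z
  proof -
    obtain b t where b: "b \<in> carrier R" "t \<in> carrier R" "t \<notin> P" "z = fr b t" using z by (elim local_cases)
    have "scalar R k \<in> carrier R" using k by simp
    then have "loc (scalar R k) \<otimes>\<^bsub>B\<^esub> z = fr (scalar R k \<otimes> b) t"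
      using b by (simp add: loc_def local_ops one_notin del: A.smult_closed)
    also have "scalar R k \<otimes> b = k \<odot>\<^bsub>R\<^esub> b" using k b(1) by (simp add: A.smult_assoc2)
    finally show ?thesis using b k by (simp add: local_smult)
  qed
  have lc: "loc (scalar R k) \<in> carrier B" if "k \<in> carrier K" for k
    by (rule ring_hom_closed[OF loc_hom]) (use that in simp)
  interpret S: ring_hom_cring K R "\<lambda>c. scalar R c" by (rule A.scalar_hom_cring)
  have sR: "scalar R k \<in> carrier R" if "k \<in> carrier K" for k using that by simp
  show cx: "c \<odot>\<^bsub>B\<^esub> x \<in> carrier B" using sm[OF cK x] lc[OF cK] x by simp
  {
    assume dK: "d \<in> carrier K"
    have "loc (scalar R (c \<oplus>\<^bsub>K\<^esub> d)) = loc (scalar R c) \<oplus>\<^bsub>B\<^esub> loc (scalar R d)"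
      unfolding S.hom_add[OF cK dK] by (rule ring_hom_add[OF loc_hom sR[OF cK] sR[OF dK]])
    then show "(c \<oplus>\<^bsub>K\<^esub> d) \<odot>\<^bsub>B\<^esub> x = c \<odot>\<^bsub>B\<^esub> x \<oplus>\<^bsub>B\<^esub> d \<odot>\<^bsub>B\<^esub> x"
      using sm[OF K.a_closed[OF cK dK] x] sm[OF cK x] sm[OF dK x] B.l_distr[OF lc[OF cK] lc[OF dK] x] by simp
    have m: "loc (scalar R (c \<otimes>\<^bsub>K\<^esub> d)) = loc (scalar R c) \<otimes>\<^bsub>B\<^esub> loc (scalar R d)"
      unfolding S.hom_mult[OF cK dK] by (rule ring_hom_mult[OF loc_hom sR[OF cK] sR[OF dK]])
    have dx: "d \<odot>\<^bsub>B\<^esub> x \<in> carrier B" using sm[OF dK x] lc[OF dK] x by simp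
    show "(c \<otimes>\<^bsub>K\<^esub> d) \<odot>\<^bsub>B\<^esub> x = c \<odot>\<^bsub>B\<^esub> (d \<odot>\<^bsub>B\<^esub> x)"
      unfolding sm[OF cK dx] unfolding sm[OF dK x] sm[OF K.m_closed[OF cK dK] x] m
      by (rule B.m_assoc[OF lc[OF cK] lc[OF dK] x])
  }
  assume y: "y \<in> carrier B"
  show "c \<odot>\<^bsub>B\<^esub> (x \<oplus>\<^bsub>B\<^esub> y) = c \<odot>\<^bsub>B\<^esub> x \<oplus>\<^bsub>B\<^esub> c \<odot>\<^bsub>B\<^esub> y"
    unfolding sm[OF cK x] sm[OF cK y] sm[OF cK B.a_closed[OF x y]] by (rule B.r_distr[OF x y lc[OF cK]])
  show "(c \<odot>\<^bsub>B\<^esub> x) \<otimes>\<^bsub>B\<^esub> y = c \<odot>\<^bsub>B\<^esub> (x \<otimes>\<^bsub>B\<^esub> y)"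
    unfolding sm[OF cK x] sm[OF cK B.m_closed[OF x y]] by (rule B.m_assoc[OF lc[OF cK] x y])
next
  fix x assume "x \<in> carrier B"
  then obtain a s where "a \<in> carrier R" "s \<in> carrier R" "s \<notin> P" "x = fr a s" by (elim local_cases)
  then show "\<one>\<^bsub>K\<^esub> \<odot>\<^bsub>B\<^esub> x = x" by (simp add: local_smult)
qed

lemma fr_loc:
  assumes "a \<in> carrier R" "s \<in> carrier R" "s \<notin> P"
  shows "fr a s = loc a \<otimes>\<^bsub>B\<^esub> fr \<one> s" "loc s \<otimes>\<^bsub>B\<^esub> fr a s = loc a"
  using assms
  by (simp_all add: loc_def local_ops one_notin) (intro local_eqI, auto simp: one_notin)

lemma local_prime_contraction:
  assumes Q: "primeideal Q B"
  shows "primeideal {a \<in> carrier R. loc a \<in> Q} R"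
proof -
  interpret B: cring B by (rule local_cring)
  interpret Q: primeideal Q B by fact
  interpret l: ring_hom_cring R B loc by (rule loc_hom_cring)
  show ?thesis
  proof (rule primeidealI_comm)
    show "ideal {a \<in> carrier R. loc a \<in> Q} R"
      by (rule ring_hom_ring.ideal_vimage[OF l.ring_hom_ring Q.is_ideal])
    show "\<one> \<notin> {a \<in> carrier R. loc a \<in> Q}"
      using Q.I_notcarr Q.one_imp_carrier by auto
    show "a \<in> {a \<in> carrier R. loc a \<in> Q} \<or> b \<in> {a \<in> carrier R. loc a \<in> Q}"
      if "a \<in> carrier R" "b \<in> carrier R" "a \<otimes> b \<in> {a \<in> carrier R. loc a \<in> Q}" for a b
      using that Q.I_prime[of "loc a" "loc b"] by auto
  qed
qed

text \<open>For \<open>x = a / s\<close>, multiplication by \<open>s\<close> and by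
  \<open>1 / s\<close> passes between \<open>x\<close> and \<open>a\<close>, so a fraction that
  separates two primes has a numerator that separates their contractions. Chains of primes thus keep
  their length in \<open>R\<close>.\<close>

lemma local_contraction_strict:
  assumes Q: "primeideal Q B" and Q': "primeideal Q' B" and sub: "Q \<subset> Q'"
  shows "{a \<in> carrier R. loc a \<in> Q} \<subset> {a \<in> carrier R. loc a \<in> Q'}"
proof -
  interpret B: cring B by (rule local_cring)
  interpret Q: primeideal Q B by fact
  interpret Q': primeideal Q' B by fact
  obtain x where x: "x \<in> Q'" "x \<notin> Q" using sub by blast
  obtain a s where a: "a \<in> carrier R" "s \<in> carrier R" "s \<notin> P" "x = fr a s"
    using Q'.Icarr[OF x(1)] by (elim local_cases)
  have l: "loc s \<in> carrier B" "loc a \<in> carrier B" "fr \<one> s \<in> carrier B"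
    using a ring_hom_closed[OF loc_hom] by (auto simp: local_fr_closed)
  have "loc s \<otimes>\<^bsub>B\<^esub> x \<in> Q'" using x(1) l by (intro Q'.I_l_closed)
  then have "loc a \<in> Q'" using fr_loc(2)[OF a(1-3)] a(4) by simp
  moreover have "loc a \<notin> Q"
  proof
    assume "loc a \<in> Q"
    then have "loc a \<otimes>\<^bsub>B\<^esub> fr \<one> s \<in> Q" using l by (intro Q.I_r_closed)
    then show False using x(2) fr_loc(1)[OF a(1-3)] a(4) by simp
  qed
  ultimately show ?thesis using a(1) sub by blast
qed

lemma local_idealI: "a \<in> P \<Longrightarrow> s \<in> carrier R \<Longrightarrow> s \<notin> P \<Longrightarrow> fr a s \<in> local_ideal R P"
  unfolding local_ideal_def by blast

lemma local_ideal_ideal: "ideal (local_ideal R P) B"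
proof -
  interpret B: cring B by (rule local_cring)
  show ?thesis
  proof (rule B.idealI_comm)
    show "local_ideal R P \<subseteq> carrier B"
      using a_subset by (auto simp: local_ideal_def local_carrier)
    show "\<zero>\<^bsub>B\<^esub> \<in> local_ideal R P"
      unfolding local_zero by (rule local_idealI) (use additive_subgroup.zero_closed[OF additive_subgroup_axioms] one_not_in_P in auto)
    fix x y assume "x \<in> local_ideal R P"
    then obtain a s where a: "a \<in> P" "s \<in> carrier R" "s \<notin> P" "x = fr a s" by (auto simp: local_ideal_def)
    have ac: "a \<in> carrier R" using a(1) by (rule Icarr)
    {
      assume "y \<in> local_ideal R P"
      then obtain b t where b: "b \<in> P" "t \<in> carrier R" "t \<notin> P" "y = fr b t" by (auto simp: local_ideal_def)
      have bc: "b \<in> carrier R" using b(1) by (rule Icarr)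
      have "(a \<otimes> t) \<oplus> (b \<otimes> s) \<in> P" using a b by (intro additive_subgroup.a_closed[OF additive_subgroup_axioms] I_r_closed)
      moreover have "s \<otimes> t \<in> carrier R - P" using a b by (simp add: mult_notin)
      ultimately show "x \<oplus>\<^bsub>B\<^esub> y \<in> local_ideal R P"
        using a b ac bc by (simp add: local_ops local_idealI)
    }
    assume "y \<in> carrier B"
    then obtain b t where b: "b \<in> carrier R" "t \<in> carrier R" "t \<notin> P" "y = fr b t" by (elim local_cases)
    have "b \<otimes> a \<in> P" using a b by (intro I_l_closed)
    moreover have "t \<otimes> s \<in> carrier R - P" using a b by (simp add: mult_notin)
    ultimately show "y \<otimes>\<^bsub>B\<^esub> x \<in> local_ideal R P"
      using a b ac by (simp add: local_ops local_idealI)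
  qed
qed

lemma loc_square:
  assumes "m \<in> ideal_prod R P P"
  shows "loc m \<in> ideal_prod B (local_ideal R P) (local_ideal R P)"
proof -
  interpret l: ring_hom_cring R B loc by (rule loc_hom_cring)
  have P: "loc a \<in> local_ideal R P" if "a \<in> P" for a
    using that one_not_in_P by (simp add: loc_def local_idealI)
  have "loc m \<in> ideal_prod B (local_ideal R P) (local_ideal R P) \<and> m \<in> carrier R"
    using assms
  proof (induction m rule: ideal_prod.induct)
    case (prod i j)
    then show ?case using P Icarr by (auto intro: ideal_prod.prod)
  next
    case (sum m1 m2)
    then show ?case by (auto intro: ideal_prod.sum)
  qed
  then show ?thesis by blast
qed

lemma local_square_cases:
  assumes "x \<in> ideal_prod B (local_ideal R P) (local_ideal R P)"
  shows "\<exists>m s. m \<in> ideal_prod R P P \<and> s \<in> carrier R - P \<and> x = fr m s"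
proof -
  interpret I2: ideal "ideal_prod R P P" R by (rule ideal_prod_is_ideal) (rule is_ideal)+
  show ?thesis
    using assms
  proof (induction x rule: ideal_prod.induct)
    case (prod i j)
    then obtain a s b t where a: "a \<in> P" "s \<in> carrier R" "s \<notin> P" "i = fr a s"
      and b: "b \<in> P" "t \<in> carrier R" "t \<notin> P" "j = fr b t" by (auto simp: local_ideal_def)
    have "i \<otimes>\<^bsub>B\<^esub> j = fr (a \<otimes> b) (s \<otimes> t)" using a b Icarr by (simp add: local_ops)
    moreover have "a \<otimes> b \<in> ideal_prod R P P" using a b by (intro ideal_prod.prod)
    moreover have "s \<otimes> t \<in> carrier R - P" using a b by (simp add: mult_notin)
    ultimately show ?case by blast
  next
    case (sum x y)
    then obtain m s k t where m: "m \<in> ideal_prod R P P" "s \<in> carrier R - P" "x = fr m s"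
      and k: "k \<in> ideal_prod R P P" "t \<in> carrier R - P" "y = fr k t" by blast
    have "x \<oplus>\<^bsub>B\<^esub> y = fr ((m \<otimes> t) \<oplus> (k \<otimes> s)) (s \<otimes> t)"
      using m k I2.Icarr by (simp add: local_ops)
    moreover have "(m \<otimes> t) \<oplus> (k \<otimes> s) \<in> ideal_prod R P P"
      using m k by (intro I2.a_closed I2.I_r_closed) auto
    moreover have "s \<otimes> t \<in> carrier R - P" using m k by (simp add: mult_notin)
    ultimately show ?case by blast
  qed
qed

text \<open>Clearing denominators costs a factor \<open>u\<close> outside \<open>P\<close>; in the
  graded situation it is removed again in \<open>cotangent_basis\<close>.\<close>

lemma loc_in_square:
  assumes x: "x \<in> carrier R" and lx: "loc x \<in> ideal_prod B (local_ideal R P) (local_ideal R P)"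
  shows "\<exists>u\<in>carrier R - P. u \<otimes> x \<in> ideal_prod R P P"
proof -
  interpret I2: ideal "ideal_prod R P P" R by (rule ideal_prod_is_ideal) (rule is_ideal)+
  obtain m s where m: "m \<in> ideal_prod R P P" "s \<in> carrier R - P" "fr x \<one> = fr m s"
    using local_square_cases[OF lx] by (auto simp: loc_def)
  then obtain u where u: "u \<in> carrier R - P" "u \<otimes> (s \<otimes> x) = u \<otimes> (\<one> \<otimes> m)"
    unfolding fraction_eq_iff[OF x one_not_in_P] fraction_rel_iff by blast
  have "(u \<otimes> s) \<otimes> x = u \<otimes> m" using u m x I2.Icarr[OF m(1)] by (simp add: m_assoc)
  also have "\<dots> \<in> ideal_prod R P P" using u m by (intro I2.I_l_closed) auto
  finally show ?thesis using u m not_in_P_mult by blast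
qed

end


section \<open>The cotangent space\<close>

lemma quot_algebra_simps [simp]:
  "carrier (quot_algebra A J) = carrier (A Quot J)" "monoid.mult (quot_algebra A J) = monoid.mult (A Quot J)"
  "one (quot_algebra A J) = one (A Quot J)" "zero (quot_algebra A J) = zero (A Quot J)"
  "ring.add (quot_algebra A J) = ring.add (A Quot J)"
  "smult (quot_algebra A J) = (\<lambda>c X. \<Union>x\<in>X. J +>\<^bsub>A\<^esub> (c \<odot>\<^bsub>A\<^esub> x))"
  by (simp_all add: quot_algebra_def ring.defs module.defs)

text \<open>The scalar multiplication of \<open>quot_algebra\<close> is a union over
  representatives, which agree because an ideal absorbs scalars.\<close>

lemma coset_smult:
  assumes A: "algebra K A" and J: "ideal J A" and c: "c \<in> carrier K" and x: "x \<in> carrier A"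
  shows "(\<Union>y\<in>J +>\<^bsub>A\<^esub> x. J +>\<^bsub>A\<^esub> (c \<odot>\<^bsub>A\<^esub> y)) = J +>\<^bsub>A\<^esub> (c \<odot>\<^bsub>A\<^esub> x)"
proof -
  interpret K: cring K using A by (simp add: algebra_def module_def)
  interpret B: cring A using A by (simp add: algebra_def)
  interpret B: algebra K A by (rule A)
  interpret J: ideal J A by fact
  have "J +>\<^bsub>A\<^esub> (c \<odot>\<^bsub>A\<^esub> y) = J +>\<^bsub>A\<^esub> (c \<odot>\<^bsub>A\<^esub> x)" if y: "y \<in> J +>\<^bsub>A\<^esub> x" for y
  proof -
    obtain j where j: "j \<in> J" "y = j \<oplus>\<^bsub>A\<^esub> x" using y by (auto simp: a_r_coset_def')
    have jc: "j \<in> carrier A" using j(1) by (rule J.Icarr)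
    have "scalar A c \<otimes>\<^bsub>A\<^esub> j \<in> J" using j(1) c by (intro J.I_l_closed) auto
    then have cj: "c \<odot>\<^bsub>A\<^esub> j \<in> J" using c jc by (simp add: B.smult_assoc2)
    have "c \<odot>\<^bsub>A\<^esub> y = c \<odot>\<^bsub>A\<^esub> j \<oplus>\<^bsub>A\<^esub> c \<odot>\<^bsub>A\<^esub> x" using c jc x by (simp add: j(2) B.smult_r_distr)
    then have "c \<odot>\<^bsub>A\<^esub> y \<in> J +>\<^bsub>A\<^esub> (c \<odot>\<^bsub>A\<^esub> x)" using cj by (auto simp: a_r_coset_def')
    then show ?thesis using c x by (intro B.a_repr_independence[symmetric]) (auto intro: J.a_subgroup)
  qed
  moreover have "x \<in> J +>\<^bsub>A\<^esub> x" by (rule J.a_rcos_self[OF x])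
  ultimately show ?thesis by blast
qed

text \<open>The family \<open>s\<close> is indexed by \<open>T\<close> because it will be the image
  of \<open>T\<close> in the local ring. Its classes are distinct, since two equal classes would be
  a nontrivial relation.\<close>

lemma quotient_subspace:
  fixes K :: "'k ring" and A :: "('k, 'b) module" and s :: "'t \<Rightarrow> 'b"
  assumes K: "field K" and A: "algebra K A" and I: "ideal I A" and N: "ideal N A"
  defines "V \<equiv> (quot_algebra A I)\<lparr>carrier := (\<lambda>x. I +>\<^bsub>A\<^esub> x) ` N\<rparr>"
  shows "module K V"
    and "finite T \<Longrightarrow> (\<And>t. t \<in> T \<Longrightarrow> s t \<in> N) \<Longrightarrow>
      (\<And>x. x \<in> N \<Longrightarrow> \<exists>c. (\<forall>t\<in>T. c t \<in> carrier K) \<and> x \<ominus>\<^bsub>A\<^esub> (\<Oplus>\<^bsub>A\<^esub>t\<in>T. c t \<odot>\<^bsub>A\<^esub> s t) \<in> I) \<Longrightarrow>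
      (\<And>c. (\<And>t. t \<in> T \<Longrightarrow> c t \<in> carrier K) \<Longrightarrow> (\<Oplus>\<^bsub>A\<^esub>t\<in>T. c t \<odot>\<^bsub>A\<^esub> s t) \<in> I \<Longrightarrow> \<forall>t\<in>T. c t = \<zero>\<^bsub>K\<^esub>) \<Longrightarrow>
      \<exists>B. is_basis K V B \<and> card B = card T"
proof -
  interpret K: field K by fact
  interpret A: cring A using A by (simp add: algebra_def)
  interpret A: algebra K A by (rule A)
  interpret I: ideal I A by fact
  interpret N: ideal N A by fact
  define q where "q x = I +>\<^bsub>A\<^esub> x" for x
  have Vc: "carrier V = q ` N" by (simp add: V_def q_def[abs_def])
  have Vadd: "q x \<oplus>\<^bsub>V\<^esub> q y = q (x \<oplus>\<^bsub>A\<^esub> y)" if "x \<in> carrier A" "y \<in> carrier A" for x y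
    using I.a_rcos_sum[OF that] by (simp add: V_def q_def FactRing_def)
  have Vzero: "\<zero>\<^bsub>V\<^esub> = q \<zero>\<^bsub>A\<^esub>"
    using A.a_coset_add_zero[OF I.a_subset] by (simp add: V_def q_def FactRing_def)
  have Vsmult: "c \<odot>\<^bsub>V\<^esub> q x = q (c \<odot>\<^bsub>A\<^esub> x)" if "c \<in> carrier K" "x \<in> carrier A" for c x
    using coset_smult[OF A I that] by (simp add: V_def q_def)
  have q_eq: "q x = q y \<longleftrightarrow> x \<ominus>\<^bsub>A\<^esub> y \<in> I" if "x \<in> carrier A" "y \<in> carrier A" for x y
    using A.quotient_eq_iff_same_a_r_cos[OF I that] by (auto simp: q_def)
  have Nsmult: "c \<odot>\<^bsub>A\<^esub> x \<in> N" if "c \<in> carrier K" "x \<in> N" for c x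
  proof -
    have "scalar A c \<otimes>\<^bsub>A\<^esub> x \<in> N" using that by (intro N.I_l_closed) auto
    then show ?thesis using that N.Icarr[OF that(2)] by (simp add: A.smult_assoc2)
  qed
  have ag: "abelian_group V"
  proof (rule abelian_groupI)
    fix X Y Z assume "X \<in> carrier V" "Y \<in> carrier V" "Z \<in> carrier V"
    then obtain x y z where x: "x \<in> N" "X = q x" and y: "y \<in> N" "Y = q y" and z: "z \<in> N" "Z = q z" by (auto simp: Vc)
    note c = N.Icarr[OF x(1)] N.Icarr[OF y(1)] N.Icarr[OF z(1)]
    show "X \<oplus>\<^bsub>V\<^esub> Y \<in> carrier V" using x y c by (auto simp: Vadd Vc)
    show "X \<oplus>\<^bsub>V\<^esub> Y \<oplus>\<^bsub>V\<^esub> Z = X \<oplus>\<^bsub>V\<^esub> (Y \<oplus>\<^bsub>V\<^esub> Z)" using c by (simp add: x y z Vadd A.a_assoc)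
    show "X \<oplus>\<^bsub>V\<^esub> Y = Y \<oplus>\<^bsub>V\<^esub> X" using c by (simp add: x y Vadd A.a_comm)
  next
    fix X assume "X \<in> carrier V"
    then obtain x where x: "x \<in> N" "X = q x" by (auto simp: Vc)
    have c: "x \<in> carrier A" using x(1) by (rule N.Icarr)
    show "\<zero>\<^bsub>V\<^esub> \<oplus>\<^bsub>V\<^esub> X = X" using c by (simp add: x Vzero Vadd)
    have "q (\<ominus>\<^bsub>A\<^esub> x) \<oplus>\<^bsub>V\<^esub> X = \<zero>\<^bsub>V\<^esub>" using c by (simp add: x Vzero Vadd A.l_neg)
    then show "\<exists>Y\<in>carrier V. Y \<oplus>\<^bsub>V\<^esub> X = \<zero>\<^bsub>V\<^esub>" using x by (auto simp: Vc)
  qed (auto simp: Vzero Vc)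
  show mod: "module K V"
  proof (rule moduleI[OF K.is_cring ag])
    fix a X assume a: "a \<in> carrier K" and "X \<in> carrier V"
    then obtain x where x: "x \<in> N" "X = q x" by (auto simp: Vc)
    have xc: "x \<in> carrier A" using x(1) by (rule N.Icarr)
    show "a \<odot>\<^bsub>V\<^esub> X \<in> carrier V" using a x xc Nsmult by (auto simp: Vsmult Vc)
    {
      fix b assume b: "b \<in> carrier K"
      show "(a \<oplus>\<^bsub>K\<^esub> b) \<odot>\<^bsub>V\<^esub> X = a \<odot>\<^bsub>V\<^esub> X \<oplus>\<^bsub>V\<^esub> b \<odot>\<^bsub>V\<^esub> X"
        using a b xc by (simp add: x Vsmult Vadd A.smult_l_distr)
      show "(a \<otimes>\<^bsub>K\<^esub> b) \<odot>\<^bsub>V\<^esub> X = a \<odot>\<^bsub>V\<^esub> (b \<odot>\<^bsub>V\<^esub> X)"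
        using a b xc by (simp add: x Vsmult A.smult_assoc1)
    }
    fix Y assume "Y \<in> carrier V"
    then obtain y where y: "y \<in> N" "Y = q y" by (auto simp: Vc)
    have yc: "y \<in> carrier A" using y(1) by (rule N.Icarr)
    show "a \<odot>\<^bsub>V\<^esub> (X \<oplus>\<^bsub>V\<^esub> Y) = a \<odot>\<^bsub>V\<^esub> X \<oplus>\<^bsub>V\<^esub> a \<odot>\<^bsub>V\<^esub> Y"
      using a xc yc by (simp add: x y Vsmult Vadd A.smult_r_distr)
  next
    fix X assume "X \<in> carrier V"
    then obtain x where x: "x \<in> N" "X = q x" by (auto simp: Vc)
    show "\<one>\<^bsub>K\<^esub> \<odot>\<^bsub>V\<^esub> X = X" using N.Icarr[OF x(1)] by (simp add: x Vsmult)
  qed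
  interpret V: abelian_group V by (rule ag)
  interpret V: module K V by (rule mod)
  have qsum: "(\<Oplus>\<^bsub>V\<^esub>t\<in>T. q (f t)) = q (\<Oplus>\<^bsub>A\<^esub>t\<in>T. f t)" if "finite T" "\<And>t. t \<in> T \<Longrightarrow> f t \<in> N" for T and f :: "'t \<Rightarrow> 'b"
    using that
  proof (induction T rule: finite_induct)
    case (insert t T)
    have "(\<Oplus>\<^bsub>V\<^esub>t\<in>insert t T. q (f t)) = q (f t) \<oplus>\<^bsub>V\<^esub> (\<Oplus>\<^bsub>V\<^esub>t\<in>T. q (f t))"
      using insert by (intro V.finsum_insert) (auto simp: Vc)
    moreover have "(\<Oplus>\<^bsub>A\<^esub>t\<in>insert t T. f t) = f t \<oplus>\<^bsub>A\<^esub> (\<Oplus>\<^bsub>A\<^esub>t\<in>T. f t)"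
      using insert N.Icarr by (intro A.finsum_insert) auto
    moreover have "(\<Oplus>\<^bsub>A\<^esub>t\<in>T. f t) \<in> carrier A" using insert N.Icarr by (intro A.finsum_closed) auto
    ultimately show ?case using insert N.Icarr by (simp add: Vadd)
  qed (simp add: Vzero)
  assume fin: "finite T" and s: "\<And>t. t \<in> T \<Longrightarrow> s t \<in> N"
    and span: "\<And>x. x \<in> N \<Longrightarrow> \<exists>c. (\<forall>t\<in>T. c t \<in> carrier K) \<and> x \<ominus>\<^bsub>A\<^esub> (\<Oplus>\<^bsub>A\<^esub>t\<in>T. c t \<odot>\<^bsub>A\<^esub> s t) \<in> I"
    and indep: "\<And>c. (\<And>t. t \<in> T \<Longrightarrow> c t \<in> carrier K) \<Longrightarrow> (\<Oplus>\<^bsub>A\<^esub>t\<in>T. c t \<odot>\<^bsub>A\<^esub> s t) \<in> I \<Longrightarrow> \<forall>t\<in>T. c t = \<zero>\<^bsub>K\<^esub>"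
  have sc: "s t \<in> carrier A" if "t \<in> T" for t using s[OF that] by (rule N.Icarr)
  have comb: "(\<Oplus>\<^bsub>V\<^esub>t\<in>T. c t \<odot>\<^bsub>V\<^esub> q (s t)) = q (\<Oplus>\<^bsub>A\<^esub>t\<in>T. c t \<odot>\<^bsub>A\<^esub> s t)"
    if "\<And>t. t \<in> T \<Longrightarrow> c t \<in> carrier K" for c
  proof -
    have "(\<Oplus>\<^bsub>V\<^esub>t\<in>T. c t \<odot>\<^bsub>V\<^esub> q (s t)) = (\<Oplus>\<^bsub>V\<^esub>t\<in>T. q (c t \<odot>\<^bsub>A\<^esub> s t))"
      using that sc s Nsmult by (intro V.finsum_cong') (auto simp: Vsmult Vc)
    also have "\<dots> = q (\<Oplus>\<^bsub>A\<^esub>t\<in>T. c t \<odot>\<^bsub>A\<^esub> s t)" using that s Nsmult by (intro qsum fin) auto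
    finally show ?thesis .
  qed
  have csum: "(\<Oplus>\<^bsub>A\<^esub>t\<in>T. c t \<odot>\<^bsub>A\<^esub> s t) \<in> carrier A" if "\<And>t. t \<in> T \<Longrightarrow> c t \<in> carrier K" for c
    using that sc by (intro A.finsum_closed) auto
  have diff: "(\<Oplus>\<^bsub>A\<^esub>t\<in>T. (c t \<ominus>\<^bsub>K\<^esub> d t) \<odot>\<^bsub>A\<^esub> s t) = (\<Oplus>\<^bsub>A\<^esub>t\<in>T. c t \<odot>\<^bsub>A\<^esub> s t) \<ominus>\<^bsub>A\<^esub> (\<Oplus>\<^bsub>A\<^esub>t\<in>T. d t \<odot>\<^bsub>A\<^esub> s t)"
    if c: "\<And>t. t \<in> T \<Longrightarrow> c t \<in> carrier K" and d: "\<And>t. t \<in> T \<Longrightarrow> d t \<in> carrier K" for c d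
  proof -
    let ?e = "\<lambda>t. c t \<ominus>\<^bsub>K\<^esub> d t"
    have e: "?e t \<in> carrier K" if "t \<in> T" for t using c[OF that] d[OF that] by simp
    have "(\<Oplus>\<^bsub>A\<^esub>t\<in>T. c t \<odot>\<^bsub>A\<^esub> s t) = (\<Oplus>\<^bsub>A\<^esub>t\<in>T. ?e t \<odot>\<^bsub>A\<^esub> s t \<oplus>\<^bsub>A\<^esub> d t \<odot>\<^bsub>A\<^esub> s t)"
    proof (rule A.finsum_cong'[OF refl])
      fix t assume t: "t \<in> T"
      have "c t = ?e t \<oplus>\<^bsub>K\<^esub> d t" using c[OF t] d[OF t] by (simp add: a_minus_def K.a_assoc K.l_neg)
      then show "c t \<odot>\<^bsub>A\<^esub> s t = ?e t \<odot>\<^bsub>A\<^esub> s t \<oplus>\<^bsub>A\<^esub> d t \<odot>\<^bsub>A\<^esub> s t"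
        using A.smult_l_distr[OF e[OF t] d[OF t] sc[OF t]] by simp
    qed (use e d sc in auto)
    also have "\<dots> = (\<Oplus>\<^bsub>A\<^esub>t\<in>T. ?e t \<odot>\<^bsub>A\<^esub> s t) \<oplus>\<^bsub>A\<^esub> (\<Oplus>\<^bsub>A\<^esub>t\<in>T. d t \<odot>\<^bsub>A\<^esub> s t)"
      using e d sc by (intro A.finsum_addf) auto
    finally show ?thesis
      using csum[of ?e, OF e] csum[of d, OF d] by (simp add: a_minus_def A.a_assoc A.r_neg)
  qed
  let ?b = "\<lambda>t. q (s t)"
  have inj: "inj_on ?b T"
  proof (rule inj_onI, rule ccontr)
    fix t u assume t: "t \<in> T" and u: "u \<in> T" and eq: "?b t = ?b u" and ne: "t \<noteq> u"
    \<comment> \<open>Coefficients that single out one element; the difference of those for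
      \<open>t\<close> and \<open>u\<close> is the nontrivial relation.\<close>
    define \<delta> where "\<delta> v = (\<lambda>w. if w = v then \<one>\<^bsub>K\<^esub> else \<zero>\<^bsub>K\<^esub>)" for v :: 't
    have \<delta>: "\<delta> v w \<in> carrier K" for v w by (simp add: \<delta>_def)
    have "(\<Oplus>\<^bsub>A\<^esub>w\<in>T. \<delta> v w \<odot>\<^bsub>A\<^esub> s w) = \<delta> v v \<odot>\<^bsub>A\<^esub> s v" if "v \<in> T" for v
      using that sc by (intro A.finsum_single fin) (auto simp: \<delta>_def)
    then have \<delta>s: "(\<Oplus>\<^bsub>A\<^esub>w\<in>T. \<delta> v w \<odot>\<^bsub>A\<^esub> s w) = s v" if "v \<in> T" for v
      using that sc[OF that] by (simp add: \<delta>_def)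
    have "s t \<ominus>\<^bsub>A\<^esub> s u \<in> I" using eq q_eq[OF sc[OF t] sc[OF u]] by simp
    then have "(\<Oplus>\<^bsub>A\<^esub>w\<in>T. (\<delta> t w \<ominus>\<^bsub>K\<^esub> \<delta> u w) \<odot>\<^bsub>A\<^esub> s w) \<in> I"
      using diff[of "\<delta> t" "\<delta> u", OF \<delta> \<delta>] \<delta>s[OF t] \<delta>s[OF u] by simp
    then have "\<forall>w\<in>T. \<delta> t w \<ominus>\<^bsub>K\<^esub> \<delta> u w = \<zero>\<^bsub>K\<^esub>" using \<delta> by (intro indep) auto
    then have "\<one>\<^bsub>K\<^esub> = \<zero>\<^bsub>K\<^esub>" using t ne by (auto simp: \<delta>_def a_minus_def)
    then show False by simp
  qed
  have "is_basis K V (?b ` T)"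
    unfolding is_basis_def
  proof (intro conjI ballI)
    show "finite (?b ` T)" using fin by simp
    show "?b ` T \<subseteq> carrier V" using s by (auto simp: Vc)
    fix X assume "X \<in> carrier V"
    then obtain x where x: "x \<in> N" "X = q x" by (auto simp: Vc)
    have xc: "x \<in> carrier A" using x(1) by (rule N.Icarr)
    have bV: "?b t \<in> carrier V" if "t \<in> T" for t using s[OF that] by (simp add: Vc)
    have reindex: "(\<Oplus>\<^bsub>V\<^esub>b\<in>?b ` T. c b \<odot>\<^bsub>V\<^esub> b) = (\<Oplus>\<^bsub>V\<^esub>t\<in>T. c (?b t) \<odot>\<^bsub>V\<^esub> ?b t)"
      if "\<And>t. t \<in> T \<Longrightarrow> c (?b t) \<in> carrier K" for c
      using that bV inj by (intro V.finsum_reindex) auto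
    obtain c where c: "\<And>t. t \<in> T \<Longrightarrow> c t \<in> carrier K" "x \<ominus>\<^bsub>A\<^esub> (\<Oplus>\<^bsub>A\<^esub>t\<in>T. c t \<odot>\<^bsub>A\<^esub> s t) \<in> I"
      using span[OF x(1)] by blast
    have Xc: "X = (\<Oplus>\<^bsub>V\<^esub>t\<in>T. c t \<odot>\<^bsub>V\<^esub> ?b t)"
      using comb[of c, OF c(1)] x(2) q_eq[OF xc csum[of c, OF c(1)]] c(2) by simp
    let ?c = "restrict (\<lambda>b. c (inv_into T ?b b)) (?b ` T)"
    have cb: "?c (?b t) = c t" if "t \<in> T" for t using that inv_into_f_f[OF inj that] by simp
    show "\<exists>!d. d \<in> ?b ` T \<rightarrow>\<^sub>E carrier K \<and> X = (\<Oplus>\<^bsub>V\<^esub>b\<in>?b ` T. d b \<odot>\<^bsub>V\<^esub> b)"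
    proof (rule ex1I)
      have "(\<Oplus>\<^bsub>V\<^esub>b\<in>?b ` T. ?c b \<odot>\<^bsub>V\<^esub> b) = (\<Oplus>\<^bsub>V\<^esub>t\<in>T. ?c (?b t) \<odot>\<^bsub>V\<^esub> ?b t)"
        using cb c(1) by (intro reindex) auto
      also have "\<dots> = X"
        unfolding Xc using cb c(1) bV by (intro V.finsum_cong') auto
      finally show "?c \<in> ?b ` T \<rightarrow>\<^sub>E carrier K \<and> X = (\<Oplus>\<^bsub>V\<^esub>b\<in>?b ` T. ?c b \<odot>\<^bsub>V\<^esub> b)"
        using cb c(1) by auto
      fix d assume d: "d \<in> ?b ` T \<rightarrow>\<^sub>E carrier K \<and> X = (\<Oplus>\<^bsub>V\<^esub>b\<in>?b ` T. d b \<odot>\<^bsub>V\<^esub> b)"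
      have dc: "d (?b t) \<in> carrier K" if "t \<in> T" for t using d that by blast
      have "X = (\<Oplus>\<^bsub>V\<^esub>t\<in>T. d (?b t) \<odot>\<^bsub>V\<^esub> ?b t)" using d reindex[of d] dc by simp
      also have "\<dots> = q (\<Oplus>\<^bsub>A\<^esub>t\<in>T. d (?b t) \<odot>\<^bsub>A\<^esub> s t)" by (rule comb) (rule dc)
      finally have "q (\<Oplus>\<^bsub>A\<^esub>t\<in>T. d (?b t) \<odot>\<^bsub>A\<^esub> s t) = q (\<Oplus>\<^bsub>A\<^esub>t\<in>T. c t \<odot>\<^bsub>A\<^esub> s t)"
        using Xc comb[of c, OF c(1)] by simp
      then have "(\<Oplus>\<^bsub>A\<^esub>t\<in>T. (d (?b t) \<ominus>\<^bsub>K\<^esub> c t) \<odot>\<^bsub>A\<^esub> s t) \<in> I"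
        using q_eq[OF csum[of "\<lambda>t. d (?b t)", OF dc] csum[of c, OF c(1)]] diff[of "\<lambda>t. d (?b t)" c, OF dc c(1)] by simp
      then have z: "\<forall>t\<in>T. d (?b t) \<ominus>\<^bsub>K\<^esub> c t = \<zero>\<^bsub>K\<^esub>" using dc c(1) by (intro indep) auto
      have "d (?b t) = c t" if "t \<in> T" for t
        using z that dc[OF that] c(1)[OF that] K.r_right_minus_eq[of "d (?b t)" "c t"] by auto
      then show "d = ?c"
        using d cb by (intro extensionalityI[of _ "?b ` T"]) (auto simp: PiE_def)
    qed
  qed
  moreover have "card (?b ` T) = card T" using inj by (rule card_image)
  ultimately show "\<exists>B. is_basis K V B \<and> card B = card T" by blast
qed

context connected_graded_algebra
begin

sublocale L: algebra_localization K R irrelevant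
  by (rule algebra_localization.intro[OF algebra_A irrelevant_prime])

text \<open>A denominator \<open>s\<close> outside the irrelevant ideal has a nonzero scalar as
  component of degree 0 and may be replaced by it modulo the square, so what spans in
  \<open>R\<close> spans in the local ring. For independence, a factor \<open>u\<close> outside the
  irrelevant ideal is likewise congruent to a unit and can be cancelled modulo the square.\<close>

lemma cotangent_basis:
  assumes fin: "finite T" and TM: "T \<subseteq> irrelevant" and span: "spans_cotangent T"
    and indep: "\<And>c. (\<forall>t\<in>T. c t \<in> carrier K) \<Longrightarrow> lincomb T c \<in> irrelevant_square \<Longrightarrow> \<forall>t\<in>T. c t = \<zero>\<^bsub>K\<^esub>"
  shows "module K (cotangent_space R irrelevant)"
    and "\<exists>B. is_basis K (cotangent_space R irrelevant) B \<and> card B = card T"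
proof -
  let ?B = "local_ring R irrelevant" and ?M = "local_ideal R irrelevant"
  let ?M2 = "ideal_prod ?B ?M ?M"
  let ?loc = "L.loc" and ?fr = "fraction R irrelevant"
  interpret B: cring ?B by (rule L.local_cring)
  interpret B: algebra K ?B by (rule L.local_algebra)
  interpret M: ideal ?M ?B by (rule L.local_ideal_ideal)
  have M2: "ideal ?M2 ?B" by (rule B.ideal_prod_is_ideal) (rule M.is_ideal)+
  interpret M2: ideal ?M2 ?B by (rule M2)
  interpret I: ideal irrelevant R by (rule irrelevant_ideal)
  interpret I2: ideal irrelevant_square R by (rule irrelevant_square_ideal)
  interpret l: ring_hom_cring R ?B ?loc by (rule L.loc_hom_cring)
  have Tc: "T \<subseteq> carrier R" using TM irrelevant_carrier by blast
  have lsum: "(\<Oplus>\<^bsub>?B\<^esub>t\<in>T. c t \<odot>\<^bsub>?B\<^esub> ?loc t) = ?loc (lincomb T c)"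
    if c: "\<And>t. t \<in> T \<Longrightarrow> c t \<in> carrier K" for c
  proof -
    have fm: "(\<lambda>t. c t \<odot>\<^bsub>R\<^esub> t) \<in> T \<rightarrow> carrier R" using Tc c by auto
    have "?loc (lincomb T c) = (\<Oplus>\<^bsub>?B\<^esub>t\<in>T. ?loc (c t \<odot>\<^bsub>R\<^esub> t))"
      unfolding lincomb_def using l.hom_finsum[OF fm] by (simp add: o_def)
    also have "\<dots> = (\<Oplus>\<^bsub>?B\<^esub>t\<in>T. c t \<odot>\<^bsub>?B\<^esub> ?loc t)"
    proof (rule B.finsum_cong'[OF refl])
      have lT: "?loc t \<in> carrier ?B" if "t \<in> T" for t using that Tc by (intro l.hom_closed) blast
      show "(\<lambda>t. c t \<odot>\<^bsub>?B\<^esub> ?loc t) \<in> T \<rightarrow> carrier ?B" using lT c by blast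
      show "?loc (c t \<odot>\<^bsub>R\<^esub> t) = c t \<odot>\<^bsub>?B\<^esub> ?loc t" if "t \<in> T" for t
        using that Tc c by (intro L.loc_smult) auto
    qed
    finally show ?thesis by simp
  qed
  have cot: "cotangent_space R irrelevant = (quot_algebra ?B ?M2)\<lparr>carrier := (\<lambda>x. ?M2 +>\<^bsub>?B\<^esub> x) ` ?M\<rparr>"
    by (simp add: cotangent_space_def Let_def)
  show "module K (cotangent_space R irrelevant)"
    unfolding cot by (rule quotient_subspace(1)[OF K.field_axioms L.local_algebra M2 M.is_ideal])
  show "\<exists>B. is_basis K (cotangent_space R irrelevant) B \<and> card B = card T"
    unfolding cot
  proof (rule quotient_subspace(2)[OF K.field_axioms L.local_algebra M2 M.is_ideal fin, where s = ?loc])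
    show "?loc t \<in> ?M" if "t \<in> T" for t
      using that TM L.one_notin by (auto simp: L.loc_def intro!: L.local_idealI)
    show "\<exists>c. (\<forall>t\<in>T. c t \<in> carrier K) \<and> x \<ominus>\<^bsub>?B\<^esub> (\<Oplus>\<^bsub>?B\<^esub>t\<in>T. c t \<odot>\<^bsub>?B\<^esub> ?loc t) \<in> ?M2" if x: "x \<in> ?M" for x
    proof -
      obtain a s where a: "a \<in> irrelevant" "s \<in> carrier R" "s \<notin> irrelevant" "x = ?fr a s"
        using x unfolding local_ideal_def by blast
      have ac: "a \<in> carrier R" using a(1) by (rule ideal.Icarr[OF irrelevant_ideal])
      obtain k where k: "k \<in> carrier K" "comp 0 s = scalar R k" using comp_0[OF a(2)] by blast
      have k0: "k \<noteq> \<zero>\<^bsub>K\<^esub>"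
      proof
        assume "k = \<zero>\<^bsub>K\<^esub>"
        then have "comp 0 s = \<zero>\<^bsub>R\<^esub>" using k(2) S.hom_zero by simp
        then show False using a(2,3) unfolding irrelevant_def by blast
      qed
      then have kU: "k \<in> Units K" using k(1) by (simp add: K.field_Units)
      \<comment> \<open>The inverse scalar: \<open>e s\<close> is congruent to one modulo the
        irrelevant ideal.\<close>
      define e where "e = inv\<^bsub>K\<^esub> k"
      have e: "e \<in> carrier K" "e \<otimes>\<^bsub>K\<^esub> k = \<one>\<^bsub>K\<^esub>" using kU by (auto simp: e_def)
      have se: "scalar R e \<in> carrier R" using e(1) by simp
      have d: "\<one>\<^bsub>R\<^esub> \<ominus>\<^bsub>R\<^esub> scalar R e \<otimes>\<^bsub>R\<^esub> s \<in> irrelevant"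
      proof -
        have "comp 0 (scalar R e \<otimes>\<^bsub>R\<^esub> s) = scalar R e \<otimes>\<^bsub>R\<^esub> scalar R k"
          using se a(2) k(2) by (simp add: comp_0_mult comp_0_scalar[OF e(1)])
        also have "\<dots> = scalar R (e \<otimes>\<^bsub>K\<^esub> k)" by (rule S.hom_mult[OF e(1) k(1), symmetric])
        also have "\<dots> = \<one>\<^bsub>R\<^esub>" by (simp add: e(2))
        finally have 1: "comp 0 (scalar R e \<otimes>\<^bsub>R\<^esub> s) = \<one>\<^bsub>R\<^esub>" .
        let ?z = "scalar R e \<otimes>\<^bsub>R\<^esub> s"
        have zc: "?z \<in> carrier R" using se a(2) by simp
        have dc: "\<one>\<^bsub>R\<^esub> \<ominus>\<^bsub>R\<^esub> ?z \<in> carrier R" using zc by simp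
        have "\<one>\<^bsub>R\<^esub> = (\<one>\<^bsub>R\<^esub> \<ominus>\<^bsub>R\<^esub> ?z) \<oplus>\<^bsub>R\<^esub> ?z" using zc by (simp add: a_minus_def A.a_assoc A.l_neg)
        then have "comp 0 \<one>\<^bsub>R\<^esub> = comp 0 (\<one>\<^bsub>R\<^esub> \<ominus>\<^bsub>R\<^esub> ?z) \<oplus>\<^bsub>R\<^esub> comp 0 ?z" using comp_add[OF dc zc] by (simp only:)
        then have "\<one>\<^bsub>R\<^esub> = comp 0 (\<one>\<^bsub>R\<^esub> \<ominus>\<^bsub>R\<^esub> ?z) \<oplus>\<^bsub>R\<^esub> \<one>\<^bsub>R\<^esub>" by (simp only: 1 comp_0_one)
        then have "comp 0 (\<one>\<^bsub>R\<^esub> \<ominus>\<^bsub>R\<^esub> ?z) = \<zero>\<^bsub>R\<^esub>"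
          using A.add.r_cancel_one'[OF A.one_closed comp_closed[OF dc]] by (simp only:)
        then show ?thesis using dc by (simp only: irrelevant_def mem_Collect_eq)
      qed
      obtain c where c: "\<And>t. t \<in> T \<Longrightarrow> c t \<in> carrier K" "a \<ominus>\<^bsub>R\<^esub> lincomb T c \<in> irrelevant_square"
        using span a(1) unfolding spans_cotangent_def by blast
      have lc: "lincomb T c \<in> carrier R" by (rule lincomb_closed[OF Tc c(1)])
      let ?c = "\<lambda>t. e \<otimes>\<^bsub>K\<^esub> c t"
      have ec: "?c t \<in> carrier K" if "t \<in> T" for t using e(1) c(1)[OF that] by simp
      have lec: "lincomb T ?c = scalar R e \<otimes>\<^bsub>R\<^esub> lincomb T c"
        using lincomb_smult[OF fin Tc c(1) e(1)] lc e(1) by (simp add: A.smult_assoc2)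
      have fs: "?fr \<one>\<^bsub>R\<^esub> s \<in> carrier ?B" by (rule L.local_fr_closed[OF A.one_closed a(2,3)])
      have P1: "(?loc a \<otimes>\<^bsub>?B\<^esub> ?fr \<one>\<^bsub>R\<^esub> s) \<otimes>\<^bsub>?B\<^esub> ?loc (\<one>\<^bsub>R\<^esub> \<ominus>\<^bsub>R\<^esub> scalar R e \<otimes>\<^bsub>R\<^esub> s) \<in> ?M2"
      proof (rule ideal_prod.prod)
        show "?loc a \<otimes>\<^bsub>?B\<^esub> ?fr \<one>\<^bsub>R\<^esub> s \<in> ?M" using x L.fr_loc(1)[OF ac a(2,3)] a(4) by (simp only:)
        show "?loc (\<one>\<^bsub>R\<^esub> \<ominus>\<^bsub>R\<^esub> scalar R e \<otimes>\<^bsub>R\<^esub> s) \<in> ?M"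
          unfolding L.loc_def by (rule L.local_idealI[OF d A.one_closed L.one_notin])
      qed
      have P2: "?loc (scalar R e \<otimes>\<^bsub>R\<^esub> (a \<ominus>\<^bsub>R\<^esub> lincomb T c)) \<in> ?M2"
        by (rule L.loc_square[OF I2.I_l_closed[OF c(2) se]])
      \<comment> \<open>The difference between \<open>a / s\<close> and \<open>e\<close> times the
        combination splits into a product of two elements of the maximal ideal and the image of an
        element of the square.\<close>
      have "x \<ominus>\<^bsub>?B\<^esub> ?loc (lincomb T ?c) =
          (?loc a \<otimes>\<^bsub>?B\<^esub> ?fr \<one>\<^bsub>R\<^esub> s) \<otimes>\<^bsub>?B\<^esub> ?loc (\<one>\<^bsub>R\<^esub> \<ominus>\<^bsub>R\<^esub> scalar R e \<otimes>\<^bsub>R\<^esub> s) \<oplus>\<^bsub>?B\<^esub>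
          ?loc (scalar R e \<otimes>\<^bsub>R\<^esub> (a \<ominus>\<^bsub>R\<^esub> lincomb T c))"
      proof -
        define la ls le ll where "la = ?loc a" and "ls = ?loc s" and "le = ?loc (scalar R e)" and "ll = ?loc (lincomb T c)"
        have cl: "la \<in> carrier ?B" "ls \<in> carrier ?B" "le \<in> carrier ?B" "ll \<in> carrier ?B"
          unfolding la_def ls_def le_def ll_def by (rule l.hom_closed, fact)+
        have inv: "?fr \<one>\<^bsub>R\<^esub> s \<otimes>\<^bsub>?B\<^esub> ls = \<one>\<^bsub>?B\<^esub>"
          using L.fr_loc(2)[OF A.one_closed a(2,3)] B.m_comm[OF fs cl(2)] by (simp add: ls_def)
        have x': "x = la \<otimes>\<^bsub>?B\<^esub> ?fr \<one>\<^bsub>R\<^esub> s" using L.fr_loc(1)[OF ac a(2,3)] a(4) by (simp add: la_def)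
        have e1: "?loc (lincomb T ?c) = le \<otimes>\<^bsub>?B\<^esub> ll"
          unfolding lec le_def ll_def by (rule l.hom_mult[OF se lc])
        have e2: "?loc (\<one>\<^bsub>R\<^esub> \<ominus>\<^bsub>R\<^esub> scalar R e \<otimes>\<^bsub>R\<^esub> s) = \<one>\<^bsub>?B\<^esub> \<ominus>\<^bsub>?B\<^esub> le \<otimes>\<^bsub>?B\<^esub> ls"
          using se a(2) by (simp add: a_minus_def le_def ls_def del: A.smult_closed)
        have e3: "?loc (scalar R e \<otimes>\<^bsub>R\<^esub> (a \<ominus>\<^bsub>R\<^esub> lincomb T c)) = le \<otimes>\<^bsub>?B\<^esub> (la \<ominus>\<^bsub>?B\<^esub> ll)"
          using se ac lc by (simp add: a_minus_def le_def la_def ll_def del: A.smult_closed)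
        define f where "f = ?fr \<one>\<^bsub>R\<^esub> s"
        have fc: "f \<in> carrier ?B" using fs by (simp add: f_def)
        have "(la \<otimes>\<^bsub>?B\<^esub> f) \<otimes>\<^bsub>?B\<^esub> (\<one>\<^bsub>?B\<^esub> \<ominus>\<^bsub>?B\<^esub> le \<otimes>\<^bsub>?B\<^esub> ls) \<oplus>\<^bsub>?B\<^esub> le \<otimes>\<^bsub>?B\<^esub> (la \<ominus>\<^bsub>?B\<^esub> ll) =
            la \<otimes>\<^bsub>?B\<^esub> f \<ominus>\<^bsub>?B\<^esub> (la \<otimes>\<^bsub>?B\<^esub> le) \<otimes>\<^bsub>?B\<^esub> (f \<otimes>\<^bsub>?B\<^esub> ls) \<oplus>\<^bsub>?B\<^esub> le \<otimes>\<^bsub>?B\<^esub> (la \<ominus>\<^bsub>?B\<^esub> ll)"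
          using cl fc by algebra
        also have "\<dots> = la \<otimes>\<^bsub>?B\<^esub> f \<ominus>\<^bsub>?B\<^esub> (la \<otimes>\<^bsub>?B\<^esub> le) \<otimes>\<^bsub>?B\<^esub> \<one>\<^bsub>?B\<^esub> \<oplus>\<^bsub>?B\<^esub> le \<otimes>\<^bsub>?B\<^esub> (la \<ominus>\<^bsub>?B\<^esub> ll)"
          using inv by (simp only: f_def)
        also have "\<dots> = la \<otimes>\<^bsub>?B\<^esub> f \<ominus>\<^bsub>?B\<^esub> le \<otimes>\<^bsub>?B\<^esub> ll" using cl fc by algebra
        finally show ?thesis unfolding e1 e2 e3 x' f_def la_def[symmetric] by simp
      qed
      then have "x \<ominus>\<^bsub>?B\<^esub> ?loc (lincomb T ?c) \<in> ?M2" using M2.a_closed[OF P1 P2] by simp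
      then show ?thesis using ec lsum[of ?c, OF ec] by (intro exI[of _ ?c]) simp
    qed
    fix c assume c: "\<And>t. t \<in> T \<Longrightarrow> c t \<in> carrier K" and "(\<Oplus>\<^bsub>?B\<^esub>t\<in>T. c t \<odot>\<^bsub>?B\<^esub> ?loc t) \<in> ?M2"
    then have "?loc (lincomb T c) \<in> ?M2" using lsum[of c, OF c] by simp
    moreover have lc: "lincomb T c \<in> carrier R" by (rule lincomb_closed[OF Tc c])
    ultimately obtain u where u: "u \<in> carrier R" "u \<notin> irrelevant" "u \<otimes>\<^bsub>R\<^esub> lincomb T c \<in> irrelevant_square"
      using L.loc_in_square by blast
    let ?l = "lincomb T c"
    have u0: "comp 0 u \<in> Units R" using comp_0_zero_or_Units[OF u(1)] u(1,2) unfolding irrelevant_def by blast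
    have u0c: "comp 0 u \<in> carrier R" by (rule comp_closed[OF u(1)])
    \<comment> \<open>The irrelevant part of \<open>u\<close>: its product with the combination lies
      in the square, so \<open>u\<close> may be replaced by its unit part
      \<open>comp 0 u\<close>.\<close>
    define v where "v = u \<ominus>\<^bsub>R\<^esub> comp 0 u"
    have vc: "v \<in> carrier R" using u(1) u0c by (simp add: v_def)
    have uv: "u = v \<oplus>\<^bsub>R\<^esub> comp 0 u" using u(1) u0c by (simp add: v_def a_minus_def A.a_assoc A.l_neg)
    have "comp 0 u = comp 0 v \<oplus>\<^bsub>R\<^esub> comp 0 u"
    proof -
      have "comp 0 u = comp 0 (v \<oplus>\<^bsub>R\<^esub> comp 0 u)" using uv by (rule arg_cong)
      also have "\<dots> = comp 0 v \<oplus>\<^bsub>R\<^esub> comp 0 (comp 0 u)" by (rule comp_add[OF vc u0c])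
      also have "comp 0 (comp 0 u) = comp 0 u" using comp_comp[OF u(1), of 0 0] by simp
      finally show ?thesis .
    qed
    then have "comp 0 v = \<zero>\<^bsub>R\<^esub>" using A.add.r_cancel_one'[OF u0c comp_closed[OF vc]] by (simp only:)
    then have "v \<in> irrelevant" using vc unfolding irrelevant_def by blast
    then have "v \<otimes>\<^bsub>R\<^esub> ?l \<in> irrelevant_square" using lincomb_irrelevant[OF TM c] by (rule ideal_prod.prod)
    then have "u \<otimes>\<^bsub>R\<^esub> ?l \<oplus>\<^bsub>R\<^esub> \<ominus>\<^bsub>R\<^esub> (v \<otimes>\<^bsub>R\<^esub> ?l) \<in> irrelevant_square"
      using u(3) by (intro I2.a_closed I2.a_inv_closed)
    moreover have "u \<otimes>\<^bsub>R\<^esub> ?l \<oplus>\<^bsub>R\<^esub> \<ominus>\<^bsub>R\<^esub> (v \<otimes>\<^bsub>R\<^esub> ?l) = comp 0 u \<otimes>\<^bsub>R\<^esub> ?l"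
    proof -
      have "(v \<oplus>\<^bsub>R\<^esub> w) \<otimes>\<^bsub>R\<^esub> ?l \<oplus>\<^bsub>R\<^esub> \<ominus>\<^bsub>R\<^esub> (v \<otimes>\<^bsub>R\<^esub> ?l) = w \<otimes>\<^bsub>R\<^esub> ?l" if "w \<in> carrier R" for w
        using vc that lc by algebra
      from this[OF u0c] show ?thesis by (simp only: uv[symmetric])
    qed
    ultimately have "comp 0 u \<otimes>\<^bsub>R\<^esub> ?l \<in> irrelevant_square" by (simp only:)
    then have "?l \<in> irrelevant_square"
      by (rule A.ideal_Units_cancel[OF irrelevant_square_ideal u0 lc])
    then show "\<forall>t\<in>T. c t = \<zero>\<^bsub>K\<^esub>" using c by (intro indep) auto
  qed
qed

end


section \<open>Evaluation of polynomials\<close>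

text \<open>Both \<open>B\<close> and \<open>C\<close> are the quotient of \<open>A\<close> by the
  same equivalence relation. This yields the isomorphism with a residue class algebra, where
  \<open>q\<close> is the projection, and the one with a polynomial ring, where \<open>q\<close> is
  the identity.\<close>

lemma alg_isomorphic_of_fibres:
  fixes K :: "'k ring" and A :: "('k, 'a) module" and B :: "('k, 'b) module" and C :: "('k, 'c) module"
  assumes A: "algebra K A"
    and f: "f \<in> ring_hom A B" "f ` carrier A = carrier B"
      "\<And>c x. c \<in> carrier K \<Longrightarrow> x \<in> carrier A \<Longrightarrow> f (c \<odot>\<^bsub>A\<^esub> x) = c \<odot>\<^bsub>B\<^esub> f x"
    and q: "q \<in> ring_hom A C" "q ` carrier A = carrier C"
      "\<And>c x. c \<in> carrier K \<Longrightarrow> x \<in> carrier A \<Longrightarrow> q (c \<odot>\<^bsub>A\<^esub> x) = c \<odot>\<^bsub>C\<^esub> q x"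
    and fibres: "\<And>x y. x \<in> carrier A \<Longrightarrow> y \<in> carrier A \<Longrightarrow> f x = f y \<longleftrightarrow> q x = q y"
  shows "alg_isomorphic K B C"
proof -
  interpret K: cring K using A by (simp add: algebra_def module_def)
  interpret A: cring A using A by (simp add: algebra_def)
  interpret A: algebra K A by (rule A)
  define g where "g = restrict (\<lambda>y. q (inv_into (carrier A) f y)) (carrier B)"
  have fc: "f x \<in> carrier B" if "x \<in> carrier A" for x using f(2) that by blast
  have gf: "g (f x) = q x" if x: "x \<in> carrier A" for x
  proof -
    have "inv_into (carrier A) f (f x) \<in> carrier A" "f (inv_into (carrier A) f (f x)) = f x"
      using x by (auto intro: inv_into_into f_inv_into_f)
    then have "q (inv_into (carrier A) f (f x)) = q x" using fibres x by blast
    then show ?thesis using fc[OF x] by (simp add: g_def)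
  qed
  have B: "\<exists>x\<in>carrier A. y = f x" if "y \<in> carrier B" for y using that f(2) by blast
  have "g \<in> ring_hom B C"
  proof (rule ring_hom_memI)
    fix x y assume "x \<in> carrier B" "y \<in> carrier B"
    then obtain a b where a: "a \<in> carrier A" "x = f a" and b: "b \<in> carrier A" "y = f b" using B by meson
    show "g x \<in> carrier C" using a gf q(2) by auto
    show "g (x \<otimes>\<^bsub>B\<^esub> y) = g x \<otimes>\<^bsub>C\<^esub> g y"
      using a b gf ring_hom_mult[OF f(1), symmetric] ring_hom_mult[OF q(1)] by simp
    show "g (x \<oplus>\<^bsub>B\<^esub> y) = g x \<oplus>\<^bsub>C\<^esub> g y"
      using a b gf ring_hom_add[OF f(1), symmetric] ring_hom_add[OF q(1)] by simp
  next
    show "g \<one>\<^bsub>B\<^esub> = \<one>\<^bsub>C\<^esub>"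
      using gf[OF A.one_closed] by (simp add: ring_hom_one[OF f(1)] ring_hom_one[OF q(1)])
  qed
  moreover have "g (c \<odot>\<^bsub>B\<^esub> y) = c \<odot>\<^bsub>C\<^esub> g y" if c: "c \<in> carrier K" and y: "y \<in> carrier B" for c y
  proof -
    obtain x where x: "x \<in> carrier A" "y = f x" using B[OF y] by blast
    have "g (c \<odot>\<^bsub>B\<^esub> y) = g (f (c \<odot>\<^bsub>A\<^esub> x))" using c x f(3) by simp
    also have "\<dots> = q (c \<odot>\<^bsub>A\<^esub> x)" using c x by (intro gf) simp
    also have "\<dots> = c \<odot>\<^bsub>C\<^esub> g y" using c x gf q(3) by simp
    finally show ?thesis .
  qed
  moreover have "inj_on g (carrier B)"
  proof (rule inj_onI)
    fix y z assume "y \<in> carrier B" "z \<in> carrier B" and eq: "g y = g z"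
    then obtain a b where "a \<in> carrier A" "y = f a" "b \<in> carrier A" "z = f b" using B by meson
    then show "y = z" using eq gf fibres by simp
  qed
  moreover have "g ` carrier B = carrier C"
  proof -
    have "g ` (f ` carrier A) = q ` carrier A" using gf by (auto simp: image_image)
    then show ?thesis using f(2) q(2) by simp
  qed
  moreover have "g \<in> extensional (carrier B)" by (simp add: g_def)
  ultimately show ?thesis unfolding alg_isomorphic_def alg_hom_def bij_betw_def by blast
qed

lemma alg_isomorphic_quot:
  fixes K :: "'k ring" and A :: "('k, 'a) module" and B :: "('k, 'b) module"
  assumes A: "algebra K A" and B: "cring B"
    and f: "f \<in> ring_hom A B" "f ` carrier A = carrier B"
      "\<And>c x. c \<in> carrier K \<Longrightarrow> x \<in> carrier A \<Longrightarrow> f (c \<odot>\<^bsub>A\<^esub> x) = c \<odot>\<^bsub>B\<^esub> f x"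
  shows "iso_closed_subscheme K B A"
proof -
  interpret K: cring K using A by (simp add: algebra_def module_def)
  interpret A: cring A using A by (simp add: algebra_def)
  interpret A: algebra K A by (rule A)
  interpret B: cring B by (rule B)
  interpret f: ring_hom_cring A B f using f(1) by unfold_locales
  let ?J = "a_kernel A B f"
  have J: "ideal ?J A" by (rule ring_hom_ring.kernel_is_ideal[OF f.ring_hom_ring])
  interpret J: ideal ?J A by (rule J)
  have "alg_isomorphic K B (quot_algebra A ?J)"
  proof (rule alg_isomorphic_of_fibres[OF A f])
    show "(\<lambda>x. ?J +>\<^bsub>A\<^esub> x) \<in> ring_hom A (quot_algebra A ?J)"
      using J.rcos_ring_hom by (simp add: ring_hom_def)
    show "(\<lambda>x. ?J +>\<^bsub>A\<^esub> x) ` carrier A = carrier (quot_algebra A ?J)"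
      by (auto simp: FactRing_def A_RCOSETS_def')
    show "?J +>\<^bsub>A\<^esub> (c \<odot>\<^bsub>A\<^esub> x) = c \<odot>\<^bsub>quot_algebra A ?J\<^esub> (?J +>\<^bsub>A\<^esub> x)" if "c \<in> carrier K" "x \<in> carrier A" for c x
      using coset_smult[OF A J that] by simp
    show "f x = f y \<longleftrightarrow> ?J +>\<^bsub>A\<^esub> x = ?J +>\<^bsub>A\<^esub> y" if x: "x \<in> carrier A" and y: "y \<in> carrier A" for x y
    proof -
      have "f x = f y \<longleftrightarrow> f x \<ominus>\<^bsub>B\<^esub> f y = \<zero>\<^bsub>B\<^esub>" using x y by simp
      also have "f x \<ominus>\<^bsub>B\<^esub> f y = f (x \<ominus>\<^bsub>A\<^esub> y)" using x y by (simp add: a_minus_def)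
      also have "f (x \<ominus>\<^bsub>A\<^esub> y) = \<zero>\<^bsub>B\<^esub> \<longleftrightarrow> x \<ominus>\<^bsub>A\<^esub> y \<in> ?J" using A.minus_closed[OF x y] unfolding a_kernel_def' by blast
      also have "\<dots> \<longleftrightarrow> ?J +>\<^bsub>A\<^esub> x = ?J +>\<^bsub>A\<^esub> y"
        using A.quotient_eq_iff_same_a_r_cos[OF J x y] by (auto simp: eq_commute)
      finally show ?thesis .
    qed
  qed
  then show ?thesis unfolding iso_closed_subscheme_def using J by blast
qed

lemma mpoly_algebra:
  fixes A :: "'a ring"
  assumes "cring A"
  shows "algebra A (mpoly A n)"
proof -
  interpret A: cring A by fact
  interpret M: cring "mpoly A n" by (rule A.mpoly_cring)
  have sm: "c \<odot>\<^bsub>mpoly A n\<^esub> p = mconst A c \<otimes>\<^bsub>mpoly A n\<^esub> p"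
    if "c \<in> carrier A" "p \<in> carrier (mpoly A n)" for c p
    using A.mconst_mult[OF that(2,1)] by (simp add: mpoly_simps)
  interpret c: ring_hom_cring A "mpoly A n" "mconst A" by (rule A.mconst_hom_cring)
  show ?thesis
  proof (rule algebraI)
    show "\<one>\<^bsub>A\<^esub> \<odot>\<^bsub>mpoly A n\<^esub> x = x" if "x \<in> carrier (mpoly A n)" for x
      using that by (simp only: sm[OF A.one_closed that] c.hom_one M.l_one)
    fix c x assume c: "c \<in> carrier A" and x: "x \<in> carrier (mpoly A n)"
    note cc = c.hom_closed[OF c]
    show "c \<odot>\<^bsub>mpoly A n\<^esub> x \<in> carrier (mpoly A n)" using sm[OF c x] cc x by simp
    {
      fix d assume d: "d \<in> carrier A"
      note dc = c.hom_closed[OF d]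
      show "(c \<oplus>\<^bsub>A\<^esub> d) \<odot>\<^bsub>mpoly A n\<^esub> x = c \<odot>\<^bsub>mpoly A n\<^esub> x \<oplus>\<^bsub>mpoly A n\<^esub> d \<odot>\<^bsub>mpoly A n\<^esub> x"
        unfolding sm[OF c x] sm[OF d x] sm[OF A.a_closed[OF c d] x] c.hom_add[OF c d] by (rule M.l_distr[OF cc dc x])
      show "(c \<otimes>\<^bsub>A\<^esub> d) \<odot>\<^bsub>mpoly A n\<^esub> x = c \<odot>\<^bsub>mpoly A n\<^esub> (d \<odot>\<^bsub>mpoly A n\<^esub> x)"
        unfolding sm[OF d x] sm[OF c M.m_closed[OF dc x]] sm[OF A.m_closed[OF c d] x] c.hom_mult[OF c d] by (rule M.m_assoc[OF cc dc x])
    }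
    fix y assume y: "y \<in> carrier (mpoly A n)"
    show "c \<odot>\<^bsub>mpoly A n\<^esub> (x \<oplus>\<^bsub>mpoly A n\<^esub> y) = c \<odot>\<^bsub>mpoly A n\<^esub> x \<oplus>\<^bsub>mpoly A n\<^esub> c \<odot>\<^bsub>mpoly A n\<^esub> y"
      unfolding sm[OF c x] sm[OF c y] sm[OF c M.a_closed[OF x y]] by (rule M.r_distr[OF x y cc])
    show "(c \<odot>\<^bsub>mpoly A n\<^esub> x) \<otimes>\<^bsub>mpoly A n\<^esub> y = c \<odot>\<^bsub>mpoly A n\<^esub> (x \<otimes>\<^bsub>mpoly A n\<^esub> y)"
      unfolding sm[OF c x] sm[OF c M.m_closed[OF x y]] by (rule M.m_assoc[OF cc x y])
  qed (rule A.is_cring M.is_cring)+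
qed

text \<open>The value at the point where every variable is one. Evaluation at \<open>t\<close>
  reduces to it, after the coefficient of each monomial has been multiplied by the value of that
  monomial at \<open>t\<close>.\<close>

definition coeff_sum :: "('a, 'm) ring_scheme \<Rightarrow> (monomial \<Rightarrow> 'a) \<Rightarrow> 'a" where
  "coeff_sum A p = (\<Oplus>\<^bsub>A\<^esub>m\<in>{m. p m \<noteq> \<zero>\<^bsub>A\<^esub>}. p m)"

context cring
begin

lemma coeff_sum_eq:
  assumes "\<And>m. p m \<in> carrier R" "finite S" "\<And>m. p m \<noteq> \<zero> \<Longrightarrow> m \<in> S"
  shows "coeff_sum R p = (\<Oplus>m\<in>S. p m)"
  unfolding coeff_sum_def using assms by (intro finsum_neutral) auto

lemma coeff_sum_hom: "coeff_sum R \<in> ring_hom (mpoly R n) R"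
proof (rule ring_hom_memI)
  fix p assume p: "p \<in> carrier (mpoly R n)"
  note pc = mpoly_carrierD(1)[OF p]
  let ?S = "{m. p m \<noteq> \<zero>}"
  show "coeff_sum R p \<in> carrier R" unfolding coeff_sum_def using pc by (intro finsum_closed) auto
  fix q assume q: "q \<in> carrier (mpoly R n)"
  note qc = mpoly_carrierD(1)[OF q]
  let ?T = "{m. q m \<noteq> \<zero>}"
  have fin: "finite ?S" "finite ?T" using p q by (simp_all add: mpoly_carrierD(2))
  have "coeff_sum R (p \<oplus>\<^bsub>mpoly R n\<^esub> q) = (\<Oplus>m\<in>?S \<union> ?T. p m \<oplus> q m)"
    unfolding mpoly_simps using fin pc qc by (intro coeff_sum_eq) auto
  also have "\<dots> = (\<Oplus>m\<in>?S \<union> ?T. p m) \<oplus> (\<Oplus>m\<in>?S \<union> ?T. q m)" using pc qc by (intro finsum_addf) auto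
  also have "(\<Oplus>m\<in>?S \<union> ?T. p m) = coeff_sum R p" using fin pc by (intro coeff_sum_eq[symmetric]) auto
  also have "(\<Oplus>m\<in>?S \<union> ?T. q m) = coeff_sum R q" using fin qc by (intro coeff_sum_eq[symmetric]) auto
  finally show "coeff_sum R (p \<oplus>\<^bsub>mpoly R n\<^esub> q) = coeff_sum R p \<oplus> coeff_sum R q" .
  let ?M = "(\<lambda>ab. fst ab + snd ab) ` (?S \<times> ?T)"
  let ?P = "\<lambda>m. splits m \<inter> ?S \<times> ?T"
  let ?g = "\<lambda>ab. p (fst ab) \<otimes> q (snd ab)"
  have gc: "?g ab \<in> carrier R" for ab using pc qc by simp
  have inner: "(\<Oplus>ab\<in>splits m. ?g ab) = (\<Oplus>ab\<in>?P m. ?g ab)" for m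
    using gc pc qc by (intro finsum_neutral[symmetric] finite_monomial_splittings) auto
  have nz: "m \<in> ?M" if "(\<Oplus>ab\<in>splits m. ?g ab) \<noteq> \<zero>" for m
  proof (rule ccontr)
    assume "m \<notin> ?M"
    then have "?P m = {}" by force
    then show False using that inner[of m] by simp
  qed
  have "coeff_sum R (p \<otimes>\<^bsub>mpoly R n\<^esub> q) = (\<Oplus>m\<in>?M. \<Oplus>ab\<in>splits m. ?g ab)"
    unfolding mpoly_simps
  proof (rule coeff_sum_eq)
    show "(\<Oplus>ab\<in>splits m. ?g ab) \<in> carrier R" for m using gc by (intro finsum_closed) auto
    show "finite ?M" using fin by simp
    show "m \<in> ?M" if "(\<Oplus>ab\<in>splits m. ?g ab) \<noteq> \<zero>" for m by (rule nz[OF that])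
  qed
  also have "\<dots> = (\<Oplus>m\<in>?M. \<Oplus>ab\<in>?P m. ?g ab)" by (simp only: inner)
  also have "\<dots> = (\<Oplus>mab\<in>Sigma ?M ?P. ?g (snd mab))"
    using fin gc by (intro finsum_Sigma) (auto intro: finite_subset[OF _ finite_monomial_splittings])
  \<comment> \<open>A pair of terms belongs to exactly one monomial, the product of theirs, so
    \<open>m\<close> can be forgotten.\<close>
  also have "\<dots> = (\<Oplus>ab\<in>?S \<times> ?T. ?g ab)"
  proof (rule finsum_bij)
    show "bij_betw snd (Sigma ?M ?P) (?S \<times> ?T)"
      by (rule bij_betw_byWitness[where f' = "\<lambda>ab. (fst ab + snd ab, ab)"]) force+
  qed (rule gc, rule refl)
  also have "\<dots> = coeff_sum R p \<otimes> coeff_sum R q"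
    unfolding coeff_sum_def using fin pc qc by (intro finsum_mult[symmetric]) auto
  finally show "coeff_sum R (p \<otimes>\<^bsub>mpoly R n\<^esub> q) = coeff_sum R p \<otimes> coeff_sum R q" .
next
  have "coeff_sum R (mconst R \<one>) = (\<Oplus>m\<in>{0}. mconst R \<one> m)" by (rule coeff_sum_eq) (auto split: if_splits)
  then show "coeff_sum R \<one>\<^bsub>mpoly R n\<^esub> = \<one>" by (simp add: mpoly_simps)
qed

definition monom_value :: "nat \<Rightarrow> (nat \<Rightarrow> 'a) \<Rightarrow> monomial \<Rightarrow> 'a" where
  "monom_value n t m = (\<Otimes>i\<in>{..<n}. t i [^] Poly_Mapping.lookup m i)"

lemma monom_value:
  assumes t: "\<And>i. i < n \<Longrightarrow> t i \<in> carrier R"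
  shows "monom_value n t m \<in> carrier R" "monom_value n t 0 = \<one>"
    "monom_value n t (a + b) = monom_value n t a \<otimes> monom_value n t b"
    "i < n \<Longrightarrow> monom_value n t (Poly_Mapping.single i 1) = t i"
proof -
  show "monom_value n t m \<in> carrier R" unfolding monom_value_def using t by (intro finprod_closed) auto
  show "monom_value n t 0 = \<one>" unfolding monom_value_def using t by (intro finprod_one_eqI) auto
  have "monom_value n t (a + b) = (\<Otimes>i\<in>{..<n}. t i [^] Poly_Mapping.lookup a i \<otimes> t i [^] Poly_Mapping.lookup b i)"
    unfolding monom_value_def using t by (intro finprod_cong') (auto simp: lookup_add nat_pow_mult)
  also have "\<dots> = monom_value n t a \<otimes> monom_value n t b"
    unfolding monom_value_def using t by (intro finprod_multf) auto
  finally show "monom_value n t (a + b) = monom_value n t a \<otimes> monom_value n t b" .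
  assume i: "i < n"
  have "monom_value n t (Poly_Mapping.single i 1) = (\<Otimes>j\<in>{..<n}. if i = j then t j else \<one>)"
    unfolding monom_value_def using t by (intro finprod_cong') (auto simp: lookup_single when_def)
  also have "\<dots> = t i" using i t by (intro finprod_singleton) auto
  finally show "monom_value n t (Poly_Mapping.single i 1) = t i" .
qed

end

definition (in ring_hom_cring) mpoly_eval :: "nat \<Rightarrow> (nat \<Rightarrow> 'c) \<Rightarrow> (monomial \<Rightarrow> 'a) \<Rightarrow> 'c" where
  "mpoly_eval n t p = coeff_sum S (twist S (S.monom_value n t) h p)"

lemma (in ring_hom_cring) mpoly_eval_hom:
  assumes t: "\<And>i. i < n \<Longrightarrow> t i \<in> carrier S"
  shows "mpoly_eval n t \<in> ring_hom (mpoly R n) S"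
    and "c \<in> carrier R \<Longrightarrow> mpoly_eval n t (mconst R c) = h c"
    and "i < n \<Longrightarrow> mpoly_eval n t (mpoly_var R i) = t i"
proof -
  note mv = S.monom_value[of n t, OF t]
  have "twist S (S.monom_value n t) h \<in> ring_hom (mpoly R n) (mpoly S n)"
    by (rule twist_ring_hom) (use mv in auto)
  then have "coeff_sum S \<circ> twist S (S.monom_value n t) h \<in> ring_hom (mpoly R n) S"
    by (rule ring_hom_trans) (rule S.coeff_sum_hom)
  then show "mpoly_eval n t \<in> ring_hom (mpoly R n) S" by (simp add: mpoly_eval_def[abs_def] o_def)
  have single: "coeff_sum S (twist S (S.monom_value n t) h (\<lambda>m. if m = k then c else \<zero>)) = S.monom_value n t k \<otimes>\<^bsub>S\<^esub> h c"
    if "c \<in> carrier R" for c k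
  proof -
    have "coeff_sum S (twist S (S.monom_value n t) h (\<lambda>m. if m = k then c else \<zero>)) =
        (\<Oplus>\<^bsub>S\<^esub>m\<in>{k}. twist S (S.monom_value n t) h (\<lambda>m. if m = k then c else \<zero>) m)"
      by (rule S.coeff_sum_eq) (use mv(1) that in \<open>auto simp: twist_def split: if_splits\<close>)
    then show ?thesis using mv(1) that by (simp add: twist_def)
  qed
  show "mpoly_eval n t (mconst R c) = h c" if "c \<in> carrier R"
    using single[OF that, of 0] that mv(2) by (simp add: mpoly_eval_def)
  show "mpoly_eval n t (mpoly_var R i) = t i" if "i < n"
    using single[OF R.one_closed, of "Poly_Mapping.single i 1"] mv(4)[OF _ that] t[OF that]
    by (simp add: mpoly_eval_def mpoly_var_def)
qed


section \<open>Chains of prime ideals in polynomial rings\<close>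

text \<open>The linear order on monomials is compatible with addition, so the product of the leading
  terms cannot cancel.\<close>

lemma (in field) mpoly_prod_nonzero:
  assumes p: "p \<in> carrier (mpoly R n)" "p \<noteq> \<zero>\<^bsub>mpoly R n\<^esub>"
    and q: "q \<in> carrier (mpoly R n)" "q \<noteq> \<zero>\<^bsub>mpoly R n\<^esub>"
  shows "p \<otimes>\<^bsub>mpoly R n\<^esub> q \<noteq> \<zero>\<^bsub>mpoly R n\<^esub>"
proof -
  have lead: "\<exists>m. r m \<noteq> \<zero> \<and> (\<forall>k. r k \<noteq> \<zero> \<longrightarrow> k \<le> m)"
    if r: "r \<in> carrier (mpoly R n)" "r \<noteq> \<zero>\<^bsub>mpoly R n\<^esub>" for r
  proof -
    let ?S = "{m. r m \<noteq> \<zero>}"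
    have fin: "finite ?S" by (rule mpoly_carrierD(2)[OF r(1)])
    moreover have "?S \<noteq> {}" using r(2) by (auto simp: mpoly_simps fun_eq_iff)
    ultimately have "Max ?S \<in> ?S" by (rule Max_in)
    then show ?thesis using Max_ge[OF fin] by (intro exI[of _ "Max ?S"]) auto
  qed
  obtain a where a: "p a \<noteq> \<zero>" "\<And>k. p k \<noteq> \<zero> \<Longrightarrow> k \<le> a" using lead[OF p] by blast
  obtain b where b: "q b \<noteq> \<zero>" "\<And>k. q k \<noteq> \<zero> \<Longrightarrow> k \<le> b" using lead[OF q] by blast
  have c: "p k \<in> carrier R" "q k \<in> carrier R" for k
    using mpoly_carrierD(1)[OF p(1)] mpoly_carrierD(1)[OF q(1)] by auto
  have "(\<Oplus>ab\<in>splits (a + b). p (fst ab) \<otimes> q (snd ab)) = p (fst (a, b)) \<otimes> q (snd (a, b))"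
  proof (rule finsum_single[OF finite_monomial_splittings])
    fix ab assume "ab \<in> splits (a + b)" and ne: "ab \<noteq> (a, b)"
    then obtain k l where kl: "ab = (k, l)" "k + l = a + b" by (cases ab) auto
    show "p (fst ab) \<otimes> q (snd ab) = \<zero>"
    proof (rule ccontr)
      assume "p (fst ab) \<otimes> q (snd ab) \<noteq> \<zero>"
      then have "p k \<noteq> \<zero>" "q l \<noteq> \<zero>" using kl(1) c by auto
      then have "k \<le> a" "l \<le> b" using a b by auto
      moreover have "k \<noteq> a \<or> l \<noteq> b" using ne kl(1) by auto
      ultimately have "k + l < a + b" by (metis add_le_less_mono add_less_le_mono order_le_less)
      then show False using kl(2) by simp
    qed
  qed (use c in auto)
  then have "(p \<otimes>\<^bsub>mpoly R n\<^esub> q) (a + b) = p a \<otimes> q b" by (simp add: mpoly_simps)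
  also have "\<dots> \<noteq> \<zero>" using a(1) b(1) c integral by blast
  finally have nz: "(p \<otimes>\<^bsub>mpoly R n\<^esub> q) (a + b) \<noteq> \<zero>" .
  show ?thesis
  proof
    assume "p \<otimes>\<^bsub>mpoly R n\<^esub> q = \<zero>\<^bsub>mpoly R n\<^esub>"
    then have "(p \<otimes>\<^bsub>mpoly R n\<^esub> q) (a + b) = \<zero>\<^bsub>mpoly R n\<^esub> (a + b)" by (rule fun_cong)
    then show False using nz by (simp only: mpoly_simps(3))
  qed
qed

lemma (in field) mpoly_zero_prime: "primeideal {\<zero>\<^bsub>mpoly R n\<^esub>} (mpoly R n)"
proof -
  interpret M: cring "mpoly R n" by (rule mpoly_cring)
  have "\<one>\<^bsub>mpoly R n\<^esub> \<noteq> \<zero>\<^bsub>mpoly R n\<^esub>" by (auto simp: mpoly_simps fun_eq_iff)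
  then show ?thesis
    using mpoly_prod_nonzero[of _ n]
    by (intro primeidealI M.zeroideal M.is_cring) blast+
qed

section \<open>Power products along a chain of primes\<close>

context cring
begin

fun power_product :: "'a list \<Rightarrow> nat list \<Rightarrow> 'a" where
  "power_product (x # xs) (e # es) = x [^] e \<otimes> power_product xs es"
| "power_product _ _ = \<one>"

lemma power_product_closed: "set xs \<subseteq> carrier R \<Longrightarrow> power_product xs es \<in> carrier R"
  by (induction xs es rule: power_product.induct) auto

text \<open>Take the terms whose exponent of \<open>x\<^sub>0\<close> is minimal: divide by that power of \<open>x\<^sub>0 \<notin> P\<^sub>0\<close>
  and reduce modulo \<open>P\<^sub>1 \<ni> x\<^sub>0\<close>.\<close>

lemma power_products_independent:
  assumes "\<And>i. i \<le> length xs \<Longrightarrow> primeideal (P i) R"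
    and "\<And>i. i < length xs \<Longrightarrow> P i \<subseteq> P (Suc i) \<and> xs ! i \<in> P (Suc i) \<and> xs ! i \<notin> P i"
    and "finite E" "\<And>es. es \<in> E \<Longrightarrow> length es = length xs"
    and "\<And>es. es \<in> E \<Longrightarrow> c es = \<zero> \<or> c es \<in> Units R"
    and "(\<Oplus>es\<in>E. c es \<otimes> power_product xs es) \<in> P 0" and "es \<in> E"
  shows "c es = \<zero>"
  using assms
proof (induction xs arbitrary: P E c es)
  case Nil
  interpret P0: primeideal "P 0" R using Nil.prems(1)[of 0] by simp
  \<comment> \<open>Only the empty exponent list remains, so the sum is a single coefficient, and a
    unit does not lie in a prime.\<close>
  have E: "E = {[]}" using Nil.prems(4,7) by auto
  have cc: "c [] \<in> carrier R" using Nil.prems(5)[of "[]"] E by auto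
  have "(\<Oplus>es\<in>E. c es \<otimes> power_product [] es) = c []"
    unfolding E using cc by (subst finsum_insert) auto
  then have "c [] \<in> P 0" using Nil.prems(6) by simp
  then have "c [] \<notin> Units R"
    using P0.I_notcarr P0.I_r_closed[of "c []" "inv c []"] P0.one_imp_carrier by auto
  then show ?case using Nil.prems(5)[of "[]"] E Nil.prems(7) by auto
next
  case (Cons x xs)
  have len: "i \<le> length (x # xs)" if "i \<le> Suc (length xs)" for i using that by simp
  interpret P0: primeideal "P 0" R using Cons.prems(1)[of 0] by simp
  interpret P1: primeideal "P 1" R using Cons.prems(1)[of 1] by simp
  have x: "x \<in> P 1" "x \<notin> P 0" "P 0 \<subseteq> P 1" using Cons.prems(2)[of 0] by auto
  have xc: "x \<in> carrier R" using x(1) by (rule P1.Icarr)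
  have xsc: "set xs \<subseteq> carrier R"
  proof
    fix y assume "y \<in> set xs"
    then obtain i where i: "i < length xs" "y = xs ! i" by (auto simp: in_set_conv_nth)
    have "y \<in> P (Suc (Suc i))" using Cons.prems(2)[of "Suc i"] i by simp
    moreover have "primeideal (P (Suc (Suc i))) R" using i by (intro Cons.prems(1)) simp
    ultimately show "y \<in> carrier R" by (meson primeideal.axioms(1) ideal.Icarr)
  qed
  note ppc = power_product_closed[OF xsc]
  have cc: "c es \<in> carrier R" if "es \<in> E" for es using Cons.prems(5)[OF that] by auto
  show ?case
  proof (rule ccontr)
    assume ne: "c es \<noteq> \<zero>"
    let ?N = "{es\<in>E. c es \<noteq> \<zero>}"
    define k where "k = Min (hd ` ?N)"
    have fN: "finite ?N" using Cons.prems(3) by simp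
    have esN: "es \<in> ?N" using ne Cons.prems(7) by simp
    have kle: "k \<le> hd fs" if "fs \<in> ?N" for fs unfolding k_def using fN that by (intro Min_le) auto
    have "k \<in> hd ` ?N" unfolding k_def using fN esN by (intro Min_in) auto
    then obtain fs where fs: "fs \<in> ?N" "hd fs = k" by blast
    \<comment> \<open>\<open>L\<close> collects the tails of the exponent lists that begin with the
      least exponent \<open>k\<close>, \<open>H\<close> the lists with nonzero coefficient that
      begin with a larger one; the remaining lists have coefficient zero.\<close>
    define L where "L = {as. k # as \<in> E}"
    define H where "H = {fs\<in>?N. k < hd fs}"
    have cons: "fs = hd fs # tl fs \<and> length (tl fs) = length xs" if "fs \<in> E" for fs
      using Cons.prems(4)[OF that] by (cases fs) auto
    have fL: "finite L"
    proof -
      have "finite (tl ` E)" using Cons.prems(3) by simp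
      moreover have "L \<subseteq> tl ` E" by (force simp: L_def)
      ultimately show ?thesis by (rule rev_finite_subset)
    qed
    have fH: "finite H" by (rule finite_subset[OF _ Cons.prems(3)]) (auto simp: H_def)
    define u where "u = (\<Oplus>as\<in>L. c (k # as) \<otimes> power_product xs as)"
    define v where "v = (\<Oplus>fs\<in>H. c fs \<otimes> (x [^] (hd fs - Suc k) \<otimes> power_product xs (tl fs)))"
    have Lc: "c (k # as) \<otimes> power_product xs as \<in> carrier R" if "as \<in> L" for as
      using that cc ppc by (simp add: L_def)
    have Hc: "c fs \<otimes> (x [^] (hd fs - Suc k) \<otimes> power_product xs (tl fs)) \<in> carrier R" if "fs \<in> H" for fs
      using that cc ppc xc by (simp add: H_def)
    have uc: "u \<in> carrier R" unfolding u_def using Lc by (intro finsum_closed) auto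
    have vc: "v \<in> carrier R" unfolding v_def using Hc by (intro finsum_closed) auto
    let ?f = "\<lambda>fs. c fs \<otimes> power_product (x # xs) fs"
    have fc: "?f fs \<in> carrier R" if "fs \<in> E" for fs
      using cc[OF that] power_product_closed[of "x # xs"] xc xsc by simp
    have "(\<Oplus>fs\<in>E. ?f fs) = (\<Oplus>fs\<in>Cons k ` L \<union> H. ?f fs)"
    proof (rule finsum_neutral[OF Cons.prems(3), symmetric])
      show "Cons k ` L \<union> H \<subseteq> E" by (auto simp: L_def H_def)
      fix fs assume fs: "fs \<in> E - (Cons k ` L \<union> H)"
      have "c fs = \<zero>"
      proof (rule ccontr)
        assume "c fs \<noteq> \<zero>"
        then have N: "fs \<in> ?N" using fs by simp
        have "k \<noteq> hd fs"
        proof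
          assume "k = hd fs"
          then have "fs = k # tl fs" using cons[of fs] fs by simp
          then show False using fs by (auto simp: L_def)
        qed
        then have "fs \<in> H" using kle[OF N] N by (simp add: H_def)
        then show False using fs by blast
      qed
      then show "?f fs = \<zero>" using power_product_closed[of "x # xs"] xc xsc by simp
    qed (rule fc)
    also have "\<dots> = (\<Oplus>fs\<in>Cons k ` L. ?f fs) \<oplus> (\<Oplus>fs\<in>H. ?f fs)"
      using fL fH fc by (intro finsum_Un_disjoint) (auto simp: H_def L_def)
    also have "(\<Oplus>fs\<in>Cons k ` L. ?f fs) = (\<Oplus>as\<in>L. ?f (k # as))"
      using fc by (intro finsum_reindex) (auto simp: L_def)
    also have "\<dots> = (\<Oplus>as\<in>L. x [^] k \<otimes> (c (k # as) \<otimes> power_product xs as))"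
    proof (rule finsum_cong'[OF refl])
      show "(\<lambda>as. x [^] k \<otimes> (c (k # as) \<otimes> power_product xs as)) \<in> L \<rightarrow> carrier R" using Lc xc by auto
      show "?f (k # as) = x [^] k \<otimes> (c (k # as) \<otimes> power_product xs as)" if "as \<in> L" for as
        using that cc ppc xc by (simp add: L_def m_lcomm)
    qed
    also have "\<dots> = x [^] k \<otimes> u"
      unfolding u_def using fL Lc xc by (intro finsum_rdistr[symmetric]) auto
    also have "(\<Oplus>fs\<in>H. ?f fs) =
        (\<Oplus>fs\<in>H. (x [^] k \<otimes> x) \<otimes> (c fs \<otimes> (x [^] (hd fs - Suc k) \<otimes> power_product xs (tl fs))))"
    proof (rule finsum_cong'[OF refl])
      show "(\<lambda>fs. (x [^] k \<otimes> x) \<otimes> (c fs \<otimes> (x [^] (hd fs - Suc k) \<otimes> power_product xs (tl fs)))) \<in> H \<rightarrow> carrier R"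
        using Hc xc by auto
      fix fs assume fs: "fs \<in> H"
      define a where "a = hd fs - Suc k"
      have hd: "hd fs = Suc k + a" using fs by (simp add: H_def a_def)
      have fsE: "fs \<in> E" using fs by (simp add: H_def)
      have "power_product (x # xs) fs = x [^] hd fs \<otimes> power_product xs (tl fs)"
        using cons[OF fsE] by (metis power_product.simps(1))
      also have "x [^] hd fs = (x [^] k \<otimes> x) \<otimes> x [^] a"
        using nat_pow_mult[OF xc, of "Suc k" a] by (simp only: hd nat_pow_Suc)
      finally have "?f fs = c fs \<otimes> (((x [^] k \<otimes> x) \<otimes> x [^] a) \<otimes> power_product xs (tl fs))" by simp
      also have "\<dots> = (x [^] k \<otimes> x) \<otimes> (c fs \<otimes> (x [^] a \<otimes> power_product xs (tl fs)))"
      proof -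
        have "g \<otimes> ((z \<otimes> y) \<otimes> w) = z \<otimes> (g \<otimes> (y \<otimes> w))"
          if "g \<in> carrier R" "z \<in> carrier R" "y \<in> carrier R" "w \<in> carrier R" for g z y w
          using that by (simp add: m_ac)
        then show ?thesis by this (use xc cc[OF fsE] ppc in simp_all)
      qed
      finally show "?f fs = (x [^] k \<otimes> x) \<otimes> (c fs \<otimes> (x [^] (hd fs - Suc k) \<otimes> power_product xs (tl fs)))"
        by (simp only: a_def)
    qed
    also have "\<dots> = (x [^] k \<otimes> x) \<otimes> v"
      unfolding v_def using fH Hc xc by (intro finsum_rdistr[symmetric]) auto
    also have "x [^] k \<otimes> u \<oplus> (x [^] k \<otimes> x) \<otimes> v = x [^] k \<otimes> (u \<oplus> x \<otimes> v)"
      using xc uc vc by (simp add: r_distr m_assoc)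
    finally have "x [^] k \<otimes> (u \<oplus> x \<otimes> v) \<in> P 0" using Cons.prems(6) by simp
    moreover have "x [^] j \<notin> P 0" for j :: nat
    proof (induction j)
      case 0
      then show ?case using P0.I_notcarr P0.one_imp_carrier by auto
    next
      case (Suc j)
      then show ?case using P0.I_prime[of "x [^] j" x] x(2) xc by auto
    qed
    ultimately have "u \<oplus> x \<otimes> v \<in> P 0" using P0.I_prime[of "x [^] k" "u \<oplus> x \<otimes> v"] uc vc xc by auto
    then have 1: "u \<oplus> x \<otimes> v \<in> P 1" using x(3) by blast
    have 2: "\<ominus> (x \<otimes> v) \<in> P 1" using P1.a_inv_closed[OF P1.I_r_closed[OF x(1) vc]] .
    have "(u \<oplus> x \<otimes> v) \<oplus> \<ominus> (x \<otimes> v) = u" using uc vc xc by (simp add: a_assoc r_neg)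
    then have "u \<in> P (Suc 0)" using P1.a_closed[OF 1 2] by simp
    then have "(\<Oplus>as\<in>L. c (k # as) \<otimes> power_product xs as) \<in> P (Suc 0)" by (simp only: u_def)
    moreover have "tl fs \<in> L" using fs cons[of fs] by (auto simp: L_def)
    ultimately have "c (k # tl fs) = \<zero>"
    proof (intro Cons.IH[where P = "\<lambda>i. P (Suc i)" and E = L and c = "\<lambda>as. c (k # as)" and es = "tl fs"])
      show "primeideal (P (Suc i)) R" if "i \<le> length xs" for i using that by (intro Cons.prems(1)) simp
      show "P (Suc i) \<subseteq> P (Suc (Suc i)) \<and> xs ! i \<in> P (Suc (Suc i)) \<and> xs ! i \<notin> P (Suc i)"
        if "i < length xs" for i using Cons.prems(2)[of "Suc i"] that by simp
      show "length as = length xs" if "as \<in> L" for as using Cons.prems(4)[of "k # as"] that by (simp add: L_def)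
      show "c (k # as) = \<zero> \<or> c (k # as) \<in> Units R" if "as \<in> L" for as
        using Cons.prems(5)[of "k # as"] that by (simp add: L_def)
    qed (use fL in auto)
    moreover have "k # tl fs = fs" using fs cons[of fs] by auto
    ultimately show False using fs(1) by simp
  qed
qed

text \<open>A bound for each exponent separately, not for the degree: it is additive under
  multiplication, and monomials in \<open>n\<close> variables within the bound are counted by
  \<open>(d + 1) ^ n\<close>.\<close>

definition exponents_bounded :: "nat \<Rightarrow> (monomial \<Rightarrow> 'a) \<Rightarrow> bool" where
  "exponents_bounded d p \<longleftrightarrow> (\<forall>m i. p m \<noteq> \<zero> \<longrightarrow> Poly_Mapping.lookup m i \<le> d)"

lemma exponents_bounded_exists:
  assumes p: "p \<in> carrier (mpoly R n)"
  shows "\<exists>d. exponents_bounded d p"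
proof -
  let ?S = "{m. p m \<noteq> \<zero>}"
  have fin: "finite ?S" by (rule mpoly_carrierD(2)[OF p])
  have "Poly_Mapping.lookup m i \<le> (\<Sum>m\<in>?S. \<Sum>i\<in>Poly_Mapping.keys m. Poly_Mapping.lookup m i)" if m: "m \<in> ?S" for m i
  proof (cases "i \<in> Poly_Mapping.keys m")
    case True
    have "Poly_Mapping.lookup m i \<le> (\<Sum>i\<in>Poly_Mapping.keys m. Poly_Mapping.lookup m i)"
      using True by (intro member_le_sum) auto
    also have "\<dots> \<le> (\<Sum>m\<in>?S. \<Sum>i\<in>Poly_Mapping.keys m. Poly_Mapping.lookup m i)"
      using m fin by (intro member_le_sum) auto
    finally show ?thesis .
  qed (simp add: in_keys_iff)
  then show ?thesis unfolding exponents_bounded_def by blast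
qed

lemma exponents_bounded_mult:
  assumes p: "p \<in> carrier (mpoly R n)" "exponents_bounded d p"
    and q: "q \<in> carrier (mpoly R n)" "exponents_bounded e q"
  shows "exponents_bounded (d + e) (p \<otimes>\<^bsub>mpoly R n\<^esub> q)"
  unfolding exponents_bounded_def
proof (intro allI impI)
  fix m i assume nz: "(p \<otimes>\<^bsub>mpoly R n\<^esub> q) m \<noteq> \<zero>"
  have c: "p k \<in> carrier R" "q k \<in> carrier R" for k
    using mpoly_carrierD(1)[OF p(1)] mpoly_carrierD(1)[OF q(1)] by auto
  have "\<exists>a b. a + b = m \<and> p a \<otimes> q b \<noteq> \<zero>"
  proof (rule ccontr)
    assume "\<not> ?thesis"
    then have "(\<Oplus>ab\<in>splits m. p (fst ab) \<otimes> q (snd ab)) = \<zero>" by (intro add.finprod_one_eqI) auto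
    then show False using nz by (simp add: mpoly_simps)
  qed
  then obtain a b where ab: "a + b = m" "p a \<otimes> q b \<noteq> \<zero>" by blast
  then have "p a \<noteq> \<zero>" "q b \<noteq> \<zero>" using c by auto
  then show "Poly_Mapping.lookup m i \<le> d + e"
    using p(2) q(2) ab(1) by (auto simp: exponents_bounded_def lookup_add intro!: add_mono)
qed

lemma exponents_bounded_one: "exponents_bounded d \<one>\<^bsub>mpoly R n\<^esub>"
  by (auto simp: exponents_bounded_def mpoly_simps)

lemma exponents_bounded_power_product:
  assumes "set xs \<subseteq> carrier (mpoly R n)" "\<And>x. x \<in> set xs \<Longrightarrow> exponents_bounded d x"
  shows "exponents_bounded (sum_list es * d) (cring.power_product (mpoly R n) xs es)"
proof -
  interpret M: cring "mpoly R n" by (rule mpoly_cring)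
  have pow: "exponents_bounded (e * d) (x [^]\<^bsub>mpoly R n\<^esub> e)"
    if "x \<in> carrier (mpoly R n)" "exponents_bounded d x" for x and e :: nat
  proof (induction e)
    case (Suc e)
    then show ?case
      using exponents_bounded_mult[OF M.nat_pow_closed[OF that(1)] Suc that] by (simp add: add.commute)
  qed (simp add: exponents_bounded_one)
  show ?thesis using assms
  proof (induction xs es rule: M.power_product.induct)
    case (1 x xs e es)
    then have "exponents_bounded (e * d + sum_list es * d) (x [^]\<^bsub>mpoly R n\<^esub> e \<otimes>\<^bsub>mpoly R n\<^esub> M.power_product xs es)"
      by (intro exponents_bounded_mult[of _ n] pow M.nat_pow_closed M.power_product_closed) auto
    then show ?case by (simp add: add_mult_distrib)
  qed (simp_all add: exponents_bounded_one)
qed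

end

lemma card_bounded_monomials:
  fixes n e :: nat
  defines "Y \<equiv> {m :: monomial. Poly_Mapping.keys m \<subseteq> {..<n} \<and> (\<forall>i. Poly_Mapping.lookup m i \<le> e)}"
  shows "finite Y" "card Y \<le> (e + 1) ^ n"
proof -
  let ?f = "\<lambda>m :: monomial. restrict (Poly_Mapping.lookup m) {..<n}"
  have inj: "inj_on ?f Y"
  proof (rule inj_onI)
    fix a b assume a: "a \<in> Y" and b: "b \<in> Y" and eq: "?f a = ?f b"
    have "Poly_Mapping.lookup a i = Poly_Mapping.lookup b i" for i
    proof (cases "i < n")
      case True
      then show ?thesis using fun_cong[OF eq, of i] by simp
    next
      case False
      then have "i \<notin> Poly_Mapping.keys a" "i \<notin> Poly_Mapping.keys b" using a b by (auto simp: Y_def)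
      then show ?thesis by (simp add: in_keys_iff)
    qed
    then show "a = b" by (rule poly_mapping_eqI)
  qed
  have sub: "?f ` Y \<subseteq> {..<n} \<rightarrow>\<^sub>E {..e}" by (auto simp: Y_def split: if_splits)
  have fin: "finite ({..<n} \<rightarrow>\<^sub>E {..e})" by (intro finite_PiE) auto
  show "finite Y" by (rule finite_imageD[OF finite_subset[OF sub fin] inj])
  have "card Y \<le> card ({..<n} \<rightarrow>\<^sub>E {..e})" by (rule card_inj_on_le[OF inj sub fin])
  then show "card Y \<le> (e + 1) ^ n" by (simp add: card_PiE)
qed

text \<open>In a chain with \<open>n + 1\<close> steps, choose for each step an element that enters
  there. The power products of these elements with exponents below \<open>D\<close> number
  \<open>D ^ (n + 1)\<close> but lie in a space of dimension at most a constant times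
  \<open>D ^ n\<close>; for large \<open>D\<close> they are linearly dependent, against
  \<open>power_products_independent\<close>.\<close>

lemma (in field) mpoly_chain_length:
  assumes P: "\<And>i. i \<le> r \<Longrightarrow> primeideal (P i) (mpoly R n)" and sub: "\<And>i. i < r \<Longrightarrow> P i \<subset> P (Suc i)"
  shows "r \<le> n"
proof (rule ccontr)
  assume "\<not> r \<le> n"
  then have nr: "Suc n \<le> r" by simp
  let ?M = "mpoly R n"
  interpret M: cring ?M by (rule mpoly_cring)
  interpret c: ring_hom_cring R ?M "mconst R" by (rule mconst_hom_cring)
  have "\<forall>i. \<exists>x. i < r \<longrightarrow> x \<in> P (Suc i) \<and> x \<notin> P i" using sub by blast
  then obtain x where x: "\<And>i. i < r \<Longrightarrow> x i \<in> P (Suc i)" "\<And>i. i < r \<Longrightarrow> x i \<notin> P i" by metis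
  define xs where "xs = map x [0..<Suc n]"
  have len: "length xs = Suc n" by (simp add: xs_def)
  have nth: "xs ! i = x i" if "i < Suc n" for i using that by (simp add: xs_def del: upt_Suc)
  have xc: "x i \<in> carrier ?M" if "i < r" for i
    using x(1)[OF that] P[of "Suc i"] that by (meson Suc_leI primeideal.axioms(1) ideal.Icarr)
  have xsc: "set xs \<subseteq> carrier ?M" using xc nr by (auto simp: xs_def simp del: upt_Suc)
  have "\<forall>y\<in>set xs. \<exists>d. exponents_bounded d y" using xsc exponents_bounded_exists by blast
  then obtain b where b: "\<And>y. y \<in> set xs \<Longrightarrow> exponents_bounded (b y) y" by metis
  define d where "d = sum_list (map b xs)"
  have bd: "exponents_bounded d y" if "y \<in> set xs" for y
  proof -
    have "b y \<le> d" unfolding d_def using that by (intro member_le_sum_list) auto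
    then show ?thesis using b[OF that] unfolding exponents_bounded_def by (meson order_trans)
  qed
  \<comment> \<open>\<open>d\<close> bounds the exponents in the chosen elements, hence
    \<open>e\<close> those in their power products. \<open>C\<close> is made for
    \<open>e + 1 \<le> C * D\<close>, and \<open>D\<close> exceeds \<open>C ^ n\<close>, which makes
    \<open>(e + 1) ^ n\<close> smaller than \<open>D ^ (n + 1)\<close>.\<close>
  define C where "C = Suc n * d + 1"
  define D where "D = C ^ n + 1"
  define e where "e = Suc n * D * d"
  define E where "E = {es. set es \<subseteq> {..<D} \<and> length es = Suc n}"
  define Y where "Y = {m :: monomial. Poly_Mapping.keys m \<subseteq> {..<n} \<and> (\<forall>i. Poly_Mapping.lookup m i \<le> e)}"
  have fE: "finite E" unfolding E_def by (intro finite_lists_length_eq) simp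
  have cE: "card E = D ^ Suc n" unfolding E_def by (subst card_lists_length_eq) auto
  have fY: "finite Y" and cY: "card Y \<le> (e + 1) ^ n"
    unfolding Y_def by (rule card_bounded_monomials)+
  have "e + 1 \<le> C * D" by (simp add: e_def C_def D_def algebra_simps)
  then have "card Y \<le> (C * D) ^ n" using cY by (meson order_trans power_mono zero_le)
  also have "\<dots> = C ^ n * D ^ n" by (rule power_mult_distrib)
  also have "\<dots> < D * D ^ n" by (rule mult_strict_right_mono) (simp_all add: D_def)
  also have "\<dots> = D ^ Suc n" by simp
  finally have less: "card Y < card E" by (simp only: cE)
  let ?w = "M.power_product xs"
  have wc: "?w es \<in> carrier ?M" for es by (rule M.power_product_closed[OF xsc])
  have wY: "m \<in> Y" if es: "es \<in> E" and nz: "?w es m \<noteq> \<zero>" for es m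
  proof -
    have "sum_list as \<le> length as * D" if "set as \<subseteq> {..<D}" for as using that by (induction as) auto
    then have "sum_list es \<le> Suc n * D" using es unfolding E_def by force
    then have "sum_list es * d \<le> e" unfolding e_def by (rule mult_right_mono) simp
    moreover have "Poly_Mapping.lookup m i \<le> sum_list es * d" for i
      using exponents_bounded_power_product[OF xsc bd, of es] nz unfolding exponents_bounded_def by blast
    ultimately have "Poly_Mapping.lookup m i \<le> e" for i by (meson order_trans)
    then show ?thesis using mpoly_carrierD(3)[OF wc nz] unfolding Y_def by blast
  qed
  \<comment> \<open>One equation for each monomial that can occur, one unknown for each power
    product.\<close>
  obtain c where c: "\<And>es. es \<in> E \<Longrightarrow> c es \<in> carrier R" and cnz: "\<exists>es\<in>E. c es \<noteq> \<zero>"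
    and rel: "\<And>m. m \<in> Y \<Longrightarrow> (\<Oplus>es\<in>E. ?w es m \<otimes> c es) = \<zero>"
    using homogeneous_system[OF fY fE less, of "\<lambda>m es. ?w es m"] mpoly_carrierD(1)[OF wc] by blast
  have tc: "mconst R (c es) \<otimes>\<^bsub>?M\<^esub> ?w es \<in> carrier ?M" if "es \<in> E" for es
    using c.hom_closed[OF c[OF that]] wc by simp
  have "(\<Oplus>\<^bsub>?M\<^esub>es\<in>E. mconst R (c es) \<otimes>\<^bsub>?M\<^esub> ?w es) = \<zero>\<^bsub>?M\<^esub>"
  proof
    fix m
    have "(\<Oplus>\<^bsub>?M\<^esub>es\<in>E. mconst R (c es) \<otimes>\<^bsub>?M\<^esub> ?w es) m = (\<Oplus>es\<in>E. (mconst R (c es) \<otimes>\<^bsub>?M\<^esub> ?w es) m)"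
      by (rule mpoly_finsum[OF fE tc])
    also have "\<dots> = (\<Oplus>es\<in>E. ?w es m \<otimes> c es)"
    proof (rule finsum_cong'[OF refl])
      show "(\<lambda>es. ?w es m \<otimes> c es) \<in> E \<rightarrow> carrier R" using c mpoly_carrierD(1)[OF wc] by auto
      show "(mconst R (c es) \<otimes>\<^bsub>?M\<^esub> ?w es) m = ?w es m \<otimes> c es" if "es \<in> E" for es
        using mconst_mult[OF wc c[OF that]] m_comm[OF c[OF that] mpoly_carrierD(1)[OF wc]] by simp
    qed
    also have "\<dots> = \<zero>"
    proof (cases "m \<in> Y")
      case False
      then have "?w es m = \<zero>" if "es \<in> E" for es using wY[OF that] by blast
      then show ?thesis using c by (intro add.finprod_one_eqI) auto
    qed (rule rel)
    finally show "(\<Oplus>\<^bsub>?M\<^esub>es\<in>E. mconst R (c es) \<otimes>\<^bsub>?M\<^esub> ?w es) m = \<zero>\<^bsub>?M\<^esub> m" by (simp add: mpoly_simps)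
  qed
  moreover have "\<zero>\<^bsub>?M\<^esub> \<in> P 0"
    using P[of 0] by (simp add: primeideal_def ideal_def additive_subgroup.zero_closed)
  ultimately have in0: "(\<Oplus>\<^bsub>?M\<^esub>es\<in>E. mconst R (c es) \<otimes>\<^bsub>?M\<^esub> ?w es) \<in> P 0" by simp
  have cz: "mconst R (c es) = \<zero>\<^bsub>?M\<^esub>" if es: "es \<in> E" for es
  proof (rule M.power_products_independent[where P = P and xs = xs and E = E and c = "\<lambda>es. mconst R (c es)"])
    show "primeideal (P i) ?M" if "i \<le> length xs" for i using that nr len by (intro P) simp
    show "P i \<subseteq> P (Suc i) \<and> xs ! i \<in> P (Suc i) \<and> xs ! i \<notin> P i" if "i < length xs" for i
      using that nr len sub[of i] x[of i] nth[of i] by auto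
    show "length es = length xs" if "es \<in> E" for es using that len by (simp add: E_def)
    show "mconst R (c es) = \<zero>\<^bsub>?M\<^esub> \<or> mconst R (c es) \<in> Units ?M" if "es \<in> E" for es
    proof (cases "c es = \<zero>")
      case True
      then show ?thesis by (auto simp: mpoly_simps)
    next
      case False
      then have U: "c es \<in> Units R" using c[OF that] by (simp add: field_Units)
      have "mconst R (c es) \<otimes>\<^bsub>?M\<^esub> mconst R (inv c es) = \<one>\<^bsub>?M\<^esub>"
      proof -
        have "mconst R (c es \<otimes> inv c es) = \<one>\<^bsub>?M\<^esub>" unfolding Units_r_inv[OF U] by (rule c.hom_one)
        then show ?thesis using c.hom_mult[OF Units_closed[OF U] Units_inv_closed[OF U]] by (metis (lifting))
      qed
      then have "mconst R (c es) \<in> Units ?M"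
        using c.hom_closed[OF Units_closed[OF U]] c.hom_closed[OF Units_inv_closed[OF U]]
        M.Units_one_closed M.unit_factor by (metis (lifting))
      then show ?thesis ..
    qed
  qed (use fE in0 es in auto)
  have "c es = \<zero>" if "es \<in> E" for es
    using fun_cong[OF cz[OF that], of 0] by (simp add: mpoly_simps(3))
  then show False using cnz by blast
qed


section \<open>The tangent space and smoothness\<close>

context connected_graded_algebra
begin

text \<open>The variables are sent to a minimal homogeneous spanning set \<open>T\<close>, which
  generates \<open>R\<close> by the graded Nakayama lemma; their number is the dimension of the
  cotangent space because the classes of \<open>T\<close> are a basis of it.\<close>

lemma presentation:
  "\<exists>f. f \<in> ring_hom (mpoly K (vdim K (cotangent_space R irrelevant))) R \<and>
     f ` carrier (mpoly K (vdim K (cotangent_space R irrelevant))) = carrier R \<and>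
     (\<forall>c\<in>carrier K. \<forall>p\<in>carrier (mpoly K (vdim K (cotangent_space R irrelevant))).
       f (c \<odot>\<^bsub>mpoly K (vdim K (cotangent_space R irrelevant))\<^esub> p) = c \<odot>\<^bsub>R\<^esub> f p)"
  "vdim K (tangent_space K R irrelevant) = vdim K (cotangent_space R irrelevant)"
proof -
  obtain T where T: "finite T" "T \<subseteq> irrelevant" "\<And>t. t \<in> T \<Longrightarrow> \<exists>d. comp d t = t" "spans_cotangent T"
    and indep: "\<And>c. (\<forall>t\<in>T. c t \<in> carrier K) \<Longrightarrow> lincomb T c \<in> irrelevant_square \<Longrightarrow> \<forall>t\<in>T. c t = \<zero>\<^bsub>K\<^esub>"
    using minimal_generators by blast
  note cb = cotangent_basis[OF T(1,2,4) indep]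
  obtain B where B: "is_basis K (cotangent_space R irrelevant) B" "card B = card T" using cb(2) by blast
  obtain D where D: "is_basis K (tangent_space K R irrelevant) D" "card D = card B"
    unfolding tangent_space_def using dual_space_basis[OF K.field_axioms cb(1) B(1)] by blast
  have dim: "vdim K (cotangent_space R irrelevant) = card T"
    using vdim_eq[OF K.field_axioms cb(1) B(1)] B(2) by simp
  moreover have "vdim K (tangent_space K R irrelevant) = card T"
    using vdim_eq[OF K.field_axioms dual_space_module[OF cb(1)]] D B(2) by (simp add: tangent_space_def)
  ultimately show "vdim K (tangent_space K R irrelevant) = vdim K (cotangent_space R irrelevant)" by simp
  let ?N = "card T"
  let ?M = "mpoly K ?N"
  obtain t where "bij_betw t {0..<?N} T" using ex_bij_betw_nat_finite[OF T(1)] by blast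
  then have t: "T = t ` {..<?N}" by (simp add: bij_betw_def atLeast0LessThan)
  have Tc: "T \<subseteq> carrier R" using T(2) irrelevant_carrier by blast
  have tc: "t i \<in> carrier R" if "i < ?N" for i
  proof -
    have "t i \<in> t ` {..<?N}" using that by blast
    then show ?thesis using t Tc by blast
  qed
  define f where "f = S.mpoly_eval ?N t"
  note ev = S.mpoly_eval_hom[of ?N t, OF tc, folded f_def]
  have f: "f \<in> ring_hom ?M R" by (rule ev(1))
  have fconst: "f (mconst K c) = scalar R c" if "c \<in> carrier K" for c by (rule ev(2)) (use that in auto)
  have fvar: "f (mpoly_var K i) = t i" if "i < ?N" for i by (rule ev(3)) (use that in auto)
  interpret M: cring ?M by (rule K.mpoly_cring)
  interpret F: ring_hom_cring ?M R f using f by unfold_locales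
  have "carrier R \<subseteq> f ` carrier ?M"
  proof (rule generated_by_cotangent_basis[OF T(2,3,4)])
    show "scalar R c \<in> f ` carrier ?M" if "c \<in> carrier K" for c
      using fconst[OF that] K.mpoly_mconst_closed[OF that, of ?N] by (metis imageI)
    show "T \<subseteq> f ` carrier ?M"
    proof
      fix x assume "x \<in> T"
      then obtain i where i: "i < ?N" "x = t i" using t by blast
      show "x \<in> f ` carrier ?M" using fvar[OF i(1)] K.mpoly_var_closed[OF i(1)] i(2) by (metis imageI)
    qed
    show "f ` carrier ?M \<subseteq> carrier R" using F.hom_closed by blast
    fix x y assume "x \<in> f ` carrier ?M" "y \<in> f ` carrier ?M"
    then obtain p q where pq: "p \<in> carrier ?M" "x = f p" "q \<in> carrier ?M" "y = f q" by blast
    show "x \<oplus>\<^bsub>R\<^esub> y \<in> f ` carrier ?M"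
      unfolding pq(2,4) F.hom_add[OF pq(1,3), symmetric] by (intro imageI M.a_closed pq(1,3))
    show "x \<otimes>\<^bsub>R\<^esub> y \<in> f ` carrier ?M"
      unfolding pq(2,4) F.hom_mult[OF pq(1,3), symmetric] by (intro imageI M.m_closed pq(1,3))
  qed
  then have surj: "f ` carrier ?M = carrier R" using F.hom_closed by blast
  have "f (c \<odot>\<^bsub>?M\<^esub> p) = c \<odot>\<^bsub>R\<^esub> f p" if c: "c \<in> carrier K" and p: "p \<in> carrier ?M" for c p
  proof -
    have "c \<odot>\<^bsub>?M\<^esub> p = mconst K c \<otimes>\<^bsub>?M\<^esub> p" using K.mconst_mult[OF p c] by (simp add: mpoly_simps)
    then have "f (c \<odot>\<^bsub>?M\<^esub> p) = scalar R c \<otimes>\<^bsub>R\<^esub> f p"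
      by (simp only: F.hom_mult[OF K.mpoly_mconst_closed[OF c] p] fconst[OF c])
    also have "\<dots> = c \<odot>\<^bsub>R\<^esub> f p" using c F.hom_closed[OF p] by (simp add: A.smult_assoc2)
    finally show ?thesis .
  qed
  then show "\<exists>f. f \<in> ring_hom (mpoly K (vdim K (cotangent_space R irrelevant))) R \<and>
     f ` carrier (mpoly K (vdim K (cotangent_space R irrelevant))) = carrier R \<and>
     (\<forall>c\<in>carrier K. \<forall>p\<in>carrier (mpoly K (vdim K (cotangent_space R irrelevant))).
       f (c \<odot>\<^bsub>mpoly K (vdim K (cotangent_space R irrelevant))\<^esub> p) = c \<odot>\<^bsub>R\<^esub> f p)"
    unfolding dim using f surj by blast
qed

text \<open>A chain in the local ring contracts to \<open>R\<close> and pulls back to the polynomial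
  ring. As \<open>x\<close> is a nonzero element of the kernel, the zero ideal can be put strictly
  below the pulled back chain, which makes it longer by one; the bound for polynomial rings then
  gives the strict inequality.\<close>

lemma krull_dim_local_ring_less:
  assumes f: "f \<in> ring_hom (mpoly K N) R" "f ` carrier (mpoly K N) = carrier R"
    and x: "x \<in> carrier (mpoly K N)" "x \<noteq> \<zero>\<^bsub>mpoly K N\<^esub>" "f x = \<zero>\<^bsub>R\<^esub>"
  shows "krull_dim (local_ring R irrelevant) < enat N"
proof -
  let ?M = "mpoly K N" and ?B = "local_ring R irrelevant"
  interpret M: cring ?M by (rule K.mpoly_cring)
  interpret F: ring_hom_cring ?M R f using f(1) by unfold_locales
  have chain: "Suc r \<le> N" if Q: "\<And>i. i \<le> r \<Longrightarrow> primeideal (Q i) R" and Qs: "\<And>i. i < r \<Longrightarrow> Q i \<subset> Q (Suc i)"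
    for r :: nat and Q
  proof (rule K.mpoly_chain_length)
    define P where "P i = (case i of 0 \<Rightarrow> {\<zero>\<^bsub>?M\<^esub>} | Suc j \<Rightarrow> {p \<in> carrier ?M. f p \<in> Q j})" for i
    show "primeideal (P i) ?M" if "i \<le> Suc r" for i
    proof (cases i)
      case 0
      then show ?thesis using K.mpoly_zero_prime by (simp add: P_def)
    next
      case (Suc j)
      then show ?thesis using ring_hom_ring.primeideal_vimage[OF F.ring_hom_ring M.is_cring Q[of j]] that by (simp add: P_def)
    qed
    show "P i \<subset> P (Suc i)" if "i < Suc r" for i
    proof (cases i)
      case 0
      have z: "\<zero>\<^bsub>R\<^esub> \<in> Q 0" using Q[of 0] by (simp add: primeideal_def ideal_def additive_subgroup.zero_closed)
      then have "x \<in> P 1" "\<zero>\<^bsub>?M\<^esub> \<in> P 1" using x F.hom_zero by (simp_all add: P_def)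
      then show ?thesis using x(2) 0 by (auto simp: P_def)
    next
      case (Suc j)
      then have lt: "Q j \<subset> Q (Suc j)" using Qs that by simp
      then obtain y where y: "y \<in> Q (Suc j)" "y \<notin> Q j" by blast
      have "primeideal (Q (Suc j)) R" using that Suc by (intro Q) simp
      then have "y \<in> carrier R" using y(1) by (meson primeideal.axioms(1) ideal.Icarr)
      then obtain p where p: "p \<in> carrier ?M" "y = f p" using f(2) by blast
      show ?thesis using lt y p Suc by (auto simp: P_def)
    qed
  qed
  \<comment> \<open>The chain that consists of one prime shows that \<open>N\<close> is positive, so
    that \<open>N - 1\<close> is really smaller than \<open>N\<close>.\<close>
  have N: "1 \<le> N" using chain[of 0 "\<lambda>_. irrelevant"] irrelevant_prime by simp
  have "krull_dim ?B \<le> enat (N - 1)"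
    unfolding krull_dim_def
  proof (rule Sup_least)
    fix d assume "d \<in> {enat r | r. \<exists>P :: nat \<Rightarrow> ('a \<times> 'a) set set. (\<forall>i\<le>r. P i \<in> Spec ?B) \<and> (\<forall>i<r. P i \<subset> P (Suc i))}"
    then obtain r and P :: "nat \<Rightarrow> ('a \<times> 'a) set set" where d: "d = enat r"
      and P: "\<forall>i\<le>r. P i \<in> Spec ?B" "\<forall>i<r. P i \<subset> P (Suc i)" by blast
    have pr: "primeideal (P i) ?B" if "i \<le> r" for i using P(1) that by (simp add: Spec_def)
    have "Suc r \<le> N"
    proof (rule chain)
      show "primeideal {a \<in> carrier R. L.loc a \<in> P i} R" if "i \<le> r" for i
        by (rule L.local_prime_contraction[OF pr[OF that]])
      show "{a \<in> carrier R. L.loc a \<in> P i} \<subset> {a \<in> carrier R. L.loc a \<in> P (Suc i)}" if i: "i < r" for i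
      proof (rule L.local_contraction_strict)
        show "primeideal (P i) ?B" by (rule pr) (use i in simp)
        show "primeideal (P (Suc i)) ?B" by (rule pr) (use i in simp)
        show "P i \<subset> P (Suc i)" using P(2) i by blast
      qed
    qed
    then show "d \<le> enat (N - 1)" using d by simp
  qed
  also have "\<dots> < enat N" using N by simp
  finally show ?thesis .
qed

lemma embeds_in_tangent_space:
  "iso_closed_subscheme K R (vector_space_scheme K (tangent_space K R irrelevant))"
  unfolding vector_space_scheme_def affine_space_def presentation(2)
proof -
  let ?M = "mpoly K (vdim K (cotangent_space R irrelevant))"
  obtain f where f: "f \<in> ring_hom ?M R" "f ` carrier ?M = carrier R"
    "\<forall>c\<in>carrier K. \<forall>p\<in>carrier ?M. f (c \<odot>\<^bsub>?M\<^esub> p) = c \<odot>\<^bsub>R\<^esub> f p"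
    using presentation(1) by (elim exE conjE)
  show "iso_closed_subscheme K R ?M"
    by (rule alg_isomorphic_quot[OF mpoly_algebra[OF K.is_cring] A.is_cring f(1,2)]) (rule f(3)[rule_format])
qed

text \<open>Smoothness says that the dimension of the local ring is the number of variables, which
  by \<open>krull_dim_local_ring_less\<close> leaves no nonzero element in the kernel.\<close>

lemma affine_space_if_smooth:
  assumes smooth: "smooth_point K R irrelevant"
  shows "\<exists>N. alg_isomorphic K R (affine_space K N)"
proof -
  define N where "N = vdim K (cotangent_space R irrelevant)"
  let ?M = "mpoly K N"
  obtain f where f: "f \<in> ring_hom ?M R" "f ` carrier ?M = carrier R"
    "\<And>c p. c \<in> carrier K \<Longrightarrow> p \<in> carrier ?M \<Longrightarrow> f (c \<odot>\<^bsub>?M\<^esub> p) = c \<odot>\<^bsub>R\<^esub> f p"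
    using presentation(1) unfolding N_def[symmetric] by blast
  interpret M: cring ?M by (rule K.mpoly_cring)
  interpret F: ring_hom_cring ?M R f using f(1) by unfold_locales
  have inj: "x = \<zero>\<^bsub>?M\<^esub>" if "x \<in> carrier ?M" "f x = \<zero>\<^bsub>R\<^esub>" for x
    using krull_dim_local_ring_less[OF f(1,2) that(1) _ that(2)] smooth
    unfolding smooth_point_def N_def[symmetric] by auto
  have "alg_isomorphic K R ?M"
  \<comment> \<open>The polynomial ring maps onto \<open>R\<close> by \<open>f\<close> and onto
    itself by the identity; the fibres agree because \<open>f\<close> is injective.\<close>
  proof (rule alg_isomorphic_of_fibres[OF mpoly_algebra[OF K.is_cring] f(1,2), where q = "\<lambda>p. p"])
    show "f (c \<odot>\<^bsub>?M\<^esub> p) = c \<odot>\<^bsub>R\<^esub> f p" if "c \<in> carrier K" "p \<in> carrier ?M" for c p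
      by (rule f(3)[OF that])
    show "(\<lambda>p. p) \<in> ring_hom ?M ?M" by (rule ring_hom_memI) auto
    show "f p = f q \<longleftrightarrow> p = q" if p: "p \<in> carrier ?M" and q: "q \<in> carrier ?M" for p q
    proof
      assume eq: "f p = f q"
      have "f (p \<ominus>\<^bsub>?M\<^esub> q) = f p \<ominus>\<^bsub>R\<^esub> f q" using p q by (simp add: a_minus_def)
      also have "\<dots> = \<zero>\<^bsub>R\<^esub>" unfolding eq using F.hom_closed[OF q] by (simp add: a_minus_def A.r_neg)
      finally have "p \<ominus>\<^bsub>?M\<^esub> q = \<zero>\<^bsub>?M\<^esub>" by (intro inj M.minus_closed p q)
      then show "p = q" using p q by simp
    qed simp
  qed (simp_all only: image_ident)
  then show ?thesis unfolding affine_space_def by blast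
qed

end

lemma (in lifting_scheme) connected_graded: "connected_graded_algebra K R weight_comp"
  by unfold_locales

theorem corollary6p5:
  fixes K :: "'k ring" and n :: nat and H :: "(monomial \<Rightarrow> 'k) set"
    and R :: "('k, 'a) module" and U :: "(monomial \<Rightarrow> 'a) set" and y0 :: "'a set"
  assumes "field K" and "infinite (carrier K)"
    and "homogeneous_ideal K n H"
    and "scheme_of_liftings K n H R U"
    and "y0 = lifting_point K n R U (genideal (mpoly K (Suc n)) H)"
  shows "(\<forall>Z. irreducible_component (zariski_topology R) Z \<longrightarrow> y0 \<in> Z) \<and>
         iso_closed_subscheme K R (vector_space_scheme K (tangent_space K R y0)) \<and>
         (smooth_point K R y0 \<longrightarrow> (\<exists>N. alg_isomorphic K R (affine_space K N)))"
proof -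
  note L = lifting_scheme.intro[OF assms(1-4)]
  note G = lifting_scheme.connected_graded[OF L]
  let ?M = "connected_graded_algebra.irrelevant R (lifting_scheme.weight_comp K n R U)"
  have y0: "y0 = ?M"
    using lifting_scheme.lifting_point_eq[OF L] assms(5) unfolding connected_graded_algebra.irrelevant_def[OF G] by (rule trans[rotated])
  show ?thesis
    unfolding y0
    using connected_graded_algebra.irrelevant_in_components[OF G]
      connected_graded_algebra.embeds_in_tangent_space[OF G]
      connected_graded_algebra.affine_space_if_smooth[OF G] by (intro conjI allI impI)
qed

end
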